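(* Assume (A1), (A2), (A3) of the context. Then $Y_m$ converges in traffic distribution: for every finite connected bipartite multigraph $G=(W\cup V,E)$ with associated test graph $T=(W\cup V,E,Y_m)$, there is a real number $\tau_G^0$, depending only on $G,\phi,\psi,f,\Phi,\nu_x$, such that $$\lim_{m,p,n\to\infty}\tau^0_{p,m,n}[T]=\tau_G^0 .$$ Moreover $\tau_G^0=0$ unless $G$ is admissible, in which case $$\tau_G^0=\frac{\phi^{\frac{|E|}2-|V|}}{\psi^{|W|-1}}\prod_{w\in W\setminus\cup_{i=1}^RW_{B_i}}C_{\deg(w)}(f)\;\prod_{i=1}^R\Big(\sum_{K\ge1}\ \sum_{\{W_1,\dots,W_K\}\in\mathcal A_K(W_{B_i})}C_{(W_k)_{k=1}^K}(f)\Big),$$ where $B_i=G(W_{B_i})$, $1\le i\le R$, are the blocks of $G$ with $|W_{B_i}|\ge2$. In particular, when $G$ is a double tree (i.e. admissible with $R=0$), $\tau_G^0=\dfrac{\phi^{\frac{|E|}2-|V|}}{\psi^{|W|-1}}\prod_{w\in W}C_{\deg(w)}(f)$.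
   Context: **Model.** $\mathbf W\in\mathbb R^{p\times n}$ has i.i.d. entries of law $\nu_w$ (which may depend on $n$), $\mathbf X\in\mathbb R^{n\times m}$ has i.i.d. entries of law $\nu_x$, and $\mathbf W,\mathbf X$ are independent. $Y_m\in\mathbb R^{p\times m}$ has entries $Y_{ij}=\frac1{\sqrt m}f\big(\sum_{k=1}^n \mathbf W_{ik}\mathbf X_{kj}\big)$. (A1) (a) $\nu_w$ is symmetric and $\Phi_n(\lambda):=n\log\mathbb E[\exp(i\lambda \mathbf W_{ij})]\to\Phi(\lambda)$ as $n\to\infty$, uniformly in $\lambda\in\mathbb R$, for some limiting function $\Phi$. (b) $\nu_x$ is symmetric with finite moments of all orders and variance $\sigma_x^2$. (A2) $f:\mathbb R\to\mathbb R$ is odd, $C^\infty$, and $f^{(k)}\in L^1(\mathbb R)$ for all $k\ge0$. Write $\hat f(t)=\int_{\mathbb R} f(x)e^{-itx}dx$. (A3) $m,p,n\to\infty$ with $n/m\to\phi$, $n/p\to\psi$, $\phi,\psi>0$ constants. **Graphs.** $G=(W\cup V,E)$ is a finite connected bipartite multigraph; $m(e)\ge1$ is the multiplicity of the edge $e=(w,v)$, $|E'|=\sum_{e\in E'}m(e)$ for sets of edges $E'$, $\deg(x)=\sum_{y\sim x}m((x,y))$. Products over $e\in E$ are over distinct edges. The mean injective trace is $$\tau^0_{p,m,n}[T]=\mathbb E\Big[\frac1p\sum_{\phi_W:W\to[p]\text{ inj.}}\ \sum_{\phi_V:V\to[m]\text{ inj.}}\ \prod_{e=(w,v)\in E}Y_m(\phi_W(w),\phi_V(v))^{m(e)}\Big].$$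 *Induced subgraphs.* For $W_i\subseteq W$, $G_i=G(W_i)=(W_i\cup V_i,E_i)$ where $V_i$ is the set of neighbours of $W_i$ and $E_i$ the set of all edges (with multiplicity) incident to $W_i$; $\deg_{G_i}$ is the degree in $G_i$. For subgraphs $G_{\ell_1},\dots,G_{\ell_k}$, $W_{G_{\ell_1},\dots,G_{\ell_k}}$ (resp. $V_{G_{\ell_1},\dots,G_{\ell_k}}$) is the set of vertices of $W$ (resp. $V$) belonging to at least two of $W_{\ell_1},\dots,W_{\ell_k}$ (resp. of $V_{\ell_1},\dots,V_{\ell_k}$). *Blocks.* A vertex $v\in V$ is separating for $G$ if $G$ can be decomposed into $K\ge2$ connected subgraphs $G(W_1),\dots,G(W_K)$ with $W_1,\dots,W_K$ disjoint, $E_1,\dots,E_K$ disjoint, and $v$ the only vertex common to $V_1,\dots,V_K$. A block $B=(W_B\cup V_B,E_B)=G(W_B)$ is a maximal connected subgraph of this form having no separating vertex in $V_B$ (separating for $B$ itself). $G$ is a block tree if for all $k\ge2$ and distinct blocks $B_{\ell_1},\dots,B_{\ell_k}$, $|V_{B_{\ell_1},\dots,B_{\ell_k}}|\le k-1$. $G$ is admissible if it is a block tree such that within each block every vertex of $W$ has even degree and every vertex of $V$ has degree $2$. $R$ is the number of blocks $B$ with $|W_B|\ge2$. *Admissible decompositions.* For a block $B$ of an admissible graph with $|W_B|\ge2$, $\mathcal A_K(W_B)$ is the set of collections $\{W_1,\dots,W_K\}$ of subsets of $W_B$ such that: (a) $W_B=\cup_iW_i$; (b) every $W_i$ intersects some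 $W_j$, $j\ne i$; (c) $|W_i|\ge2$; (d) each $G_i=G(W_i)$ is connected; (e) for every $v\in V_B$ there is $i$ with $v\in V_i$ and $\deg_{G_i}(v)\ge2$; (f) for all $2\le k\le K$ and distinct $\ell_1,\dots,\ell_k\in[K]$, $|W_{G_{\ell_1},\dots,G_{\ell_k}}|\le k-1$. By convention $\{W_B\}\in\mathcal A_1(W_B)$ (condition (b) is not imposed for $K=1$). *Parameters.* For even $d$, $$C_d(f)=\frac1{(2\pi)^d}\int_{\mathbb R^d}\prod_{i=1}^{d/2}d\gamma_i^1d\gamma_i^2\hat f(\gamma_i^1)\hat f(\gamma_i^2)\,e^{\mathbb E_X[\Phi(\sum_{i=1}^{d/2}(\gamma_i^1+\gamma_i^2)X_i)]},\quad X_i\text{ i.i.d. }\sim\nu_x.$$ For $W_1,\dots,W_K\subseteq W$ with $|W_k|\ge2$ and $G(W_k)$ connected, $$C_{(W_k)_{k=1}^K}(f)=\frac1{(2\pi)^{|\cup_kE_k|}}\int_{\mathbb R^{|\cup_kE_k|}}\prod_{e\in\cup_kE_k}\prod_{i=1}^{m(e)}d\gamma_e^i\hat f(\gamma_e^i)\;e^{\sum_{w\in\cup_kW_k}\mathbb E_X[Z_w(\gamma)]}\prod_{k=1}^K\mathbb E_X\Big[\prod_{w\in W_k}Z_w(\gamma)\Big],$$ with $Z_w(\gamma)=\Phi\big(\sum_{v\sim w}(\gamma^1_{(w,v)}+\dots+\gamma^{m((w,v))}_{(w,v)})X_v\big)$, $(X_v)_{v\in V}$ i.i.d. $\sim\nu_x$.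 *)

theory Defs
  imports "HOL-Probability.Probability"
begin

section \<open>Bipartite multigraphs\<close>

text \<open>\<open>mult G w v\<close> is the multiplicity of the edge \<open>(w, v)\<close>, and it is \<open>0\<close> if there is no such edge.\<close>

record ('w, 'v) bigraph =
  wverts :: "'w set"
  vverts :: "'v set"
  mult :: "'w \<Rightarrow> 'v \<Rightarrow> nat"

definition finite_bigraph :: "('w, 'v) bigraph \<Rightarrow> bool" where
  "finite_bigraph G \<longleftrightarrow> finite (wverts G) \<and> finite (vverts G) \<and>
     (\<forall>w v. mult G w v \<ge> 1 \<longrightarrow> w \<in> wverts G \<and> v \<in> vverts G)"

definition edges :: "('w, 'v) bigraph \<Rightarrow> ('w \<times> 'v) set" where
  "edges G = {(w, v). w \<in> wverts G \<and> v \<in> vverts G \<and> mult G w v \<ge> 1}"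

definition total_mult :: "('w, 'v) bigraph \<Rightarrow> ('w \<times> 'v) set \<Rightarrow> nat" where
  "total_mult G F = (\<Sum>(w, v)\<in>F. mult G w v)"

definition wdeg :: "('w, 'v) bigraph \<Rightarrow> 'w \<Rightarrow> nat" where
  "wdeg G w = (\<Sum>v\<in>vverts G. mult G w v)"

definition vdeg :: "('w, 'v) bigraph \<Rightarrow> 'v \<Rightarrow> nat" where
  "vdeg G v = (\<Sum>w\<in>wverts G. mult G w v)"

definition adjacency :: "('w, 'v) bigraph \<Rightarrow> ('w + 'v) rel" where
  "adjacency G = {(Inl w, Inr v) | w v. (w, v) \<in> edges G} \<union> {(Inr v, Inl w) | w v. (w, v) \<in> edges G}"

text \<open>The graph without vertices does not count as connected.\<close>

definition connected_bigraph :: "('w, 'v) bigraph \<Rightarrow> bool" where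
  "connected_bigraph G \<longleftrightarrow> wverts G <+> vverts G \<noteq> {} \<and>
     (\<forall>x\<in>wverts G <+> vverts G. \<forall>y\<in>wverts G <+> vverts G. (x, y) \<in> (adjacency G)\<^sup>*)"

definition induced :: "('w, 'v) bigraph \<Rightarrow> 'w set \<Rightarrow> ('w, 'v) bigraph" where
  "induced G A =
     \<lparr>wverts = A,
      vverts = {v \<in> vverts G. \<exists>w\<in>A. mult G w v \<ge> 1},
      mult = (\<lambda>w v. if w \<in> A then mult G w v else 0)\<rparr>"

definition in_at_least_two :: "'i set \<Rightarrow> ('i \<Rightarrow> 'b set) \<Rightarrow> 'b set" where
  "in_at_least_two S F = {x. \<exists>a\<in>S. \<exists>b\<in>S. a \<noteq> b \<and> x \<in> F a \<and> x \<in> F b}"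


section \<open>Blocks and admissible graphs\<close>

text \<open>That \<open>v\<close> is the only vertex common to the \<open>V\<^sub>i\<close> is read pairwise: no two of the \<open>V\<^sub>i\<close> share
  another vertex. The edge sets of \<open>induced G A\<close>, for \<open>A\<close> in a partition of the \<open>W\<close>-side, are
  automatically disjoint.\<close>

definition separating :: "('w, 'v) bigraph \<Rightarrow> 'v \<Rightarrow> bool" where
  "separating G v \<longleftrightarrow> v \<in> vverts G \<and>
     (\<exists>P. partition_on (wverts G) P \<and> card P \<ge> 2 \<and>
        (\<Union>A\<in>P. vverts (induced G A)) = vverts G \<and>
        (\<forall>A\<in>P. connected_bigraph (induced G A) \<and> v \<in> vverts (induced G A)) \<and>
        (\<forall>A\<in>P. \<forall>B\<in>P. A \<noteq> B \<longrightarrow> vverts (induced G A) \<inter> vverts (induced G B) = {v}))"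

definition nonseparable :: "('w, 'v) bigraph \<Rightarrow> bool" where
  "nonseparable G \<longleftrightarrow> connected_bigraph G \<and> (\<forall>v\<in>vverts G. \<not> separating G v)"

text \<open>The block \<open>B = G(W\<^sub>B)\<close> is represented by \<open>W\<^sub>B\<close>, which determines it.\<close>

definition blocks :: "('w, 'v) bigraph \<Rightarrow> 'w set set" where
  "blocks G = {A. A \<subseteq> wverts G \<and> nonseparable (induced G A) \<and>
     (\<forall>A'. A \<subset> A' \<and> A' \<subseteq> wverts G \<longrightarrow> \<not> nonseparable (induced G A'))}"

definition big_blocks :: "('w, 'v) bigraph \<Rightarrow> 'w set set" where
  "big_blocks G = {A \<in> blocks G. card A \<ge> 2}"

definition block_tree :: "('w, 'v) bigraph \<Rightarrow> bool" where
  "block_tree G \<longleftrightarrow> (\<forall>S. S \<subseteq> blocks G \<and> card S \<ge> 2 \<longrightarrow>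
     card (in_at_least_two S (\<lambda>A. vverts (induced G A))) \<le> card S - 1)"

definition admissible :: "('w, 'v) bigraph \<Rightarrow> bool" where
  "admissible G \<longleftrightarrow> block_tree G \<and>
     (\<forall>A\<in>blocks G. (\<forall>w\<in>A. even (wdeg (induced G A) w)) \<and>
        (\<forall>v\<in>vverts (induced G A). vdeg (induced G A) v = 2))"

definition double_tree :: "('w, 'v) bigraph \<Rightarrow> bool" where
  "double_tree G \<longleftrightarrow> admissible G \<and> card (big_blocks G) = 0"

text \<open>\<open>\<A>\<^sub>K(W\<^sub>B)\<close>. Condition (f) for two members together with (c) excludes repeated members, so the
  collections are sets of sets.\<close>

definition adm_decomps :: "('w, 'v) bigraph \<Rightarrow> nat \<Rightarrow> 'w set \<Rightarrow> 'w set set set" where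
  "adm_decomps G K B = {C. finite C \<and> card C = K \<and>
     \<Union>C = B \<and>
     (K \<noteq> 1 \<longrightarrow> (\<forall>A\<in>C. \<exists>A'\<in>C. A' \<noteq> A \<and> A \<inter> A' \<noteq> {})) \<and>
     (\<forall>A\<in>C. card A \<ge> 2) \<and>
     (\<forall>A\<in>C. connected_bigraph (induced G A)) \<and>
     (\<forall>v\<in>vverts (induced G B). \<exists>A\<in>C. v \<in> vverts (induced G A) \<and> vdeg (induced G A) v \<ge> 2) \<and>
     (\<forall>S. S \<subseteq> C \<and> card S \<ge> 2 \<longrightarrow> card (in_at_least_two S (\<lambda>A. A)) \<le> card S - 1)}"


section \<open>Limiting parameters\<close>

definition fourier :: "(real \<Rightarrow> real) \<Rightarrow> real \<Rightarrow> complex" where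
  "fourier f t = (\<integral>x. complex_of_real (f x) * exp (- \<i> * complex_of_real (t * x)) \<partial>lborel)"

definition C_deg :: "(real \<Rightarrow> complex) \<Rightarrow> real measure \<Rightarrow> (real \<Rightarrow> real) \<Rightarrow> nat \<Rightarrow> complex" where
  "C_deg \<Phi> \<nu>x f d =
     1 / (2 * of_real pi) ^ d *
     (\<integral>\<gamma>. (\<Prod>i\<in>{1..d div 2}. fourier f (\<gamma> (i, 1)) * fourier f (\<gamma> (i, 2))) *
          exp (\<integral>x. \<Phi> (\<Sum>i\<in>{1..d div 2}. (\<gamma> (i, 1) + \<gamma> (i, 2)) * x i) \<partial>(\<Pi>\<^sub>M i\<in>{1..d div 2}. \<nu>x))
        \<partial>(\<Pi>\<^sub>M e\<in>{1..d div 2} \<times> {1, 2 :: nat}. lborel))"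

text \<open>The integration variables are \<open>\<gamma> (w, v, i)\<close> with \<open>1 \<le> i \<le> m((w, v))\<close>.\<close>

definition Z_fun :: "(real \<Rightarrow> complex) \<Rightarrow> ('w, 'v) bigraph \<Rightarrow> ('w \<times> 'v \<times> nat \<Rightarrow> real) \<Rightarrow> 'w \<Rightarrow>
    ('v \<Rightarrow> real) \<Rightarrow> complex" where
  "Z_fun \<Phi> G \<gamma> w x = \<Phi> (\<Sum>v | (w, v) \<in> edges G. (\<Sum>i=1..mult G w v. \<gamma> (w, v, i)) * x v)"

definition C_family :: "(real \<Rightarrow> complex) \<Rightarrow> real measure \<Rightarrow> (real \<Rightarrow> real) \<Rightarrow> ('w, 'v) bigraph \<Rightarrow>
    'w set set \<Rightarrow> complex" where
  "C_family \<Phi> \<nu>x f G C =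
     (let E = (\<Union>A\<in>C. edges (induced G A));
          \<mu> = (\<Pi>\<^sub>M v\<in>vverts G. \<nu>x)
      in 1 / (2 * of_real pi) ^ total_mult G E *
         (\<integral>\<gamma>. (\<Prod>(w, v)\<in>E. \<Prod>i=1..mult G w v. fourier f (\<gamma> (w, v, i))) *
              exp (\<Sum>w\<in>\<Union>C. \<integral>x. Z_fun \<Phi> G \<gamma> w x \<partial>\<mu>) *
              (\<Prod>A\<in>C. \<integral>x. (\<Prod>w\<in>A. Z_fun \<Phi> G \<gamma> w x) \<partial>\<mu>)
            \<partial>(\<Pi>\<^sub>M e\<in>{(w, v, i). (w, v) \<in> E \<and> i \<in> {1..mult G w v}}. lborel)))"

text \<open>The real powers allow for the exponent \<open>-1\<close> that occurs for the graph with one \<open>V\<close>-vertex and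
  no \<open>W\<close>-vertex.\<close>

definition scale_factor :: "('w, 'v) bigraph \<Rightarrow> real \<Rightarrow> real \<Rightarrow> real" where
  "scale_factor G \<phi> \<psi> =
     \<phi> powr (real (total_mult G (edges G)) / 2 - real (card (vverts G))) /
     \<psi> powr (real (card (wverts G)) - 1)"


section \<open>The random matrix model\<close>

definition symmetric_law :: "real measure \<Rightarrow> bool" where
  "symmetric_law \<nu> \<longleftrightarrow> distr \<nu> borel uminus = \<nu>"

text \<open>The logarithm is taken to be defined for all large \<open>n\<close>, i.e. the characteristic function has no
  zero. This has to be said because \<open>Ln 0 = 0\<close>; by symmetry and continuity the characteristic function
  is then positive and \<open>Ln\<close> is the real logarithm.\<close>

definition A1 :: "(nat \<Rightarrow> real measure) \<Rightarrow> (real \<Rightarrow> complex) \<Rightarrow> real measure \<Rightarrow> real \<Rightarrow> bool" where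
  "A1 \<nu>w \<Phi> \<nu>x \<sigma>x \<longleftrightarrow>
     (\<forall>n. real_distribution (\<nu>w n) \<and> symmetric_law (\<nu>w n)) \<and>
     (\<forall>\<^sub>F n in sequentially. \<forall>t. char (\<nu>w n) t \<noteq> 0) \<and>
     uniform_limit UNIV (\<lambda>n t. of_nat n * Ln (char (\<nu>w n) t)) \<Phi> sequentially \<and>
     real_distribution \<nu>x \<and> symmetric_law \<nu>x \<and>
     (\<forall>k :: nat. integrable \<nu>x (\<lambda>x. x ^ k)) \<and>
     prob_space.variance \<nu>x (\<lambda>x. x) = \<sigma>x\<^sup>2"

definition A2 :: "(real \<Rightarrow> real) \<Rightarrow> bool" where
  "A2 f \<longleftrightarrow> (\<forall>x. f (- x) = - f x) \<and>
     (\<forall>k x. ((deriv ^^ k) f) differentiable (at x)) \<and>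
     (\<forall>k. integrable lborel ((deriv ^^ k) f))"

text \<open>The limit \<open>m, p, n \<rightarrow> \<infinity>\<close> is taken along arbitrary sequences of dimensions.\<close>

definition A3 :: "(nat \<Rightarrow> nat) \<Rightarrow> (nat \<Rightarrow> nat) \<Rightarrow> (nat \<Rightarrow> nat) \<Rightarrow> real \<Rightarrow> real \<Rightarrow> bool" where
  "A3 p m n \<phi> \<psi> \<longleftrightarrow> \<phi> > 0 \<and> \<psi> > 0 \<and>
     filterlim p at_top sequentially \<and> filterlim m at_top sequentially \<and>
     filterlim n at_top sequentially \<and>
     (\<lambda>N. real (n N) / real (m N)) \<longlonglongrightarrow> \<phi> \<and> (\<lambda>N. real (n N) / real (p N)) \<longlonglongrightarrow> \<psi>"

text \<open>All the entries of \<open>W\<close> and \<open>X\<close> together form one independent family.\<close>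

definition matrix_model :: "'a measure \<Rightarrow> nat \<Rightarrow> nat \<Rightarrow> nat \<Rightarrow> real measure \<Rightarrow> real measure \<Rightarrow>
    (nat \<Rightarrow> nat \<Rightarrow> 'a \<Rightarrow> real) \<Rightarrow> (nat \<Rightarrow> nat \<Rightarrow> 'a \<Rightarrow> real) \<Rightarrow> bool" where
  "matrix_model M p m n \<nu>w \<nu>x W X \<longleftrightarrow> prob_space M \<and>
     prob_space.indep_vars M (\<lambda>_. borel) (case_sum (\<lambda>(i, k). W i k) (\<lambda>(k, j). X k j))
       ({1..p} \<times> {1..n} <+> {1..n} \<times> {1..m}) \<and>
     (\<forall>i\<in>{1..p}. \<forall>k\<in>{1..n}. distr M borel (W i k) = \<nu>w) \<and>
     (\<forall>k\<in>{1..n}. \<forall>j\<in>{1..m}. distr M borel (X k j) = \<nu>x)"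

definition Y_mat :: "(real \<Rightarrow> real) \<Rightarrow> nat \<Rightarrow> nat \<Rightarrow> (nat \<Rightarrow> nat \<Rightarrow> 'a \<Rightarrow> real) \<Rightarrow>
    (nat \<Rightarrow> nat \<Rightarrow> 'a \<Rightarrow> real) \<Rightarrow> nat \<Rightarrow> nat \<Rightarrow> 'a \<Rightarrow> real" where
  "Y_mat f m n W X i j \<omega> = 1 / sqrt (real m) * f (\<Sum>k=1..n. W i k \<omega> * X k j \<omega>)"

definition mean_inj_trace :: "'a measure \<Rightarrow> nat \<Rightarrow> nat \<Rightarrow> (nat \<Rightarrow> nat \<Rightarrow> 'a \<Rightarrow> real) \<Rightarrow>
    ('w, 'v) bigraph \<Rightarrow> real" where
  "mean_inj_trace M p m Y G =
     (\<integral>\<omega>. 1 / real p *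
        (\<Sum>g | g \<in> wverts G \<rightarrow>\<^sub>E {1..p} \<and> inj_on g (wverts G).
         \<Sum>h | h \<in> vverts G \<rightarrow>\<^sub>E {1..m} \<and> inj_on h (vverts G).
           \<Prod>(w, v)\<in>edges G. Y (g w) (h v) \<omega> ^ mult G w v) \<partial>M)"

end

(* Fourier inversion turns the mean injective trace into a scaling factor times an oscillatory
   integral of a product of Fourier transforms of f against the n-th power of
   E_X[prod_w (1 - q_n(lin_w))], where 1 - q_n is the characteristic function of an entry of W and
   n q_n tends to -Phi. Expanding the n-th power into joint moments of the q_n over sets D of W-vertices
   gives a sum over families C of such sets, a term being of order n to the power -sum (|D| - 1).
   Since f is odd and the laws are symmetric, flipping signs of frequencies annihilates all terms except
   those passing a parity test. For these, the components of C partition the W-vertices, every degree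
   inside a component is at least 2, and counting gives 2 (|W| + |V|) <= |E| + 2 cost C + 2. This is
   exactly the power of n in the scaling factor, so only the families with equality survive. Equality
   forces a forest structure at every level: the components of C are the blocks, G is admissible, and C
   restricts to an admissible decomposition on each big block. Different blocks share no frequencies,
   hence the limit factorizes. *)

theory Submission imports Defs begin

section \<open>Counting in connected and in forest-like set systems\<close>

section \<open>Connected families of sets\<close>

text \<open>The passage to the limit is dominated in the frequencies, which range over an unbounded
  space, although no moment of the entries of W is assumed. The majorant comes from the doubling
  inequality of characteristic functions: it survives in the limit and gives the exponent quadratic
  growth, and the uniformity in (A1) hands this growth back to finite n. The resulting powers of the
  frequencies are absorbed by the Fourier transform of f, which decays faster than every power
  because f is smooth. The second obstacle is that the number of terms in the n-th power grows with
  n. So the product over w of the means of 1 - q_n(lin_w) is split off, whose n-th power tends to an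
  exponential; the rest is a sum over sets of at least two W-vertices and of order n^(-2), so a
  binomial expansion in it may stop at a fixed length. The exponent count rests on one principle,
  that a connected graph has at most one vertex more than edges. It is applied to the incidences of
  W-vertices with the members of C and of V-vertices with the components; the remaining factor 2 is
  the least positive even degree.\<close>

definition connected_family :: "('i \<Rightarrow> 'b set) \<Rightarrow> 'i set \<Rightarrow> bool" where
  "connected_family S A \<longleftrightarrow> A \<noteq> {} \<and>
     (\<forall>D. D \<subset> A \<and> D \<noteq> {} \<longrightarrow> \<Union>(S ` D) \<inter> \<Union>(S ` (A - D)) \<noteq> {})"

lemma connected_familyD:
  "connected_family S A \<Longrightarrow> D \<subset> A \<Longrightarrow> D \<noteq> {} \<Longrightarrow> \<exists>a\<in>D. \<exists>b\<in>A - D. S a \<inter> S b \<noteq> {}"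
  unfolding connected_family_def by blast

text \<open>The sets outside \<open>D\<close> can be added one at a time, each meeting the union
  built so far, so each contributes at most its size minus one new points. The start
  \<open>D\<close> is arbitrary: a single index gives the global count, and a subfamily gives the
  local count behind \<open>tight_family_shared\<close>.\<close>

lemma connected_family_growth:
  assumes conn: "connected_family S A" and fin: "finite A" "\<And>a. a \<in> A \<Longrightarrow> finite (S a)"
    and D: "D \<subseteq> A" "D \<noteq> {}"
  shows "card (\<Union>(S ` A)) + card (A - D) \<le> card (\<Union>(S ` D)) + (\<Sum>a\<in>A - D. card (S a))"
  using D
proof (induction "card (A - D)" arbitrary: D rule: less_induct)
  case less
  show ?case
  proof (cases "D = A")
    case False
    with less.prems have "D \<subset> A" by blast
    from connected_familyD[OF conn this less.prems(2)]
    obtain d a where a: "d \<in> D" "a \<in> A - D" "S d \<inter> S a \<noteq> {}" by blast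
    define D' where "D' = insert a D"
    have AD: "A - D = insert a (A - D')" "a \<notin> A - D'" using a by (auto simp: D'_def)
    have finA: "finite (A - D')" using fin by auto
    have "card (A - D') < card (A - D)" using AD finA by simp
    then have IH: "card (\<Union>(S ` A)) + card (A - D') \<le> card (\<Union>(S ` D')) + (\<Sum>a\<in>A - D'. card (S a))"
      using less.hyps[of D'] less.prems a by (auto simp: D'_def)
    have finD: "finite D" using less.prems fin by (meson finite_subset)
    have finU: "finite (\<Union>(S ` D))" using finD less.prems fin(2) by blast
    have finS: "finite (S a)" using a fin by blast
    have "card (\<Union>(S ` D)) + card (S a) = card (\<Union>(S ` D) \<union> S a) + card (\<Union>(S ` D) \<inter> S a)"
      using card_Un_Int[OF finU finS] .
    moreover have "card (\<Union>(S ` D) \<inter> S a) \<ge> 1"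
      using a finU by (simp add: Suc_le_eq card_gt_0_iff) blast
    moreover have "\<Union>(S ` D') = \<Union>(S ` D) \<union> S a" by (auto simp: D'_def)
    ultimately have "card (\<Union>(S ` D')) + 1 \<le> card (\<Union>(S ` D)) + card (S a)" by simp
    then show ?thesis using IH AD finA by simp
  qed simp
qed

text \<open>In the incidence graph between points and indices, the left side counts vertices and the
  sum counts edges: a connected graph has at most one vertex more than edges.\<close>

lemma connected_family_card_Union:
  assumes "connected_family S A" "finite A" "\<And>a. a \<in> A \<Longrightarrow> finite (S a)"
  shows "card (\<Union>(S ` A)) + card A \<le> (\<Sum>a\<in>A. card (S a)) + 1"
proof -
  obtain a where a: "a \<in> A" using assms(1) unfolding connected_family_def by blast
  have "card (\<Union>(S ` A)) + card (A - {a}) \<le> card (S a) + (\<Sum>a\<in>A - {a}. card (S a))"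
    using connected_family_growth[OF assms, of "{a}"] a by simp
  moreover have "card A = card (A - {a}) + 1"
    using card.remove[OF assms(2) a] by linarith
  moreover have "(\<Sum>a\<in>A. card (S a)) = card (S a) + (\<Sum>a\<in>A - {a}. card (S a))"
    using a assms(2) by (simp add: sum.remove)
  ultimately show ?thesis by linarith
qed

text \<open>A split of the classes induces a split of the underlying indices, and it is again proper
  because the classes are nonempty and disjoint. This carries connectivity from W-vertices to
  components and blocks.\<close>

lemma connected_family_coarsen:
  assumes conn: "connected_family S A" and P: "partition_on A P"
  shows "connected_family (\<lambda>q. \<Union>(S ` q)) P"
  unfolding connected_family_def
proof (intro conjI allI impI)
  show "P \<noteq> {}" using conn P unfolding connected_family_def partition_on_def by auto
next
  fix D assume D: "D \<subset> P \<and> D \<noteq> {}"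
  have dis: "q = q'" if "q \<in> P" "q' \<in> P" "x \<in> q" "x \<in> q'" for q q' x
    using partition_onD2[OF P] that unfolding disjoint_def by blast
  have ne: "q \<noteq> {}" if "q \<in> P" for q using partition_onD3[OF P] that by metis
  have un: "A = \<Union>P" using partition_onD1[OF P] .
  have "\<Union>D \<noteq> {}" using D ne by blast
  moreover obtain q where q: "q \<in> P" "q \<notin> D" using D by blast
  moreover obtain x where "x \<in> q" using ne[OF q(1)] by blast
  ultimately have "\<Union>D \<subset> A" using dis un D by blast
  then obtain a b where ab: "a \<in> \<Union>D" "b \<in> A - \<Union>D" "S a \<inter> S b \<noteq> {}"
    using connected_familyD[OF conn _ \<open>\<Union>D \<noteq> {}\<close>] by blast
  obtain q1 where "q1 \<in> D" "a \<in> q1" using ab by blast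
  moreover obtain q2 where "q2 \<in> P - D" "b \<in> q2" using ab un by blast
  ultimately show "\<Union>((\<lambda>q. \<Union>(S ` q)) ` D) \<inter> \<Union>((\<lambda>q. \<Union>(S ` q)) ` (P - D)) \<noteq> {}"
    using ab(3) by blast
qed

text \<open>A point lying in two or more of the sets is counted at least twice on the right.\<close>

lemma card_Union_add_shared_le:
  assumes "finite J" "\<And>j. j \<in> J \<Longrightarrow> finite (S j)"
  shows "card (\<Union>(S ` J)) + card (in_at_least_two J S) \<le> (\<Sum>j\<in>J. card (S j))"
  using assms
proof (induction J)
  case (insert j J)
  have fin: "finite (\<Union>(S ` J))" "finite (S j)" using insert by auto
  have "in_at_least_two (insert j J) S \<subseteq> in_at_least_two J S \<union> (\<Union>(S ` J) \<inter> S j)"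
    unfolding in_at_least_two_def by blast
  moreover have "finite (in_at_least_two J S)"
    by (rule finite_subset[OF _ fin(1)]) (auto simp: in_at_least_two_def)
  ultimately have "card (in_at_least_two (insert j J) S) \<le> card (in_at_least_two J S) + card (\<Union>(S ` J) \<inter> S j)"
    using fin by (meson card_Un_le card_mono finite_Int finite_UnI order_trans)
  moreover have "card (\<Union>(S ` insert j J)) + card (\<Union>(S ` J) \<inter> S j) = card (\<Union>(S ` J)) + card (S j)"
    using card_Un_Int[OF fin] by (simp add: Un_commute)
  ultimately show ?case using insert by simp
qed (simp add: in_at_least_two_def)

lemma in_at_least_two_mono:
  "K \<subseteq> J \<Longrightarrow> (\<And>k. k \<in> K \<Longrightarrow> S' k \<subseteq> S k) \<Longrightarrow> in_at_least_two K S' \<subseteq> in_at_least_two J S"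
  unfolding in_at_least_two_def by blast

lemma finite_in_at_least_two:
  "finite J \<Longrightarrow> (\<And>j. j \<in> J \<Longrightarrow> finite (S j)) \<Longrightarrow> finite (in_at_least_two J S)"
  by (rule finite_subset[of _ "\<Union>(S ` J)"]) (auto simp: in_at_least_two_def)

text \<open>A smallest counterexample would have all sets of size at least two, all points shared and equality
  up to one, so that there are as many shared points as sets.\<close>

lemma forest_card_Union:
  fixes S :: "'i \<Rightarrow> 'b set"
  assumes "finite J" "J \<noteq> {}" "\<And>j. j \<in> J \<Longrightarrow> finite (S j)"
    and "\<And>K. K \<subseteq> J \<Longrightarrow> card K \<ge> 2 \<Longrightarrow> card (in_at_least_two K S) \<le> card K - 1"
  shows "(\<Sum>j\<in>J. card (S j)) + 1 \<le> card (\<Union>(S ` J)) + card J"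
  using assms
proof (induction "(\<Sum>j\<in>J. card (S j)) + card J" arbitrary: J S rule: less_induct)
  case less
  note fin = less.prems(1) and finS = less.prems(3)
  \<comment> \<open>Deleting one incidence preserves the hypothesis and lowers the sum by one, so
    the induction hypothesis applies. The cases below differ in what happens to the union.\<close>
  have shrink: "(\<Sum>j\<in>J. card ((S(k := S k - {x})) j)) + 1 \<le> card (\<Union>((S(k := S k - {x})) ` J)) + card J
      \<and> (\<Sum>j\<in>J. card (S j)) = (\<Sum>j\<in>J. card ((S(k := S k - {x})) j)) + 1"
    if k: "k \<in> J" "x \<in> S k" for k x
  proof -
    define T where "T = S(k := S k - {x})"
    have sub: "T j \<subseteq> S j" for j by (auto simp: T_def)
    have cT: "card (S k) = card (T k) + 1"
      using card.remove[OF finS[OF k(1)] k(2)] unfolding T_def fun_upd_same by linarith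
    have "(\<Sum>j\<in>J. card (S j)) = card (S k) + (\<Sum>j\<in>J - {k}. card (S j))"
      using k fin by (simp add: sum.remove)
    also have "(\<Sum>j\<in>J - {k}. card (S j)) = (\<Sum>j\<in>J - {k}. card (T j))"
      by (rule sum.cong) (auto simp: T_def)
    also have "card (S k) + (\<Sum>j\<in>J - {k}. card (T j)) = (\<Sum>j\<in>J. card (T j)) + 1"
      using k fin cT by (simp add: sum.remove)
    finally have eq: "(\<Sum>j\<in>J. card (S j)) = (\<Sum>j\<in>J. card (T j)) + 1" .
    have "(\<Sum>j\<in>J. card (T j)) + 1 \<le> card (\<Union>(T ` J)) + card J"
    proof (rule less.hyps)
      show "(\<Sum>j\<in>J. card (T j)) + card J < (\<Sum>j\<in>J. card (S j)) + card J" using eq by simp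
      show "finite (T j)" if "j \<in> J" for j using finS[OF that] sub finite_subset by blast
      show "card (in_at_least_two K T) \<le> card K - 1" if "K \<subseteq> J" "card K \<ge> 2" for K
      proof -
        have "finite K" by (rule finite_subset[OF that(1) fin])
        then have "finite (in_at_least_two K S)"
          using that(1) finS by (intro finite_in_at_least_two) auto
        moreover have "in_at_least_two K T \<subseteq> in_at_least_two K S"
          by (rule in_at_least_two_mono[OF subset_refl]) (rule sub)
        ultimately have "card (in_at_least_two K T) \<le> card (in_at_least_two K S)"
          by (rule card_mono)
        then show ?thesis using less.prems(4)[OF that] by simp
      qed
    qed (use less.prems(1,2) in auto)
    then show ?thesis using eq unfolding T_def by simp
  qed
  consider "card J = 1" | j where "card J \<noteq> 1" "j \<in> J" "card (S j) \<le> 1"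
    | "card J \<noteq> 1" "\<forall>j\<in>J. card (S j) \<ge> 2" by fastforce
  then show ?case
  proof cases
    case 1
    then obtain j where "J = {j}" using card_1_singletonE by blast
    then show ?thesis by simp
  next
    case 2
    have cJ: "card J = card (J - {j}) + 1" using card.remove[OF fin 2(2)] by linarith
    have sJ: "(\<Sum>j\<in>J. card (S j)) = card (S j) + (\<Sum>j\<in>J - {j}. card (S j))"
      using 2 fin by (simp add: sum.remove)
    have "card (J - {j}) \<noteq> 0" using 2(1) cJ by linarith
    then have "J - {j} \<noteq> {}" by (metis card.empty)
    have "(\<Sum>i\<in>J - {j}. card (S i)) + 1 \<le> card (\<Union>(S ` (J - {j}))) + card (J - {j})"
    proof (rule less.hyps)
      show "(\<Sum>i\<in>J - {j}. card (S i)) + card (J - {j}) < (\<Sum>j\<in>J. card (S j)) + card J"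
        using cJ sJ by linarith
      show "card (in_at_least_two K S) \<le> card K - 1" if "K \<subseteq> J - {j}" "card K \<ge> 2" for K
        by (rule less.prems(4)) (use that in auto)
    qed (use fin finS \<open>J - {j} \<noteq> {}\<close> in auto)
    moreover have "card (\<Union>(S ` (J - {j}))) \<le> card (\<Union>(S ` J))"
      using fin finS by (intro card_mono) auto
    ultimately show ?thesis using cJ sJ 2(3) by linarith
  next
    case 3
    obtain j where j: "j \<in> J" using less.prems by blast
    then have "S j \<noteq> {}" using 3 by force
    then obtain x where x: "x \<in> S j" by blast
    show ?thesis
    proof (cases "\<exists>k\<in>J. \<exists>y\<in>S k. \<forall>i\<in>J - {k}. y \<notin> S i")
      case True
      then obtain k y where k: "k \<in> J" "y \<in> S k" "\<forall>i\<in>J - {k}. y \<notin> S i" by blast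
      have U: "\<Union>(S ` J) = insert y (\<Union>((S(k := S k - {y})) ` J))" using k by auto
      have "y \<notin> \<Union>((S(k := S k - {y})) ` J)" using k by auto
      moreover have "finite (\<Union>((S(k := S k - {y})) ` J))" using fin finS by auto
      ultimately have "card (\<Union>(S ` J)) = card (\<Union>((S(k := S k - {y})) ` J)) + 1"
        unfolding U by (metis Suc_eq_plus1 card_insert_disjoint)
      then show ?thesis using shrink[OF k(1,2)] by linarith
    next
      case False
      have sh: "\<Union>(S ` J) = in_at_least_two J S"
      proof
        show "\<Union>(S ` J) \<subseteq> in_at_least_two J S"
        proof
          fix y assume "y \<in> \<Union>(S ` J)"
          then obtain k where k: "k \<in> J" "y \<in> S k" by blast
          then obtain i where "i \<in> J" "i \<noteq> k" "y \<in> S i" using False by blast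
          with k show "y \<in> in_at_least_two J S" unfolding in_at_least_two_def by blast
        qed
      qed (auto simp: in_at_least_two_def)
      have "card J \<noteq> 0" using j fin by auto
      then have c2: "card J \<ge> 2" using 3(1) by linarith
      have "card (\<Union>(S ` J)) \<le> card J - 1"
        unfolding sh by (rule less.prems(4)) (use c2 in auto)
      moreover have "2 * card J \<le> (\<Sum>j\<in>J. card (S j))"
        using sum_mono[of J "\<lambda>_. 2" "\<lambda>j. card (S j)"] 3 by (simp add: mult.commute)
      moreover have "card (\<Union>((S(j := S j - {x})) ` J)) \<le> card (\<Union>(S ` J))"
        using fin finS by (intro card_mono) (auto split: if_splits)
      ultimately show ?thesis using shrink[OF j x] c2 by linarith
    qed
  qed
qed

text \<open>Growing the whole family from \<open>J\<close> loses at least one point per added set.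
  As the global count is tight, the sizes over \<open>J\<close> sum to at most
  \<open>card J - 1\<close> more than the size of their union, and this excess bounds the number of
  shared points.\<close>

lemma tight_family_shared:
  assumes conn: "connected_family S A" and fin: "finite A" "\<And>a. a \<in> A \<Longrightarrow> finite (S a)"
    and tight: "(\<Sum>a\<in>A. card (S a)) + 1 \<le> card (\<Union>(S ` A)) + card A"
    and J: "J \<subseteq> A" "card J \<ge> 2"
  shows "card (in_at_least_two J S) \<le> card J - 1"
proof -
  have finJ: "finite J" "J \<noteq> {}" using J fin finite_subset by auto
  have "card (\<Union>(S ` A)) + card (A - J) \<le> card (\<Union>(S ` J)) + (\<Sum>a\<in>A - J. card (S a))"
    using connected_family_growth[OF conn fin] J finJ by blast
  moreover have "card (A - J) + card J = card A"
    using J fin finJ by (simp add: card_Diff_subset card_mono)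
  moreover have "(\<Sum>a\<in>A. card (S a)) = (\<Sum>a\<in>A - J. card (S a)) + (\<Sum>a\<in>J. card (S a))"
    using J fin by (simp add: sum.subset_diff)
  moreover have "card (\<Union>(S ` J)) + card (in_at_least_two J S) \<le> (\<Sum>j\<in>J. card (S j))"
    using J fin by (intro card_Union_add_shared_le finJ) auto
  ultimately show ?thesis using tight J by linarith
qed

text \<open>Intersecting every set with the set \<open>X\<close> of shared points keeps the forest
  property. If every trace had two points, the sizes would sum to at least
  \<open>2 * card J\<close>, whereas \<open>forest_card_Union\<close> together with
  \<open>card X \<le> card J - 1\<close> bounds the sum by \<open>2 * card J - 2\<close>.\<close>

lemma forest_leaf:
  assumes fin: "finite J" "\<And>j. j \<in> J \<Longrightarrow> finite (S j)" and J2: "card J \<ge> 2"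
    and forest: "\<And>K. K \<subseteq> J \<Longrightarrow> card K \<ge> 2 \<Longrightarrow> card (in_at_least_two K S) \<le> card K - 1"
  obtains j where "j \<in> J" "card (S j \<inter> \<Union>(S ` (J - {j}))) \<le> 1"
proof -
  define X where "X = in_at_least_two J S"
  have "\<exists>j\<in>J. card (S j \<inter> X) \<le> 1"
  proof (rule ccontr)
    assume "\<not> ?thesis"
    then have "2 \<le> card (S j \<inter> X)" if "j \<in> J" for j
    proof -
      have "\<not> card (S j \<inter> X) \<le> 1" using that \<open>\<not> (\<exists>j\<in>J. card (S j \<inter> X) \<le> 1)\<close> by blast
      then show ?thesis by linarith
    qed
    then have "2 * card J \<le> (\<Sum>j\<in>J. card (S j \<inter> X))"
      using sum_mono[of J "\<lambda>_. 2" "\<lambda>j. card (S j \<inter> X)"] by (simp add: mult.commute)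
    moreover have "(\<Sum>j\<in>J. card (S j \<inter> X)) + 1 \<le> card (\<Union>((\<lambda>j. S j \<inter> X) ` J)) + card J"
    proof (rule forest_card_Union)
      fix K assume K: "K \<subseteq> J" "card K \<ge> 2"
      then have "finite K" using fin(1) by (metis finite_subset)
      then have "finite (in_at_least_two K S)"
        using K(1) fin by (intro finite_in_at_least_two) auto
      then have "card (in_at_least_two K (\<lambda>j. S j \<inter> X)) \<le> card (in_at_least_two K S)"
        by (rule card_mono[OF _ in_at_least_two_mono[OF subset_refl]]) blast
      then show "card (in_at_least_two K (\<lambda>j. S j \<inter> X)) \<le> card K - 1"
        using forest[OF K] by linarith
    next
      show "J \<noteq> {}" using J2 by auto
    qed (use fin in auto)
    moreover have "card (\<Union>((\<lambda>j. S j \<inter> X) ` J)) \<le> card X"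
      using fin by (intro card_mono) (auto simp: X_def intro: finite_in_at_least_two)
    moreover have "card X \<le> card J - 1" unfolding X_def using forest J2 by blast
    ultimately show False using J2 by linarith
  qed
  moreover have "S j \<inter> \<Union>(S ` (J - {j})) = S j \<inter> X" if "j \<in> J" for j
    using that unfolding X_def in_at_least_two_def by auto
  ultimately show thesis using that by auto
qed

section \<open>Components of a hypergraph and the cost of a family\<close>

section \<open>Components of a set system\<close>

definition closed_for :: "'a set set \<Rightarrow> 'a set \<Rightarrow> bool" where
  "closed_for \<D> U \<longleftrightarrow> (\<forall>A\<in>\<D>. A \<inter> U \<noteq> {} \<longrightarrow> A \<subseteq> U)"

text \<open>Connected components of the hypergraph with edges \<open>\<D>\<close>, described as
  minimal nonempty closed sets. A vertex of \<open>W\<close> that lies in no member with two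
  elements is a component by itself.\<close>

definition comps :: "'a set \<Rightarrow> 'a set set \<Rightarrow> 'a set set" where
  "comps W \<D> = {q. q \<subseteq> W \<and> q \<noteq> {} \<and> closed_for \<D> q \<and> (\<forall>U. U \<subset> q \<and> U \<noteq> {} \<longrightarrow> \<not> closed_for \<D> U)}"

text \<open>A hypertree of this cost spans \<open>cost + 1\<close> vertices. In the asymptotic
  expansion, the term of a family has order n to the power minus its cost.\<close>

definition cost :: "'a set set \<Rightarrow> nat" where
  "cost \<D> = (\<Sum>A\<in>\<D>. card A - 1)"

lemma comps_partition:
  assumes fin: "finite W" and sub: "\<Union>\<D> \<subseteq> W"
  shows "partition_on W (comps W \<D>)"
proof (rule partition_onI)
  show "\<Union>(comps W \<D>) = W"
  proof
    show "W \<subseteq> \<Union>(comps W \<D>)"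
    proof
      fix w assume w: "w \<in> W"
      define good where "good = (\<lambda>q. q \<subseteq> W \<and> w \<in> q \<and> closed_for \<D> q)"
      have "good W" using w sub by (auto simp: good_def closed_for_def)
      then obtain q where q: "good q" "\<And>q'. good q' \<Longrightarrow> card q \<le> card q'"
        by (metis arg_min_natI arg_min_nat_le)
      have finq: "finite q" using q(1) fin finite_subset unfolding good_def by blast
      have "\<not> closed_for \<D> U" if U: "U \<subset> q" "U \<noteq> {}" for U
      proof
        assume cl: "closed_for \<D> U"
        show False
        proof (cases "w \<in> U")
          case True
          then have "good U" using U q(1) cl by (auto simp: good_def)
          then show False using q(2)[of U] psubset_card_mono[OF finq U(1)] by simp
        next
          case False
          \<comment> \<open>The complement of a closed set inside a closed set is closed, so
            \<open>w\<close> lies in a smaller closed set whether or not it belongs to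
            \<open>U\<close>.\<close>
          have "closed_for \<D> (q - U)"
            unfolding closed_for_def
          proof (intro ballI impI)
            fix A assume A: "A \<in> \<D>" "A \<inter> (q - U) \<noteq> {}"
            then have "A \<subseteq> q" using q(1) unfolding good_def closed_for_def by blast
            moreover have "A \<inter> U = {}" using A cl unfolding closed_for_def by blast
            ultimately show "A \<subseteq> q - U" by blast
          qed
          then have "good (q - U)" using False U q(1) unfolding good_def by blast
          moreover have "card (q - U) < card q" using U finq by (intro psubset_card_mono) auto
          ultimately show False using q(2)[of "q - U"] by simp
        qed
      qed
      then have "q \<in> comps W \<D>" using q(1) by (auto simp: comps_def good_def)
      then show "w \<in> \<Union>(comps W \<D>)" using q(1) by (auto simp: good_def)
    qed
  qed (auto simp: comps_def)
next
  fix p q assume pq: "p \<in> comps W \<D>" "q \<in> comps W \<D>" "p \<noteq> q"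
  show "disjnt p q"
  proof (rule ccontr)
    assume "\<not> disjnt p q"
    then have ne: "p \<inter> q \<noteq> {}" by (simp add: disjnt_def)
    have "closed_for \<D> p" "closed_for \<D> q" using pq by (simp_all add: comps_def)
    then have cl: "closed_for \<D> (p \<inter> q)" unfolding closed_for_def by (meson Int_subset_iff disjoint_iff Int_iff)
    have "\<forall>U. U \<subset> p \<and> U \<noteq> {} \<longrightarrow> \<not> closed_for \<D> U" "\<forall>U. U \<subset> q \<and> U \<noteq> {} \<longrightarrow> \<not> closed_for \<D> U"
      using pq by (simp_all add: comps_def)
    then have "\<not> p \<inter> q \<subset> p" "\<not> p \<inter> q \<subset> q" using ne cl by metis+
    then show False using pq(3) by blast
  qed
qed (auto simp: comps_def)

text \<open>A subfamily disjoint from the rest would have a closed union strictly inside the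
  component, against minimality.\<close>

lemma comps_connected_family:
  assumes q: "q \<in> comps W \<D>" and F: "F = {A \<in> \<D>. A \<subseteq> q}"
    and ne: "{} \<notin> \<D>" and cov: "\<Union>F = q"
  shows "connected_family (\<lambda>A. A) F"
  unfolding connected_family_def
proof (intro conjI allI impI)
  show "F \<noteq> {}" using q cov by (auto simp: comps_def)
next
  fix D assume D: "D \<subset> F \<and> D \<noteq> {}"
  show "\<Union>((\<lambda>A. A) ` D) \<inter> \<Union>((\<lambda>A. A) ` (F - D)) \<noteq> {}"
  proof
    assume dis: "\<Union>((\<lambda>A. A) ` D) \<inter> \<Union>((\<lambda>A. A) ` (F - D)) = {}"
    have "closed_for \<D> (\<Union>D)"
      unfolding closed_for_def
    proof (intro ballI impI)
      fix A assume A: "A \<in> \<D>" "A \<inter> \<Union>D \<noteq> {}"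
      then have "A \<inter> q \<noteq> {}" using cov D by blast
      then have "A \<subseteq> q" using q A unfolding comps_def closed_for_def by blast
      then have "A \<in> F" using A F by blast
      then show "A \<subseteq> \<Union>D" using dis A by blast
    qed
    moreover obtain A where A: "A \<in> F" "A \<notin> D" using D by blast
    moreover have "A \<noteq> {}" using A F ne by blast
    ultimately have "\<Union>D \<subset> q" "closed_for \<D> (\<Union>D)" using dis cov D by blast+
    moreover obtain B where B: "B \<in> D" using D by blast
    moreover have "B \<noteq> {}" using B D F ne by blast
    ultimately have "\<Union>D \<subset> q" "closed_for \<D> (\<Union>D)" "\<Union>D \<noteq> {}" by blast+
    then show False using q by (auto simp: comps_def)
  qed
qed

text \<open>An uncovered vertex would form a closed singleton and hence be the whole
  component.\<close>

lemma comps_cover: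
  assumes q: "q \<in> comps W \<D>" and q2: "card q \<ge> 2"
  shows "\<Union>{A \<in> \<D>. A \<subseteq> q} = q"
proof
  show "q \<subseteq> \<Union>{A \<in> \<D>. A \<subseteq> q}"
  proof
    fix w assume w: "w \<in> q"
    show "w \<in> \<Union>{A \<in> \<D>. A \<subseteq> q}"
    proof (rule ccontr)
      assume "w \<notin> \<Union>{A \<in> \<D>. A \<subseteq> q}"
      moreover have "closed_for \<D> q" using q by (simp add: comps_def)
      ultimately have "closed_for \<D> {w}" using w unfolding closed_for_def by blast
      moreover have "q \<noteq> {w}" using q2 by auto
      then have "{w} \<subset> q" using w by blast
      ultimately show False using q unfolding comps_def by blast
    qed
  qed
qed auto

text \<open>For two or more vertices this is \<open>connected_family_card_Union\<close> for the
  members inside \<open>q\<close>, with one unit per member moved from the left side into the sum.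
  For a single vertex the summand 1 suffices.\<close>

lemma comps_cost_le:
  assumes q: "q \<in> comps W \<D>" and fin: "finite W" and fD: "finite \<D>" and ne: "{} \<notin> \<D>"
  shows "card q \<le> (\<Sum>A\<in>{A \<in> \<D>. A \<subseteq> q}. card A - 1) + 1"
proof (cases "card q \<ge> 2")
  case True
  define F where "F = {A \<in> \<D>. A \<subseteq> q}"
  have cov: "\<Union>F = q" using comps_cover[OF q True] by (simp add: F_def)
  have finq: "finite q" using True by (metis card.infinite not_numeral_le_zero)
  have finF: "finite F" "\<And>A. A \<in> F \<Longrightarrow> finite A" using fD finq finite_subset by (auto simp: F_def)
  have "card (\<Union>((\<lambda>A. A) ` F)) + card F \<le> (\<Sum>A\<in>F. card A) + 1"
    using connected_family_card_Union[OF comps_connected_family[OF q F_def ne cov] finF] by blast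
  moreover have "(\<Sum>A\<in>F. card A) = (\<Sum>A\<in>F. card A - 1) + card F"
  proof -
    have "(\<Sum>A\<in>F. card A) = (\<Sum>A\<in>F. (card A - 1) + 1)"
    proof (rule sum.cong)
      fix A assume "A \<in> F"
      then have "card A \<noteq> 0" using finF ne by (auto simp: F_def)
      then show "card A = card A - 1 + 1" by simp
    qed simp
    then show ?thesis by (simp only: sum.distrib) simp
  qed
  ultimately show ?thesis using cov by (simp add: F_def)
qed simp

lemma cost_comps:
  assumes fin: "finite W" and D: "\<And>A. A \<in> \<D> \<Longrightarrow> A \<noteq> {} \<and> A \<subseteq> W"
  shows "cost \<D> = (\<Sum>q\<in>comps W \<D>. \<Sum>A\<in>{A \<in> \<D>. A \<subseteq> q}. card A - 1)"
proof -
  have part: "partition_on W (comps W \<D>)" by (rule comps_partition[OF fin]) (use D in blast)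
  have U: "\<Union>(comps W \<D>) = W" by (rule partition_onD1[OF part, symmetric])
  have "\<D> \<subseteq> Pow W" using D by blast
  then have fD: "finite \<D>" using fin by (simp add: finite_subset)
  have "finite (comps W \<D>)" using fin part by (rule finite_elements)
  moreover have "\<forall>p\<in>comps W \<D>. \<forall>q\<in>comps W \<D>. p \<noteq> q \<longrightarrow> {A \<in> \<D>. A \<subseteq> p} \<inter> {A \<in> \<D>. A \<subseteq> q} = {}"
  proof (intro ballI impI)
    fix p q assume pq: "p \<in> comps W \<D>" "q \<in> comps W \<D>" "p \<noteq> q"
    then have "p \<inter> q = {}" using partition_onD2[OF part] by (meson disjointD)
    then show "{A \<in> \<D>. A \<subseteq> p} \<inter> {A \<in> \<D>. A \<subseteq> q} = {}" using D by blast
  qed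
  ultimately have "(\<Sum>q\<in>comps W \<D>. \<Sum>A\<in>{A \<in> \<D>. A \<subseteq> q}. card A - 1)
      = (\<Sum>A\<in>(\<Union>q\<in>comps W \<D>. {A \<in> \<D>. A \<subseteq> q}). card A - 1)"
    using fD by (subst sum.UNION_disjoint) auto
  also have "(\<Union>q\<in>comps W \<D>. {A \<in> \<D>. A \<subseteq> q}) = \<D>"
  proof
    show "\<D> \<subseteq> (\<Union>q\<in>comps W \<D>. {A \<in> \<D>. A \<subseteq> q})"
    proof
      fix A assume A: "A \<in> \<D>"
      then obtain w where "w \<in> A" "w \<in> W" using D by blast
      then have "w \<in> \<Union>(comps W \<D>)" by (simp only: U)
      then obtain q where q: "q \<in> comps W \<D>" "w \<in> q" by blast
      then have "closed_for \<D> q" by (simp add: comps_def)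
      then have "A \<subseteq> q" using A q(2) \<open>w \<in> A\<close> unfolding closed_for_def by blast
      then show "A \<in> (\<Union>q\<in>comps W \<D>. {A \<in> \<D>. A \<subseteq> q})" using A q(1) by blast
    qed
  qed auto
  finally show ?thesis by (simp add: cost_def)
qed

section \<open>Connectivity expressed by neighbourhoods\<close>

section \<open>Connectivity of bipartite multigraphs\<close>

definition nbs :: "('w, 'v) bigraph \<Rightarrow> 'w \<Rightarrow> 'v set" where
  "nbs G w = {v \<in> vverts G. mult G w v \<ge> 1}"

lemma wverts_induced [simp]: "wverts (induced G A) = A"
  by (simp add: induced_def)

lemma vverts_induced: "vverts (induced G A) = \<Union>(nbs G ` A)"
  by (auto simp: induced_def nbs_def)

lemma vdeg_induced: "vdeg (induced G A) v = (\<Sum>w\<in>A. mult G w v)"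
  by (simp add: vdeg_def induced_def)

lemma wdeg_induced:
  assumes "finite (vverts G)" "w \<in> A"
  shows "wdeg (induced G A) w = wdeg G w"
proof -
  have "(\<Sum>v | v \<in> vverts G \<and> (\<exists>w\<in>A. 1 \<le> mult G w v). mult G w v) = (\<Sum>v\<in>vverts G. mult G w v)"
    using assms by (intro sum.mono_neutral_left) (auto simp: Suc_le_eq)
  then show ?thesis using assms by (simp add: wdeg_def induced_def)
qed

lemma induced_induced: "B \<subseteq> A \<Longrightarrow> induced (induced G A) B = induced G B"
  by (auto simp: induced_def fun_eq_iff)

lemma edges_induced: "edges (induced G A) = {(w, v). w \<in> A \<and> v \<in> nbs G w}"
  by (auto simp: edges_def induced_def nbs_def)

lemma adjacency_closed_verts: "adjacency G `` (wverts G <+> vverts G) \<subseteq> wverts G <+> vverts G"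
  by (auto simp: adjacency_def edges_def)

text \<open>Reachability is replaced by invariant vertex sets, so that graph connectivity can be
  compared with \<open>connected_family\<close> without handling paths.\<close>

lemma connected_bigraph_iff_closed:
  "connected_bigraph G \<longleftrightarrow> wverts G <+> vverts G \<noteq> {} \<and>
     (\<forall>S. S \<subseteq> wverts G <+> vverts G \<and> S \<noteq> {} \<and> adjacency G `` S \<subseteq> S \<longrightarrow> S = wverts G <+> vverts G)"
proof
  assume *: "connected_bigraph G"
  have "S = wverts G <+> vverts G"
    if S: "S \<subseteq> wverts G <+> vverts G" "S \<noteq> {}" "adjacency G `` S \<subseteq> S" for S
  proof -
    obtain x where x: "x \<in> S" using S by blast
    have cl: "(adjacency G)\<^sup>* `` S = S" by (rule Image_closed_trancl[OF S(3)])
    have "y \<in> S" if "y \<in> wverts G <+> vverts G" for y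
    proof -
      have "(x, y) \<in> (adjacency G)\<^sup>*" using * that x S(1) unfolding connected_bigraph_def by blast
      then show ?thesis using cl x by blast
    qed
    then show ?thesis using S(1) by blast
  qed
  then show "wverts G <+> vverts G \<noteq> {} \<and>
     (\<forall>S. S \<subseteq> wverts G <+> vverts G \<and> S \<noteq> {} \<and> adjacency G `` S \<subseteq> S \<longrightarrow> S = wverts G <+> vverts G)"
    using * unfolding connected_bigraph_def by blast
next
  assume *: "wverts G <+> vverts G \<noteq> {} \<and>
     (\<forall>S. S \<subseteq> wverts G <+> vverts G \<and> S \<noteq> {} \<and> adjacency G `` S \<subseteq> S \<longrightarrow> S = wverts G <+> vverts G)"
  have "(x, y) \<in> (adjacency G)\<^sup>*"
    if xy: "x \<in> wverts G <+> vverts G" "y \<in> wverts G <+> vverts G" for x y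
  proof -
    define S where "S = (adjacency G)\<^sup>* `` {x}"
    have "S \<subseteq> wverts G <+> vverts G"
      using xy(1) Image_closed_trancl[OF adjacency_closed_verts, of G] by (auto simp: S_def)
    moreover have "S \<noteq> {}" "adjacency G `` S \<subseteq> S" by (auto simp: S_def intro: rtrancl_into_rtrancl)
    ultimately have "S = wverts G <+> vverts G" using * by blast
    then show ?thesis using xy(2) by (auto simp: S_def)
  qed
  then show "connected_bigraph G" using * unfolding connected_bigraph_def by blast
qed

lemma adjacency_induced:
  "adjacency (induced G A) = {(Inl w, Inr v) | w v. w \<in> A \<and> v \<in> nbs G w} \<union>
     {(Inr v, Inl w) | w v. w \<in> A \<and> v \<in> nbs G w}"
  by (auto simp: adjacency_def edges_induced)

text \<open>A set \<open>D\<close> of W-vertices together with its neighbours is invariant in G(A)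
  exactly when no neighbour is shared with \<open>A - D\<close>. From here on, connectivity of
  induced subgraphs is a statement about the family \<open>nbs G\<close>.\<close>

lemma connected_induced: "connected_bigraph (induced G A) \<longleftrightarrow> connected_family (nbs G) A"
proof
  assume *: "connected_bigraph (induced G A)"
  have A: "A \<noteq> {}" using * by (auto simp: connected_bigraph_def vverts_induced)
  have "\<Union>(nbs G ` D) \<inter> \<Union>(nbs G ` (A - D)) \<noteq> {}" if D: "D \<subset> A" "D \<noteq> {}" for D
  proof
    assume dis: "\<Union>(nbs G ` D) \<inter> \<Union>(nbs G ` (A - D)) = {}"
    define S where "S = Inl ` D \<union> Inr ` \<Union>(nbs G ` D)"
    have "S \<subseteq> A <+> \<Union>(nbs G ` A)" using D by (auto simp: S_def)
    moreover have "S \<noteq> {}" using D by (auto simp: S_def)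
    moreover have "adjacency (induced G A) `` S \<subseteq> S"
      using dis by (fastforce simp: S_def adjacency_induced)
    ultimately have "S = A <+> \<Union>(nbs G ` A)"
      using * unfolding connected_bigraph_iff_closed by (simp add: vverts_induced)
    then have "A \<subseteq> D" by (auto simp: S_def)
    then show False using D by blast
  qed
  then show "connected_family (nbs G) A" using A unfolding connected_family_def by blast
next
  assume *: "connected_family (nbs G) A"
  then have A: "A \<noteq> {}" by (simp add: connected_family_def)
  have "S = A <+> \<Union>(nbs G ` A)"
    if S: "S \<subseteq> A <+> \<Union>(nbs G ` A)" "S \<noteq> {}" and cl: "adjacency (induced G A) `` S \<subseteq> S" for S
  proof -
    have lr: "Inr v \<in> S" if "Inl w \<in> S" "w \<in> A" "v \<in> nbs G w" for w v
    proof -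
      have "Inr v \<in> adjacency (induced G A) `` S" using that unfolding adjacency_induced by blast
      then show ?thesis using cl by blast
    qed
    have rl: "Inl w \<in> S" if "Inr v \<in> S" "w \<in> A" "v \<in> nbs G w" for w v
    proof -
      have "Inl w \<in> adjacency (induced G A) `` S" using that unfolding adjacency_induced by blast
      then show ?thesis using cl by blast
    qed
    define D where "D = {w \<in> A. Inl w \<in> S}"
    have "D \<noteq> {}"
    proof -
      obtain x where x: "x \<in> S" using S by blast
      then consider w where "x = Inl w" "w \<in> A" | w v where "x = Inr v" "w \<in> A" "v \<in> nbs G w"
        using S(1) by blast
      then show ?thesis using x rl by cases (auto simp: D_def)
    qed
    have "D = A"
    proof (rule ccontr)
      assume "D \<noteq> A"
      then have "D \<subset> A" by (auto simp: D_def)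
      then obtain a b where "a \<in> D" "b \<in> A - D" "nbs G a \<inter> nbs G b \<noteq> {}"
        using connected_familyD[OF * _ \<open>D \<noteq> {}\<close>] by blast
      then show False using lr rl by (auto simp: D_def)
    qed
    then have "Inl w \<in> S" if "w \<in> A" for w using that by (auto simp: D_def)
    then show ?thesis using S(1) lr by fastforce
  qed
  then show "connected_bigraph (induced G A)"
    using A unfolding connected_bigraph_iff_closed by (auto simp: vverts_induced)
qed

lemma connected_vverts:
  assumes conn: "connected_bigraph G" and W: "wverts G \<noteq> {}"
  shows "\<Union>(nbs G ` wverts G) = vverts G"
proof
  show "vverts G \<subseteq> \<Union>(nbs G ` wverts G)"
  proof
    fix v assume v: "v \<in> vverts G"
    show "v \<in> \<Union>(nbs G ` wverts G)"
    proof (rule ccontr)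
      assume "v \<notin> \<Union>(nbs G ` wverts G)"
      then have "adjacency G `` {Inr v} \<subseteq> {Inr v}"
        by (auto simp: adjacency_def edges_def nbs_def)
      moreover have "{Inr v} \<subseteq> wverts G <+> vverts G" "{Inr v} \<noteq> {}" using v by auto
      ultimately have "{Inr v} = wverts G <+> vverts G"
        using conn unfolding connected_bigraph_iff_closed by blast
      then show False using W by auto
    qed
  qed
qed (auto simp: nbs_def)

lemma induced_wverts:
  assumes fin: "finite_bigraph G" and conn: "connected_bigraph G" and W: "wverts G \<noteq> {}"
  shows "induced G (wverts G) = G"
proof (rule bigraph.equality)
  show "vverts (induced G (wverts G)) = vverts G"
    using connected_vverts[OF conn W] by (simp add: vverts_induced)
  show "mult (induced G (wverts G)) = mult G"
  proof (intro ext)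
    fix w v
    have "mult G w v = 0" if "w \<notin> wverts G"
      using fin that unfolding finite_bigraph_def by (metis One_nat_def less_one linorder_not_le)
    then show "mult (induced G (wverts G)) w v = mult G w v" by (simp add: induced_def)
  qed
qed (auto simp: induced_def)

lemma connected_family_wverts:
  assumes "finite_bigraph G" "connected_bigraph G" "wverts G \<noteq> {}"
  shows "connected_family (nbs G) (wverts G)"
  using assms induced_wverts[OF assms] connected_induced[of G "wverts G"] by simp

text \<open>Without W-vertices there are no edges, and every V-vertex alone is an invariant set.
  This degenerate graph is treated separately in the final limit.\<close>

lemma connected_no_wverts:
  assumes "connected_bigraph G" "wverts G = {}"
  shows "card (vverts G) = 1"
proof -
  obtain v where v: "v \<in> vverts G" using assms by (auto simp: connected_bigraph_def)
  have "adjacency G `` {Inr v} \<subseteq> {Inr v}" using assms by (auto simp: adjacency_def edges_def)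
  moreover have "{Inr v} \<subseteq> wverts G <+> vverts G" "{Inr v} \<noteq> {}" using v by auto
  ultimately have "{Inr v} = wverts G <+> vverts G"
    using assms unfolding connected_bigraph_iff_closed by blast
  then have "vverts G = {v}" using v by auto
  then show ?thesis by simp
qed

section \<open>Blocks as maximal inseparable sets of W-vertices\<close>

section \<open>Blocks\<close>

text \<open>The inclusion in \<open>{v}\<close> treats two defects at once: an empty overlap means
  that G(A) is disconnected, an overlap of one vertex that this vertex is separating.\<close>

definition inseparable :: "('w, 'v) bigraph \<Rightarrow> 'w set \<Rightarrow> bool" where
  "inseparable G A \<longleftrightarrow> A \<noteq> {} \<and>
     (\<forall>D v. D \<subset> A \<and> D \<noteq> {} \<longrightarrow> \<not> \<Union>(nbs G ` D) \<inter> \<Union>(nbs G ` (A - D)) \<subseteq> {v})"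

text \<open>One class of the separating partition is set against the union of all the others, which
  reduces any number of pieces to two.\<close>

lemma separating_split:
  assumes "separating (induced G A) v"
  obtains D where "D \<subset> A" "D \<noteq> {}" "\<Union>(nbs G ` D) \<inter> \<Union>(nbs G ` (A - D)) \<subseteq> {v}"
proof -
  obtain P where P: "partition_on A P" "card P \<ge> 2"
    and int: "\<And>B C. B \<in> P \<Longrightarrow> C \<in> P \<Longrightarrow> B \<noteq> C \<Longrightarrow>
      vverts (induced (induced G A) B) \<inter> vverts (induced (induced G A) C) = {v}"
    using assms unfolding separating_def by auto
  have sub: "B \<subseteq> A" if "B \<in> P" for B using partition_onD1[OF P(1)] that by blast
  obtain B C where BC: "B \<in> P" "C \<in> P" "B \<noteq> C"
    using P(2) by (metis One_nat_def card_le_Suc0_iff_eq card.infinite not_less_eq_eq numeral_2_eq_2 not_numeral_le_zero)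
  have "B \<noteq> {}" using partition_onD3[OF P(1)] BC by blast
  moreover have "B \<subset> A"
  proof -
    have "C \<noteq> {}" using partition_onD3[OF P(1)] BC by blast
    moreover have "B \<inter> C = {}" using partition_onD2[OF P(1)] BC by (meson disjointD)
    ultimately show ?thesis using sub BC by blast
  qed
  moreover have "\<Union>(nbs G ` B) \<inter> \<Union>(nbs G ` (A - B)) \<subseteq> {v}"
  proof
    fix x assume x: "x \<in> \<Union>(nbs G ` B) \<inter> \<Union>(nbs G ` (A - B))"
    then obtain w where w: "w \<in> A - B" "x \<in> nbs G w" by blast
    then obtain D where D: "D \<in> P" "w \<in> D" using partition_onD1[OF P(1)] by auto
    then have "B \<noteq> D" using w by blast
    from int[OF BC(1) D(1) this] show "x \<in> {v}"
      using x w D sub BC by (auto simp: induced_induced vverts_induced)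
  qed
  ultimately show thesis using that by blast
qed

text \<open>A part of one half that misses the rest of that half could only be attached through \<open>v\<close>.\<close>

lemma split_half_connected:
  assumes conn: "connected_family S A" and D: "D \<subset> A" "D \<noteq> {}"
    and v: "\<Union>(S ` D) \<inter> \<Union>(S ` (A - D)) \<subseteq> {v}"
  shows "connected_family S D" "v \<in> \<Union>(S ` D)"
proof -
  show "v \<in> \<Union>(S ` D)" using conn D v unfolding connected_family_def by blast
  show "connected_family S D"
    unfolding connected_family_def
  proof (intro conjI allI impI)
    fix B assume B: "B \<subset> D \<and> B \<noteq> {}"
    show "\<Union>(S ` B) \<inter> \<Union>(S ` (D - B)) \<noteq> {}"
    proof
      assume dis: "\<Union>(S ` B) \<inter> \<Union>(S ` (D - B)) = {}"
      have aux: "v \<in> \<Union>(S ` F)" if F: "F \<subset> D" "F \<noteq> {}" "\<Union>(S ` F) \<inter> \<Union>(S ` (D - F)) = {}" for F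
      proof -
        have "F \<subset> A" using F D by blast
        then obtain a b where ab: "a \<in> F" "b \<in> A - F" "S a \<inter> S b \<noteq> {}"
          using connected_familyD[OF conn _ F(2)] by blast
        then have "b \<notin> D" using F(3) by blast
        then have "S a \<inter> S b \<subseteq> {v}" using v ab F(1) by blast
        then show ?thesis using ab by blast
      qed
      have "v \<in> \<Union>(S ` B)" using aux[of B] B dis by blast
      moreover have "D - (D - B) = B" using B by blast
      then have "v \<in> \<Union>(S ` (D - B))" using aux[of "D - B"] B dis by (metis Int_commute Diff_eq_empty_iff psubset_eq psubsetE Diff_subset)
      ultimately show False using dis by blast
    qed
  qed (use D in blast)
qed

text \<open>By \<open>split_half_connected\<close> both halves are connected and contain
  \<open>v\<close>, so the partition into \<open>D\<close> and \<open>A - D\<close> is a witness for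
  separation.\<close>

lemma split_separating:
  assumes conn: "connected_family (nbs G) A" and D: "D \<subset> A" "D \<noteq> {}"
    and v: "\<Union>(nbs G ` D) \<inter> \<Union>(nbs G ` (A - D)) \<subseteq> {v}"
  shows "separating (induced G A) v"
proof -
  have E: "A - D \<subset> A" "A - D \<noteq> {}" "A - (A - D) = D" using D by auto
  have h1: "connected_family (nbs G) D" "v \<in> \<Union>(nbs G ` D)"
    using split_half_connected[OF conn D v] by auto
  have "\<Union>(nbs G ` (A - D)) \<inter> \<Union>(nbs G ` (A - (A - D))) \<subseteq> {v}"
    unfolding E(3) using v by blast
  from split_half_connected[OF conn E(1,2) this]
  have h2: "connected_family (nbs G) (A - D)" "v \<in> \<Union>(nbs G ` (A - D))" by auto
  have ne: "D \<noteq> A - D" using D by blast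
  have V: "induced (induced G A) B = induced G B" if "B \<in> {D, A - D}" for B
    using that D by (intro induced_induced) blast
  show ?thesis
    unfolding separating_def
  proof (intro conjI exI[of _ "{D, A - D}"])
    show "v \<in> vverts (induced G A)" using h1(2) D by (auto simp: vverts_induced)
    show "partition_on (wverts (induced G A)) {D, A - D}"
      using D E by (auto simp: partition_on_def disjoint_def)
    show "2 \<le> card {D, A - D}" using ne by simp
    show "(\<Union>B\<in>{D, A - D}. vverts (induced (induced G A) B)) = vverts (induced G A)"
      using D by (subst SUP_cong[OF refl arg_cong[OF V]]) (auto simp: vverts_induced)
    show "\<forall>B\<in>{D, A - D}. connected_bigraph (induced (induced G A) B) \<and> v \<in> vverts (induced (induced G A) B)"
    proof
      fix B assume B: "B \<in> {D, A - D}"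
      show "connected_bigraph (induced (induced G A) B) \<and> v \<in> vverts (induced (induced G A) B)"
        unfolding V[OF B] vverts_induced connected_induced using B h1 h2 by blast
    qed
    show "\<forall>B\<in>{D, A - D}. \<forall>C\<in>{D, A - D}. B \<noteq> C \<longrightarrow>
        vverts (induced (induced G A) B) \<inter> vverts (induced (induced G A) C) = {v}"
    proof (intro ballI impI)
      fix B C assume B: "B \<in> {D, A - D}" and C: "C \<in> {D, A - D}" and "B \<noteq> C"
      then have "B = D \<and> C = A - D \<or> B = A - D \<and> C = D" by blast
      then show "vverts (induced (induced G A) B) \<inter> vverts (induced (induced G A) C) = {v}"
        unfolding V[OF B] V[OF C] vverts_induced using h1(2) h2(2) v by blast
    qed
  qed
qed

lemma nonseparable_induced: "nonseparable (induced G A) \<longleftrightarrow> inseparable G A"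
proof
  assume *: "nonseparable (induced G A)"
  then have conn: "connected_family (nbs G) A" by (simp add: nonseparable_def connected_induced)
  show "inseparable G A"
    unfolding inseparable_def
  proof (intro conjI allI impI)
    show "A \<noteq> {}" using conn by (simp add: connected_family_def)
    fix D v assume "D \<subset> A \<and> D \<noteq> {}"
    then show "\<not> \<Union>(nbs G ` D) \<inter> \<Union>(nbs G ` (A - D)) \<subseteq> {v}"
      using split_separating[OF conn, of D v] * unfolding nonseparable_def separating_def by blast
  qed
next
  assume *: "inseparable G A"
  then have "connected_family (nbs G) A" unfolding inseparable_def connected_family_def by blast
  moreover have "\<not> separating (induced G A) v" for v
    using * unfolding inseparable_def by (metis separating_split)
  ultimately show "nonseparable (induced G A)" by (simp add: nonseparable_def connected_induced)
qed

lemma inseparable_connected: "inseparable G A \<Longrightarrow> connected_family (nbs G) A"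
  unfolding inseparable_def connected_family_def by blast

text \<open>A split along one vertex cannot cut \<open>A\<close> or \<open>B\<close>, so each lies
  entirely on one side; a common element puts both on the same side.\<close>

lemma inseparable_Un:
  assumes "inseparable G A" "inseparable G B" "A \<inter> B \<noteq> {}"
  shows "inseparable G (A \<union> B)"
  unfolding inseparable_def
proof (intro conjI allI impI)
  show "A \<union> B \<noteq> {}" using assms(3) by blast
  fix D v assume D: "D \<subset> A \<union> B \<and> D \<noteq> {}"
  show "\<not> \<Union>(nbs G ` D) \<inter> \<Union>(nbs G ` (A \<union> B - D)) \<subseteq> {v}"
  proof
    assume sub: "\<Union>(nbs G ` D) \<inter> \<Union>(nbs G ` (A \<union> B - D)) \<subseteq> {v}"
    have aux: "D \<inter> C = {} \<or> D \<inter> C = C" if C: "inseparable G C" "C \<subseteq> A \<union> B" for C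
    proof (rule ccontr)
      assume "\<not> ?thesis"
      then have "D \<inter> C \<subset> C" "D \<inter> C \<noteq> {}" by auto
      then have "\<not> \<Union>(nbs G ` (D \<inter> C)) \<inter> \<Union>(nbs G ` (C - D \<inter> C)) \<subseteq> {v}"
        using C(1) unfolding inseparable_def by blast
      moreover have "\<Union>(nbs G ` (D \<inter> C)) \<subseteq> \<Union>(nbs G ` D)"
        "\<Union>(nbs G ` (C - D \<inter> C)) \<subseteq> \<Union>(nbs G ` (A \<union> B - D))" using C(2) by auto
      ultimately show False using sub by blast
    qed
    have "D \<inter> A = {} \<or> D \<inter> A = A" "D \<inter> B = {} \<or> D \<inter> B = B" using aux assms by auto
    then show False using D assms(3) by auto
  qed
qed

lemma blocks_iff:
  "A \<in> blocks G \<longleftrightarrow> A \<subseteq> wverts G \<and> inseparable G A \<and>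
     (\<forall>B. A \<subset> B \<and> B \<subseteq> wverts G \<longrightarrow> \<not> inseparable G B)"
  by (simp add: blocks_def nonseparable_induced)

lemma inseparable_subset_block:
  assumes "B \<in> blocks G" "inseparable G A" "A \<subseteq> wverts G" "A \<inter> B \<noteq> {}"
  shows "A \<subseteq> B"
proof (rule ccontr)
  assume "\<not> A \<subseteq> B"
  then have "B \<subset> A \<union> B" "A \<union> B \<subseteq> wverts G" using assms by (auto simp: blocks_iff)
  moreover have "inseparable G (A \<union> B)" using assms by (intro inseparable_Un) (auto simp: blocks_iff)
  ultimately show False using assms(1) by (simp add: blocks_iff)
qed

text \<open>Singletons are inseparable, so every W-vertex lies in some maximal inseparable set, and
  maximal inseparable sets that overlap coincide.\<close>

lemma blocks_partition:
  assumes fin: "finite (wverts G)"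
  shows "partition_on (wverts G) (blocks G)"
proof (rule partition_onI)
  show "\<Union>(blocks G) = wverts G"
  proof
    show "wverts G \<subseteq> \<Union>(blocks G)"
    proof
      fix w assume w: "w \<in> wverts G"
      define good where "good = (\<lambda>A. A \<subseteq> wverts G \<and> w \<in> A \<and> inseparable G A)"
      have "good {w}" using w by (auto simp: good_def inseparable_def)
      moreover have "finite {A. good A}"
        by (rule finite_subset[of _ "Pow (wverts G)"]) (use fin in \<open>auto simp: good_def\<close>)
      ultimately have "\<exists>B\<in>{A. good A}. \<forall>C\<in>{A. good A}. B \<le> C \<longrightarrow> B = C"
        by (intro finite_has_maximal) blast+
      then obtain B where B: "good B" "\<And>C. good C \<Longrightarrow> B \<subseteq> C \<Longrightarrow> B = C" by blast
      have "B \<in> blocks G"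
        unfolding blocks_iff
      proof (intro conjI allI impI)
        fix C assume C: "B \<subset> C \<and> C \<subseteq> wverts G"
        show "\<not> inseparable G C"
        proof
          assume "inseparable G C"
          then have "good C" using C B(1) by (auto simp: good_def)
          then show False using B(2)[of C] C by blast
        qed
      qed (use B(1) in \<open>auto simp: good_def\<close>)
      then show "w \<in> \<Union>(blocks G)" using B(1) by (auto simp: good_def)
    qed
  qed (auto simp: blocks_iff)
next
  fix A B assume AB: "A \<in> blocks G" "B \<in> blocks G" "A \<noteq> B"
  show "disjnt A B"
  proof (rule ccontr)
    assume "\<not> disjnt A B"
    then have ne: "A \<inter> B \<noteq> {}" by (simp add: disjnt_def)
    have "A \<subseteq> B" by (rule inseparable_subset_block[OF AB(2)]) (use AB ne in \<open>auto simp: blocks_iff\<close>)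
    moreover have "B \<subseteq> A" by (rule inseparable_subset_block[OF AB(1)]) (use AB ne in \<open>auto simp: blocks_iff\<close>)
    ultimately show False using AB(3) by blast
  qed
next
  show "{} \<notin> blocks G" by (simp add: blocks_iff inseparable_def)
qed

text \<open>If \<open>A\<close> met several classes, its traces on them would inherit the forest
  property. A leaf among the traces meets the others in at most one V-vertex and therefore splits
  \<open>A\<close>.\<close>

lemma inseparable_in_class:
  assumes fin: "finite (wverts G)" "\<And>w. w \<in> wverts G \<Longrightarrow> finite (nbs G w)"
    and Q: "partition_on (wverts G) Q"
    and forest: "\<And>J. J \<subseteq> Q \<Longrightarrow> card J \<ge> 2 \<Longrightarrow> card (in_at_least_two J (\<lambda>q. \<Union>(nbs G ` q))) \<le> card J - 1"
    and A: "inseparable G A" "A \<subseteq> wverts G"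
  shows "\<exists>q\<in>Q. A \<subseteq> q"
proof (rule ccontr)
  assume no: "\<not> (\<exists>q\<in>Q. A \<subseteq> q)"
  define S where "S = (\<lambda>q. \<Union>(nbs G ` (A \<inter> q)))"
  define J where "J = {q \<in> Q. A \<inter> q \<noteq> {}}"
  have finQ: "finite Q" by (rule finite_elements[OF fin(1) Q])
  have finJ: "finite J" using finQ by (simp add: J_def)
  have U: "\<Union>Q = wverts G" by (rule partition_onD1[OF Q, symmetric])
  have AJ: "A \<subseteq> \<Union>J" using A(2) unfolding U[symmetric] J_def by blast
  have qW: "q \<subseteq> wverts G" if "q \<in> Q" for q using that U by blast
  have finS: "finite (S q)" if "q \<in> J" for q
    unfolding S_def using fin A(2) finite_subset[OF A(2) fin(1)] by (intro finite_UN_I) auto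
  have J2: "card J \<ge> 2"
  proof (rule ccontr)
    assume "\<not> ?thesis"
    then have "card J \<le> Suc 0" by simp
    then have eq: "\<forall>p\<in>J. \<forall>q\<in>J. p = q" using finJ by (simp add: card_le_Suc0_iff_eq)
    have "A \<noteq> {}" using A(1) by (simp add: inseparable_def)
    then obtain q where q: "q \<in> J" using AJ by blast
    then have "J = {q}" using eq by blast
    then have "A \<subseteq> q" using AJ by simp
    moreover have "q \<in> Q" using q by (simp add: J_def)
    ultimately show False using no by blast
  qed
  have forestS: "card (in_at_least_two K S) \<le> card K - 1" if K: "K \<subseteq> J" "card K \<ge> 2" for K
  proof -
    have finK: "finite K" by (rule finite_subset[OF K(1) finJ])
    have KQ: "K \<subseteq> Q" using K(1) by (auto simp: J_def)
    have "finite (\<Union>(nbs G ` q))" if "q \<in> K" for q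
    proof -
      have "q \<subseteq> wverts G" using that KQ qW by blast
      then show ?thesis using fin finite_subset[OF _ fin(1)] by (intro finite_UN_I) auto
    qed
    then have "finite (in_at_least_two K (\<lambda>q. \<Union>(nbs G ` q)))"
      by (rule finite_in_at_least_two[OF finK])
    moreover have "in_at_least_two K S \<subseteq> in_at_least_two K (\<lambda>q. \<Union>(nbs G ` q))"
      by (rule in_at_least_two_mono[OF subset_refl]) (auto simp: S_def)
    ultimately have "card (in_at_least_two K S) \<le> card (in_at_least_two K (\<lambda>q. \<Union>(nbs G ` q)))"
      by (rule card_mono)
    then show ?thesis using forest[OF KQ K(2)] by linarith
  qed
  obtain q where q: "q \<in> J" "card (S q \<inter> \<Union>(S ` (J - {q}))) \<le> 1"
    by (rule forest_leaf[OF finJ finS J2 forestS])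
  have "finite (S q \<inter> \<Union>(S ` (J - {q})))" using finS[OF q(1)] by blast
  then obtain v where v: "S q \<inter> \<Union>(S ` (J - {q})) \<subseteq> {v}"
    using q(2) by (metis One_nat_def card_le_Suc0_iff_eq insertCI subsetI)
  have "A \<inter> q \<subset> A" using no q(1) by (auto simp: J_def)
  moreover have "A \<inter> q \<noteq> {}" using q(1) by (simp add: J_def)
  moreover have "\<Union>(nbs G ` (A - A \<inter> q)) \<subseteq> \<Union>(S ` (J - {q}))"
    using AJ by (fastforce simp: S_def)
  then have "\<Union>(nbs G ` (A \<inter> q)) \<inter> \<Union>(nbs G ` (A - A \<inter> q)) \<subseteq> {v}"
    using v by (auto simp: S_def)
  ultimately show False using A(1) unfolding inseparable_def by blast
qed

section \<open>The parity test and the lower bound for the cost\<close>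

section \<open>Parity and the exponent of a family\<close>

text \<open>\<open>U\<close> ranges over the unions of classes of neighbours of \<open>v\<close> that the sets in \<open>\<D>\<close> do not separate: a sign
  flip of \<open>X v\<close> within \<open>U\<close> leaves all joint moments over members of \<open>\<D>\<close> unchanged.\<close>

definition parity_ok :: "('w, 'v) bigraph \<Rightarrow> 'w set set \<Rightarrow> bool" where
  "parity_ok G \<D> \<longleftrightarrow> (\<forall>v U. U \<subseteq> wverts G \<and>
     (\<forall>A\<in>\<D>. {w \<in> A. v \<in> nbs G w} \<subseteq> U \<or> {w \<in> A. v \<in> nbs G w} \<inter> U = {}) \<longrightarrow>
     even (\<Sum>w\<in>U. mult G w v))"

lemma parity_okD:
  assumes "parity_ok G \<D>" "U \<subseteq> wverts G"
    and "\<forall>A\<in>\<D>. {w \<in> A. v \<in> nbs G w} \<subseteq> U \<or> {w \<in> A. v \<in> nbs G w} \<inter> U = {}"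
  shows "even (\<Sum>w\<in>U. mult G w v)"
  using assms unfolding parity_ok_def by simp

lemma total_mult_partition:
  assumes fin: "finite_bigraph G" and P: "partition_on (wverts G) P"
  shows "total_mult G (edges G) = (\<Sum>q\<in>P. \<Sum>v\<in>\<Union>(nbs G ` q). \<Sum>w\<in>q. mult G w v)"
proof -
  have finW: "finite (wverts G)" and finV: "finite (vverts G)" using fin by (auto simp: finite_bigraph_def)
  have U: "\<Union>P = wverts G" by (rule partition_onD1[OF P, symmetric])
  have sub: "q \<subseteq> wverts G" if "q \<in> P" for q using that U by blast
  have "total_mult G (edges G) = (\<Sum>(w, v)\<in>wverts G \<times> vverts G. mult G w v)"
    unfolding total_mult_def
    by (rule sum.mono_neutral_left) (use finW finV in \<open>auto simp: edges_def\<close>)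
  also have "\<dots> = (\<Sum>w\<in>\<Union>P. \<Sum>v\<in>vverts G. mult G w v)"
    unfolding U by (rule sum.cartesian_product[symmetric])
  also have "\<dots> = (\<Sum>q\<in>P. \<Sum>w\<in>q. \<Sum>v\<in>vverts G. mult G w v)"
  proof (subst sum.Union_disjoint)
    show "\<forall>A\<in>P. finite A" using sub finite_subset[OF _ finW] by blast
    show "\<forall>A\<in>P. \<forall>B\<in>P. A \<noteq> B \<longrightarrow> A \<inter> B = {}" using partition_onD2[OF P] by (meson disjointD)
  qed simp
  also have "\<dots> = (\<Sum>q\<in>P. \<Sum>v\<in>\<Union>(nbs G ` q). \<Sum>w\<in>q. mult G w v)"
  proof (rule sum.cong[OF refl])
    fix q assume "q \<in> P"
    have "finite q" using sub[OF \<open>q \<in> P\<close>] finite_subset[OF _ finW] by blast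
    have "(\<Sum>w\<in>q. \<Sum>v\<in>vverts G. mult G w v) = (\<Sum>v\<in>vverts G. \<Sum>w\<in>q. mult G w v)"
      by (rule sum.swap)
    also have "\<dots> = (\<Sum>v\<in>\<Union>(nbs G ` q). \<Sum>w\<in>q. mult G w v)"
      by (rule sum.mono_neutral_right) (use finV in \<open>auto simp: nbs_def Suc_le_eq\<close>)
    finally show "(\<Sum>w\<in>q. \<Sum>v\<in>vverts G. mult G w v) = (\<Sum>v\<in>\<Union>(nbs G ` q). \<Sum>w\<in>q. mult G w v)" .
  qed
  finally show ?thesis .
qed

text \<open>Excludes the one connected graph without W-vertices, a single V-vertex, for which the
  neighbourhoods of W-vertices do not cover \<open>vverts G\<close>.\<close>

locale connected_graph =
  fixes G :: "('w, 'v) bigraph"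
  assumes fin_G: "finite_bigraph G" and conn_G: "connected_bigraph G" and W_ne: "wverts G \<noteq> {}"
begin

abbreviation "W \<equiv> wverts G"
abbreviation "V \<equiv> vverts G"
abbreviation nb :: "'w set \<Rightarrow> 'v set" where "nb q \<equiv> \<Union>(nbs G ` q)"
abbreviation mdeg :: "'w set \<Rightarrow> 'v \<Rightarrow> nat" where "mdeg q v \<equiv> \<Sum>w\<in>q. mult G w v"
abbreviation "totE \<equiv> total_mult G (edges G)"

lemma finW: "finite W" and finV: "finite V"
  using fin_G by (auto simp: finite_bigraph_def)

lemma fin_nbs: "finite (nbs G w)"
  using finV by (auto simp: nbs_def)

lemma nb_subset: "nb q \<subseteq> V"
  by (auto simp: nbs_def)

lemma fin_nb: "finite (nb q)"
  using nb_subset finV by (rule finite_subset)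

lemma nb_connected: "partition_on W Q \<Longrightarrow> connected_family nb Q"
  using connected_family_coarsen[OF connected_family_wverts[OF fin_G conn_G W_ne]] .

lemma nb_Union: "partition_on W Q \<Longrightarrow> \<Union>(nb ` Q) = V"
  using connected_vverts[OF conn_G W_ne] partition_onD1[of W Q] by auto

text \<open>No member of \<open>\<D>\<close> is cut by a component \<open>q\<close>, so the parity
  test applies to \<open>U = q\<close>: every degree inside a component is even, and at least 2
  where it is positive. The second and third bounds are connectivity counts, one for the members of
  \<open>\<D>\<close> inside the components, the other for the neighbourhoods of the
  components.\<close>

lemma parity_bounds:
  assumes D0: "\<forall>A\<in>\<D>. A \<noteq> {} \<and> A \<subseteq> W" and par: "parity_ok G \<D>"
  shows "partition_on W (comps W \<D>)"
    and "card W \<le> cost \<D> + card (comps W \<D>)"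
    and "card V + card (comps W \<D>) \<le> (\<Sum>q\<in>comps W \<D>. card (nb q)) + 1"
    and "\<And>q v. q \<in> comps W \<D> \<Longrightarrow> v \<in> nb q \<Longrightarrow> 2 \<le> mdeg q v"
    and "2 * (\<Sum>q\<in>comps W \<D>. card (nb q)) \<le> totE"
proof -
  have D: "A \<noteq> {} \<and> A \<subseteq> W" if "A \<in> \<D>" for A using D0 that by blast
  show part: "partition_on W (comps W \<D>)" by (rule comps_partition[OF finW]) (use D in blast)
  have finQ: "finite (comps W \<D>)" using finW part by (rule finite_elements)
  have "\<D> \<subseteq> Pow W" using D by blast
  then have fD: "finite \<D>" using finW by (simp add: finite_subset)
  have ne: "{} \<notin> \<D>" using D by blast
  have finq: "finite q" if "q \<in> comps W \<D>" for q
    using that finite_subset[OF _ finW] by (simp add: comps_def)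
  have "card W = (\<Sum>q\<in>comps W \<D>. card q)"
    by (rule product_partition[OF part]) (rule finq)
  also have "\<dots> \<le> (\<Sum>q\<in>comps W \<D>. (\<Sum>A\<in>{A \<in> \<D>. A \<subseteq> q}. card A - 1) + 1)"
    by (rule sum_mono) (rule comps_cost_le[OF _ finW fD ne])
  also have "\<dots> = cost \<D> + card (comps W \<D>)"
    by (simp only: sum.distrib cost_comps[OF finW D, symmetric]) simp
  finally show "card W \<le> cost \<D> + card (comps W \<D>)" .
  have "card (\<Union>(nb ` comps W \<D>)) + card (comps W \<D>) \<le> (\<Sum>q\<in>comps W \<D>. card (nb q)) + 1"
    by (rule connected_family_card_Union[OF nb_connected[OF part] finQ]) (rule fin_nb)
  then show "card V + card (comps W \<D>) \<le> (\<Sum>q\<in>comps W \<D>. card (nb q)) + 1"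
    using nb_Union[OF part] by simp
  show m2: "2 \<le> mdeg q v" if q: "q \<in> comps W \<D>" and v: "v \<in> nb q" for q v
  proof -
    have cl: "closed_for \<D> q" and qW: "q \<subseteq> W" using q by (auto simp: comps_def)
    have "even (mdeg q v)"
    proof -
      have "\<forall>A\<in>\<D>. {w \<in> A. v \<in> nbs G w} \<subseteq> q \<or> {w \<in> A. v \<in> nbs G w} \<inter> q = {}"
        using cl unfolding closed_for_def by blast
      then show ?thesis by (rule parity_okD[OF par qW])
    qed
    moreover obtain w where "w \<in> q" "mult G w v \<ge> 1" using v by (auto simp: nbs_def)
    then have "mdeg q v \<noteq> 0" using finq[OF q] by (auto simp: sum_eq_0_iff Suc_le_eq)
    ultimately show ?thesis by (cases "mdeg q v = 1") (auto simp: even_two_times_div_two)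
  qed
  have "2 * (\<Sum>q\<in>comps W \<D>. card (nb q)) = (\<Sum>q\<in>comps W \<D>. \<Sum>v\<in>nb q. 2)"
    by (simp add: sum_distrib_left mult.commute)
  also have "\<dots> \<le> totE"
    unfolding total_mult_partition[OF fin_G part] by (intro sum_mono m2)
  finally show "2 * (\<Sum>q\<in>comps W \<D>. card (nb q)) \<le> totE" .
qed

text \<open>Adding the three counts cancels the number of components and the sum of the sizes of
  their neighbourhoods. In terms of exponents, no family passing the test can have a cost below the
  power of n in the scaling factor, so no surviving term diverges.\<close>

lemma parity_cost_bound:
  assumes "\<forall>A\<in>\<D>. A \<noteq> {} \<and> A \<subseteq> W" "parity_ok G \<D>"
  shows "2 * (card W + card V) \<le> totE + 2 * cost \<D> + 2"
proof -
  have "2 * (w + v) \<le> e + 2 * c + 2" if "w \<le> c + q" "v + q \<le> s + 1" "2 * s \<le> e" for w v e c q s :: nat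
  proof -
    have "w + v \<le> c + s + 1" using that(1,2) by linarith
    then have "2 * (w + v) \<le> 2 * (c + s + 1)" by (rule mult_le_mono2)
    then show ?thesis using that(3) by simp
  qed
  then show ?thesis using parity_bounds(2,3,5)[OF assms] .
qed

text \<open>The forest property puts every inseparable set inside a class. Hence the classes, being
  inseparable, are maximal, and nothing else is.\<close>

lemma blocks_eq:
  assumes Q: "partition_on W Q" and ins: "\<And>q. q \<in> Q \<Longrightarrow> inseparable G q"
    and forest: "\<And>J. J \<subseteq> Q \<Longrightarrow> card J \<ge> 2 \<Longrightarrow> card (in_at_least_two J nb) \<le> card J - 1"
  shows "blocks G = Q"
proof -
  have U: "\<Union>Q = W" by (rule partition_onD1[OF Q, symmetric])
  have dis: "p = q" if "p \<in> Q" "q \<in> Q" "p \<inter> q \<noteq> {}" for p q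
    using partition_onD2[OF Q] that by (meson disjointD)
  have cls: "\<exists>q\<in>Q. A \<subseteq> q" if "inseparable G A" "A \<subseteq> W" for A
    by (rule inseparable_in_class[OF finW fin_nbs Q forest that])
  have 1: "q \<in> blocks G" if q: "q \<in> Q" for q
    unfolding blocks_iff
  proof (intro conjI allI impI)
    show "q \<subseteq> W" using q U by blast
    show "inseparable G q" using ins[OF q] .
    fix B assume B: "q \<subset> B \<and> B \<subseteq> W"
    show "\<not> inseparable G B"
    proof
      assume "inseparable G B"
      then obtain p where p: "p \<in> Q" "B \<subseteq> p" using cls B by blast
      have "q \<noteq> {}" using ins[OF q] by (simp add: inseparable_def)
      then have "p \<inter> q \<noteq> {}" using p B by blast
      then show False using dis[OF p(1) q] p(2) B by blast
    qed
  qed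
  have 2: "B \<in> Q" if B: "B \<in> blocks G" for B
  proof -
    have "inseparable G B" "B \<subseteq> W" using B by (auto simp: blocks_iff)
    then obtain q where q: "q \<in> Q" "B \<subseteq> q" using cls by blast
    have "\<not> B \<subset> q"
      using B q(1) ins[OF q(1)] U unfolding blocks_iff by blast
    then show ?thesis using q by blast
  qed
  show ?thesis using 1 2 by blast
qed

section \<open>Families attaining equality in the cost bound\<close>

definition decomps :: "'w set \<Rightarrow> 'w set set set" where
  "decomps B = (\<Union>K\<in>{1..}. adm_decomps G K B)"

text \<open>The index \<open>K\<close> can be recovered as \<open>card C\<close>, so the double sum
  over \<open>K\<close> and collections becomes a single sum over \<open>decomps B\<close>.\<close>

lemma decomps_iff:
  assumes "B \<noteq> {}"
  shows "C \<in> decomps B \<longleftrightarrow> C \<in> adm_decomps G (card C) B"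
proof
  assume "C \<in> decomps B"
  then obtain K where "C \<in> adm_decomps G K B" by (auto simp: decomps_def)
  moreover then have "card C = K" by (simp add: adm_decomps_def)
  ultimately show "C \<in> adm_decomps G (card C) B" by simp
next
  assume C: "C \<in> adm_decomps G (card C) B"
  then have "finite C" "\<Union>C = B" by (auto simp: adm_decomps_def)
  then have "card C \<noteq> 0" using assms by auto
  then show "C \<in> decomps B" using C by (force simp: decomps_def)
qed

text \<open>Equality leaves no slack in any of the counts of \<open>parity_bounds\<close>: the
  components overlap like a forest, all degrees inside them are 2, and the members inside each
  component form a hypertree. Connectedness of the members then follows from minimality of the cost,
  and inseparability of the components from the even W-degrees.\<close>

lemma tight_structure:
  assumes C: "\<And>A. A \<in> C \<Longrightarrow> A \<subseteq> W \<and> card A \<ge> 2" and par: "parity_ok G C"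
    and wdeg: "\<And>w. w \<in> W \<Longrightarrow> even (wdeg G w)"
    and eq: "2 * (card W + card V) = totE + 2 * cost C + 2"
  shows "admissible G" and "blocks G = comps W C"
    and "\<And>B. B \<in> big_blocks G \<Longrightarrow> {A \<in> C. A \<subseteq> B} \<in> decomps B"
    and "C = (\<Union>B\<in>big_blocks G. {A \<in> C. A \<subseteq> B})"
proof -
  define Q where "Q = comps W C"
  have C': "A \<noteq> {} \<and> A \<subseteq> W" if "A \<in> C" for A using C[OF that] by auto
  then have "\<forall>A\<in>C. A \<noteq> {} \<and> A \<subseteq> W" by blast
  note pb = parity_bounds[OF this par, folded Q_def]
  have finQ: "finite Q" by (rule finite_elements[OF finW pb(1)])
  have CW: "C \<subseteq> Pow W" using C' by blast
  have finC: "finite C" by (rule finite_subset[OF CW]) (use finW in simp)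
  have ne: "{} \<notin> C" using C' by blast
  have finq: "finite q" if "q \<in> Q" for q
    using that finite_subset[OF _ finW] by (simp add: Q_def comps_def)
  have qW: "q \<subseteq> W" if "q \<in> Q" for q using that by (simp add: Q_def comps_def)
  have "s + 1 \<le> v + q \<and> e = 2 * s \<and> w = c + q"
    if "w \<le> c + q" "v + q \<le> s + 1" "2 * s \<le> e" "2 * (w + v) = e + 2 * c + 2" for w v e c q s :: nat
  proof -
    have "w + v \<le> c + s + 1" using that(1,2) by linarith
    then have "2 * (w + v) \<le> 2 * (c + s + 1)" by (rule mult_le_mono2)
    then have "2 * (w + v) \<le> 2 * c + 2 * s + 2" by simp
    then have "e \<le> 2 * s" using that(4) by linarith
    then have e: "e = 2 * s" using that(3) by (rule antisym)
    then have "2 * (w + v) = 2 * (s + c + 1)" using that(4) by simp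
    then have wv: "w + v = s + c + 1" by simp
    have "s + 1 \<le> v + q" using that(1) wv by linarith
    moreover have "c + q \<le> w" using that(2) wv by linarith
    ultimately show ?thesis using e that(1) by simp
  qed
  from this[OF pb(2,3,5) eq]
  have tightV: "(\<Sum>q\<in>Q. card (nb q)) + 1 \<le> card V + card Q"
    and tightE: "totE = 2 * (\<Sum>q\<in>Q. card (nb q))" and tightC: "card W = cost C + card Q" by blast+
  \<comment> \<open>Every degree is at least 2 and the totals agree, so no single degree can be
    larger.\<close>
  have deg2: "mdeg q v = 2" if q: "q \<in> Q" "v \<in> nb q" for q v
  proof -
    have le: "(\<Sum>v\<in>nb q. 2) \<le> (\<Sum>v\<in>nb q. mdeg q v)" if "q \<in> Q" for q
      using pb(4)[OF that] by (intro sum_mono)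
    have "(\<Sum>q\<in>Q. \<Sum>v\<in>nb q. 2) = (\<Sum>q\<in>Q. \<Sum>v\<in>nb q. mdeg q v)"
      using tightE unfolding total_mult_partition[OF fin_G pb(1)] by (simp add: sum_distrib_left mult.commute)
    then have "(\<Sum>v\<in>nb q. 2) = (\<Sum>v\<in>nb q. mdeg q v)"
      by (rule sum_mono_inv) (use le q finQ in auto)
    then have "2 = mdeg q v"
      by (rule sum_mono_inv) (use pb(4)[OF q(1)] q fin_nb in auto)
    then show ?thesis by simp
  qed
  have forest: "card (in_at_least_two J nb) \<le> card J - 1" if "J \<subseteq> Q" "card J \<ge> 2" for J
    by (rule tight_family_shared[OF nb_connected[OF pb(1)] finQ fin_nb _ that])
      (use tightV nb_Union[OF pb(1)] in simp)
  \<comment> \<open>A disconnected member could be replaced by its two parts. The test would still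
    be passed, since all neighbours of a given V-vertex inside the member lie in one part, but the
    cost would fall below the lower bound.\<close>
  have connA: "connected_family (nbs G) A" if A: "A \<in> C" for A
  proof (rule ccontr)
    assume "\<not> ?thesis"
    then obtain D where D: "D \<subset> A" "D \<noteq> {}" "nb D \<inter> nb (A - D) = {}"
      using C'[OF A] unfolding connected_family_def by blast
    define C1 where "C1 = (C - {A}) \<union> {D, A - D}"
    have finA: "finite A" using C'[OF A] finite_subset[OF _ finW] by blast
    have "parity_ok G C1"
      unfolding parity_ok_def
    proof (intro allI impI)
      fix v U assume U: "U \<subseteq> W \<and>
        (\<forall>A\<in>C1. {w \<in> A. v \<in> nbs G w} \<subseteq> U \<or> {w \<in> A. v \<in> nbs G w} \<inter> U = {})"
      have "{w \<in> A. v \<in> nbs G w} \<subseteq> U \<or> {w \<in> A. v \<in> nbs G w} \<inter> U = {}"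
      proof -
        have "{w \<in> A. v \<in> nbs G w} = {w \<in> D. v \<in> nbs G w} \<or> {w \<in> A. v \<in> nbs G w} = {w \<in> A - D. v \<in> nbs G w}"
          using D(1,3) by blast
        then show ?thesis using U by (auto simp only: C1_def)
      qed
      moreover have "\<forall>B\<in>C - {A}. {w \<in> B. v \<in> nbs G w} \<subseteq> U \<or> {w \<in> B. v \<in> nbs G w} \<inter> U = {}"
        using U by (simp add: C1_def)
      ultimately have "\<forall>A\<in>C. {w \<in> A. v \<in> nbs G w} \<subseteq> U \<or> {w \<in> A. v \<in> nbs G w} \<inter> U = {}"
        by blast
      then show "even (mdeg U v)" using U by (intro parity_okD[OF par]) auto
    qed
    moreover have "A' \<noteq> {} \<and> A' \<subseteq> W" if "A' \<in> C1" for A'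
      using that D C' A unfolding C1_def by blast
    ultimately have bound: "2 * (card W + card V) \<le> totE + 2 * cost C1 + 2"
      by (intro parity_cost_bound) auto
    \<comment> \<open>Only an inequality, because one of the two parts may already belong to
      \<open>C\<close>.\<close>
    have "cost C1 \<le> cost (C - {A}) + cost {D, A - D}"
      unfolding cost_def C1_def using finC by (subst sum.union_inter[symmetric]) auto
    also have "cost {D, A - D} = (card D - 1) + (card (A - D) - 1)"
    proof -
      have "D \<noteq> A - D" using D by blast
      then show ?thesis by (simp add: cost_def)
    qed
    also have "cost (C - {A}) + ((card D - 1) + (card (A - D) - 1)) < cost C"
    proof -
      have finD: "finite D" using D(1) finA finite_subset by (metis psubset_imp_subset)
      have "card D + card (A - D) = card A"
        using D(1) finD finA card_Un_disjoint[of D "A - D"] by (metis Diff_disjoint Diff_partition finite_Diff psubset_imp_subset)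
      moreover have "card D \<noteq> 0" "card (A - D) \<noteq> 0" using D finD finA by auto
      moreover have "cost C = (card A - 1) + cost (C - {A})"
        using finC A by (simp add: cost_def sum.remove)
      ultimately show ?thesis by linarith
    qed
    finally show False using bound eq by linarith
  qed
  have closedQ: "closed_for C q" if "q \<in> Q" for q using that by (simp add: Q_def comps_def)
  \<comment> \<open>A proper part of a component is cut by some member, and that member is connected
    through a common V-vertex on both sides of the cut.\<close>
  have connq: "connected_family (nbs G) q" if q: "q \<in> Q" for q
    unfolding connected_family_def
  proof (intro conjI allI impI)
    show "q \<noteq> {}" using q by (simp add: Q_def comps_def)
    fix D assume D: "D \<subset> q \<and> D \<noteq> {}"
    then have "\<not> closed_for C D" using q by (simp add: Q_def comps_def)
    then obtain A where A: "A \<in> C" "A \<inter> D \<noteq> {}" "\<not> A \<subseteq> D" unfolding closed_for_def by blast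
    have Aq: "A \<subseteq> q" using closedQ[OF q] A D unfolding closed_for_def by blast
    have "A \<inter> D \<subset> A" using A(3) by blast
    then obtain a b where "a \<in> A \<inter> D" "b \<in> A - A \<inter> D" "nbs G a \<inter> nbs G b \<noteq> {}"
      using connected_familyD[OF connA[OF A(1)] _ A(2)] by blast
    then show "nb D \<inter> nb (q - D) \<noteq> {}" using Aq by blast
  qed
  have insq: "inseparable G q" if q: "q \<in> Q" for q
    unfolding inseparable_def
  proof (intro conjI allI impI)
    show "q \<noteq> {}" using q by (simp add: Q_def comps_def)
    fix D v assume D: "D \<subset> q \<and> D \<noteq> {}"
    \<comment> \<open>If the overlap were only \<open>v\<close>, then \<open>D\<close> would have
      degree 1 at \<open>v\<close> and degree 2 at its other neighbours. The W-degrees over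
      \<open>D\<close> would sum to an odd number, although each of them is even.\<close>
    show "\<not> nb D \<inter> nb (q - D) \<subseteq> {v}"
    proof
      assume sub: "nb D \<inter> nb (q - D) \<subseteq> {v}"
      have finD: "finite D" using D finq[OF q] finite_subset by (metis psubset_imp_subset)
      have v: "v \<in> nb D" "v \<in> nb (q - D)"
        using connq[OF q] D sub unfolding connected_family_def by blast+
      have split: "mdeg q u = mdeg D u + mdeg (q - D) u" for u
        using sum.subset_diff[OF psubset_imp_subset finq[OF q], of D "\<lambda>w. mult G w u"] D
        by (simp only: add.commute)
      have pos: "mdeg A u \<noteq> 0" if "u \<in> nb A" "A \<subseteq> q" for A u
        using that finite_subset[OF that(2) finq[OF q]] by (auto simp: nbs_def Suc_le_eq)
      have "mdeg D v \<noteq> 0" by (rule pos[OF v(1)]) (use D in blast)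
      moreover have "mdeg (q - D) v \<noteq> 0" by (rule pos[OF v(2)]) blast
      ultimately have v1: "mdeg D v = 1" using deg2[OF q, of v] split[of v] v(1) D by fastforce
      have u2: "mdeg D u = 2" if u: "u \<in> nb D - {v}" for u
      proof -
        have "u \<notin> nb (q - D)" using u sub by blast
        then have "mdeg (q - D) u = 0" using nb_subset[of D] u by (intro sum.neutral) (auto simp: nbs_def Suc_le_eq)
        moreover have "u \<in> nb q" using u D by blast
        ultimately show ?thesis using deg2[OF q, of u] split[of u] by simp
      qed
      have "(\<Sum>w\<in>D. wdeg G w) = (\<Sum>u\<in>V. mdeg D u)"
        unfolding wdeg_def by (rule sum.swap)
      also have "\<dots> = (\<Sum>u\<in>nb D. mdeg D u)"
        by (rule sum.mono_neutral_right) (use finV in \<open>auto simp: nbs_def Suc_le_eq\<close>)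
      also have "\<dots> = mdeg D v + (\<Sum>u\<in>nb D - {v}. mdeg D u)"
        using fin_nb v(1) by (rule sum.remove)
      also have "(\<Sum>u\<in>nb D - {v}. mdeg D u) = (\<Sum>u\<in>nb D - {v}. 2)"
        by (rule sum.cong) (use u2 in auto)
      finally have "odd (\<Sum>w\<in>D. wdeg G w)" using v1 by simp
      moreover have "even (\<Sum>w\<in>D. wdeg G w)"
        by (rule dvd_sum) (use wdeg D qW[OF q] in blast)
      ultimately show False by simp
    qed
  qed
  have blocksQ: "blocks G = Q" by (rule blocks_eq[OF pb(1) insq forest])
  then show "blocks G = comps W C" by (simp add: Q_def)
  show "admissible G"
    unfolding admissible_def block_tree_def blocksQ
  proof (intro conjI allI impI ballI)
    fix S assume "S \<subseteq> Q \<and> card S \<ge> 2"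
    then show "card (in_at_least_two S (\<lambda>A. vverts (induced G A))) \<le> card S - 1"
      using forest[of S] by (simp add: vverts_induced)
  next
    fix A w assume "A \<in> Q" "w \<in> A"
    then show "even (wdeg (induced G A) w)"
      using wdeg qW by (auto simp: wdeg_induced[OF finV])
  next
    fix A v assume "A \<in> Q" "v \<in> vverts (induced G A)"
    then show "vdeg (induced G A) v = 2" by (simp add: vdeg_induced vverts_induced deg2)
  qed
  show "{A \<in> C. A \<subseteq> B} \<in> decomps B" if B: "B \<in> big_blocks G" for B
  proof -
    have B: "B \<in> Q" "card B \<ge> 2" using B by (auto simp: big_blocks_def blocksQ)
    define F where "F = {A \<in> C. A \<subseteq> B}"
    have cov: "\<Union>F = B" using comps_cover[of B W C] B by (simp add: F_def Q_def)
    have finF: "finite F" "\<And>A. A \<in> F \<Longrightarrow> finite A"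
      using finC finite_subset[OF _ finq[OF B(1)]] by (auto simp: F_def)
    have connF: "connected_family (\<lambda>A. A) F"
      by (rule comps_connected_family[OF _ F_def ne cov]) (use B in \<open>simp add: Q_def\<close>)
    have sF: "(\<Sum>A\<in>F. card A - 1) + card F = (\<Sum>A\<in>F. card A)"
    proof -
      have "(\<Sum>A\<in>F. card A) = (\<Sum>A\<in>F. (card A - 1) + 1)"
      proof (rule sum.cong)
        fix A assume "A \<in> F"
        then have "card A \<ge> 2" using C by (simp add: F_def)
        then show "card A = card A - 1 + 1" by simp
      qed simp
      then show ?thesis by (simp only: sum.distrib) simp
    qed
    \<comment> \<open>The bound of \<open>comps_cost_le\<close> holds for each component, and the
      sums over all components agree, so it is an equality for each of them.\<close>
    have tightB: "card B = (\<Sum>A\<in>F. card A - 1) + 1"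
    proof -
      have cc: "cost C = (\<Sum>q\<in>Q. \<Sum>A\<in>{A \<in> C. A \<subseteq> q}. card A - 1)"
        unfolding Q_def by (rule cost_comps[OF finW C'])
      have "(\<Sum>q\<in>Q. card q) = cost C + card Q"
        using tightC product_partition[OF pb(1) finq] by (rule trans[OF sym, rotated])
      also have "\<dots> = (\<Sum>q\<in>Q. (\<Sum>A\<in>{A \<in> C. A \<subseteq> q}. card A - 1) + 1)"
        unfolding cc by (simp only: sum.distrib) simp
      finally have "(\<Sum>q\<in>Q. card q) = (\<Sum>q\<in>Q. (\<Sum>A\<in>{A \<in> C. A \<subseteq> q}. card A - 1) + 1)" .
      then show ?thesis unfolding F_def
        by (rule sum_mono_inv) (use comps_cost_le[OF _ finW finC ne] B finQ in \<open>auto simp: Q_def\<close>)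
    qed
    have "B \<noteq> {}" using B by auto
    have "F \<in> adm_decomps G (card F) B"
      unfolding adm_decomps_def
    proof (intro CollectI conjI ballI impI allI)
      show "finite F" "\<Union>F = B" by fact+
    next
      fix A assume F1: "card F \<noteq> 1" and A: "A \<in> F"
      have "{A} \<noteq> F" using F1 by auto
      then have "{A} \<subset> F" using A by blast
      then obtain B where "B \<in> F - {A}" "A \<inter> B \<noteq> {}" using connected_familyD[OF connF, of "{A}"] by auto
      then show "\<exists>A'\<in>F. A' \<noteq> A \<and> A \<inter> A' \<noteq> {}" by blast
    next
      fix A assume "A \<in> F"
      then show "card A \<ge> 2" "connected_bigraph (induced G A)"
        using C connA by (auto simp: F_def connected_induced)
    next
      fix v assume "v \<in> vverts (induced G B)"
      then have vB: "v \<in> nb B" by (simp add: vverts_induced)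
      have d2: "mdeg B v = 2" by (rule deg2[OF B(1) vB])
      obtain w where w: "w \<in> B" "v \<in> nbs G w" using vB by blast
      obtain A where A: "A \<in> F" "w \<in> A" using w cov by blast
      have big: "v \<in> vverts (induced G A) \<and> vdeg (induced G A) v \<ge> 2"
        if "A \<in> F" "w \<in> A" "mdeg A v \<ge> 2" for A
        using that w by (auto simp: vverts_induced vdeg_induced)
      have m1: "mult G w v \<ge> 1" using w by (simp add: nbs_def)
      have rem: "mdeg B v = mult G w v + mdeg (B - {w}) v"
        using finq[OF B(1)] w(1) by (rule sum.remove)
      show "\<exists>A\<in>F. v \<in> vverts (induced G A) \<and> vdeg (induced G A) v \<ge> 2"
      proof (cases "mult G w v = 1")
        case False
        then have "mult G w v \<ge> 2" using m1 by simp
        then have "mdeg A v \<ge> 2" using member_le_sum[of w A "\<lambda>w. mult G w v"] A finF by fastforce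
        then show ?thesis using big A by blast
      next
        case True
        show ?thesis
        proof (rule ccontr)
          assume no: "\<not> ?thesis"
          \<comment> \<open>If no member has degree 2 at \<open>v\<close>, then no member contains
            \<open>w\<close> together with another neighbour of \<open>v\<close>. So
            \<open>U = {w}\<close> is a legitimate choice in the parity test, and it fails because
            \<open>mult G w v = 1\<close>.\<close>
          have "{u \<in> A. v \<in> nbs G u} \<subseteq> {w} \<or> {u \<in> A. v \<in> nbs G u} \<inter> {w} = {}" if A: "A \<in> C" for A
          proof (cases "w \<in> A")
            case wA: True
            have "A \<inter> B \<noteq> {}" using wA w(1) by blast
            then have "A \<subseteq> B" using closedQ[OF B(1)] A unfolding closed_for_def by blast
            then have AF: "A \<in> F" using A by (simp add: F_def)
            have "u = w" if u: "u \<in> A" "v \<in> nbs G u" for u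
            proof (rule ccontr)
              assume "u \<noteq> w"
              have "mdeg {w, u} v \<le> mdeg A v" using finF(2)[OF AF] u wA by (intro sum_mono2) auto
              moreover have "mult G u v \<ge> 1" using u by (simp add: nbs_def)
              ultimately have "mdeg A v \<ge> 2" using m1 \<open>u \<noteq> w\<close> by simp
              then show False using no big[OF AF wA] AF by blast
            qed
            then show ?thesis by blast
          qed auto
          then have "even (mdeg {w} v)"
            using w(1) qW[OF B(1)] by (intro parity_okD[OF par]) blast+
          then show False using True by simp
        qed
      qed
    next
      fix S assume "S \<subseteq> F \<and> card S \<ge> 2"
      then show "card (in_at_least_two S (\<lambda>A. A)) \<le> card S - 1"
        using tight_family_shared[OF connF finF, of S] sF tightB cov by simp
    qed (rule refl)
    then show ?thesis using decomps_iff[OF \<open>B \<noteq> {}\<close>] by (simp add: F_def)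
  qed
  show "C = (\<Union>B\<in>big_blocks G. {A \<in> C. A \<subseteq> B})"
  proof
    show "C \<subseteq> (\<Union>B\<in>big_blocks G. {A \<in> C. A \<subseteq> B})"
    proof
      fix A assume A: "A \<in> C"
      then obtain w where w: "w \<in> A" "w \<in> W" using C' by blast
      have "\<Union>Q = W" by (rule partition_onD1[OF pb(1), symmetric])
      then obtain q where q: "q \<in> Q" "w \<in> q" using w by blast
      have "A \<subseteq> q" using closedQ[OF q(1)] A w(1) q(2) unfolding closed_for_def by blast
      moreover have "card q \<ge> 2" using card_mono[OF finq[OF q(1)] \<open>A \<subseteq> q\<close>] C[OF A] by linarith
      ultimately show "A \<in> (\<Union>B\<in>big_blocks G. {A \<in> C. A \<subseteq> B})"
        using A q(1) by (auto simp: big_blocks_def blocksQ)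
    qed
  qed auto
qed

text \<open>Converse to \<open>tight_structure\<close>: independent choices of a decomposition for
  each big block recombine to a family of critical cost. The block tree condition reverses the count
  of V-vertices, and condition (f) of the decompositions reverses the count of W-vertices.\<close>

lemma admissible_family:
  assumes adm: "admissible G" and c: "\<And>B. B \<in> big_blocks G \<Longrightarrow> c B \<in> decomps B"
  defines "C \<equiv> \<Union>B\<in>big_blocks G. c B"
  shows "\<And>A. A \<in> C \<Longrightarrow> A \<subseteq> W \<and> card A \<ge> 2"
    and "\<And>B. B \<in> big_blocks G \<Longrightarrow> {A \<in> C. A \<subseteq> B} = c B"
    and "2 * (card W + card V) = totE + 2 * cost C + 2"
proof -
  have part: "partition_on W (blocks G)" by (rule blocks_partition[OF finW])
  have finQ: "finite (blocks G)" by (rule finite_elements[OF finW part])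
  have BW: "B \<subseteq> W" if "B \<in> blocks G" for B using that by (simp add: blocks_iff)
  have finB: "finite B" if "B \<in> blocks G" for B by (rule finite_subset[OF BW[OF that] finW])
  have big: "B \<in> blocks G \<and> card B \<ge> 2" if "B \<in> big_blocks G" for B using that by (simp add: big_blocks_def)
  have fin_big: "finite (big_blocks G)" using finQ by (simp add: big_blocks_def)
  have dc: "c B \<in> adm_decomps G (card (c B)) B" if "B \<in> big_blocks G" for B
  proof -
    have "B \<noteq> {}" using big[OF that] by auto
    then show ?thesis using c[OF that] decomps_iff by blast
  qed
  have cB: "finite (c B)" "\<Union>(c B) = B" "\<And>A. A \<in> c B \<Longrightarrow> card A \<ge> 2 \<and> A \<subseteq> B \<and> finite A"
    if "B \<in> big_blocks G" for B
  proof -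
    show "finite (c B)" "\<Union>(c B) = B" using dc[OF that] by (auto simp: adm_decomps_def)
    then show "card A \<ge> 2 \<and> A \<subseteq> B \<and> finite A" if "A \<in> c B" for A
      using dc[OF \<open>B \<in> big_blocks G\<close>] that finite_subset[OF _ finB, of A B] big[OF \<open>B \<in> big_blocks G\<close>]
      by (auto simp: adm_decomps_def)
  qed
  have dis: "B = B'" if "B \<in> blocks G" "B' \<in> blocks G" "B \<inter> B' \<noteq> {}" for B B'
    using partition_onD2[OF part] that by (meson disjointD)
  show "A \<subseteq> W \<and> card A \<ge> 2" if "A \<in> C" for A
  proof -
    obtain B where "B \<in> big_blocks G" "A \<in> c B" using \<open>A \<in> C\<close> by (auto simp: C_def)
    then show ?thesis using cB(3)[of B A] BW big by blast
  qed
  show res: "{A \<in> C. A \<subseteq> B} = c B" if B: "B \<in> big_blocks G" for B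
  proof
    show "{A \<in> C. A \<subseteq> B} \<subseteq> c B"
    proof
      fix A assume "A \<in> {A \<in> C. A \<subseteq> B}"
      then obtain B' where B': "B' \<in> big_blocks G" "A \<in> c B'" and AB: "A \<subseteq> B" by (auto simp: C_def)
      have "A \<noteq> {}" "A \<subseteq> B'" using cB(3)[OF B'] by auto
      then have "B \<inter> B' \<noteq> {}" using AB by blast
      then show "A \<in> c B" using dis[of B B'] big B B' by blast
    qed
    show "c B \<subseteq> {A \<in> C. A \<subseteq> B}" using cB(3)[OF B] B by (auto simp: C_def)
  qed
  have deg2: "mdeg B v = 2" if "B \<in> blocks G" "v \<in> nb B" for B v
  proof -
    have "\<forall>v\<in>vverts (induced G B). vdeg (induced G B) v = 2"
      using adm that(1) unfolding admissible_def by blast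
    moreover have "v \<in> vverts (induced G B)" unfolding vverts_induced by (rule that(2))
    ultimately show ?thesis unfolding vdeg_induced by blast
  qed
  have "totE = (\<Sum>B\<in>blocks G. \<Sum>v\<in>nb B. 2)"
    unfolding total_mult_partition[OF fin_G part] by (intro sum.cong refl deg2)
  then have E: "totE = 2 * (\<Sum>B\<in>blocks G. card (nb B))" by (simp add: sum_distrib_left mult.commute)
  have V1: "card V + card (blocks G) \<le> (\<Sum>B\<in>blocks G. card (nb B)) + 1"
    using connected_family_card_Union[OF nb_connected[OF part] finQ fin_nb] nb_Union[OF part] by simp
  have "blocks G \<noteq> {}" using part W_ne by (auto simp: partition_on_def)
  have "(\<Sum>B\<in>blocks G. card (nb B)) + 1 \<le> card (\<Union>(nb ` blocks G)) + card (blocks G)"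
  proof (rule forest_card_Union[OF finQ \<open>blocks G \<noteq> {}\<close> fin_nb])
    fix K assume "K \<subseteq> blocks G" "card K \<ge> 2"
    then show "card (in_at_least_two K nb) \<le> card K - 1"
      using adm unfolding admissible_def block_tree_def by (simp add: vverts_induced)
  qed
  then have V2: "(\<Sum>B\<in>blocks G. card (nb B)) + 1 \<le> card V + card (blocks G)"
    using nb_Union[OF part] by simp
  have costB: "card B = (\<Sum>A\<in>c B. card A - 1) + 1" if B: "B \<in> big_blocks G" for B
  proof -
    have ne: "c B \<noteq> {}" using cB(2)[OF B] big[OF B] by auto
    \<comment> \<open>Connectedness of the collection comes from condition (e). Since
      \<open>B\<close> is connected, some V-vertex would join the two parts; having degree 2 in
      \<open>B\<close>, it sends one simple edge to each, and the member of degree 2 at it would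
      meet both parts.\<close>
    have cf: "connected_family (\<lambda>A. A) (c B)"
      unfolding connected_family_def
    proof (intro conjI allI impI)
      show "c B \<noteq> {}" by (rule ne)
      fix D assume D: "D \<subset> c B \<and> D \<noteq> {}"
      show "\<Union>((\<lambda>A. A) ` D) \<inter> \<Union>((\<lambda>A. A) ` (c B - D)) \<noteq> {}"
      proof
        assume dj: "\<Union>((\<lambda>A. A) ` D) \<inter> \<Union>((\<lambda>A. A) ` (c B - D)) = {}"
        have mem: "A \<noteq> {}" "A \<subseteq> B" if "A \<in> c B" for A using cB(3)[OF B that] by auto
        obtain A1 where "A1 \<in> c B - D" using D by blast
        then have "\<Union>D \<subset> B" using mem[of A1] dj D mem(2) by blast
        moreover obtain A2 where "A2 \<in> D" using D by blast
        then have "\<Union>D \<noteq> {}" using D mem(1)[of A2] by blast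
        ultimately obtain a b where ab: "a \<in> \<Union>D" "b \<in> B - \<Union>D" "nbs G a \<inter> nbs G b \<noteq> {}"
          using connected_familyD[OF inseparable_connected, of G B "\<Union>D"] big[OF B] by (auto simp: blocks_iff)
        then obtain v where v: "v \<in> nbs G a" "v \<in> nbs G b" by blast
        have aB: "a \<in> B" using ab \<open>\<Union>D \<subset> B\<close> by blast
        have "v \<in> vverts (induced G B)" using v aB by (auto simp: vverts_induced)
        then obtain A where A: "A \<in> c B" "vdeg (induced G A) v \<ge> 2"
          using dc[OF B] unfolding adm_decomps_def by blast
        have not_both: "\<not> (a \<in> A \<and> b \<in> A)" using dj ab A(1) by blast
        have two: "mdeg {a, b} v + mdeg (B - {a, b}) v = 2"
        proof -
          have "{a, b} \<subseteq> B" using aB ab by blast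
          then have "mdeg B v = mdeg (B - {a, b}) v + mdeg {a, b} v"
            using finB big[OF B] by (intro sum.subset_diff) auto
          moreover have "v \<in> nb B" using v aB by blast
          ultimately show ?thesis using deg2 big[OF B] by simp
        qed
        have ne: "a \<noteq> b" using ab by blast
        have m1: "mult G a v \<ge> 1" "mult G b v \<ge> 1" using v by (auto simp: nbs_def)
        have zero: "mdeg (B - {a, b}) v = 0" and m11: "mult G a v = 1" "mult G b v = 1"
          using two m1 ne by simp_all
        have finA: "finite A" "A \<subseteq> B" using cB(3)[OF B A(1)] by auto
        have "mdeg A v \<le> mdeg (A \<inter> {a, b}) v + mdeg (B - {a, b}) v"
        proof -
          have "mdeg A v = mdeg (A \<inter> {a, b}) v + mdeg (A - {a, b}) v"
            using finA by (metis Int_Diff_Un Int_Diff_disjoint finite_Diff finite_Int sum.union_disjoint)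
          moreover have "mdeg (A - {a, b}) v \<le> mdeg (B - {a, b}) v"
            using finA finB big[OF B] by (intro sum_mono2) auto
          ultimately show ?thesis by simp
        qed
        moreover have "mdeg (A \<inter> {a, b}) v \<le> 1"
        proof -
          have "A \<inter> {a, b} = {} \<or> A \<inter> {a, b} = {a} \<or> A \<inter> {a, b} = {b}" using not_both by blast
          then show ?thesis using m11 by auto
        qed
        ultimately show False using A(2) zero by (simp add: vdeg_induced)
      qed
    qed
    have fA: "\<And>A. A \<in> c B \<Longrightarrow> finite A" using cB(3)[OF B] by blast
    have "card B + card (c B) \<le> (\<Sum>A\<in>c B. card A) + 1"
      using connected_family_card_Union[OF cf cB(1)[OF B] fA] cB(2)[OF B] by simp
    moreover have "(\<Sum>A\<in>c B. card A) + 1 \<le> card B + card (c B)"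
    proof -
      have "card (in_at_least_two K (\<lambda>A. A)) \<le> card K - 1" if "K \<subseteq> c B" "card K \<ge> 2" for K
        using dc[OF B] that by (simp add: adm_decomps_def)
      from forest_card_Union[OF cB(1)[OF B] ne fA this] show ?thesis using cB(2)[OF B] by simp
    qed
    moreover have "(\<Sum>A\<in>c B. card A) = (\<Sum>A\<in>c B. card A - 1) + card (c B)"
    proof -
      have "(\<Sum>A\<in>c B. card A) = (\<Sum>A\<in>c B. (card A - 1) + 1)"
      proof (rule sum.cong)
        fix A assume "A \<in> c B"
        then have "card A \<ge> 2" using cB(3)[OF B] by blast
        then show "card A = card A - 1 + 1" by simp
      qed simp
      then show ?thesis by (simp only: sum.distrib) simp
    qed
    ultimately show ?thesis by linarith
  qed
  have "cost C = (\<Sum>B\<in>big_blocks G. \<Sum>A\<in>c B. card A - 1)"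
    unfolding cost_def C_def
  proof (rule sum.UNION_disjoint[OF fin_big])
    show "\<forall>B\<in>big_blocks G. finite (c B)" using cB(1) by blast
    show "\<forall>B\<in>big_blocks G. \<forall>B'\<in>big_blocks G. B \<noteq> B' \<longrightarrow> c B \<inter> c B' = {}"
    proof (intro ballI impI)
      fix B B' assume B: "B \<in> big_blocks G" "B' \<in> big_blocks G" "B \<noteq> B'"
      show "c B \<inter> c B' = {}"
      proof (rule ccontr)
        assume "c B \<inter> c B' \<noteq> {}"
        then obtain A where A: "A \<in> c B" "A \<in> c B'" by blast
        have "A \<noteq> {}" "A \<subseteq> B" "A \<subseteq> B'" using cB(3)[OF B(1) A(1)] cB(3)[OF B(2) A(2)] by auto
        then have "B \<inter> B' \<noteq> {}" by blast
        then show False using dis big B by blast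
      qed
    qed
  qed
  moreover have "card W = (\<Sum>B\<in>blocks G. card B)"
    by (rule product_partition[OF part finB])
  moreover have "(\<Sum>B\<in>blocks G. card B) = (\<Sum>B\<in>blocks G. card B - 1) + card (blocks G)"
  proof -
    have "(\<Sum>B\<in>blocks G. card B) = (\<Sum>B\<in>blocks G. (card B - 1) + 1)"
    proof (rule sum.cong)
      fix B assume "B \<in> blocks G"
      then have "card B \<noteq> 0" using finB by (auto simp: blocks_iff inseparable_def)
      then show "card B = card B - 1 + 1" by simp
    qed simp
    then show ?thesis by (simp only: sum.distrib) simp
  qed
  moreover have "(\<Sum>B\<in>blocks G. card B - 1) = (\<Sum>B\<in>big_blocks G. \<Sum>A\<in>c B. card A - 1)"
  proof -
    have "(\<Sum>B\<in>blocks G. card B - 1) = (\<Sum>B\<in>big_blocks G. card B - 1)"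
      by (rule sum.mono_neutral_right) (use finQ in \<open>auto simp: big_blocks_def\<close>)
    also have "\<dots> = (\<Sum>B\<in>big_blocks G. \<Sum>A\<in>c B. card A - 1)"
      by (rule sum.cong) (use costB in auto)
    finally show ?thesis .
  qed
  ultimately have "card W = cost C + card (blocks G)" by metis
  moreover have "2 * (w + v) = e + 2 * c + 2"
    if "w = c + q" "e = 2 * n" "v + q \<le> n + 1" "n + 1 \<le> v + q" for w v e c q n :: nat
  proof -
    have "v + q = n + 1" using that(3,4) by (rule antisym)
    then have "2 * (w + v) = 2 * (c + n + 1)" unfolding that(1) by simp
    then show ?thesis unfolding that(2) by simp
  qed
  ultimately show "2 * (card W + card V) = totE + 2 * cost C + 2" using E V1 V2 by blast
qed

end

section \<open>Decay of the Fourier transform and inversion\<close>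

section \<open>Fourier transforms of smooth integrable functions\<close>

lemma fourier_eq: "fourier f t = (LBINT x. f x *\<^sub>R exp (- \<i> * of_real (t * x)))"
  by (simp add: fourier_def scaleR_conv_of_real)

lemma norm_exp_minus_i [simp]: "norm (exp (\<i> * of_real x)) = 1"
  using norm_exp_i_times[of x] norm_exp_i_times[of "- x"] by simp_all

lemma fourier_integrable:
  assumes "integrable lborel f"
  shows "integrable lborel (\<lambda>x. f x *\<^sub>R exp (- \<i> * of_real (t * x)))"
proof (rule Bochner_Integration.integrable_bound[OF assms])
  show "(\<lambda>x. f x *\<^sub>R exp (- \<i> * of_real (t * x))) \<in> borel_measurable lborel"
    using borel_measurable_integrable[OF assms] by measurable
qed (simp del: of_real_mult)

lemma norm_fourier_le:
  assumes "integrable lborel f"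
  shows "norm (fourier f t) \<le> (LBINT x. \<bar>f x\<bar>)"
  using integral_norm_bound[of lborel "\<lambda>x. f x *\<^sub>R exp (- \<i> * of_real (t * x))"]
  by (simp add: fourier_eq del: of_real_mult)

lemma fourier_measurable [measurable]:
  assumes "integrable lborel f"
  shows "fourier f \<in> borel_measurable borel"
proof -
  note [measurable] = borel_measurable_integrable[OF assms]
  have "(\<lambda>t. LBINT x. f x *\<^sub>R exp (- \<i> * of_real (t * x))) \<in> borel_measurable borel"
    by (intro lborel.borel_measurable_lebesgue_integral) measurable
  then show ?thesis by (simp add: fourier_eq[abs_def])
qed

lemma fourier_uminus:
  assumes "\<And>x. f (- x) = - f x"
  shows "fourier f (- t) = - fourier f t"
proof -
  have "fourier f (- t) = (LBINT x. f (- x) *\<^sub>R exp (- \<i> * of_real (- t * - x)))"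
    unfolding fourier_eq
    using lborel_integral_real_affine[of "-1" "\<lambda>x. f x *\<^sub>R exp (- \<i> * of_real (- t * x))" 0] by simp
  also have "\<dots> = - fourier f t" unfolding fourier_eq using assms by simp
  finally show ?thesis .
qed

text \<open>Averaging \<open>F'\<close> over translates by a number in [0, 1] turns its integral
  into that of \<open>F (1 + x) - F x\<close>, which vanishes by translation invariance. This
  bypasses the limits of \<open>F\<close> at infinity.\<close>

lemma integral_vector_derivative_eq_0:
  fixes F F' :: "real \<Rightarrow> complex"
  assumes deriv: "\<And>x. (F has_vector_derivative F' x) (at x)" and cont: "continuous_on UNIV F'"
    and int: "integrable lborel F" "integrable lborel F'"
  shows "(LBINT x. F' x) = 0"
proof -
  note [measurable] = borel_measurable_integrable[OF int(2)]
  have shift: "integrable lborel (\<lambda>x. g (s + x))" "(LBINT x. g (s + x)) = (LBINT x. g x)"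
    if "integrable lborel g" for g :: "real \<Rightarrow> complex" and s
    using lborel_integrable_real_affine[OF that, of 1 s] lborel_integral_real_affine[of 1 g s] by simp_all
  have ftc: "(LBINT s. indicator {0..1} s *\<^sub>R F' (s + x)) = F (1 + x) - F x" for x
  proof -
    have "(LBINT s. indicator {0..1} s *\<^sub>R F' (s + x)) = F (1 + x) - F (0 + x)"
    proof (rule integral_FTC_Icc)
      fix s :: real
      have "((\<lambda>s. s + x) has_vector_derivative 1) (at s)"
        unfolding has_real_derivative_iff_has_vector_derivative[symmetric]
        by (auto intro!: derivative_eq_intros)
      then have "((\<lambda>s. F (s + x)) has_vector_derivative F' (s + x)) (at s)"
        using vector_diff_chain_at[of "\<lambda>s. s + x" 1 s F "F' (s + x)"] deriv[of "s + x"]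
        by (simp add: o_def)
      then show "((\<lambda>s. F (s + x)) has_vector_derivative F' (s + x)) (at s within {0..1})"
        by (rule has_vector_derivative_at_within)
    next
      show "continuous_on {0..1} (\<lambda>s. F' (s + x))"
        by (rule continuous_on_compose2[OF cont]) (auto intro!: continuous_intros)
    qed simp
    then show ?thesis by simp
  qed
  have pair: "integrable (lborel \<Otimes>\<^sub>M lborel) (\<lambda>(s, x). indicator {0..1::real} s *\<^sub>R F' (s + x))"
  proof (rule lborel_pair.Fubini_integrable)
    have "(\<lambda>s. LBINT x. norm (case (s, x) of (s, x) \<Rightarrow> indicator {0..1::real} s *\<^sub>R F' (s + x)))
        = (\<lambda>s. (LBINT x. norm (F' x)) * indicator {0..1} s)"
    proof
      fix s :: real
      have "(LBINT x. norm (F' (s + x))) = (LBINT x. norm (F' x))"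
        using lborel_integral_real_affine[of 1 "\<lambda>x. norm (F' x)" s] by simp
      then show "(LBINT x. norm (case (s, x) of (s, x) \<Rightarrow> indicator {0..1::real} s *\<^sub>R F' (s + x)))
          = (LBINT x. norm (F' x)) * indicator {0..1} s"
        by (simp add: indicator_def)
    qed
    then show "integrable lborel (\<lambda>s. LBINT x. norm (case (s, x) of (s, x) \<Rightarrow> indicator {0..1::real} s *\<^sub>R F' (s + x)))"
      by simp
    show "AE s in lborel. integrable lborel (\<lambda>x. case (s, x) of (s, x) \<Rightarrow> indicator {0..1::real} s *\<^sub>R F' (s + x))"
      using shift(1)[OF int(2)] by simp
  qed measurable
  have "(LBINT x. F (1 + x) - F x) = (LBINT x. LBINT s. indicator {0..1} s *\<^sub>R F' (s + x))"
    by (simp add: ftc)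
  also have "\<dots> = (LBINT s. LBINT x. indicator {0..1::real} s *\<^sub>R F' (s + x))"
    using lborel_pair.Fubini_integral[OF pair] by simp
  also have "\<dots> = (LBINT s. indicator {0..1::real} s *\<^sub>R (LBINT x. F' x))"
    by (simp add: shift(2)[OF int(2)])
  also have "\<dots> = (LBINT x. F' x)" by simp
  finally show ?thesis
    using shift[OF int(1), of 1] int(1) by simp
qed

text \<open>Integration by parts, in the form that the derivative of the integrable function
  \<open>f x *\<^sub>R exp (- \<i> * of_real (t * x))\<close> has integral 0.\<close>

lemma fourier_deriv:
  assumes deriv: "\<And>x. (f has_real_derivative f' x) (at x)" and cont: "continuous_on UNIV f'"
    and int: "integrable lborel f" "integrable lborel f'"
  shows "fourier f' t = \<i> * of_real t * fourier f t"
proof -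
  let ?e = "\<lambda>x. exp (- \<i> * of_real (t * x)) :: complex"
  have de: "(?e has_vector_derivative (- \<i> * of_real t) * ?e x) (at x)" for x
  proof -
    have "((\<lambda>z. exp (- \<i> * of_real t * z)) has_field_derivative (- \<i> * of_real t) * exp (- \<i> * of_real t * of_real x))
        (at (of_real x))"
      by (auto intro!: derivative_eq_intros)
    from has_vector_derivative_real_field[OF this] show ?thesis by (simp add: mult.assoc)
  qed
  have df: "((\<lambda>x. complex_of_real (f x)) has_vector_derivative of_real (f' x)) (at x)" for x
    using deriv[of x] by (intro has_vector_derivative_of_real) simp
  have "(LBINT x. f x *\<^sub>R ((- \<i> * of_real t) * ?e x) + f' x *\<^sub>R ?e x) = 0"
  proof (rule integral_vector_derivative_eq_0[of "\<lambda>x. f x *\<^sub>R ?e x"])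
    show "((\<lambda>x. f x *\<^sub>R ?e x) has_vector_derivative f x *\<^sub>R ((- \<i> * of_real t) * ?e x) + f' x *\<^sub>R ?e x) (at x)" for x
      by (rule has_vector_derivative_scaleR[OF deriv de])
    have "continuous_on UNIV f"
      using deriv by (meson DERIV_isCont continuous_at_imp_continuous_on)
    then show "continuous_on UNIV (\<lambda>x. f x *\<^sub>R ((- \<i> * of_real t) * ?e x) + f' x *\<^sub>R ?e x)"
      by (intro continuous_intros cont)
    show "integrable lborel (\<lambda>x. f x *\<^sub>R ?e x)" by (rule fourier_integrable[OF int(1)])
    have "integrable lborel (\<lambda>x. (- \<i> * of_real t) * (f x *\<^sub>R ?e x) + f' x *\<^sub>R ?e x)"
      by (intro Bochner_Integration.integrable_add integrable_mult_right fourier_integrable int)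
    then show "integrable lborel (\<lambda>x. f x *\<^sub>R ((- \<i> * of_real t) * ?e x) + f' x *\<^sub>R ?e x)"
      by (simp add: algebra_simps)
  qed
  then have "0 = (LBINT x. (- \<i> * of_real t) * (f x *\<^sub>R ?e x) + f' x *\<^sub>R ?e x)"
    by simp
  also have "(LBINT x. (- \<i> * of_real t) * (f x *\<^sub>R ?e x) + f' x *\<^sub>R ?e x)
      = (- \<i> * of_real t) * fourier f t + fourier f' t"
    unfolding fourier_eq integral_mult_right_zero[symmetric]
    by (rule Bochner_Integration.integral_add) (intro integrable_mult_right fourier_integrable int)+
  finally show ?thesis by (simp add: algebra_simps add_eq_0_iff)
qed

text \<open>Condition (A2) without oddness. Unlike (A2), this class is closed under
  \<open>deriv\<close>, which the induction on the order of derivatives requires.\<close>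

definition smooth_L1 :: "(real \<Rightarrow> real) \<Rightarrow> bool" where
  "smooth_L1 f \<longleftrightarrow> (\<forall>k x. ((deriv ^^ k) f) differentiable (at x)) \<and> (\<forall>k. integrable lborel ((deriv ^^ k) f))"

lemma smooth_L1_deriv: "smooth_L1 f \<Longrightarrow> smooth_L1 (deriv f)"
  unfolding smooth_L1_def by (metis funpow_Suc_right comp_apply)

lemma smooth_L1_integrable: "smooth_L1 f \<Longrightarrow> integrable lborel f"
  unfolding smooth_L1_def by (metis funpow_0)

lemma smooth_L1_DERIV: "smooth_L1 f \<Longrightarrow> (f has_real_derivative deriv f x) (at x)"
  unfolding smooth_L1_def by (metis funpow_0 DERIV_deriv_iff_real_differentiable)

lemma smooth_L1_continuous: "smooth_L1 f \<Longrightarrow> continuous_on UNIV f"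
  using smooth_L1_DERIV by (meson DERIV_isCont continuous_at_imp_continuous_on)

lemma fourier_funpow_deriv:
  "smooth_L1 f \<Longrightarrow> fourier ((deriv ^^ k) f) t = (\<i> * of_real t) ^ k * fourier f t"
proof (induction k arbitrary: f)
  case (Suc k)
  have "fourier ((deriv ^^ Suc k) f) t = fourier ((deriv ^^ k) (deriv f)) t"
    by (simp only: funpow_Suc_right comp_apply)
  also have "\<dots> = (\<i> * of_real t) ^ k * fourier (deriv f) t"
    using Suc.IH[OF smooth_L1_deriv[OF Suc.prems]] .
  also have "fourier (deriv f) t = \<i> * of_real t * fourier f t"
    using Suc.prems smooth_L1_deriv[OF Suc.prems]
    by (intro fourier_deriv smooth_L1_DERIV smooth_L1_continuous smooth_L1_integrable)
  finally show ?case by (simp add: mult_ac)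
qed simp

lemma fourier_decay:
  assumes "smooth_L1 f"
  shows "\<bar>t\<bar> ^ k * norm (fourier f t) \<le> (LBINT x. \<bar>(deriv ^^ k) f x\<bar>)"
proof -
  have "integrable lborel ((deriv ^^ k) f)" using assms by (simp add: smooth_L1_def)
  from norm_fourier_le[OF this, of t] show ?thesis
    by (simp add: fourier_funpow_deriv[OF assms] norm_mult norm_power)
qed

text \<open>Decay of order \<open>k + 2\<close> pays for the weight of degree \<open>k\<close> and
  leaves the majorant \<open>1 / (1 + t^2)\<close>. The constant comes from bounding
  \<open>(1 + u) ^ (k + 2)\<close> by \<open>2 ^ (k + 2) * (1 + u ^ (k + 2))\<close>.\<close>

lemma fourier_poly_integrable:
  assumes f: "smooth_L1 f"
  shows "integrable lborel (\<lambda>t. norm (fourier f t) * (1 + \<bar>t\<bar>) ^ k)"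
proof -
  define C where "C = 2 ^ (k + 2) * ((LBINT x. \<bar>f x\<bar>) + (LBINT x. \<bar>(deriv ^^ (k + 2)) f x\<bar>))"
  have [measurable]: "fourier f \<in> borel_measurable borel"
    by (rule fourier_measurable[OF smooth_L1_integrable[OF f]])
  have "integrable lborel (\<lambda>x::real. inverse (1 + x\<^sup>2))"
    using integrable_inverse_1_plus_square by (simp add: set_integrable_def)
  then have "integrable lborel (\<lambda>x::real. C * inverse (1 + x\<^sup>2))" by simp
  then show ?thesis
  proof (rule Bochner_Integration.integrable_bound)
    show "AE t in lborel. norm (norm (fourier f t) * (1 + \<bar>t\<bar>) ^ k) \<le> norm (C * inverse (1 + t\<^sup>2))"
    proof (intro AE_I2)
      fix t :: real
      define u where "u = \<bar>t\<bar>"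
      have u: "u \<ge> 0" by (simp add: u_def)
      have "1 + t\<^sup>2 \<le> (1 + u)\<^sup>2" using u by (simp add: u_def power2_eq_square algebra_simps)
      then have "(1 + u) ^ k * (1 + t\<^sup>2) \<le> (1 + u) ^ k * (1 + u)\<^sup>2"
        using u by (intro mult_left_mono) auto
      also have "\<dots> = (1 + u) ^ (k + 2)" by (simp only: power_add)
      also have "\<dots> \<le> 2 ^ (k + 2) * (1 + u ^ (k + 2))"
      proof (cases "u \<le> 1")
        case True
        have "(1 + u) ^ (k + 2) \<le> 2 ^ (k + 2)" using u True by (intro power_mono) auto
        also have "\<dots> \<le> 2 ^ (k + 2) * (1 + u ^ (k + 2))" using u by simp
        finally show ?thesis .
      next
        case False
        have "(1 + u) ^ (k + 2) \<le> (2 * u) ^ (k + 2)" using u False by (intro power_mono) auto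
        also have "\<dots> = 2 ^ (k + 2) * u ^ (k + 2)" by (rule power_mult_distrib)
        also have "\<dots> \<le> 2 ^ (k + 2) * (1 + u ^ (k + 2))" by simp
        finally show ?thesis .
      qed
      finally have "norm (fourier f t) * ((1 + u) ^ k * (1 + t\<^sup>2)) \<le> norm (fourier f t) * (2 ^ (k + 2) * (1 + u ^ (k + 2)))"
        by (intro mult_left_mono) auto
      also have "\<dots> = 2 ^ (k + 2) * (norm (fourier f t) + u ^ (k + 2) * norm (fourier f t))"
        by (simp add: algebra_simps)
      also have "\<dots> \<le> C"
        unfolding C_def u_def
        using norm_fourier_le[OF smooth_L1_integrable[OF f], of t] fourier_decay[OF f, of t "k + 2"]
        by (intro mult_left_mono add_mono) auto
      finally have "norm (fourier f t) * (1 + u) ^ k * (1 + t\<^sup>2) \<le> C" by (simp add: mult.assoc)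
      moreover have "1 + t\<^sup>2 > 0" by (simp add: add_pos_nonneg)
      ultimately have "norm (fourier f t) * (1 + u) ^ k \<le> C / (1 + t\<^sup>2)" by (simp add: pos_le_divide_eq)
      moreover have "norm (norm (fourier f t) * (1 + u) ^ k) = norm (fourier f t) * (1 + u) ^ k"
        using u by simp
      ultimately show "norm (norm (fourier f t) * (1 + \<bar>t\<bar>) ^ k) \<le> norm (C * inverse (1 + t\<^sup>2))"
        unfolding u_def by (simp add: divide_inverse)
    qed
  qed measurable
qed

lemma integrable_fourier: "smooth_L1 f \<Longrightarrow> integrable lborel (fourier f)"
  using fourier_poly_integrable[of f 0] fourier_measurable[OF smooth_L1_integrable, of f]
  by (simp add: integrable_iff_bounded)

text \<open>The total variation of \<open>f\<close> is the integral of the modulus of its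
  derivative. Boundedness is used both as domination in the inversion formula and for integrability
  of products of values of \<open>f\<close>.\<close>

lemma smooth_L1_bounded:
  assumes f: "smooth_L1 f"
  shows "\<bar>f x\<bar> \<le> \<bar>f 0\<bar> + (LBINT x. \<bar>deriv f x\<bar>)"
proof -
  have int: "integrable lborel (deriv f)" using smooth_L1_integrable[OF smooth_L1_deriv[OF f]] .
  have main: "\<bar>f b - f a\<bar> \<le> (LBINT x. \<bar>deriv f x\<bar>)" if "a \<le> b" for a b
  proof -
    have cont: "isCont (deriv f) x" for x
      using smooth_L1_DERIV[OF smooth_L1_deriv[OF f]] DERIV_isCont by blast
    have "f b - f a = (LBINT x. deriv f x * indicator {a..b} x)"
      using integral_FTC_Icc_real[OF that smooth_L1_DERIV[OF f] cont] by simp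
    also have "\<bar>\<dots>\<bar> \<le> (LBINT x. \<bar>deriv f x * indicator {a..b} x\<bar>)" by (rule integral_abs_bound)
    also have "\<dots> \<le> (LBINT x. \<bar>deriv f x\<bar>)"
    proof (rule integral_mono)
      show "integrable lborel (\<lambda>x. \<bar>deriv f x * indicator {a..b} x\<bar>)"
        using int by (intro integrable_abs integrable_real_mult_indicator) auto
    qed (use int in \<open>auto simp: indicator_def\<close>)
    finally show ?thesis .
  qed
  show ?thesis
  proof (cases "0 \<le> x")
    case True
    then show ?thesis using main[of 0 x] by linarith
  next
    case False
    then show ?thesis using main[of x 0] by linarith
  qed
qed

text \<open>The characteristic function of the standard normal law, in the normalization used for
  inversion.\<close>

lemma fourier_gaussian:
  "(LBINT t. std_normal_density t *\<^sub>R exp (\<i> * of_real (u * t))) = of_real (exp (- u\<^sup>2 / 2))"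
proof -
  have "char std_normal_distribution u = (LBINT t. std_normal_density t *\<^sub>R exp (\<i> * of_real (u * t)))"
    unfolding char_def by (subst integral_density) auto
  then show ?thesis by (simp add: char_std_normal_distribution)
qed

text \<open>Inserting a wide Gaussian into the inversion integral turns it, by Fubini, into an average of
  \<open>f\<close> against a narrow Gaussian.\<close>

lemma fourier_inversion:
  assumes f: "smooth_L1 f"
  shows "of_real (f x) = 1 / (2 * of_real pi) * (LBINT t. fourier f t * exp (\<i> * of_real (t * x)))"
proof -
  let ?d = std_normal_density
  have intf: "integrable lborel f" by (rule smooth_L1_integrable[OF f])
  have [measurable]: "f \<in> borel_measurable borel" using borel_measurable_integrable[OF intf] by simp
  have [measurable]: "fourier f \<in> borel_measurable borel" by (rule fourier_measurable[OF intf])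
  have d_le: "?d t \<le> ?d 0" for t
    by (auto simp: normal_density_def intro!: divide_right_mono)
  have d_cont: "isCont ?d t" for t
    unfolding normal_density_def by (intro continuous_intros) auto
  \<comment> \<open>The inversion integral with a Gaussian cutoff of width \<open>Suc n\<close>. Its
    limit is computed twice, in the frequency variable and, after Fubini, in the space
    variable.\<close>
  define A where "A n = (LBINT t. ?d (t / real (Suc n)) *\<^sub>R (fourier f t * exp (\<i> * of_real (t * x))))" for n
  have lim1: "A \<longlonglongrightarrow> (LBINT t. ?d 0 *\<^sub>R (fourier f t * exp (\<i> * of_real (t * x))))"
    unfolding A_def
  proof (rule integral_dominated_convergence)
    show "integrable lborel (\<lambda>t. ?d 0 * norm (fourier f t))"
      using integrable_fourier[OF f] by simp
    show "AE t in lborel. (\<lambda>n. ?d (t / real (Suc n)) *\<^sub>R (fourier f t * exp (\<i> * of_real (t * x))))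
        \<longlonglongrightarrow> ?d 0 *\<^sub>R (fourier f t * exp (\<i> * of_real (t * x)))"
    proof (intro AE_I2 tendsto_intros)
      fix t :: real
      have "(\<lambda>n. t / real (Suc n)) \<longlonglongrightarrow> 0" by real_asymp
      then show "(\<lambda>n. ?d (t / real (Suc n))) \<longlonglongrightarrow> ?d 0"
        by (rule isCont_tendsto_compose[OF d_cont])
    qed
    show "AE t in lborel. norm (?d (t / real (Suc n)) *\<^sub>R (fourier f t * exp (\<i> * of_real (t * x))))
        \<le> ?d 0 * norm (fourier f t)" for n
    proof (intro AE_I2)
      fix t :: real
      have "norm (?d (t / real (Suc n)) *\<^sub>R (fourier f t * exp (\<i> * of_real (t * x))))
          = ?d (t / real (Suc n)) * norm (fourier f t)"
        by (simp add: norm_mult del: of_real_mult)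
      also have "\<dots> \<le> ?d 0 * norm (fourier f t)" by (intro mult_right_mono d_le) simp
      finally show "norm (?d (t / real (Suc n)) *\<^sub>R (fourier f t * exp (\<i> * of_real (t * x))))
          \<le> ?d 0 * norm (fourier f t)" .
    qed
  qed measurable
  have A_eq: "A n = (LBINT z. (f (x + z / real (Suc n)) * exp (- z\<^sup>2 / 2)) *\<^sub>R 1)" for n
  proof -
    define N where "N = real (Suc n)"
    have N: "N > 0" by (simp add: N_def)
    have intd: "integrable lborel (\<lambda>t. ?d (t / N))"
      using lborel_integrable_real_affine[of ?d "1 / N" 0] N integrable_normal_moment_nz_1 by (simp add: integrable_normal_density)
    have pair: "integrable (lborel \<Otimes>\<^sub>M lborel)
        (\<lambda>(t, y). (?d (t / N) * f y) *\<^sub>R exp (\<i> * of_real (t * (x - y))))"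
    proof (rule lborel_pair.Fubini_integrable)
      show "integrable lborel (\<lambda>t. LBINT y. norm (case (t, y) of (t, y) \<Rightarrow> (?d (t / N) * f y) *\<^sub>R exp (\<i> * of_real (t * (x - y)))))"
        using intd by (simp add: abs_mult del: of_real_mult of_real_diff)
      show "AE t in lborel. integrable lborel (\<lambda>y. case (t, y) of (t, y) \<Rightarrow> (?d (t / N) * f y) *\<^sub>R exp (\<i> * of_real (t * (x - y))))"
      proof (intro AE_I2)
        fix t
        have "integrable lborel (\<lambda>y. ?d (t / N) * f y)" using intf by simp
        then show "integrable lborel (\<lambda>y. case (t, y) of (t, y) \<Rightarrow> (?d (t / N) * f y) *\<^sub>R exp (\<i> * of_real (t * (x - y))))"
          by (rule Bochner_Integration.integrable_bound) (auto simp del: of_real_mult of_real_diff)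
      qed
    qed measurable
    have "A n = (LBINT t. LBINT y. (?d (t / N) * f y) *\<^sub>R exp (\<i> * of_real (t * (x - y))))"
      unfolding A_def
    proof (rule Bochner_Integration.integral_cong[OF refl])
      fix t :: real
      have "?d (t / real (Suc n)) *\<^sub>R (fourier f t * exp (\<i> * of_real (t * x)))
          = ?d (t / N) *\<^sub>R (LBINT y. (f y *\<^sub>R exp (- \<i> * of_real (t * y))) * exp (\<i> * of_real (t * x)))"
        unfolding fourier_eq N_def integral_mult_left_zero by (rule refl)
      also have "\<dots> = (LBINT y. ?d (t / N) *\<^sub>R ((f y *\<^sub>R exp (- \<i> * of_real (t * y))) * exp (\<i> * of_real (t * x))))"
        by (rule integral_scaleR_right[symmetric])
      also have "\<dots> = (LBINT y. (?d (t / N) * f y) *\<^sub>R exp (\<i> * of_real (t * (x - y))))"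
        by (rule Bochner_Integration.integral_cong[OF refl])
          (simp add: exp_add[symmetric] algebra_simps)
      finally show "?d (t / real (Suc n)) *\<^sub>R (fourier f t * exp (\<i> * of_real (t * x)))
          = (LBINT y. (?d (t / N) * f y) *\<^sub>R exp (\<i> * of_real (t * (x - y))))" .
    qed
    also have "\<dots> = (LBINT y. LBINT t. (?d (t / N) * f y) *\<^sub>R exp (\<i> * of_real (t * (x - y))))"
      using lborel_pair.Fubini_integral[OF pair] by simp
    \<comment> \<open>Rescaling the frequency by \<open>N\<close> makes the inner integral the
      transform of a Gaussian, hence a Gaussian in \<open>y\<close> of width \<open>1 / N\<close>
      centred at \<open>x\<close>. The substitution \<open>y = x + z / N\<close> below then moves
      the dependence on \<open>N\<close> into the argument of \<open>f\<close>.\<close>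
    also have "\<dots> = (LBINT y. (f y * (N * exp (- (N * (x - y))\<^sup>2 / 2))) *\<^sub>R 1)"
    proof (rule Bochner_Integration.integral_cong[OF refl])
      fix y
      have "(LBINT t. (?d (t / N) * f y) *\<^sub>R exp (\<i> * of_real (t * (x - y))))
          = N *\<^sub>R (LBINT s. (?d (N * s / N) * f y) *\<^sub>R exp (\<i> * of_real (N * s * (x - y))))"
        using lborel_integral_real_affine[of N "\<lambda>t. (?d (t / N) * f y) *\<^sub>R exp (\<i> * of_real (t * (x - y)))" 0] N
        by simp
      also have "\<dots> = N *\<^sub>R (LBINT s. f y *\<^sub>R (?d s *\<^sub>R exp (\<i> * of_real (N * (x - y) * s))))"
        using N by (intro arg_cong[where f = "\<lambda>z. N *\<^sub>R z"] Bochner_Integration.integral_cong[OF refl]) (simp add: mult_ac)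
      also have "\<dots> = N *\<^sub>R (f y *\<^sub>R (LBINT s. ?d s *\<^sub>R exp (\<i> * of_real (N * (x - y) * s))))"
        unfolding integral_scaleR_right by (rule refl)
      also have "\<dots> = (f y * (N * exp (- (N * (x - y))\<^sup>2 / 2))) *\<^sub>R 1"
        unfolding fourier_gaussian by (simp add: scaleR_conv_of_real mult_ac)
      finally show "(LBINT t. (?d (t / N) * f y) *\<^sub>R exp (\<i> * of_real (t * (x - y))))
          = (f y * (N * exp (- (N * (x - y))\<^sup>2 / 2))) *\<^sub>R 1" .
    qed
    also have "\<dots> = (1 / N) *\<^sub>R (LBINT z. (f (x + z / N) * (N * exp (- (N * (x - (x + z / N)))\<^sup>2 / 2))) *\<^sub>R 1)"
      using lborel_integral_real_affine[of "1 / N" "\<lambda>y. (f y * (N * exp (- (N * (x - y))\<^sup>2 / 2))) *\<^sub>R (1 :: complex)" x] N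
      by simp
    also have "\<dots> = (LBINT z. (1 / N) *\<^sub>R ((f (x + z / N) * (N * exp (- (N * (x - (x + z / N)))\<^sup>2 / 2))) *\<^sub>R 1))"
      by (rule integral_scaleR_right[symmetric]) 
    also have "\<dots> = (LBINT z. (f (x + z / N) * exp (- z\<^sup>2 / 2)) *\<^sub>R 1)"
      using N by (intro Bochner_Integration.integral_cong[OF refl]) (simp add: field_simps)
    finally show ?thesis by (simp add: N_def)
  qed
  have lim2: "A \<longlonglongrightarrow> (LBINT z. (f x * exp (- z\<^sup>2 / 2)) *\<^sub>R 1)"
    unfolding A_eq
  proof (rule integral_dominated_convergence)
    define B where "B = \<bar>f 0\<bar> + (LBINT x. \<bar>deriv f x\<bar>)"
    have exp_d: "exp (- z\<^sup>2 / 2) = sqrt (2 * pi) * ?d z" for z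
      by (simp add: std_normal_density_def)
    show "integrable lborel (\<lambda>z. B * exp (- z\<^sup>2 / 2))"
      unfolding exp_d by (simp add: integrable_normal_density)
    show "AE z in lborel. (\<lambda>n. (f (x + z / real (Suc n)) * exp (- z\<^sup>2 / 2)) *\<^sub>R (1 :: complex))
        \<longlonglongrightarrow> (f x * exp (- z\<^sup>2 / 2)) *\<^sub>R 1"
    proof (intro AE_I2 tendsto_intros)
      fix z :: real
      have "(\<lambda>n. x + z / real (Suc n)) \<longlonglongrightarrow> x" by real_asymp
      moreover have "isCont f x" using smooth_L1_DERIV[OF f] DERIV_isCont by blast
      ultimately show "(\<lambda>n. f (x + z / real (Suc n))) \<longlonglongrightarrow> f x" by (rule isCont_tendsto_compose[rotated])
    qed
    show "AE z in lborel. norm ((f (x + z / real (Suc n)) * exp (- z\<^sup>2 / 2)) *\<^sub>R (1 :: complex)) \<le> B * exp (- z\<^sup>2 / 2)" for n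
      using smooth_L1_bounded[OF f] by (intro AE_I2) (simp add: abs_mult B_def)
  qed measurable
  have "(LBINT z. (f x * exp (- z\<^sup>2 / 2)) *\<^sub>R (1 :: complex)) = of_real (f x * sqrt (2 * pi))"
  proof -
    have "(\<lambda>z. (f x * exp (- z\<^sup>2 / 2)) *\<^sub>R (1 :: complex)) = (\<lambda>z. of_real (f x * sqrt (2 * pi) * ?d z))"
      by (simp add: fun_eq_iff std_normal_density_def scaleR_conv_of_real)
    moreover have "(LBINT z. ?d z) = 1" by (rule integral_normal_density) simp
    ultimately show ?thesis by (simp del: of_real_mult add: integral_complex_of_real)
  qed
  then have "of_real (f x * sqrt (2 * pi)) = ?d 0 *\<^sub>R (LBINT t. fourier f t * exp (\<i> * of_real (t * x)))"
    using LIMSEQ_unique[OF lim1 lim2] by simp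
  then have "of_real (sqrt (2 * pi) * (f x * sqrt (2 * pi)))
      = of_real (sqrt (2 * pi) * ?d 0) * (LBINT t. fourier f t * exp (\<i> * of_real (t * x)))"
    by (simp add: scaleR_conv_of_real)
  moreover have "sqrt (2 * pi) * (f x * sqrt (2 * pi)) = 2 * pi * f x"
    by (simp add: mult_ac)
  moreover have "sqrt (2 * pi) * ?d 0 = 1" by (simp add: std_normal_density_def)
  ultimately have "2 * of_real pi * of_real (f x) = (LBINT t. fourier f t * exp (\<i> * of_real (t * x)))"
    by simp
  then show ?thesis by (simp add: field_simps)
qed

section \<open>Reindexing, reflecting and factorizing product integrals\<close>

section \<open>Finite product measures\<close>

text \<open>Verified on boxes. Reindexing is combined with coordinatewise measure-preserving maps,
  and sigma-finiteness suffices, so Lebesgue measure and probability laws are covered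
  together.\<close>

lemma distr_PiM_bij:
  fixes N :: "'a measure"
  assumes sf: "sigma_finite_measure N" and fin: "finite I" and bij: "bij_betw \<pi> I J"
    and T: "\<And>i. i \<in> I \<Longrightarrow> T i \<in> measurable N N" "\<And>i. i \<in> I \<Longrightarrow> distr N N (T i) = N"
  shows "distr (PiM J (\<lambda>_. N)) (PiM I (\<lambda>_. N)) (\<lambda>x. \<lambda>i\<in>I. T i (x (\<pi> i))) = PiM I (\<lambda>_. N)"
proof -
  interpret product_sigma_finite "\<lambda>_. N" by (simp add: product_sigma_finite_def sf)
  have finJ: "finite J" using bij fin by (simp add: bij_betw_finite)
  have piJ: "\<pi> i \<in> J" if "i \<in> I" for i using bij that by (auto simp: bij_betw_def)
  define \<rho> where "\<rho> = the_inv_into I \<pi>"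
  have rho: "\<rho> (\<pi> i) = i" if "i \<in> I" for i
    using bij that by (simp add: \<rho>_def bij_betw_def the_inv_into_f_f)
  have meas: "(\<lambda>x. \<lambda>i\<in>I. T i (x (\<pi> i))) \<in> measurable (PiM J (\<lambda>_. N)) (PiM I (\<lambda>_. N))"
    by (intro measurable_restrict measurable_compose[OF measurable_component_singleton[OF piJ] T(1)])
  show ?thesis
  proof (rule PiM_eqI[OF fin])
    fix A assume A: "\<And>i. i \<in> I \<Longrightarrow> A i \<in> sets N"
    define B where "B j = T (\<rho> j) -` A (\<rho> j) \<inter> space N" for j
    have B: "B (\<pi> i) = T i -` A i \<inter> space N" if "i \<in> I" for i using rho that by (simp add: B_def)
    have Bs: "B (\<pi> i) \<in> sets N" if "i \<in> I" for i
      unfolding B[OF that] by (rule measurable_sets[OF T(1)[OF that] A[OF that]])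
    have J: "J = \<pi> ` I" using bij by (simp add: bij_betw_def)
    have "(\<lambda>x. \<lambda>i\<in>I. T i (x (\<pi> i))) -` Pi\<^sub>E I A \<inter> space (PiM J (\<lambda>_. N)) = Pi\<^sub>E J B"
    proof (intro set_eqI iffI)
      fix x assume x: "x \<in> (\<lambda>x. \<lambda>i\<in>I. T i (x (\<pi> i))) -` Pi\<^sub>E I A \<inter> space (PiM J (\<lambda>_. N))"
      then have sp: "x \<in> (\<Pi>\<^sub>E j\<in>J. space N)" and T: "\<And>i. i \<in> I \<Longrightarrow> T i (x (\<pi> i)) \<in> A i"
        by (auto simp: space_PiM PiE_iff)
      show "x \<in> Pi\<^sub>E J B"
      proof (rule PiE_I)
        fix j assume "j \<in> J"
        then obtain i where i: "i \<in> I" "j = \<pi> i" using J by blast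
        then show "x j \<in> B j" using T[OF i(1)] B[OF i(1)] sp \<open>j \<in> J\<close> by (auto simp: PiE_iff)
      qed (use sp in \<open>auto simp: PiE_iff extensional_def\<close>)
    next
      fix x assume x: "x \<in> Pi\<^sub>E J B"
      have xB: "x (\<pi> i) \<in> T i -` A i \<inter> space N" if "i \<in> I" for i
        using PiE_mem[OF x piJ[OF that]] B[OF that] by simp
      have "x j \<in> space N" if "j \<in> J" for j using xB that J by blast
      then have "x \<in> space (PiM J (\<lambda>_. N))" using x by (auto simp: space_PiM PiE_iff)
      then show "x \<in> (\<lambda>x. \<lambda>i\<in>I. T i (x (\<pi> i))) -` Pi\<^sub>E I A \<inter> space (PiM J (\<lambda>_. N))"
        using xB by (auto simp: PiE_iff)
    qed
    then have "emeasure (distr (PiM J (\<lambda>_. N)) (PiM I (\<lambda>_. N)) (\<lambda>x. \<lambda>i\<in>I. T i (x (\<pi> i)))) (Pi\<^sub>E I A)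
        = emeasure (PiM J (\<lambda>_. N)) (Pi\<^sub>E J B)"
      by (subst emeasure_distr[OF meas]) (use A fin in \<open>auto intro!: sets_PiM_I_finite\<close>)
    also have "\<dots> = (\<Prod>j\<in>J. emeasure N (B j))"
      by (rule emeasure_PiM[OF finJ]) (use Bs J in auto)
    also have "\<dots> = (\<Prod>i\<in>I. emeasure N (B (\<pi> i)))"
      by (rule prod.reindex_bij_betw[OF bij, symmetric])
    also have "\<dots> = (\<Prod>i\<in>I. emeasure N (A i))"
    proof (rule prod.cong[OF refl])
      fix i assume i: "i \<in> I"
      have "emeasure N (A i) = emeasure (distr N N (T i)) (A i)" using T(2)[OF i] by simp
      then show "emeasure N (B (\<pi> i)) = emeasure N (A i)"
        by (simp add: emeasure_distr[OF T(1)[OF i] A[OF i]] B[OF i])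
    qed
    finally show "emeasure (distr (PiM J (\<lambda>_. N)) (PiM I (\<lambda>_. N)) (\<lambda>x. \<lambda>i\<in>I. T i (x (\<pi> i)))) (Pi\<^sub>E I A)
        = (\<Prod>i\<in>I. emeasure N (A i))" .
  qed simp
qed

lemma integral_PiM_bij:
  fixes g :: "_ \<Rightarrow> 'b :: {banach, second_countable_topology}"
  assumes sf: "sigma_finite_measure N" and fin: "finite I" and bij: "bij_betw \<pi> I J"
    and T: "\<And>i. i \<in> I \<Longrightarrow> T i \<in> measurable N N" "\<And>i. i \<in> I \<Longrightarrow> distr N N (T i) = N"
    and g: "g \<in> borel_measurable (PiM I (\<lambda>_. N))"
  shows "(\<integral>x. g (\<lambda>i\<in>I. T i (x (\<pi> i))) \<partial>PiM J (\<lambda>_. N)) = (\<integral>x. g x \<partial>PiM I (\<lambda>_. N))"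
proof -
  have piJ: "\<pi> i \<in> J" if "i \<in> I" for i using bij that by (auto simp: bij_betw_def)
  have meas: "(\<lambda>x. \<lambda>i\<in>I. T i (x (\<pi> i))) \<in> measurable (PiM J (\<lambda>_. N)) (PiM I (\<lambda>_. N))"
    by (intro measurable_restrict measurable_compose[OF measurable_component_singleton[OF piJ] T(1)])
  have "(\<integral>x. g x \<partial>PiM I (\<lambda>_. N)) = (\<integral>x. g x \<partial>distr (PiM J (\<lambda>_. N)) (PiM I (\<lambda>_. N)) (\<lambda>x. \<lambda>i\<in>I. T i (x (\<pi> i))))"
    by (simp only: distr_PiM_bij[OF sf fin bij T])
  also have "\<dots> = (\<integral>x. g (\<lambda>i\<in>I. T i (x (\<pi> i))) \<partial>PiM J (\<lambda>_. N))"
    by (rule integral_distr[OF meas g])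
  finally show ?thesis by simp
qed

definition flip :: "'i set \<Rightarrow> ('i \<Rightarrow> real) \<Rightarrow> 'i \<Rightarrow> real" where
  "flip S x = (\<lambda>i. if i \<in> S then - x i else x i)"

text \<open>Used with Lebesgue measure to flip frequencies, and with the symmetric law of the
  entries of X to flip vertex variables.\<close>

lemma integral_PiM_flip:
  fixes g :: "_ \<Rightarrow> 'b :: {banach, second_countable_topology}" and N :: "real measure"
  assumes sf: "sigma_finite_measure N" and fin: "finite I" and S: "S \<subseteq> I"
    and N: "sets N = sets borel" "distr N borel uminus = N"
    and g: "g \<in> borel_measurable (PiM I (\<lambda>_. N))"
  shows "(\<integral>x. g (flip S x) \<partial>PiM I (\<lambda>_. N)) = (\<integral>x. g x \<partial>PiM I (\<lambda>_. N))"
proof -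
  have d: "distr N N uminus = N" using N by (metis distr_cong)
  have m: "uminus \<in> measurable N N" using N(1) by (simp cong: measurable_cong_sets)
  have "(\<integral>x. g (flip S x) \<partial>PiM I (\<lambda>_. N))
      = (\<integral>x. g (\<lambda>i\<in>I. (if i \<in> S then uminus else (\<lambda>y. y)) (x (id i))) \<partial>PiM I (\<lambda>_. N))"
  proof (rule Bochner_Integration.integral_cong[OF refl])
    fix x assume "x \<in> space (PiM I (\<lambda>_. N))"
    then have "x i = undefined" if "i \<notin> I" for i using that by (auto simp: space_PiM PiE_iff extensional_def)
    then have "flip S x = (\<lambda>i\<in>I. (if i \<in> S then uminus else (\<lambda>y. y)) (x (id i)))"
      using S by (auto simp: flip_def fun_eq_iff)
    then show "g (flip S x) = g (\<lambda>i\<in>I. (if i \<in> S then uminus else (\<lambda>y. y)) (x (id i)))" by simp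
  qed
  also have "\<dots> = (\<integral>x. g x \<partial>PiM I (\<lambda>_. N))"
    by (rule integral_PiM_bij[OF sf fin bij_betw_id _ _ g]) (use m d in \<open>auto simp: distr_id2\<close>)
  finally show ?thesis .
qed

lemma integral_PiM_Un:
  fixes g h :: "('i \<Rightarrow> 'a) \<Rightarrow> complex"
  assumes M: "product_sigma_finite M" and fin: "finite I" "finite J" and dis: "I \<inter> J = {}"
    and g: "integrable (PiM I M) g" and h: "integrable (PiM J M) h"
  shows "integrable (PiM (I \<union> J) M) (\<lambda>x. g (restrict x I) * h (restrict x J))"
    and "(\<integral>x. g (restrict x I) * h (restrict x J) \<partial>PiM (I \<union> J) M)
      = (\<integral>x. g x \<partial>PiM I M) * (\<integral>x. h x \<partial>PiM J M)"
proof -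
  interpret product_sigma_finite M by (rule M)
  interpret I: finite_product_sigma_finite M I by standard fact
  interpret J: finite_product_sigma_finite M J by standard fact
  interpret P: pair_sigma_finite "PiM I M" "PiM J M" ..
  note [measurable] = borel_measurable_integrable[OF g] borel_measurable_integrable[OF h]
  have [measurable]: "(\<lambda>x. restrict x I) \<in> measurable (PiM (I \<union> J) M) (PiM I M)"
    "(\<lambda>x. restrict x J) \<in> measurable (PiM (I \<union> J) M) (PiM J M)"
    by (auto intro!: measurable_restrict_subset)
  have m: "(\<lambda>x. g (restrict x I) * h (restrict x J)) \<in> borel_measurable (PiM (I \<union> J) M)"
    by measurable
  have eq: "g (restrict (merge I J z) I) * h (restrict (merge I J z) J) = g (fst z) * h (snd z)"
    if "z \<in> space (PiM I M \<Otimes>\<^sub>M PiM J M)" for z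
  proof -
    have "restrict (merge I J z) I = fst z" "restrict (merge I J z) J = snd z"
      using that dis by (auto simp: space_pair_measure space_PiM PiE_iff merge_def fun_eq_iff extensional_def split: prod.splits)
    then show ?thesis by simp
  qed
  have int: "integrable (PiM I M \<Otimes>\<^sub>M PiM J M) (\<lambda>z. g (fst z) * h (snd z))"
  proof (rule P.Fubini_integrable)
    show "integrable (PiM I M) (\<lambda>x. \<integral>y. norm (g (fst (x, y)) * h (snd (x, y))) \<partial>PiM J M)"
      using g by (simp add: norm_mult)
    show "AE x in PiM I M. integrable (PiM J M) (\<lambda>y. g (fst (x, y)) * h (snd (x, y)))"
      using h by simp
  qed measurable
  have mm: "merge I J \<in> measurable (PiM I M \<Otimes>\<^sub>M PiM J M) (PiM (I \<union> J) M)" by measurable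
  have "integrable (PiM I M \<Otimes>\<^sub>M PiM J M) (\<lambda>z. g (restrict (merge I J z) I) * h (restrict (merge I J z) J))"
    using int by (subst Bochner_Integration.integrable_cong[OF refl eq]) auto
  then have "integrable (distr (PiM I M \<Otimes>\<^sub>M PiM J M) (PiM (I \<union> J) M) (merge I J)) (\<lambda>x. g (restrict x I) * h (restrict x J))"
    by (subst integrable_distr_eq[OF mm m])
  then show "integrable (PiM (I \<union> J) M) (\<lambda>x. g (restrict x I) * h (restrict x J))"
    by (simp only: distr_merge[OF dis fin])
  have "(\<integral>x. g (restrict x I) * h (restrict x J) \<partial>PiM (I \<union> J) M)
      = (\<integral>x. g (restrict x I) * h (restrict x J) \<partial>distr (PiM I M \<Otimes>\<^sub>M PiM J M) (PiM (I \<union> J) M) (merge I J))"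
    by (simp only: distr_merge[OF dis fin])
  also have "\<dots> = (\<integral>z. g (restrict (merge I J z) I) * h (restrict (merge I J z) J) \<partial>(PiM I M \<Otimes>\<^sub>M PiM J M))"
    by (rule integral_distr[OF mm m])
  also have "\<dots> = (\<integral>z. g (fst z) * h (snd z) \<partial>(PiM I M \<Otimes>\<^sub>M PiM J M))"
    by (rule Bochner_Integration.integral_cong[OF refl eq])
  also have "\<dots> = (\<integral>x. (\<integral>y. g x * h y \<partial>PiM J M) \<partial>PiM I M)"
    using P.integral_fst'[OF int] by simp
  also have "\<dots> = (\<integral>x. g x \<partial>PiM I M) * (\<integral>x. h x \<partial>PiM J M)"
    by simp
  finally show "(\<integral>x. g (restrict x I) * h (restrict x J) \<partial>PiM (I \<union> J) M)
      = (\<integral>x. g x \<partial>PiM I M) * (\<integral>x. h x \<partial>PiM J M)" .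
qed

text \<open>Serves twice: for the summation index of the matrix product, and for the blocks of the
  graph.\<close>

lemma integral_PiM_UN:
  fixes g :: "'s \<Rightarrow> ('i \<Rightarrow> 'a) \<Rightarrow> complex"
  assumes M: "product_sigma_finite M" and S: "finite S" and fin: "\<And>b. b \<in> S \<Longrightarrow> finite (I b)"
    and dis: "\<And>b c. b \<in> S \<Longrightarrow> c \<in> S \<Longrightarrow> b \<noteq> c \<Longrightarrow> I b \<inter> I c = {}"
    and g: "\<And>b. b \<in> S \<Longrightarrow> integrable (PiM (I b) M) (g b)"
  shows "integrable (PiM (\<Union>b\<in>S. I b) M) (\<lambda>x. \<Prod>b\<in>S. g b (restrict x (I b))) \<and>
    (\<integral>x. (\<Prod>b\<in>S. g b (restrict x (I b))) \<partial>PiM (\<Union>b\<in>S. I b) M) = (\<Prod>b\<in>S. \<integral>x. g b x \<partial>PiM (I b) M)"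
  using S fin dis g
proof (induction S)
  case empty
  interpret P: prob_space "PiM {} M" by (rule prob_spaceI) (simp add: space_PiM)
  show ?case by (simp add: P.prob_space)
next
  case (insert b S)
  define U where "U = (\<Union>c\<in>S. I c)"
  have IH: "integrable (PiM U M) (\<lambda>x. \<Prod>c\<in>S. g c (restrict x (I c)))"
    "(\<integral>x. (\<Prod>c\<in>S. g c (restrict x (I c))) \<partial>PiM U M) = (\<Prod>c\<in>S. \<integral>x. g c x \<partial>PiM (I c) M)"
    using insert.IH insert.prems unfolding U_def by blast+
  have disU: "I b \<inter> U = {}" using insert.prems(2)[of b] insert.hyps by (auto simp: U_def)
  have finU: "finite U" "finite (I b)" using insert.hyps insert.prems(1) by (auto simp: U_def)
  have eq: "(\<lambda>x. \<Prod>c\<in>insert b S. g c (restrict x (I c)))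
      = (\<lambda>x. g b (restrict x (I b)) * (\<Prod>c\<in>S. g c (restrict (restrict x U) (I c))))"
  proof
    fix x
    have "(\<Prod>c\<in>S. g c (restrict (restrict x U) (I c))) = (\<Prod>c\<in>S. g c (restrict x (I c)))"
    proof (rule prod.cong[OF refl])
      fix c assume "c \<in> S"
      then have "U \<inter> I c = I c" by (auto simp: U_def)
      then show "g c (restrict (restrict x U) (I c)) = g c (restrict x (I c))" by simp
    qed
    then show "(\<Prod>c\<in>insert b S. g c (restrict x (I c)))
      = g b (restrict x (I b)) * (\<Prod>c\<in>S. g c (restrict (restrict x U) (I c)))"
      using insert.hyps by simp
  qed
  have U: "(\<Union>c\<in>insert b S. I c) = I b \<union> U" by (simp add: U_def)
  note UN = integral_PiM_Un[OF M finU(2,1) disU insert.prems(3)[of b, simplified] IH(1)]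
  show ?case
    unfolding eq U using UN IH(2) insert.hyps by simp
qed

section \<open>Fourier representation of the expectation\<close>

section \<open>The expectation as an oscillatory integral\<close>

text \<open>One index per copy of an edge: every factor \<open>f\<close> in the trace receives its
  own frequency.\<close>

definition eidx :: "('w, 'v) bigraph \<Rightarrow> ('w \<times> 'v \<times> nat) set" where
  "eidx G = {(w, v, i). (w, v) \<in> edges G \<and> i \<in> {1..mult G w v}}"

text \<open>The coefficient in the phase of an entry of W in the row assigned to \<open>w\<close>,
  when the matching entries of X are given by \<open>x\<close>. It is the argument at which the
  characteristic function of that entry is evaluated.\<close>

definition lin :: "('w, 'v) bigraph \<Rightarrow> ('w \<times> 'v \<times> nat \<Rightarrow> real) \<Rightarrow> 'w \<Rightarrow> ('v \<Rightarrow> real) \<Rightarrow> real" where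
  "lin G \<gamma> w x = (\<Sum>v | (w, v) \<in> edges G. (\<Sum>i=1..mult G w v. \<gamma> (w, v, i)) * x v)"

lemma finite_edges: "finite_bigraph G \<Longrightarrow> finite (edges G)"
  by (rule finite_subset[of _ "wverts G \<times> vverts G"]) (auto simp: edges_def finite_bigraph_def)

lemma bij_betw_eidx:
  "bij_betw (\<lambda>((w, v), i). (w, v, i)) (SIGMA (w, v):E. {1..mult G w v}) {(w, v, i). (w, v) \<in> E \<and> i \<in> {1..mult G w v}}"
  by (rule bij_betwI[where g = "\<lambda>(w, v, i). ((w, v), i)"]) auto

lemma prod_eidx:
  assumes "finite E"
  shows "(\<Prod>(w, v)\<in>E. \<Prod>i=1..mult G w v. F (w, v, i)) =
    (\<Prod>e\<in>{(w, v, i). (w, v) \<in> E \<and> i \<in> {1..mult G w v}}. F e)"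
proof -
  have "(\<Prod>(w, v)\<in>E. \<Prod>i=1..mult G w v. F (w, v, i))
      = (\<Prod>p\<in>E. \<Prod>i\<in>(case p of (w, v) \<Rightarrow> {1..mult G w v}). F (fst p, snd p, i))"
    by (simp add: split_beta)
  also have "\<dots> = (\<Prod>q\<in>(SIGMA p:E. case p of (w, v) \<Rightarrow> {1..mult G w v}). F (fst (fst q), snd (fst q), snd q))"
    by (subst prod.Sigma) (use assms in \<open>auto simp: split_beta\<close>)
  also have "\<dots> = (\<Prod>e\<in>{(w, v, i). (w, v) \<in> E \<and> i \<in> {1..mult G w v}}. F e)"
    using prod.reindex_bij_betw[OF bij_betw_eidx[of E G], of F] by (simp add: split_beta')
  finally show ?thesis .
qed

lemma sum_eidx:
  fixes F :: "'w \<times> 'v \<times> nat \<Rightarrow> 'b :: comm_monoid_add"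
  assumes "finite E"
  shows "(\<Sum>(w, v)\<in>E. \<Sum>i=1..mult G w v. F (w, v, i)) =
    (\<Sum>e\<in>{(w, v, i). (w, v) \<in> E \<and> i \<in> {1..mult G w v}}. F e)"
proof -
  have "(\<Sum>(w, v)\<in>E. \<Sum>i=1..mult G w v. F (w, v, i))
      = (\<Sum>p\<in>E. \<Sum>i\<in>(case p of (w, v) \<Rightarrow> {1..mult G w v}). F (fst p, snd p, i))"
    by (simp add: split_beta)
  also have "\<dots> = (\<Sum>q\<in>(SIGMA p:E. case p of (w, v) \<Rightarrow> {1..mult G w v}). F (fst (fst q), snd (fst q), snd q))"
    by (subst sum.Sigma) (use assms in \<open>auto simp: split_beta\<close>)
  also have "\<dots> = (\<Sum>e\<in>{(w, v, i). (w, v) \<in> E \<and> i \<in> {1..mult G w v}}. F e)"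
    using sum.reindex_bij_betw[OF bij_betw_eidx[of E G], of F] by (simp add: split_beta')
  finally show ?thesis .
qed

lemma finite_eidx_of:
  assumes "finite E"
  shows "finite {(w, v, i). (w, v) \<in> E \<and> i \<in> {1..mult G w v}}"
proof -
  have "finite (SIGMA (w, v):E. {1..mult G w v})" using assms by auto
  then show ?thesis using bij_betw_finite[OF bij_betw_eidx] by blast
qed

lemma finite_eidx: "finite_bigraph G \<Longrightarrow> finite (eidx G)"
  unfolding eidx_def by (rule finite_eidx_of[OF finite_edges])

lemma card_eidx_of:
  assumes "finite E"
  shows "card {(w, v, i). (w, v) \<in> E \<and> i \<in> {1..mult G w v}} = total_mult G E"
proof -
  have "total_mult G E = (\<Sum>(w, v)\<in>E. \<Sum>i=1..mult G w v. 1)" by (simp add: total_mult_def)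
  also have "\<dots> = (\<Sum>e\<in>{(w, v, i). (w, v) \<in> E \<and> i \<in> {1..mult G w v}}. 1)"
    by (rule sum_eidx[OF assms, where G = G and F = "\<lambda>_. 1"])
  finally show ?thesis by simp
qed

lemma card_eidx: "finite_bigraph G \<Longrightarrow> card (eidx G) = total_mult G (edges G)"
  unfolding eidx_def by (rule card_eidx_of[OF finite_edges])

lemma finite_nbr: "finite_bigraph G \<Longrightarrow> finite {v. (w, v) \<in> edges G}"
  by (rule finite_subset[of _ "vverts G"]) (auto simp: edges_def finite_bigraph_def)

lemma lin_restrict [simp]:
  "lin G \<gamma> w (restrict x (vverts G)) = lin G \<gamma> w x"
  "lin G (restrict \<gamma> (eidx G)) w x = lin G \<gamma> w x"
  unfolding lin_def by (auto intro!: sum.cong simp: edges_def eidx_def)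

text \<open>Regroups the bilinear phase by W-vertices, after which every entry of W occurs
  linearly.\<close>

lemma sum_eidx_lin:
  assumes fin: "finite_bigraph G"
  shows "(\<Sum>e\<in>eidx G. \<gamma> e * (a (fst e) * b (fst (snd e)))) = (\<Sum>w\<in>wverts G. a w * lin G \<gamma> w b)"
proof -
  have finW: "finite (wverts G)" and finV: "finite (vverts G)" using fin by (auto simp: finite_bigraph_def)
  have "(\<Sum>e\<in>eidx G. \<gamma> e * (a (fst e) * b (fst (snd e))))
      = (\<Sum>(w, v)\<in>edges G. \<Sum>i=1..mult G w v. \<gamma> (w, v, i) * (a w * b v))"
    unfolding eidx_def by (subst sum_eidx[OF finite_edges[OF fin], symmetric]) simp
  also have "\<dots> = (\<Sum>(w, v)\<in>(SIGMA w:wverts G. {v. (w, v) \<in> edges G}). \<Sum>i=1..mult G w v. \<gamma> (w, v, i) * (a w * b v))"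
    by (rule sum.cong) (auto simp: edges_def)
  also have "\<dots> = (\<Sum>w\<in>wverts G. \<Sum>v | (w, v) \<in> edges G. \<Sum>i=1..mult G w v. \<gamma> (w, v, i) * (a w * b v))"
    using finW finite_nbr[OF fin] by (subst sum.Sigma) auto
  also have "\<dots> = (\<Sum>w\<in>wverts G. a w * lin G \<gamma> w b)"
    unfolding lin_def sum_distrib_left sum_distrib_right
    by (intro sum.cong refl) (simp add: mult_ac)
  finally show ?thesis .
qed

lemma lin_measurable:
  assumes fin: "finite_bigraph G" and N: "sets \<nu> = sets borel"
  shows "(\<lambda>z. lin G (fst z) w (snd z)) \<in> borel_measurable (PiM (eidx G) (\<lambda>_. lborel) \<Otimes>\<^sub>M PiM (vverts G) (\<lambda>_. \<nu>))"
  unfolding lin_def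
proof (intro borel_measurable_sum borel_measurable_times)
  fix v i assume v: "v \<in> {v. (w, v) \<in> edges G}" and i: "i \<in> {1..mult G w v}"
  then have e: "(w, v, i) \<in> eidx G" by (simp add: eidx_def)
  show "(\<lambda>z. fst z (w, v, i)) \<in> borel_measurable (PiM (eidx G) (\<lambda>_. lborel) \<Otimes>\<^sub>M PiM (vverts G) (\<lambda>_. \<nu>))"
    using measurable_compose[OF measurable_fst measurable_component_singleton[OF e, of "\<lambda>_. lborel"]] by simp
next
  fix v assume v: "v \<in> {v. (w, v) \<in> edges G}"
  then have v: "v \<in> vverts G" by (simp add: edges_def)
  have "(\<lambda>z. snd z v) \<in> measurable (PiM (eidx G) (\<lambda>_. lborel) \<Otimes>\<^sub>M PiM (vverts G) (\<lambda>_. \<nu>)) \<nu>"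
    using measurable_compose[OF measurable_snd measurable_component_singleton[OF v, of "\<lambda>_. \<nu>"]] .
  then show "(\<lambda>z. snd z v) \<in> borel_measurable (PiM (eidx G) (\<lambda>_. lborel) \<Otimes>\<^sub>M PiM (vverts G) (\<lambda>_. \<nu>))"
    using N by (simp cong: measurable_cong_sets)
qed

lemma lin_measurable_snd:
  assumes fin: "finite_bigraph G" and N: "sets \<nu> = sets borel"
  shows "lin G \<gamma> w \<in> borel_measurable (PiM (vverts G) (\<lambda>_. \<nu>))"
  unfolding lin_def
proof (intro borel_measurable_sum borel_measurable_times)
  fix v assume "v \<in> {v. (w, v) \<in> edges G}"
  then have v: "v \<in> vverts G" by (simp add: edges_def)
  have "(\<lambda>x. x v) \<in> measurable (PiM (vverts G) (\<lambda>_. \<nu>)) \<nu>"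
    by (rule measurable_component_singleton[OF v])
  then show "(\<lambda>x. x v) \<in> borel_measurable (PiM (vverts G) (\<lambda>_. \<nu>))"
    using N by (simp cong: measurable_cong_sets)
qed auto

lemma measurable_PiM_borel:
  assumes "\<And>i. i \<in> I \<Longrightarrow> sets (L i) = sets borel"
  shows "measurable (PiM I L) N = measurable (PiM I (\<lambda>_. borel)) N"
  by (rule measurable_cong_sets) (auto intro!: sets_PiM_cong assms)

text \<open>The entries of W are integrated first, with those of X held fixed; the inner integral is
  then a product of characteristic functions.\<close>

lemma integral_exp_bilinear:
  fixes t :: "'a \<Rightarrow> ('b \<Rightarrow> real) \<Rightarrow> real"
  assumes A: "finite A" and B: "finite B" and nu: "real_distribution \<nu>" "real_distribution \<nu>x"
    and t: "\<And>w. w \<in> A \<Longrightarrow> t w \<in> borel_measurable (PiM B (\<lambda>_. borel))"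
  shows "(\<integral>z. (\<Prod>w\<in>A. exp (\<i> * of_real (z (Inl w) * t w (\<lambda>v\<in>B. z (Inr v))))) \<partial>PiM (A <+> B) (case_sum (\<lambda>_. \<nu>) (\<lambda>_. \<nu>x)))
    = (\<integral>x. (\<Prod>w\<in>A. char \<nu> (t w x)) \<partial>PiM B (\<lambda>_. \<nu>x))"
proof -
  interpret nu: real_distribution \<nu> by (rule nu)
  interpret nux: real_distribution \<nu>x by (rule nu)
  let ?L = "case_sum (\<lambda>_. \<nu>) (\<lambda>_. \<nu>x) :: 'a + 'b \<Rightarrow> real measure"
  have prob: "prob_space (?L i)" for i
    by (cases i) (auto simp: nu.prob_space_axioms nux.prob_space_axioms)
  interpret P: product_sigma_finite ?L
    by (simp add: product_sigma_finite_def prob prob_space_imp_sigma_finite)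
  have sL: "sets (?L i) = sets borel" for i by (cases i) auto
  let ?F = "\<lambda>z. \<Prod>w\<in>A. exp (\<i> * complex_of_real (z (Inl w) * t w (\<lambda>v\<in>B. z (Inr v))))"
  have Fm: "?F \<in> borel_measurable (PiM (A <+> B) ?L)"
    unfolding measurable_PiM_borel[of "A <+> B" ?L, OF sL]
  proof (intro borel_measurable_prod)
    fix w assume w: "w \<in> A"
    have "(\<lambda>z. \<lambda>v\<in>B. z (Inr v)) \<in> measurable (PiM (A <+> B) (\<lambda>_. borel :: real measure)) (PiM B (\<lambda>_. borel))"
      by (intro measurable_restrict measurable_component_singleton) auto
    from measurable_compose[OF this t[OF w]]
    have [measurable]: "(\<lambda>z. t w (\<lambda>v\<in>B. z (Inr v))) \<in> borel_measurable (PiM (A <+> B) (\<lambda>_. borel))" .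
    have [measurable]: "(\<lambda>z. z (Inl w)) \<in> borel_measurable (PiM (A <+> B) (\<lambda>_. borel))"
      using w by (intro measurable_component_singleton) auto
    show "(\<lambda>z. exp (\<i> * complex_of_real (z (Inl w) * t w (\<lambda>v\<in>B. z (Inr v))))) \<in> borel_measurable (PiM (A <+> B) (\<lambda>_. borel))"
      by measurable
  qed
  have probPi: "prob_space (PiM I ?L)" for I by (rule prob_space_PiM) (rule prob)
  have Fint: "integrable (PiM (A <+> B) ?L) ?F"
    by (rule finite_measure.integrable_const_bound[where B = 1])
      (use Fm probPi in \<open>auto simp: prob_space.finite_measure norm_mult prod_norm[symmetric] simp del: of_real_mult\<close>)
  have AB: "A <+> B = Inr ` B \<union> Inl ` A" by (auto simp: Plus_def)
  have "(\<integral>z. ?F z \<partial>PiM (A <+> B) ?L)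
      = (\<integral>x. (\<integral>y. ?F (merge (Inr ` B) (Inl ` A) (x, y)) \<partial>PiM (Inl ` A) ?L) \<partial>PiM (Inr ` B) ?L)"
    unfolding AB by (rule P.product_integral_fold) (use Fint A B in \<open>auto simp: AB\<close>)
  also have "\<dots> = (\<integral>x. (\<Prod>w\<in>A. char \<nu> (t w (\<lambda>v\<in>B. x (Inr v)))) \<partial>PiM (Inr ` B) ?L)"
  proof (rule Bochner_Integration.integral_cong[OF refl])
    fix x :: "'a + 'b \<Rightarrow> real"
    have "?F (merge (Inr ` B) (Inl ` A) (x, y)) = (\<Prod>j\<in>Inl ` A. exp (\<i> * complex_of_real (y j * t (projl j) (\<lambda>v\<in>B. x (Inr v)))))" for y
    proof -
      have "(\<lambda>v\<in>B. merge (Inr ` B) (Inl ` A) (x, y) (Inr v)) = (\<lambda>v\<in>B. x (Inr v))"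
        by (auto simp: merge_def fun_eq_iff)
      moreover have "merge (Inr ` B) (Inl ` A) (x, y) (Inl w) = y (Inl w)" if "w \<in> A" for w
        using that by (auto simp: merge_def)
      ultimately show ?thesis by (subst prod.reindex) (auto intro!: prod.cong)
    qed
    then have "(\<integral>y. ?F (merge (Inr ` B) (Inl ` A) (x, y)) \<partial>PiM (Inl ` A) ?L)
        = (\<integral>y. (\<Prod>j\<in>Inl ` A. exp (\<i> * complex_of_real (y j * t (projl j) (\<lambda>v\<in>B. x (Inr v))))) \<partial>PiM (Inl ` A) ?L)"
      by simp
    also have "\<dots> = (\<Prod>j\<in>Inl ` A. \<integral>y. exp (\<i> * complex_of_real (y * t (projl j) (\<lambda>v\<in>B. x (Inr v)))) \<partial>?L j)"
    proof (rule P.product_integral_prod)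
      fix j :: "'a + 'b" assume "j \<in> Inl ` A"
      show "integrable (?L j) (\<lambda>y. exp (\<i> * complex_of_real (y * t (projl j) (\<lambda>v\<in>B. x (Inr v)))))"
      proof (rule finite_measure.integrable_const_bound[where B = 1])
        show "(\<lambda>y. exp (\<i> * complex_of_real (y * t (projl j) (\<lambda>v\<in>B. x (Inr v))))) \<in> borel_measurable (?L j)"
          unfolding measurable_cong_sets[OF sL refl] by measurable
      qed (use prob[of j] in \<open>auto simp: prob_space.finite_measure simp del: of_real_mult\<close>)
    qed (use A in simp)
    also have "\<dots> = (\<Prod>w\<in>A. char \<nu> (t w (\<lambda>v\<in>B. x (Inr v))))"
      by (subst prod.reindex) (auto simp: char_def mult.commute)
    finally show "(\<integral>y. ?F (merge (Inr ` B) (Inl ` A) (x, y)) \<partial>PiM (Inl ` A) ?L) = (\<Prod>w\<in>A. char \<nu> (t w (\<lambda>v\<in>B. x (Inr v))))" .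
  qed
  also have "\<dots> = (\<integral>x. (\<Prod>w\<in>A. char \<nu> (t w x)) \<partial>distr (PiM (Inr ` B) ?L) (PiM B (\<lambda>v. ?L (Inr v))) (\<lambda>x. \<lambda>v\<in>B. x (Inr v)))"
  proof (rule integral_distr[symmetric])
    show "(\<lambda>x. \<lambda>v\<in>B. x (Inr v)) \<in> measurable (PiM (Inr ` B) ?L) (PiM B (\<lambda>v. ?L (Inr v)))"
      by (intro measurable_restrict measurable_component_singleton) auto
    show "(\<lambda>x. \<Prod>w\<in>A. char \<nu> (t w x)) \<in> borel_measurable (PiM B (\<lambda>v. ?L (Inr v)))"
      unfolding measurable_PiM_borel[of B "\<lambda>v. ?L (Inr v)", OF sL]
      by (intro borel_measurable_prod measurable_compose[OF t nu.char_measurable]) 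
  qed
  also have "distr (PiM (Inr ` B) ?L) (PiM B (\<lambda>v. ?L (Inr v))) (\<lambda>x. \<lambda>v\<in>B. x (Inr v)) = PiM B (\<lambda>v. ?L (Inr v))"
    by (rule distr_PiM_reindex) (use prob in auto)
  finally show ?thesis by (simp only: sum.case)
qed

text \<open>The summation index \<open>k\<close> of the matrix product labels independent copies of
  one random vector. This is the origin of the n-th power.\<close>

lemma integral_iid_rows:
  fixes L :: "'s \<Rightarrow> real measure" and \<eta> :: "('s \<Rightarrow> real) \<Rightarrow> complex"
  assumes prob: "\<And>a. prob_space (L a)" and sL: "\<And>a. sets (L a) = sets borel" and S: "finite S"
    and \<eta>: "\<eta> \<in> borel_measurable (PiM S (\<lambda>_. borel))" "\<And>z. norm (\<eta> z) \<le> 1"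
  shows "(\<integral>y. (\<Prod>k\<in>{1..n::nat}. \<eta> (\<lambda>a\<in>S. y (k, a))) \<partial>PiM ({1..n} \<times> S) (\<lambda>(k, a). L a)) = (\<integral>z. \<eta> z \<partial>PiM S L) ^ n"
proof -
  let ?L = "\<lambda>(k :: nat, a). L a"
  have prob': "prob_space (?L i)" for i using prob by (cases i) auto
  have M: "product_sigma_finite ?L"
    by (simp add: product_sigma_finite_def prob' prob_space_imp_sigma_finite)
  have sL': "sets (?L i) = sets borel" for i using sL by (cases i) auto
  have m: "(\<lambda>y. \<lambda>a\<in>S. y (k, a)) \<in> measurable (PiM ({k} \<times> S) ?L) (PiM S L)" for k
  proof (rule measurable_restrict)
    fix a assume "a \<in> S"
    then show "(\<lambda>y. y (k, a)) \<in> measurable (PiM ({k} \<times> S) ?L) (L a)"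
      using measurable_component_singleton[of "(k, a)" "{k} \<times> S" ?L] by simp
  qed
  have \<eta>': "\<eta> \<in> borel_measurable (PiM S L)"
    using \<eta>(1) unfolding measurable_PiM_borel[of S L, OF sL] .
  have int: "integrable (PiM ({k} \<times> S) ?L) (\<lambda>y. \<eta> (\<lambda>a\<in>S. y (k, a)))" for k
    by (rule finite_measure.integrable_const_bound[where B = 1])
      (use measurable_compose[OF m \<eta>'] prob_space_PiM[of "{k} \<times> S" ?L] prob' \<eta>(2) in \<open>auto intro: prob_space.finite_measure\<close>)
  have each: "(\<integral>y. \<eta> (\<lambda>a\<in>S. y (k, a)) \<partial>PiM ({k} \<times> S) ?L) = (\<integral>z. \<eta> z \<partial>PiM S L)" for k
  proof -
    have "distr (PiM ({k} \<times> S) ?L) (PiM S (\<lambda>a. ?L (k, a))) (\<lambda>y. \<lambda>a\<in>S. y (k, a)) = PiM S (\<lambda>a. ?L (k, a))"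
      by (rule distr_PiM_reindex) (use prob' in \<open>auto simp: inj_on_def\<close>)
    then have "(\<integral>z. \<eta> z \<partial>PiM S L) = (\<integral>z. \<eta> z \<partial>distr (PiM ({k} \<times> S) ?L) (PiM S L) (\<lambda>y. \<lambda>a\<in>S. y (k, a)))"
      by simp
    then show ?thesis by (simp add: integral_distr[OF m \<eta>'])
  qed
  have UN: "{1..n} \<times> S = (\<Union>k\<in>{1..n}. {k} \<times> S)" by auto
  have "(\<integral>y. (\<Prod>k\<in>{1..n}. \<eta> (\<lambda>a\<in>S. y (k, a))) \<partial>PiM ({1..n} \<times> S) ?L)
      = (\<integral>y. (\<Prod>k\<in>{1..n}. \<eta> (\<lambda>a\<in>S. restrict y ({k} \<times> S) (k, a))) \<partial>PiM (\<Union>k\<in>{1..n}. {k} \<times> S) ?L)"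
    unfolding UN[symmetric] by (intro Bochner_Integration.integral_cong[OF refl] prod.cong arg_cong[where f = \<eta>] refl) (auto simp: fun_eq_iff)
  also have "\<dots> = (\<Prod>k\<in>{1..n}. \<integral>y. \<eta> (\<lambda>a\<in>S. y (k, a)) \<partial>PiM ({k} \<times> S) ?L)"
    by (rule integral_PiM_UN[OF M, THEN conjunct2]) (use S int in auto)
  also have "\<dots> = (\<integral>z. \<eta> z \<partial>PiM S L) ^ n" by (simp add: each)
  finally show ?thesis .
qed

text \<open>Injectivity of \<open>g\<close> and \<open>h\<close> makes the selected entries distinct
  members of the independent family. Their joint law is therefore a product law that is the same for
  all such \<open>g\<close> and \<open>h\<close>.\<close>

lemma matrix_model_law:
  fixes g :: "'w \<Rightarrow> nat" and h :: "'v \<Rightarrow> nat"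
  assumes mm: "matrix_model M p m n \<nu> \<nu>x W X" and np: "n \<ge> 1" "p \<ge> 1"
    and nu: "real_distribution \<nu>" "real_distribution \<nu>x"
    and g: "g \<in> A \<rightarrow> {1..p}" "inj_on g A" and h: "h \<in> B \<rightarrow> {1..m}" "inj_on h B"
  defines "L \<equiv> case_sum (\<lambda>_. \<nu>) (\<lambda>_. \<nu>x) :: 'w + 'v \<Rightarrow> real measure"
    and "U \<equiv> \<lambda>(k, a) \<omega>. case a of Inl w \<Rightarrow> W (g w) k \<omega> | Inr v \<Rightarrow> X k (h v) \<omega>"
  shows "(\<lambda>\<omega>. \<lambda>i\<in>{1..n} \<times> (A <+> B). U i \<omega>) \<in> measurable M (PiM ({1..n} \<times> (A <+> B)) (\<lambda>(k, a). L a))"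
    and "distr M (PiM ({1..n} \<times> (A <+> B)) (\<lambda>(k, a). L a)) (\<lambda>\<omega>. \<lambda>i\<in>{1..n} \<times> (A <+> B). U i \<omega>)
      = PiM ({1..n} \<times> (A <+> B)) (\<lambda>(k, a). L a)"
proof -
  interpret prob_space M using mm by (simp add: matrix_model_def)
  interpret nu: real_distribution \<nu> by (rule nu)
  interpret nux: real_distribution \<nu>x by (rule nu)
  define I where "I = {1..p} \<times> {1..n} <+> {1..n} \<times> {1..m}"
  define Z where "Z = case_sum (\<lambda>(i, k). W i k) (\<lambda>(k, j). X k j)"
  define K where "K = (case_sum (\<lambda>_. \<nu>) (\<lambda>_. \<nu>x) :: (nat \<times> nat) + (nat \<times> nat) \<Rightarrow> real measure)"
  define J where "J = {1..n} \<times> (A <+> B)"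
  \<comment> \<open>Rows of W are indexed before \<open>k\<close>, columns of X after it, hence the
    two different orders in the pairs.\<close>
  define \<iota> where "\<iota> = (\<lambda>(k :: nat, a :: 'w + 'v). case a of Inl w \<Rightarrow> Inl (g w, k) | Inr v \<Rightarrow> (Inr (k, h v) :: (nat \<times> nat) + (nat \<times> nat)))"
  have ind: "indep_vars (\<lambda>_. borel) Z I"
    and lawW: "\<And>i k. i \<in> {1..p} \<Longrightarrow> k \<in> {1..n} \<Longrightarrow> distr M borel (W i k) = \<nu>"
    and lawX: "\<And>k j. k \<in> {1..n} \<Longrightarrow> j \<in> {1..m} \<Longrightarrow> distr M borel (X k j) = \<nu>x"
    using mm by (auto simp: matrix_model_def I_def Z_def)
  have rv: "Z i \<in> borel_measurable M" if "i \<in> I" for i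
    using ind that by (auto simp: indep_vars_def2)
  have law: "distr M borel (Z i) = K i" if "i \<in> I" for i
    using that lawW lawX by (auto simp: I_def Z_def K_def)
  \<comment> \<open>The characterization of independence by the joint law asks for a nonempty index
    set; this is where \<open>n \<ge> 1\<close> and \<open>p \<ge> 1\<close> enter.\<close>
  have I_ne: "I \<noteq> {}" using np by (auto simp: I_def)
  have probK: "prob_space (K i)" for i
    by (cases i) (auto simp: K_def nu.prob_space_axioms nux.prob_space_axioms)
  have sK: "sets (K i) = sets borel" for i by (cases i) (auto simp: K_def)
  have joint: "distr M (PiM I (\<lambda>_. borel)) (\<lambda>\<omega>. \<lambda>i\<in>I. Z i \<omega>) = PiM I K"
    using indep_vars_iff_distr_eq_PiM'[OF I_ne rv] ind law by (simp cong: PiM_cong)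
  have inj: "inj_on \<iota> J"
    using g(2) h(2) by (auto simp: inj_on_def \<iota>_def J_def split: sum.splits)
  have into: "\<iota> \<in> J \<rightarrow> I"
    using g(1) h(1) by (auto simp: \<iota>_def J_def I_def split: sum.splits)
  have KL: "K (\<iota> j) = (case j of (k, a) \<Rightarrow> L a)" for j
    by (auto simp: K_def L_def \<iota>_def split: prod.splits sum.splits)
  have UZ: "Z (\<iota> j) = U j" for j
    by (auto simp: Z_def U_def \<iota>_def fun_eq_iff split: prod.splits sum.splits)
  have reidx: "distr (PiM I K) (PiM J (\<lambda>j. K (\<iota> j))) (\<lambda>\<omega>. \<lambda>j\<in>J. \<omega> (\<iota> j)) = PiM J (\<lambda>j. K (\<iota> j))"
    by (rule distr_PiM_reindex[OF probK inj into])
  have m1: "(\<lambda>\<omega>. \<lambda>i\<in>I. Z i \<omega>) \<in> measurable M (PiM I (\<lambda>_. borel))"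
    using rv by (intro measurable_restrict)
  have m2: "(\<lambda>\<omega>. \<lambda>j\<in>J. \<omega> (\<iota> j)) \<in> measurable (PiM I (\<lambda>_. borel)) (PiM J (\<lambda>j. K (\<iota> j)))"
  proof (rule measurable_restrict)
    fix j assume "j \<in> J"
    then have "(\<lambda>\<omega>. \<omega> (\<iota> j)) \<in> measurable (PiM I (\<lambda>_. borel :: real measure)) borel"
      using into by (intro measurable_component_singleton) auto
    then show "(\<lambda>\<omega>. \<omega> (\<iota> j)) \<in> measurable (PiM I (\<lambda>_. borel)) (K (\<iota> j))"
      by (simp add: measurable_cong_sets[OF refl sK])
  qed
  have comp: "(\<lambda>\<omega>. \<lambda>j\<in>J. \<omega> (\<iota> j)) \<circ> (\<lambda>\<omega>. \<lambda>i\<in>I. Z i \<omega>) = (\<lambda>\<omega>. \<lambda>i\<in>J. U i \<omega>)"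
    using into by (auto simp: fun_eq_iff UZ restrict_def Pi_iff)
  have "(\<lambda>\<omega>. \<lambda>i\<in>J. U i \<omega>) \<in> measurable M (PiM J (\<lambda>j. K (\<iota> j)))"
    using measurable_comp[OF m1 m2] unfolding comp .
  then show "(\<lambda>\<omega>. \<lambda>i\<in>{1..n} \<times> (A <+> B). U i \<omega>) \<in> measurable M (PiM ({1..n} \<times> (A <+> B)) (\<lambda>(k, a). L a))"
    unfolding KL J_def .
  have "distr M (PiM J (\<lambda>j. K (\<iota> j))) (\<lambda>\<omega>. \<lambda>i\<in>J. U i \<omega>)
      = distr (distr M (PiM I (\<lambda>_. borel)) (\<lambda>\<omega>. \<lambda>i\<in>I. Z i \<omega>)) (PiM J (\<lambda>j. K (\<iota> j))) (\<lambda>\<omega>. \<lambda>j\<in>J. \<omega> (\<iota> j))"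
    unfolding comp[symmetric] by (rule distr_distr[OF m2 m1, symmetric])
  also have "\<dots> = PiM J (\<lambda>j. K (\<iota> j))" unfolding joint by (rule reidx)
  finally show "distr M (PiM ({1..n} \<times> (A <+> B)) (\<lambda>(k, a). L a)) (\<lambda>\<omega>. \<lambda>i\<in>{1..n} \<times> (A <+> B). U i \<omega>)
      = PiM ({1..n} \<times> (A <+> B)) (\<lambda>(k, a). L a)"
    unfolding KL J_def .
qed

definition inj_maps :: "'a set \<Rightarrow> nat \<Rightarrow> ('a \<Rightarrow> nat) set" where
  "inj_maps A p = {g. g \<in> A \<rightarrow>\<^sub>E {1..p} \<and> inj_on g A}"

lemma finite_inj_maps: "finite A \<Longrightarrow> finite (inj_maps A p)"
  unfolding inj_maps_def by (rule finite_subset[of _ "A \<rightarrow>\<^sub>E {1..p}"]) (auto intro: finite_PiE)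

definition osc_integral :: "('w, 'v) bigraph \<Rightarrow> (real \<Rightarrow> real) \<Rightarrow> real measure \<Rightarrow> real measure \<Rightarrow> nat \<Rightarrow> complex" where
  "osc_integral G f \<nu> \<nu>x n = (\<integral>\<gamma>. (\<Prod>e\<in>eidx G. fourier f (\<gamma> e)) *
     (\<integral>x. (\<Prod>w\<in>wverts G. char \<nu> (lin G \<gamma> w x)) \<partial>PiM (vverts G) (\<lambda>_. \<nu>x)) ^ n \<partial>PiM (eidx G) (\<lambda>_. lborel))"

text \<open>The phase splits over \<open>k\<close>; \<open>matrix_model_law\<close> supplies the law
  of the selected entries, \<open>integral_iid_rows\<close> the n-th power, and
  \<open>integral_exp_bilinear\<close> its base.\<close>

lemma char_model:
  fixes G :: "('w, 'v) bigraph"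
  assumes fin: "finite_bigraph G" and mm: "matrix_model M p m n \<nu> \<nu>x W X" and np: "n \<ge> 1" "p \<ge> 1"
    and nu: "real_distribution \<nu>" "real_distribution \<nu>x"
    and g: "g \<in> wverts G \<rightarrow> {1..p}" "inj_on g (wverts G)" and h: "h \<in> vverts G \<rightarrow> {1..m}" "inj_on h (vverts G)"
  shows "(\<integral>\<omega>. exp (\<i> * of_real (\<Sum>e\<in>eidx G. \<gamma> e * (\<Sum>k=1..n. W (g (fst e)) k \<omega> * X k (h (fst (snd e))) \<omega>))) \<partial>M)
    = (\<integral>x. (\<Prod>w\<in>wverts G. char \<nu> (lin G \<gamma> w x)) \<partial>PiM (vverts G) (\<lambda>_. \<nu>x)) ^ n"
proof -
  interpret nu: real_distribution \<nu> by (rule nu)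
  interpret nux: real_distribution \<nu>x by (rule nu)
  let ?S = "wverts G <+> vverts G"
  let ?L = "case_sum (\<lambda>_. \<nu>) (\<lambda>_. \<nu>x) :: 'w + 'v \<Rightarrow> real measure"
  define U where "U = (\<lambda>(k, a) \<omega>. case a of Inl w \<Rightarrow> W (g w) k \<omega> | Inr v \<Rightarrow> X k (h v) \<omega>)"
  have finW: "finite (wverts G)" and finV: "finite (vverts G)" using fin by (auto simp: finite_bigraph_def)
  define \<eta> where "\<eta> z = (\<Prod>w\<in>wverts G. exp (\<i> * complex_of_real (z (Inl w) * lin G \<gamma> w (\<lambda>v\<in>vverts G. z (Inr v)))))"
    for z :: "'w + 'v \<Rightarrow> real"
  have law: "(\<lambda>\<omega>. \<lambda>i\<in>{1..n} \<times> ?S. U i \<omega>) \<in> measurable M (PiM ({1..n} \<times> ?S) (\<lambda>(k, a). ?L a))"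
    "distr M (PiM ({1..n} \<times> ?S) (\<lambda>(k, a). ?L a)) (\<lambda>\<omega>. \<lambda>i\<in>{1..n} \<times> ?S. U i \<omega>) = PiM ({1..n} \<times> ?S) (\<lambda>(k, a). ?L a)"
    using matrix_model_law[OF mm np nu g h] unfolding U_def by blast+
  have prob: "prob_space (?L a)" for a
    by (cases a) (auto simp: nu.prob_space_axioms nux.prob_space_axioms)
  have sL: "sets (?L a) = sets borel" for a by (cases a) auto
  have linm: "lin G \<gamma> w \<in> borel_measurable (PiM (vverts G) (\<lambda>_. borel))" for w
    using lin_measurable_snd[OF fin, of borel] by simp
  have \<eta>m: "\<eta> \<in> borel_measurable (PiM ?S (\<lambda>_. borel))"
    unfolding \<eta>_def
  proof (intro borel_measurable_prod)
    fix w assume w: "w \<in> wverts G"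
    have "(\<lambda>z. \<lambda>v\<in>vverts G. z (Inr v)) \<in> measurable (PiM ?S (\<lambda>_. borel :: real measure)) (PiM (vverts G) (\<lambda>_. borel))"
      by (intro measurable_restrict measurable_component_singleton) auto
    from measurable_compose[OF this linm]
    have [measurable]: "(\<lambda>z. lin G \<gamma> w (\<lambda>v\<in>vverts G. z (Inr v))) \<in> borel_measurable (PiM ?S (\<lambda>_. borel))" .
    have [measurable]: "(\<lambda>z. z (Inl w)) \<in> borel_measurable (PiM ?S (\<lambda>_. borel))"
      using w by (intro measurable_component_singleton) auto
    show "(\<lambda>z. exp (\<i> * complex_of_real (z (Inl w) * lin G \<gamma> w (\<lambda>v\<in>vverts G. z (Inr v))))) \<in> borel_measurable (PiM ?S (\<lambda>_. borel))"
      by measurable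
  qed
  have \<eta>1: "norm (\<eta> z) \<le> 1" for z
    unfolding \<eta>_def by (simp add: prod_norm[symmetric] del: of_real_mult)
  have Fm: "(\<lambda>y. \<Prod>k\<in>{1..n}. \<eta> (\<lambda>a\<in>?S. y (k, a))) \<in> borel_measurable (PiM ({1..n} \<times> ?S) (\<lambda>(k, a). ?L a))"
  proof (intro borel_measurable_prod)
    fix k assume k: "k \<in> {1..n}"
    have "(\<lambda>y. \<lambda>a\<in>?S. y (k, a)) \<in> measurable (PiM ({1..n} \<times> ?S) (\<lambda>_. borel :: real measure)) (PiM ?S (\<lambda>_. borel))"
      using k by (intro measurable_restrict measurable_component_singleton) auto
    from measurable_compose[OF this \<eta>m]
    show "(\<lambda>y. \<eta> (\<lambda>a\<in>?S. y (k, a))) \<in> borel_measurable (PiM ({1..n} \<times> ?S) (\<lambda>(k, a). ?L a))"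
      by (subst measurable_PiM_borel) (use sL in auto)
  qed
  have pt: "exp (\<i> * complex_of_real (\<Sum>e\<in>eidx G. \<gamma> e * (\<Sum>k=1..n. W (g (fst e)) k \<omega> * X k (h (fst (snd e))) \<omega>)))
      = (\<Prod>k\<in>{1..n}. \<eta> (\<lambda>a\<in>?S. (\<lambda>i\<in>{1..n} \<times> ?S. U i \<omega>) (k, a)))" for \<omega>
  proof -
    have "(\<Sum>e\<in>eidx G. \<gamma> e * (\<Sum>k=1..n. W (g (fst e)) k \<omega> * X k (h (fst (snd e))) \<omega>))
        = (\<Sum>k=1..n. \<Sum>e\<in>eidx G. \<gamma> e * (W (g (fst e)) k \<omega> * X k (h (fst (snd e))) \<omega>))"
      unfolding sum_distrib_left by (rule sum.swap)
    also have "\<dots> = (\<Sum>k=1..n. \<Sum>w\<in>wverts G. W (g w) k \<omega> * lin G \<gamma> w (\<lambda>v. X k (h v) \<omega>))"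
      by (rule sum.cong[OF refl], rule sum_eidx_lin[OF fin, of \<gamma> "\<lambda>w. W (g w) _ \<omega>" "\<lambda>v. X _ (h v) \<omega>"])
    finally have "exp (\<i> * complex_of_real (\<Sum>e\<in>eidx G. \<gamma> e * (\<Sum>k=1..n. W (g (fst e)) k \<omega> * X k (h (fst (snd e))) \<omega>)))
        = (\<Prod>k=1..n. \<Prod>w\<in>wverts G. exp (\<i> * complex_of_real (W (g w) k \<omega> * lin G \<gamma> w (\<lambda>v. X k (h v) \<omega>))))"
      using finW by (simp only: of_real_sum sum_distrib_left exp_sum finite_atLeastAtMost)
    also have "\<dots> = (\<Prod>k\<in>{1..n}. \<eta> (\<lambda>a\<in>?S. (\<lambda>i\<in>{1..n} \<times> ?S. U i \<omega>) (k, a)))"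
    proof (rule prod.cong[OF refl])
      fix k assume k: "k \<in> {1..n}"
      have "(\<lambda>v\<in>vverts G. (\<lambda>a\<in>?S. (\<lambda>i\<in>{1..n} \<times> ?S. U i \<omega>) (k, a)) (Inr v)) = restrict (\<lambda>v. X k (h v) \<omega>) (vverts G)"
        using k by (auto simp: fun_eq_iff U_def)
      then have "lin G \<gamma> w (\<lambda>v\<in>vverts G. (\<lambda>a\<in>?S. (\<lambda>i\<in>{1..n} \<times> ?S. U i \<omega>) (k, a)) (Inr v)) = lin G \<gamma> w (\<lambda>v. X k (h v) \<omega>)" for w
        by (simp only: lin_restrict)
      moreover have "(\<lambda>a\<in>?S. (\<lambda>i\<in>{1..n} \<times> ?S. U i \<omega>) (k, a)) (Inl w) = W (g w) k \<omega>" if "w \<in> wverts G" for w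
        using k that by (simp add: U_def InlI)
      ultimately show "(\<Prod>w\<in>wverts G. exp (\<i> * complex_of_real (W (g w) k \<omega> * lin G \<gamma> w (\<lambda>v. X k (h v) \<omega>))))
          = \<eta> (\<lambda>a\<in>?S. (\<lambda>i\<in>{1..n} \<times> ?S. U i \<omega>) (k, a))"
        unfolding \<eta>_def by (intro prod.cong refl) (simp only:)
    qed
    finally show ?thesis .
  qed
  have "(\<integral>\<omega>. exp (\<i> * of_real (\<Sum>e\<in>eidx G. \<gamma> e * (\<Sum>k=1..n. W (g (fst e)) k \<omega> * X k (h (fst (snd e))) \<omega>))) \<partial>M)
      = (\<integral>y. (\<Prod>k\<in>{1..n}. \<eta> (\<lambda>a\<in>?S. y (k, a))) \<partial>distr M (PiM ({1..n} \<times> ?S) (\<lambda>(k, a). ?L a)) (\<lambda>\<omega>. \<lambda>i\<in>{1..n} \<times> ?S. U i \<omega>))"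
    unfolding pt by (rule integral_distr[OF law(1) Fm, symmetric])
  also have "\<dots> = (\<integral>y. (\<Prod>k\<in>{1..n}. \<eta> (\<lambda>a\<in>?S. y (k, a))) \<partial>PiM ({1..n} \<times> ?S) (\<lambda>(k, a). ?L a))"
    by (simp only: law(2))
  also have "\<dots> = (\<integral>z. \<eta> z \<partial>PiM ?S ?L) ^ n"
    by (rule integral_iid_rows[OF prob sL _ \<eta>m \<eta>1]) (use finW finV in simp)
  also have "(\<integral>z. \<eta> z \<partial>PiM ?S ?L) = (\<integral>x. (\<Prod>w\<in>wverts G. char \<nu> (lin G \<gamma> w x)) \<partial>PiM (vverts G) (\<lambda>_. \<nu>x))"
    unfolding \<eta>_def by (rule integral_exp_bilinear[OF finW finV nu linm])
  finally show ?thesis .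
qed

lemma fourier_prod_integrable:
  assumes fin: "finite I" and f: "smooth_L1 f"
  shows "integrable (PiM I (\<lambda>_. lborel)) (\<lambda>\<gamma>. \<Prod>e\<in>I. norm (fourier f (\<gamma> e)) * (1 + \<bar>\<gamma> e\<bar>) ^ k)"
proof -
  interpret product_sigma_finite "\<lambda>_. lborel :: real measure"
    by (simp add: product_sigma_finite_def sigma_finite_lborel)
  show ?thesis
    by (rule product_integrable_prod[OF fin, of "\<lambda>_ t. norm (fourier f t) * (1 + \<bar>t\<bar>) ^ k"])
      (rule fourier_poly_integrable[OF f])
qed

lemma fourier_prod_measurable:
  assumes f: "smooth_L1 f"
  shows "(\<lambda>\<gamma>. \<Prod>e\<in>I. fourier f (\<gamma> e)) \<in> borel_measurable (PiM I (\<lambda>_. lborel))"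
proof (intro borel_measurable_prod)
  fix e assume "e \<in> I"
  have "(\<lambda>\<gamma>. \<gamma> e) \<in> measurable (PiM I (\<lambda>_. lborel :: real measure)) lborel"
    by (rule measurable_component_singleton[OF \<open>e \<in> I\<close>])
  from measurable_compose[OF this, of "fourier f" borel]
  show "(\<lambda>\<gamma>. fourier f (\<gamma> e)) \<in> borel_measurable (PiM I (\<lambda>_. lborel))"
    using fourier_measurable[OF smooth_L1_integrable[OF f]] by simp
qed

text \<open>Each factor \<open>f\<close> is replaced by its inversion integral. The exponentials
  have modulus 1, so Fubini only needs the product of the Fourier transforms to be
  integrable.\<close>

lemma expectation_model:
  fixes G :: "('w, 'v) bigraph"
  assumes fin: "finite_bigraph G" and mm: "matrix_model M p m n \<nu> \<nu>x W X" and np: "n \<ge> 1" "p \<ge> 1"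
    and nu: "real_distribution \<nu>" "real_distribution \<nu>x" and f: "smooth_L1 f"
    and g: "g \<in> wverts G \<rightarrow> {1..p}" "inj_on g (wverts G)" and h: "h \<in> vverts G \<rightarrow> {1..m}" "inj_on h (vverts G)"
  shows "integrable M (\<lambda>\<omega>. \<Prod>(w, v)\<in>edges G. f (\<Sum>k=1..n. W (g w) k \<omega> * X k (h v) \<omega>) ^ mult G w v)" (is ?i)
    and "complex_of_real (\<integral>\<omega>. (\<Prod>(w, v)\<in>edges G. f (\<Sum>k=1..n. W (g w) k \<omega> * X k (h v) \<omega>) ^ mult G w v) \<partial>M)
      = 1 / (2 * of_real pi) ^ total_mult G (edges G) * osc_integral G f \<nu> \<nu>x n" (is ?e)
proof -
  interpret prob_space M using mm by (simp add: matrix_model_def)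
  interpret LB: product_sigma_finite "\<lambda>_. lborel :: real measure"
    by (simp add: product_sigma_finite_def sigma_finite_lborel)
  have finI: "finite (eidx G)" by (rule finite_eidx[OF fin])
  interpret LBI: finite_product_sigma_finite "\<lambda>_. lborel :: real measure" "eidx G" by standard (rule finI)
  let ?LI = "PiM (eidx G) (\<lambda>_. lborel :: real measure)"
  interpret P: pair_sigma_finite M ?LI ..
  define \<xi> where "\<xi> = (\<lambda>(e :: 'w \<times> 'v \<times> nat) \<omega>. \<Sum>k=1..n. W (g (fst e)) k \<omega> * X k (h (fst (snd e))) \<omega>)"
  have rvW: "W i k \<in> borel_measurable M" if "i \<in> {1..p}" "k \<in> {1..n}" for i k
    using mm that unfolding matrix_model_def indep_vars_def2 by (force dest: bspec[where x = "Inl (i, k)"])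
  have rvX: "X k j \<in> borel_measurable M" if "k \<in> {1..n}" "j \<in> {1..m}" for k j
    using mm that unfolding matrix_model_def indep_vars_def2 by (force dest: bspec[where x = "Inr (k, j)"])
  have \<xi>m: "\<xi> e \<in> borel_measurable M" if "e \<in> eidx G" for e
  proof -
    have "fst e \<in> wverts G" "fst (snd e) \<in> vverts G" using that by (auto simp: eidx_def edges_def)
    then have "g (fst e) \<in> {1..p}" "h (fst (snd e)) \<in> {1..m}" using g h by blast+
    then show ?thesis unfolding \<xi>_def by (intro borel_measurable_sum borel_measurable_times rvW rvX) auto
  qed
  have [measurable]: "f \<in> borel_measurable borel"
    using borel_measurable_integrable[OF smooth_L1_integrable[OF f]] by simp
  have fm: "fourier f \<in> borel_measurable borel" by (rule fourier_measurable[OF smooth_L1_integrable[OF f]])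
  have prod_eq: "(\<Prod>(w, v)\<in>edges G. f (\<Sum>k=1..n. W (g w) k \<omega> * X k (h v) \<omega>) ^ mult G w v) = (\<Prod>e\<in>eidx G. f (\<xi> e \<omega>))" for \<omega>
  proof -
    have "(\<Prod>e\<in>eidx G. f (\<xi> e \<omega>)) = (\<Prod>(w, v)\<in>edges G. \<Prod>i=1..mult G w v. f (\<xi> (w, v, i) \<omega>))"
      unfolding eidx_def by (rule prod_eidx[OF finite_edges[OF fin], symmetric])
    then show ?thesis by (simp add: \<xi>_def)
  qed
  obtain B where B: "\<And>x. \<bar>f x\<bar> \<le> B" using smooth_L1_bounded[OF f] by blast
  show ?i
    unfolding prod_eq
  proof (rule integrable_const_bound)
    show "AE \<omega> in M. norm (\<Prod>e\<in>eidx G. f (\<xi> e \<omega>)) \<le> B ^ card (eidx G)"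
    proof (intro AE_I2)
      fix \<omega>
      have "norm (\<Prod>e\<in>eidx G. f (\<xi> e \<omega>)) = (\<Prod>e\<in>eidx G. \<bar>f (\<xi> e \<omega>)\<bar>)" by (simp add: abs_prod)
      also have "\<dots> \<le> (\<Prod>e\<in>eidx G. B)" by (intro prod_mono) (auto simp: B)
      finally show "norm (\<Prod>e\<in>eidx G. f (\<xi> e \<omega>)) \<le> B ^ card (eidx G)" by simp
    qed
    show "(\<lambda>\<omega>. \<Prod>e\<in>eidx G. f (\<xi> e \<omega>)) \<in> borel_measurable M"
      using \<xi>m by measurable
  qed
  define H where "H = (\<lambda>\<omega> \<gamma>. \<Prod>e\<in>eidx G. fourier f (\<gamma> e) * exp (\<i> * of_real (\<gamma> e * \<xi> e \<omega>)))"
  have Hm: "(\<lambda>z. H (fst z) (snd z)) \<in> borel_measurable (M \<Otimes>\<^sub>M ?LI)"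
    unfolding H_def
  proof (intro borel_measurable_prod)
    fix e assume e: "e \<in> eidx G"
    have "(\<lambda>z. snd z e) \<in> measurable (M \<Otimes>\<^sub>M ?LI) lborel"
      using measurable_compose[OF measurable_snd measurable_component_singleton[OF e, of "\<lambda>_. lborel"]] .
    then have [measurable]: "(\<lambda>z. snd z e) \<in> borel_measurable (M \<Otimes>\<^sub>M ?LI)" by simp
    have [measurable]: "(\<lambda>z. \<xi> e (fst z)) \<in> borel_measurable (M \<Otimes>\<^sub>M ?LI)"
      using measurable_compose[OF measurable_fst \<xi>m[OF e]] .
    note [measurable] = fm
    show "(\<lambda>z. fourier f (snd z e) * exp (\<i> * of_real (snd z e * \<xi> e (fst z)))) \<in> borel_measurable (M \<Otimes>\<^sub>M ?LI)"
      by measurable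
  qed
  have Hnorm: "norm (H \<omega> \<gamma>) = (\<Prod>e\<in>eidx G. norm (fourier f (\<gamma> e)) * (1 + \<bar>\<gamma> e\<bar>) ^ 0)" for \<omega> \<gamma>
    by (simp add: H_def prod_norm[symmetric] norm_mult del: of_real_mult)
  have Hint: "integrable (M \<Otimes>\<^sub>M ?LI) (\<lambda>z. H (fst z) (snd z))"
  proof (rule P.Fubini_integrable[OF Hm])
    show "integrable M (\<lambda>\<omega>. \<integral>\<gamma>. norm (H (fst (\<omega>, \<gamma>)) (snd (\<omega>, \<gamma>))) \<partial>?LI)"
      by (simp only: fst_conv snd_conv Hnorm) simp
    show "AE \<omega> in M. integrable ?LI (\<lambda>\<gamma>. H (fst (\<omega>, \<gamma>)) (snd (\<omega>, \<gamma>)))"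
    proof (intro AE_I2)
      fix \<omega> assume \<omega>: "\<omega> \<in> space M"
      have "(\<lambda>\<gamma>. H \<omega> \<gamma>) \<in> borel_measurable ?LI"
        using measurable_compose[OF measurable_Pair1'[OF \<omega>] Hm] by simp
      then have "integrable ?LI (\<lambda>\<gamma>. H \<omega> \<gamma>)"
        by (rule Bochner_Integration.integrable_bound[OF fourier_prod_integrable[OF finI f, of 0]])
          (simp add: Hnorm prod_nonneg)
      then show "integrable ?LI (\<lambda>\<gamma>. H (fst (\<omega>, \<gamma>)) (snd (\<omega>, \<gamma>)))" by simp
    qed
  qed
  have inv: "complex_of_real (\<Prod>e\<in>eidx G. f (\<xi> e \<omega>)) = 1 / (2 * of_real pi) ^ total_mult G (edges G) * (\<integral>\<gamma>. H \<omega> \<gamma> \<partial>?LI)" for \<omega>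
  proof -
    have "complex_of_real (\<Prod>e\<in>eidx G. f (\<xi> e \<omega>))
        = (\<Prod>e\<in>eidx G. 1 / (2 * of_real pi) * (\<integral>t. fourier f t * exp (\<i> * of_real (t * \<xi> e \<omega>)) \<partial>lborel))"
      by (simp only: of_real_prod fourier_inversion[OF f])
    also have "\<dots> = (1 / (2 * of_real pi)) ^ card (eidx G) * (\<Prod>e\<in>eidx G. \<integral>t. fourier f t * exp (\<i> * of_real (t * \<xi> e \<omega>)) \<partial>lborel)"
      by (simp only: prod.distrib prod_constant)
    also have "(\<Prod>e\<in>eidx G. \<integral>t. fourier f t * exp (\<i> * of_real (t * \<xi> e \<omega>)) \<partial>lborel) = (\<integral>\<gamma>. H \<omega> \<gamma> \<partial>?LI)"
      unfolding H_def
    proof (rule LB.product_integral_prod[OF finI, symmetric])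
      fix e
      show "integrable lborel (\<lambda>t. fourier f t * exp (\<i> * of_real (t * \<xi> e \<omega>)))"
        by (rule Bochner_Integration.integrable_bound[OF integrable_fourier[OF f]])
          (use fm in \<open>auto simp: norm_mult simp del: of_real_mult\<close>)
    qed
    finally show ?thesis by (simp add: card_eidx[OF fin] power_divide)
  qed
  have "complex_of_real (\<integral>\<omega>. (\<Prod>(w, v)\<in>edges G. f (\<Sum>k=1..n. W (g w) k \<omega> * X k (h v) \<omega>) ^ mult G w v) \<partial>M)
      = (\<integral>\<omega>. complex_of_real (\<Prod>e\<in>eidx G. f (\<xi> e \<omega>)) \<partial>M)"
    unfolding prod_eq by (rule integral_complex_of_real[symmetric])
  also have "\<dots> = 1 / (2 * of_real pi) ^ total_mult G (edges G) * (\<integral>\<omega>. (\<integral>\<gamma>. H \<omega> \<gamma> \<partial>?LI) \<partial>M)"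
    unfolding inv by (rule integral_mult_right_zero)
  also have "(\<integral>\<omega>. (\<integral>\<gamma>. H \<omega> \<gamma> \<partial>?LI) \<partial>M) = (\<integral>\<gamma>. (\<integral>\<omega>. H \<omega> \<gamma> \<partial>M) \<partial>?LI)"
    using P.Fubini_integral[of H] Hint by (simp add: split_beta')
  also have "\<dots> = osc_integral G f \<nu> \<nu>x n"
    unfolding osc_integral_def
  proof (rule Bochner_Integration.integral_cong[OF refl])
    fix \<gamma>
    have "(\<integral>\<omega>. H \<omega> \<gamma> \<partial>M) = (\<integral>\<omega>. (\<Prod>e\<in>eidx G. fourier f (\<gamma> e)) * exp (\<i> * of_real (\<Sum>e\<in>eidx G. \<gamma> e * \<xi> e \<omega>)) \<partial>M)"
      unfolding H_def using finI by (simp only: prod.distrib of_real_sum sum_distrib_left exp_sum)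
    also have "\<dots> = (\<Prod>e\<in>eidx G. fourier f (\<gamma> e)) * (\<integral>\<omega>. exp (\<i> * of_real (\<Sum>e\<in>eidx G. \<gamma> e * \<xi> e \<omega>)) \<partial>M)"
      by (rule integral_mult_right_zero)
    also have "(\<integral>\<omega>. exp (\<i> * of_real (\<Sum>e\<in>eidx G. \<gamma> e * \<xi> e \<omega>)) \<partial>M)
        = (\<integral>x. (\<Prod>w\<in>wverts G. char \<nu> (lin G \<gamma> w x)) \<partial>PiM (vverts G) (\<lambda>_. \<nu>x)) ^ n"
      unfolding \<xi>_def by (rule char_model[OF fin mm np nu g h])
    finally show "(\<integral>\<omega>. H \<omega> \<gamma> \<partial>M) = (\<Prod>e\<in>eidx G. fourier f (\<gamma> e)) *
        (\<integral>x. (\<Prod>w\<in>wverts G. char \<nu> (lin G \<gamma> w x)) \<partial>PiM (vverts G) (\<lambda>_. \<nu>x)) ^ n" .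
  qed
  finally show ?e .
qed

text \<open>All pairs of injections have the same expectation, so the double sum contributes only
  its number of terms.\<close>

lemma mean_inj_trace_eq:
  fixes G :: "('w, 'v) bigraph"
  assumes fin: "finite_bigraph G" and mm: "matrix_model M p m n \<nu> \<nu>x W X" and np: "n \<ge> 1" "p \<ge> 1"
    and nu: "real_distribution \<nu>" "real_distribution \<nu>x" and f: "smooth_L1 f"
  shows "complex_of_real (mean_inj_trace M p m (Y_mat f m n W X) G)
    = of_real (1 / real p * real (card (inj_maps (wverts G) p)) * real (card (inj_maps (vverts G) m))
        * (1 / sqrt (real m)) ^ total_mult G (edges G))
      * (1 / (2 * of_real pi) ^ total_mult G (edges G) * osc_integral G f \<nu> \<nu>x n)"
proof -
  interpret prob_space M using mm by (simp add: matrix_model_def)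
  define E where "E = total_mult G (edges G)"
  define Q where "Q g h \<omega> = (\<Prod>(w, v)\<in>edges G. f (\<Sum>k=1..n. W (g w) k \<omega> * X k (h v) \<omega>) ^ mult G w v)" for g h \<omega>
  define c where "c = 1 / (2 * complex_of_real pi) ^ E * osc_integral G f \<nu> \<nu>x n"
  have Q: "integrable M (Q g h)" "complex_of_real (\<integral>\<omega>. Q g h \<omega> \<partial>M) = c"
    if "g \<in> inj_maps (wverts G) p" "h \<in> inj_maps (vverts G) m" for g h
    unfolding Q_def c_def E_def using that
    by (intro expectation_model[OF fin mm np nu f]; auto simp: inj_maps_def)+
  have pt: "(\<Prod>(w, v)\<in>edges G. Y_mat f m n W X (g w) (h v) \<omega> ^ mult G w v) = (1 / sqrt (real m)) ^ E * Q g h \<omega>" for g h \<omega>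
  proof -
    have "(\<Prod>(w, v)\<in>edges G. Y_mat f m n W X (g w) (h v) \<omega> ^ mult G w v)
        = (\<Prod>(w, v)\<in>edges G. (1 / sqrt (real m)) ^ mult G w v * f (\<Sum>k=1..n. W (g w) k \<omega> * X k (h v) \<omega>) ^ mult G w v)"
      unfolding Y_mat_def by (simp only: power_mult_distrib)
    also have "\<dots> = (\<Prod>(w, v)\<in>edges G. (1 / sqrt (real m)) ^ mult G w v) * Q g h \<omega>"
      unfolding Q_def split_beta by (rule prod.distrib)
    also have "(\<Prod>(w, v)\<in>edges G. (1 / sqrt (real m)) ^ mult G w v) = (1 / sqrt (real m)) ^ E"
      unfolding E_def total_mult_def split_beta by (rule power_sum[symmetric])
    finally show ?thesis .
  qed
  have finm: "finite (inj_maps (wverts G) p)" "finite (inj_maps (vverts G) m)"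
    using fin by (auto simp: finite_bigraph_def intro!: finite_inj_maps)
  have "mean_inj_trace M p m (Y_mat f m n W X) G
      = (\<integral>\<omega>. 1 / real p * (\<Sum>g\<in>inj_maps (wverts G) p. \<Sum>h\<in>inj_maps (vverts G) m. (1 / sqrt (real m)) ^ E * Q g h \<omega>) \<partial>M)"
    unfolding mean_inj_trace_def pt inj_maps_def ..
  also have "\<dots> = 1 / real p * (\<Sum>g\<in>inj_maps (wverts G) p. \<Sum>h\<in>inj_maps (vverts G) m. (1 / sqrt (real m)) ^ E * (\<integral>\<omega>. Q g h \<omega> \<partial>M))"
    using Q(1) by (simp add: Bochner_Integration.integral_sum Bochner_Integration.integrable_sum)
  finally have "complex_of_real (mean_inj_trace M p m (Y_mat f m n W X) G)
      = of_real (1 / real p) * (\<Sum>g\<in>inj_maps (wverts G) p. \<Sum>h\<in>inj_maps (vverts G) m. of_real ((1 / sqrt (real m)) ^ E) * complex_of_real (\<integral>\<omega>. Q g h \<omega> \<partial>M))"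
    by (simp only: of_real_mult of_real_sum)
  also have "\<dots> = of_real (1 / real p) * (\<Sum>g\<in>inj_maps (wverts G) p. \<Sum>h\<in>inj_maps (vverts G) m. of_real ((1 / sqrt (real m)) ^ E) * c)"
    using Q(2) by simp
  also have "\<dots> = of_real (1 / real p * real (card (inj_maps (wverts G) p)) * real (card (inj_maps (vverts G) m)) * (1 / sqrt (real m)) ^ E) * c"
    by (simp add: mult_ac)
  finally show ?thesis unfolding c_def E_def .
qed

section \<open>Joint moments: bounds, limits and invariance under sign flips\<close>

section \<open>Moments and sign flips\<close>

lemma one_plus_sum_le_prod:
  fixes a :: "'a \<Rightarrow> real"
  assumes "finite A" "\<And>i. i \<in> A \<Longrightarrow> a i \<ge> 0"
  shows "1 + sum a A \<le> (\<Prod>i\<in>A. 1 + a i)"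
  using assms
proof (induction A)
  case (insert x A)
  have IH: "1 + sum a A \<le> (\<Prod>i\<in>A. 1 + a i)" using insert by simp
  have "0 \<le> a x" "0 \<le> sum a A" using insert by (auto intro!: sum_nonneg)
  then have "1 + sum a (insert x A) \<le> (1 + a x) * (1 + sum a A)"
    using insert by (simp add: algebra_simps)
  also have "\<dots> \<le> (1 + a x) * (\<Prod>i\<in>A. 1 + a i)"
    using IH \<open>0 \<le> a x\<close> by (intro mult_left_mono) auto
  finally show ?case using insert by simp
qed simp

text \<open>Here \<open>\<nu>\<close> is the law of the entries of X. The laws of the entries of W
  enter later, through the functions \<open>u\<close> whose moments are formed.\<close>

locale osc_setup =
  fixes G :: "('w, 'v) bigraph" and \<nu> :: "real measure" and f :: "real \<Rightarrow> real"
  assumes fin: "finite_bigraph G" and nu: "real_distribution \<nu>" and sym: "symmetric_law \<nu>"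
    and moments: "\<And>k :: nat. integrable \<nu> (\<lambda>x. x ^ k)"
    and f: "smooth_L1 f" and f_odd: "\<And>x. f (- x) = - f x"
begin

abbreviation "edge_lborel \<equiv> PiM (eidx G) (\<lambda>_. lborel :: real measure)"
abbreviation "vert_law \<equiv> PiM (vverts G) (\<lambda>_. \<nu>)"

definition mom :: "(real \<Rightarrow> real) \<Rightarrow> 'w set \<Rightarrow> ('w \<times> 'v \<times> nat \<Rightarrow> real) \<Rightarrow> real" where
  "mom u A \<gamma> = (\<integral>x. (\<Prod>w\<in>A. u (lin G \<gamma> w x)) \<partial>vert_law)"

text \<open>Together with \<open>vert_prod\<close> a multiplicative weight: \<open>lin_bound\<close>
  estimates linear forms by the product of the two, so that frequencies and vertex variables can be
  integrated separately.\<close>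

definition edge_prod :: "('w \<times> 'v \<times> nat \<Rightarrow> real) \<Rightarrow> real" where
  "edge_prod \<gamma> = (\<Prod>e\<in>eidx G. 1 + \<bar>\<gamma> e\<bar>)"

definition vert_prod :: "('v \<Rightarrow> real) \<Rightarrow> real" where
  "vert_prod x = (\<Prod>v\<in>vverts G. 1 + \<bar>x v\<bar>)"

definition hat_prod :: "('w \<times> 'v \<times> nat \<Rightarrow> real) \<Rightarrow> complex" where
  "hat_prod \<gamma> = (\<Prod>e\<in>eidx G. fourier f (\<gamma> e))"

text \<open>The quadratic order is the one that the doubling inequality for characteristic functions
  provides.\<close>

definition growth :: "(real \<Rightarrow> real) \<Rightarrow> real \<Rightarrow> bool" where
  "growth u K \<longleftrightarrow> u \<in> borel_measurable borel \<and> (\<forall>t. \<bar>u t\<bar> \<le> K * (1 + \<bar>t\<bar>)\<^sup>2)"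

lemma finVW: "finite (wverts G)" "finite (vverts G)"
  using fin by (auto simp: finite_bigraph_def)

lemma finI: "finite (eidx G)"
  by (rule finite_eidx[OF fin])

lemma nu_sets: "sets \<nu> = sets borel"
  using nu by (simp add: real_distribution.events_eq_borel)

lemma nu_prob: "prob_space \<nu>"
  using nu by (simp add: real_distribution_def)

lemma vert_law_prob: "prob_space vert_law"
  by (rule prob_space_PiM) (rule nu_prob)

lemma growth_nonneg: "growth u K \<Longrightarrow> K \<ge> 0"
proof -
  assume "growth u K"
  then have "\<bar>u 0\<bar> \<le> K * (1 + \<bar>0\<bar>)\<^sup>2" unfolding growth_def by blast
  then show "K \<ge> 0" by simp
qed

lemma abs_moments: "integrable \<nu> (\<lambda>x. (1 + \<bar>x\<bar>) ^ k)"
proof (rule Bochner_Integration.integrable_bound)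
  interpret prob_space \<nu> by (rule nu_prob)
  show "integrable \<nu> (\<lambda>x. 2 ^ k * (1 + x ^ (2 * k)))"
    using moments[of "2 * k"] by simp
  show "(\<lambda>x. (1 + \<bar>x\<bar>) ^ k) \<in> borel_measurable \<nu>"
    unfolding measurable_cong_sets[OF nu_sets refl] by measurable
  show "AE x in \<nu>. norm ((1 + \<bar>x\<bar>) ^ k) \<le> norm (2 ^ k * (1 + x ^ (2 * k)))"
  proof (intro AE_I2)
    fix x :: real
    have x2: "x ^ (2 * k) = (x\<^sup>2) ^ k" by (simp add: power_mult)
    have "(1 + \<bar>x\<bar>) ^ k \<le> 2 ^ k * (1 + x ^ (2 * k))"
    proof (cases "\<bar>x\<bar> \<le> 1")
      case True
      then have "(1 + \<bar>x\<bar>) ^ k \<le> 2 ^ k" by (intro power_mono) auto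
      also have "\<dots> \<le> 2 ^ k * (1 + x ^ (2 * k))" by (simp add: x2)
      finally show ?thesis .
    next
      case False
      have "1 * \<bar>x\<bar> \<le> \<bar>x\<bar> * \<bar>x\<bar>" using False by (intro mult_right_mono) auto
      then have "\<bar>x\<bar> \<le> x\<^sup>2" by (simp add: power2_eq_square)
      then have "1 + \<bar>x\<bar> \<le> 2 * x\<^sup>2" using False by linarith
      then have "(1 + \<bar>x\<bar>) ^ k \<le> (2 * x\<^sup>2) ^ k" by (intro power_mono) auto
      also have "\<dots> = 2 ^ k * x ^ (2 * k)" by (simp add: power_mult_distrib x2)
      also have "\<dots> \<le> 2 ^ k * (1 + x ^ (2 * k))" by simp
      finally show ?thesis .
    qed
    moreover have "0 \<le> x ^ (2 * k)" by (simp add: x2)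
    ultimately show "norm ((1 + \<bar>x\<bar>) ^ k) \<le> norm (2 ^ k * (1 + x ^ (2 * k)))" by simp
  qed
qed

lemma vert_prod_integrable: "integrable vert_law (\<lambda>x. vert_prod x ^ k)"
proof -
  interpret product_sigma_finite "\<lambda>_. \<nu>"
    by (simp add: product_sigma_finite_def prob_space_imp_sigma_finite nu_prob)
  have "integrable vert_law (\<lambda>x. \<Prod>v\<in>vverts G. (1 + \<bar>x v\<bar>) ^ k)"
    by (rule product_integrable_prod[OF finVW(2), of "\<lambda>_ x. (1 + \<bar>x\<bar>) ^ k"]) (rule abs_moments)
  then show ?thesis by (simp add: vert_prod_def prod_power_distrib)
qed

lemma vert_prod_ge_1: "vert_prod x \<ge> 1" and edge_prod_ge_1: "edge_prod \<gamma> \<ge> 1"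
  unfolding vert_prod_def edge_prod_def by (auto intro!: prod_ge_1)

text \<open>With \<open>s\<close> and \<open>t\<close> the sums of the moduli of frequencies and of
  vertex variables, \<open>1 + s * t \<le> (1 + s) * (1 + t)\<close>, and each factor is at most the
  corresponding weight.\<close>

lemma lin_bound: "1 + \<bar>lin G \<gamma> w x\<bar> \<le> edge_prod \<gamma> * vert_prod x"
proof -
  define s where "s = (\<Sum>e\<in>eidx G. \<bar>\<gamma> e\<bar>)"
  define t where "t = (\<Sum>v\<in>vverts G. \<bar>x v\<bar>)"
  have s0: "s \<ge> 0" and t0: "t \<ge> 0" unfolding s_def t_def by (auto intro!: sum_nonneg)
  have "\<bar>lin G \<gamma> w x\<bar> \<le> (\<Sum>v | (w, v) \<in> edges G. \<bar>(\<Sum>i=1..mult G w v. \<gamma> (w, v, i)) * x v\<bar>)"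
    unfolding lin_def by (rule sum_abs)
  also have "\<dots> \<le> (\<Sum>v | (w, v) \<in> edges G. s * \<bar>x v\<bar>)"
  proof (rule sum_mono)
    fix v assume v: "v \<in> {v. (w, v) \<in> edges G}"
    have "\<bar>\<Sum>i=1..mult G w v. \<gamma> (w, v, i)\<bar> \<le> (\<Sum>i=1..mult G w v. \<bar>\<gamma> (w, v, i)\<bar>)" by (rule sum_abs)
    also have "\<dots> = (\<Sum>e\<in>(\<lambda>i. (w, v, i)) ` {1..mult G w v}. \<bar>\<gamma> e\<bar>)"
      by (subst sum.reindex) (auto simp: inj_on_def)
    also have "\<dots> \<le> s"
      unfolding s_def by (rule sum_mono2[OF finI]) (use v in \<open>auto simp: eidx_def\<close>)
    finally show "\<bar>(\<Sum>i=1..mult G w v. \<gamma> (w, v, i)) * x v\<bar> \<le> s * \<bar>x v\<bar>"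
      by (simp add: abs_mult mult_right_mono)
  qed
  also have "\<dots> \<le> (\<Sum>v\<in>vverts G. s * \<bar>x v\<bar>)"
    by (rule sum_mono2[OF finVW(2)]) (use s0 in \<open>auto simp: edges_def\<close>)
  also have "\<dots> = s * t" by (simp add: t_def sum_distrib_left)
  finally have "1 + \<bar>lin G \<gamma> w x\<bar> \<le> 1 + s * t" by simp
  also have "\<dots> \<le> (1 + s) * (1 + t)" using s0 t0 by (simp add: algebra_simps)
  also have "\<dots> \<le> edge_prod \<gamma> * vert_prod x"
    unfolding edge_prod_def vert_prod_def s_def t_def
    by (intro mult_mono one_plus_sum_le_prod finI finVW) (auto intro!: prod_nonneg add_nonneg_nonneg sum_nonneg)
  finally show ?thesis .
qed

lemma prod_u_bound:
  assumes u: "growth u K"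
  shows "\<bar>\<Prod>w\<in>A. u (lin G \<gamma> w x)\<bar> \<le> K ^ card A * edge_prod \<gamma> ^ (2 * card A) * vert_prod x ^ (2 * card A)"
proof -
  have "\<bar>\<Prod>w\<in>A. u (lin G \<gamma> w x)\<bar> = (\<Prod>w\<in>A. \<bar>u (lin G \<gamma> w x)\<bar>)" by (rule abs_prod)
  also have "\<dots> \<le> (\<Prod>w\<in>A. K * (edge_prod \<gamma> * vert_prod x)\<^sup>2)"
  proof (rule prod_mono)
    fix w
    have "\<bar>u (lin G \<gamma> w x)\<bar> \<le> K * (1 + \<bar>lin G \<gamma> w x\<bar>)\<^sup>2" using u by (simp add: growth_def)
    also have "\<dots> \<le> K * (edge_prod \<gamma> * vert_prod x)\<^sup>2"
      using growth_nonneg[OF u] by (intro mult_left_mono power_mono lin_bound) auto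
    finally show "0 \<le> \<bar>u (lin G \<gamma> w x)\<bar> \<and> \<bar>u (lin G \<gamma> w x)\<bar> \<le> K * (edge_prod \<gamma> * vert_prod x)\<^sup>2" by simp
  qed
  also have "\<dots> = K ^ card A * edge_prod \<gamma> ^ (2 * card A) * vert_prod x ^ (2 * card A)"
    by (simp add: power_mult_distrib power_mult)
  finally show ?thesis .
qed

lemma lin_measurable_x [measurable]: "lin G \<gamma> w \<in> borel_measurable vert_law"
  by (rule lin_measurable_snd[OF fin nu_sets])

lemma prod_u_integrable:
  assumes u: "growth u K"
  shows "integrable vert_law (\<lambda>x. \<Prod>w\<in>A. u (lin G \<gamma> w x))"
proof (rule Bochner_Integration.integrable_bound)
  have [measurable]: "u \<in> borel_measurable borel" using u by (simp add: growth_def)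
  show "integrable vert_law (\<lambda>x. K ^ card A * edge_prod \<gamma> ^ (2 * card A) * vert_prod x ^ (2 * card A))"
    by (intro integrable_mult_right vert_prod_integrable)
  show "(\<lambda>x. \<Prod>w\<in>A. u (lin G \<gamma> w x)) \<in> borel_measurable vert_law" by measurable
  show "AE x in vert_law. norm (\<Prod>w\<in>A. u (lin G \<gamma> w x)) \<le> norm (K ^ card A * edge_prod \<gamma> ^ (2 * card A) * vert_prod x ^ (2 * card A))"
  proof (intro AE_I2)
    fix x
    show "norm (\<Prod>w\<in>A. u (lin G \<gamma> w x)) \<le> norm (K ^ card A * edge_prod \<gamma> ^ (2 * card A) * vert_prod x ^ (2 * card A))"
      unfolding real_norm_def using prod_u_bound[OF u, of \<gamma> x A] by (rule order_trans) (rule abs_ge_self)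
  qed
qed

definition mom_const :: "real \<Rightarrow> nat \<Rightarrow> real" where
  "mom_const K k = K ^ k * (\<integral>x. vert_prod x ^ (2 * k) \<partial>vert_law)"

lemma mom_const_nonneg: "K \<ge> 0 \<Longrightarrow> mom_const K k \<ge> 0"
  unfolding mom_const_def using vert_prod_ge_1 by (intro mult_nonneg_nonneg integral_nonneg_AE AE_I2) (auto intro: order_trans[OF zero_le_one])

lemma mom_bound:
  assumes u: "growth u K"
  shows "\<bar>mom u A \<gamma>\<bar> \<le> mom_const K (card A) * edge_prod \<gamma> ^ (2 * card A)"
proof -
  have "\<bar>mom u A \<gamma>\<bar> \<le> (\<integral>x. \<bar>\<Prod>w\<in>A. u (lin G \<gamma> w x)\<bar> \<partial>vert_law)"
    unfolding mom_def by (rule integral_abs_bound)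
  also have "\<dots> \<le> (\<integral>x. K ^ card A * edge_prod \<gamma> ^ (2 * card A) * vert_prod x ^ (2 * card A) \<partial>vert_law)"
    by (intro integral_mono integrable_abs prod_u_integrable[OF u] prod_u_bound[OF u] integrable_mult_right vert_prod_integrable)
  also have "\<dots> = mom_const K (card A) * edge_prod \<gamma> ^ (2 * card A)" by (simp add: mom_const_def mult_ac)
  finally show ?thesis .
qed

lemma mom_empty [simp]: "mom u {} \<gamma> = 1"
  unfolding mom_def by (simp add: prob_space.prob_space[OF vert_law_prob])

lemma mom_measurable [measurable]:
  assumes [measurable]: "u \<in> borel_measurable borel"
  shows "mom u A \<in> borel_measurable edge_lborel"
proof -
  interpret prob_space vert_law by (rule vert_law_prob)
  note [measurable] = lin_measurable[OF fin nu_sets]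
  have "(\<lambda>z. \<Prod>w\<in>A. u (lin G (fst z) w (snd z))) \<in> borel_measurable (edge_lborel \<Otimes>\<^sub>M vert_law)" by measurable
  then have "(\<lambda>\<gamma>. \<integral>x. (\<Prod>w\<in>A. u (lin G \<gamma> w x)) \<partial>vert_law) \<in> borel_measurable edge_lborel"
    by (intro borel_measurable_lebesgue_integral) (simp add: split_beta')
  then show ?thesis unfolding mom_def .
qed

lemma hat_prod_measurable [measurable]: "hat_prod \<in> borel_measurable edge_lborel"
  unfolding hat_prod_def by (rule fourier_prod_measurable[OF f])

lemma hat_prod_edge_prod_integrable: "integrable edge_lborel (\<lambda>\<gamma>. norm (hat_prod \<gamma>) * edge_prod \<gamma> ^ k)"
  using fourier_prod_integrable[OF finI f, of k]
  by (simp add: hat_prod_def edge_prod_def prod_norm prod.distrib prod_power_distrib)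

lemma hat_prod_integrable:
  assumes [measurable]: "H \<in> borel_measurable edge_lborel" and bnd: "\<And>\<gamma>. \<bar>H \<gamma>\<bar> \<le> C * edge_prod \<gamma> ^ k"
  shows "integrable edge_lborel (\<lambda>\<gamma>. hat_prod \<gamma> * of_real (H \<gamma>))"
proof (rule Bochner_Integration.integrable_bound)
  show "integrable edge_lborel (\<lambda>\<gamma>. C * (norm (hat_prod \<gamma>) * edge_prod \<gamma> ^ k))"
    by (rule integrable_mult_right[OF hat_prod_edge_prod_integrable])
  show "AE \<gamma> in edge_lborel. norm (hat_prod \<gamma> * of_real (H \<gamma>)) \<le> norm (C * (norm (hat_prod \<gamma>) * edge_prod \<gamma> ^ k))"
  proof (intro AE_I2)
    fix \<gamma>
    have "norm (hat_prod \<gamma> * of_real (H \<gamma>)) = norm (hat_prod \<gamma>) * \<bar>H \<gamma>\<bar>" by (simp add: norm_mult)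
    also have "\<dots> \<le> norm (hat_prod \<gamma>) * (C * edge_prod \<gamma> ^ k)" by (intro mult_left_mono bnd) auto
    also have "\<dots> \<le> norm (C * (norm (hat_prod \<gamma>) * edge_prod \<gamma> ^ k))" by (simp add: mult_ac)
    finally show "norm (hat_prod \<gamma> * of_real (H \<gamma>)) \<le> norm (C * (norm (hat_prod \<gamma>) * edge_prod \<gamma> ^ k))" .
  qed
qed measurable

text \<open>Dominated convergence in the frequencies: any fixed power of \<open>edge_prod\<close>
  remains integrable against the rapidly decaying \<open>hat_prod\<close>.\<close>

lemma hat_prod_dominated:
  assumes [measurable]: "\<And>n. H n \<in> borel_measurable edge_lborel" "H0 \<in> borel_measurable edge_lborel"
    and bnd: "\<And>n \<gamma>. \<bar>H n \<gamma>\<bar> \<le> C * edge_prod \<gamma> ^ k" and lim: "\<And>\<gamma>. (\<lambda>n :: nat. H n \<gamma>) \<longlonglongrightarrow> H0 \<gamma>"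
  shows "(\<lambda>n. \<integral>\<gamma>. hat_prod \<gamma> * of_real (H n \<gamma>) \<partial>edge_lborel) \<longlonglongrightarrow> (\<integral>\<gamma>. hat_prod \<gamma> * of_real (H0 \<gamma>) \<partial>edge_lborel)"
proof (rule integral_dominated_convergence)
  show "integrable edge_lborel (\<lambda>\<gamma>. C * (norm (hat_prod \<gamma>) * edge_prod \<gamma> ^ k))"
    by (rule integrable_mult_right[OF hat_prod_edge_prod_integrable])
  show "AE \<gamma> in edge_lborel. (\<lambda>n. hat_prod \<gamma> * of_real (H n \<gamma>)) \<longlonglongrightarrow> hat_prod \<gamma> * of_real (H0 \<gamma>)"
    by (intro AE_I2 tendsto_intros lim)
  show "AE \<gamma> in edge_lborel. norm (hat_prod \<gamma> * of_real (H n \<gamma>)) \<le> C * (norm (hat_prod \<gamma>) * edge_prod \<gamma> ^ k)" for n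
  proof (intro AE_I2)
    fix \<gamma>
    have "norm (hat_prod \<gamma> * of_real (H n \<gamma>)) = norm (hat_prod \<gamma>) * \<bar>H n \<gamma>\<bar>" by (simp add: norm_mult)
    also have "\<dots> \<le> norm (hat_prod \<gamma>) * (C * edge_prod \<gamma> ^ k)" by (intro mult_left_mono bnd) auto
    finally show "norm (hat_prod \<gamma> * of_real (H n \<gamma>)) \<le> C * (norm (hat_prod \<gamma>) * edge_prod \<gamma> ^ k)" by (simp add: mult_ac)
  qed
qed measurable

text \<open>Dominated convergence in the vertex variables at fixed frequencies. The majorant is a
  power of \<open>vert_prod\<close>, integrable because all moments of the entries of X are
  finite.\<close>

lemma mom_tendsto:
  assumes u: "\<And>n. growth (u n) K" and lim: "\<And>t. (\<lambda>n :: nat. u n t) \<longlonglongrightarrow> u0 t" and u0: "u0 \<in> borel_measurable borel"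
  shows "(\<lambda>n. mom (u n) A \<gamma>) \<longlonglongrightarrow> mom u0 A \<gamma>"
  unfolding mom_def
proof (rule integral_dominated_convergence)
  have [measurable]: "u n \<in> borel_measurable borel" for n using u by (simp add: growth_def)
  note [measurable] = u0
  show "integrable vert_law (\<lambda>x. K ^ card A * edge_prod \<gamma> ^ (2 * card A) * vert_prod x ^ (2 * card A))"
    by (intro integrable_mult_right vert_prod_integrable)
  show "(\<lambda>x. \<Prod>w\<in>A. u n (lin G \<gamma> w x)) \<in> borel_measurable vert_law"
    "(\<lambda>x. \<Prod>w\<in>A. u0 (lin G \<gamma> w x)) \<in> borel_measurable vert_law" for n by measurable
  show "AE x in vert_law. (\<lambda>n. \<Prod>w\<in>A. u n (lin G \<gamma> w x)) \<longlonglongrightarrow> (\<Prod>w\<in>A. u0 (lin G \<gamma> w x))"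
    by (intro AE_I2 tendsto_prod lim)
  show "AE x in vert_law. norm (\<Prod>w\<in>A. u n (lin G \<gamma> w x)) \<le> K ^ card A * edge_prod \<gamma> ^ (2 * card A) * vert_prod x ^ (2 * card A)" for n
    unfolding real_norm_def by (intro AE_I2 prod_u_bound u)
qed

section \<open>Sign flips of frequencies\<close>

definition eset :: "'v \<Rightarrow> 'w set \<Rightarrow> ('w \<times> 'v \<times> nat) set" where
  "eset v U = {e \<in> eidx G. fst e \<in> U \<and> fst (snd e) = v}"

definition wset :: "'w \<Rightarrow> ('w \<times> 'v \<times> nat) set" where
  "wset w = {e \<in> eidx G. fst e = w}"

lemma card_eset:
  assumes "U \<subseteq> wverts G" "v \<in> vverts G"
  shows "card (eset v U) = (\<Sum>w\<in>U. mult G w v)"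
proof -
  have "bij_betw (\<lambda>(w, i). (w, v, i)) (SIGMA w:U. {1..mult G w v}) (eset v U)"
    by (rule bij_betwI[where g = "\<lambda>(w, v, i). (w, i)"]) (use assms in \<open>auto simp: eset_def eidx_def edges_def\<close>)
  then have "card (eset v U) = card (SIGMA w:U. {1..mult G w v})" by (simp add: bij_betw_same_card)
  also have "\<dots> = (\<Sum>w\<in>U. mult G w v)"
    using finite_subset[OF assms(1) finVW(1)] by (subst card_SigmaI) auto
  finally show ?thesis .
qed

lemma card_wset:
  assumes "w \<in> wverts G"
  shows "card (wset w) = wdeg G w"
proof -
  have "bij_betw (\<lambda>(v, i). (w, v, i)) (SIGMA v:vverts G. {1..mult G w v}) (wset w)"
    by (rule bij_betwI[where g = "\<lambda>(w, v, i). (v, i)"]) (use assms in \<open>auto simp: wset_def eidx_def edges_def\<close>)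
  then have "card (wset w) = card (SIGMA v:vverts G. {1..mult G w v})" by (simp add: bij_betw_same_card)
  also have "\<dots> = wdeg G w"
    unfolding wdeg_def using finVW(2) by (subst card_SigmaI) auto
  finally show ?thesis .
qed

lemma lin_flip_wset: "lin G (flip (wset w0) \<gamma>) w x = (if w = w0 then - lin G \<gamma> w x else lin G \<gamma> w x)"
proof -
  have "(\<Sum>i=1..mult G w v. flip (wset w0) \<gamma> (w, v, i)) = (if w = w0 then - (\<Sum>i=1..mult G w v. \<gamma> (w, v, i)) else (\<Sum>i=1..mult G w v. \<gamma> (w, v, i)))"
    if "(w, v) \<in> edges G" for v
    using that by (auto simp: flip_def wset_def eidx_def sum_negf[symmetric] intro!: sum.cong)
  then have "lin G (flip (wset w0) \<gamma>) w x = (\<Sum>v | (w, v) \<in> edges G. (if w = w0 then - 1 else 1) * ((\<Sum>i=1..mult G w v. \<gamma> (w, v, i)) * x v))"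
    unfolding lin_def by (intro sum.cong) auto
  also have "\<dots> = (if w = w0 then - 1 else 1) * lin G \<gamma> w x"
    unfolding lin_def by (rule sum_distrib_left[symmetric])
  finally show ?thesis by simp
qed

text \<open>Frequencies on edges at \<open>v\<close> occur only multiplied by \<open>x v\<close>, so
  their sign can be passed on to \<open>x v\<close>, separately for the W-vertices inside and
  outside \<open>U\<close>.\<close>

lemma lin_flip_eset: "lin G (flip (eset v U) \<gamma>) w x = (if w \<in> U then lin G \<gamma> w (flip {v} x) else lin G \<gamma> w x)"
proof -
  have "(\<Sum>i=1..mult G w v'. flip (eset v U) \<gamma> (w, v', i)) = (if w \<in> U \<and> v' = v then - (\<Sum>i=1..mult G w v'. \<gamma> (w, v', i)) else (\<Sum>i=1..mult G w v'. \<gamma> (w, v', i)))"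
    if "(w, v') \<in> edges G" for v'
    using that by (auto simp: flip_def eset_def eidx_def sum_negf[symmetric] intro!: sum.cong)
  then show ?thesis unfolding lin_def by (auto simp: flip_def intro!: sum.cong)
qed

lemma lin_flip_nonadjacent: "v \<notin> nbs G w \<Longrightarrow> lin G \<gamma> w (flip {v} x) = lin G \<gamma> w x"
  unfolding lin_def by (auto simp: flip_def nbs_def edges_def intro!: sum.cong)

lemma mom_flip_wset:
  assumes "\<And>t. u (- t) = u t"
  shows "mom u A (flip (wset w) \<gamma>) = mom u A \<gamma>"
  unfolding mom_def lin_flip_wset using assms by (auto intro!: Bochner_Integration.integral_cong prod.cong)

text \<open>If all neighbours of \<open>v\<close> in \<open>A\<close> lie in \<open>U\<close>, the
  flip is a reflection of the variable \<open>x v\<close>, under which its symmetric law is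
  invariant. If none does, the moment does not see the flipped frequencies.\<close>

lemma mom_flip_eset:
  assumes [measurable]: "u \<in> borel_measurable borel" and v: "v \<in> vverts G"
    and A: "{w \<in> A. v \<in> nbs G w} \<subseteq> U \<or> {w \<in> A. v \<in> nbs G w} \<inter> U = {}"
  shows "mom u A (flip (eset v U) \<gamma>) = mom u A \<gamma>"
  using A
proof
  assume sub: "{w \<in> A. v \<in> nbs G w} \<subseteq> U"
  have "lin G (flip (eset v U) \<gamma>) w x = lin G \<gamma> w (flip {v} x)" if "w \<in> A" for w x
  proof -
    have "w \<in> U \<or> v \<notin> nbs G w" using that sub by blast
    then show ?thesis using lin_flip_nonadjacent[of v w \<gamma> x] by (cases "w \<in> U") (simp_all add: lin_flip_eset)
  qed
  then have "mom u A (flip (eset v U) \<gamma>) = (\<integral>x. (\<Prod>w\<in>A. u (lin G \<gamma> w (flip {v} x))) \<partial>vert_law)"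
    unfolding mom_def by (auto intro!: Bochner_Integration.integral_cong prod.cong)
  also have "\<dots> = mom u A \<gamma>"
    unfolding mom_def
  proof (rule integral_PiM_flip[where g = "\<lambda>x. \<Prod>w\<in>A. u (lin G \<gamma> w x)"])
    show "sigma_finite_measure \<nu>" by (rule prob_space_imp_sigma_finite[OF nu_prob])
    show "distr \<nu> borel uminus = \<nu>" using sym by (simp add: symmetric_law_def)
    show "(\<lambda>x. \<Prod>w\<in>A. u (lin G \<gamma> w x)) \<in> borel_measurable vert_law" by measurable
  qed (use v finVW nu_sets in auto)
  finally show ?thesis .
next
  assume dis: "{w \<in> A. v \<in> nbs G w} \<inter> U = {}"
  have "lin G (flip (eset v U) \<gamma>) w x = lin G \<gamma> w x" if "w \<in> A" for w x
    using that dis lin_flip_nonadjacent[of v w \<gamma> x] by (auto simp: lin_flip_eset)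
  then show ?thesis
    unfolding mom_def by (auto intro!: Bochner_Integration.integral_cong prod.cong)
qed

lemma hat_prod_flip: "S \<subseteq> eidx G \<Longrightarrow> hat_prod (flip S \<gamma>) = (- 1) ^ card S * hat_prod \<gamma>"
proof -
  assume S: "S \<subseteq> eidx G"
  have "hat_prod (flip S \<gamma>) = (\<Prod>e\<in>eidx G. (if e \<in> S then - 1 else 1) * fourier f (\<gamma> e))"
    unfolding hat_prod_def by (rule prod.cong) (auto simp: flip_def fourier_uminus[where f = f, OF f_odd])
  also have "\<dots> = (\<Prod>e\<in>eidx G. if e \<in> S then - 1 else 1) * hat_prod \<gamma>"
    by (simp add: prod.distrib hat_prod_def)
  also have "(\<Prod>e\<in>eidx G. if e \<in> S then - 1 else (1 :: complex)) = (- 1) ^ card S"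
  proof -
    have "eidx G \<inter> {e. e \<in> S} = S" using S by auto
    then show ?thesis using finI by (simp add: prod.If_cases)
  qed
  finally show ?thesis .
qed

text \<open>The substitution \<open>flip S\<close> preserves Lebesgue measure and reverses the sign
  of the integrand.\<close>

lemma hat_prod_zero_flip:
  assumes S: "S \<subseteq> eidx G" "odd (card S)" and H: "H \<in> borel_measurable edge_lborel" "\<And>\<gamma>. H (flip S \<gamma>) = H \<gamma>"
  shows "(\<integral>\<gamma>. hat_prod \<gamma> * of_real (H \<gamma>) \<partial>edge_lborel) = 0"
proof -
  note [measurable] = H(1)
  have "(\<integral>\<gamma>. hat_prod (flip S \<gamma>) * of_real (H (flip S \<gamma>)) \<partial>edge_lborel) = (\<integral>\<gamma>. hat_prod \<gamma> * of_real (H \<gamma>) \<partial>edge_lborel)"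
    by (rule integral_PiM_flip[where g = "\<lambda>\<gamma>. hat_prod \<gamma> * of_real (H \<gamma>)"])
      (use finI S in \<open>auto simp: sigma_finite_lborel lborel_distr_uminus\<close>)
  moreover have "hat_prod (flip S \<gamma>) * of_real (H (flip S \<gamma>)) = - (hat_prod \<gamma> * of_real (H \<gamma>))" for \<gamma>
    using hat_prod_flip[OF S(1)] S(2) H(2) by simp
  ultimately show ?thesis by simp
qed

text \<open>Flipping the sign of the frequencies in \<open>eset v U\<close> or in \<open>wset w\<close> preserves the moments occurring in
  \<open>H\<close>, but multiplies the odd function \<open>hat_prod\<close> by \<open>- 1\<close> whenever the number of flipped frequencies
  is odd.\<close>

lemma hat_prod_zero:
  assumes u: "u \<in> borel_measurable borel" "\<And>t. u (- t) = u t" and H: "H \<in> borel_measurable edge_lborel"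
    and dep: "\<And>S \<gamma>. (\<And>A. A \<in> \<D> \<or> (\<exists>w. A = {w}) \<Longrightarrow> mom u A (flip S \<gamma>) = mom u A \<gamma>) \<Longrightarrow> H (flip S \<gamma>) = H \<gamma>"
    and bad: "\<not> parity_ok G \<D> \<or> (\<exists>w\<in>wverts G. odd (wdeg G w))"
  shows "(\<integral>\<gamma>. hat_prod \<gamma> * of_real (H \<gamma>) \<partial>edge_lborel) = 0"
  using bad
proof
  assume "\<exists>w\<in>wverts G. odd (wdeg G w)"
  then obtain w where w: "w \<in> wverts G" "odd (wdeg G w)" by blast
  show ?thesis
  proof (rule hat_prod_zero_flip[of "wset w"])
    show "wset w \<subseteq> eidx G" by (auto simp: wset_def)
    show "odd (card (wset w))" using w by (simp add: card_wset)
    show "H (flip (wset w) \<gamma>) = H \<gamma>" for \<gamma> by (rule dep) (rule mom_flip_wset, rule u(2))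
  qed (rule H)
next
  assume "\<not> parity_ok G \<D>"
  then have "\<exists>v U. (U \<subseteq> wverts G \<and>
      (\<forall>A\<in>\<D>. {w \<in> A. v \<in> nbs G w} \<subseteq> U \<or> {w \<in> A. v \<in> nbs G w} \<inter> U = {})) \<and> odd (\<Sum>w\<in>U. mult G w v)"
    unfolding parity_ok_def by (simp only: not_all not_imp simp_thms)
  then obtain v U where U: "U \<subseteq> wverts G"
    and A: "\<forall>A\<in>\<D>. {w \<in> A. v \<in> nbs G w} \<subseteq> U \<or> {w \<in> A. v \<in> nbs G w} \<inter> U = {}"
    and odd: "odd (\<Sum>w\<in>U. mult G w v)"
    by (elim exE conjE)
  have v: "v \<in> vverts G"
  proof (rule ccontr)
    assume "v \<notin> vverts G"
    then have "mult G w v = 0" for w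
      using fin unfolding finite_bigraph_def by (metis One_nat_def less_one linorder_not_le)
    then show False using odd by simp
  qed
  show ?thesis
  proof (rule hat_prod_zero_flip[of "eset v U"])
    show "eset v U \<subseteq> eidx G" by (auto simp: eset_def)
    show "odd (card (eset v U))" using odd by (simp add: card_eset[OF U v])
    show "H (flip (eset v U) \<gamma>) = H \<gamma>" for \<gamma>
    proof (rule dep)
      fix A assume "A \<in> \<D> \<or> (\<exists>w. A = {w})"
      then have "{w \<in> A. v \<in> nbs G w} \<subseteq> U \<or> {w \<in> A. v \<in> nbs G w} \<inter> U = {}"
      proof
        assume "\<exists>w. A = {w}"
        then show ?thesis by auto
      qed (use A in blast)
      then show "mom u A (flip (eset v U) \<gamma>) = mom u A \<gamma>" by (rule mom_flip_eset[OF u(1) v])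
    qed
  qed (rule H)
qed

end

section \<open>Truncated expansion of the n-th power and its asymptotics\<close>

section \<open>Expansion of the oscillatory integral\<close>

text \<open>Pascal's rule for truncated sums: multiplication by \<open>P + R\<close> yields the sum
  for \<open>Suc n\<close> plus the single term that crosses the cutoff \<open>J\<close>.\<close>

lemma binomial_truncation_step:
  fixes P R :: real
  shows "(\<Sum>j\<le>J. real (Suc n choose j) * P ^ (Suc n - j) * R ^ j)
    = (P + R) * (\<Sum>j\<le>J. real (n choose j) * P ^ (n - j) * R ^ j) - real (n choose J) * P ^ (n - J) * R ^ Suc J"
proof (induction J)
  case 0
  show ?case by (simp add: algebra_simps)
next
  case (Suc J)
  have c: "real (n choose Suc J) * (P * P ^ (n - Suc J)) = real (n choose Suc J) * P ^ (n - J)"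
  proof (cases "Suc J \<le> n")
    case True
    then have "n - J = Suc (n - Suc J)" by simp
    then show ?thesis by simp
  qed (simp add: binomial_eq_0)
  have "(\<Sum>j\<le>Suc J. real (Suc n choose j) * P ^ (Suc n - j) * R ^ j)
      = (P + R) * (\<Sum>j\<le>J. real (n choose j) * P ^ (n - j) * R ^ j) - real (n choose J) * P ^ (n - J) * R ^ Suc J
        + real (Suc n choose Suc J) * P ^ (n - J) * R ^ Suc J"
    by (simp add: Suc.IH)
  also have "\<dots> = (P + R) * (\<Sum>j\<le>J. real (n choose j) * P ^ (n - j) * R ^ j)
        + (real (n choose Suc J) * P ^ (n - J)) * R ^ Suc J"
    by (simp add: algebra_simps)
  also have "\<dots> = (P + R) * (\<Sum>j\<le>J. real (n choose j) * P ^ (n - j) * R ^ j)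
        + (real (n choose Suc J) * (P * P ^ (n - Suc J))) * R ^ Suc J"
    by (simp only: c)
  also have "\<dots> = (P + R) * (\<Sum>j\<le>Suc J. real (n choose j) * P ^ (n - j) * R ^ j)
        - real (n choose Suc J) * P ^ (n - Suc J) * R ^ Suc (Suc J)"
    by (simp add: algebra_simps)
  finally show ?case .
qed

text \<open>A Taylor remainder bound. Since \<open>P\<close> and \<open>P + R\<close> lie in [0, 1],
  earlier errors are not amplified, and the errors of the successive steps add up by Pascal's rule
  to one binomial coefficient.\<close>

lemma binomial_truncation:
  fixes P R :: real
  assumes "0 \<le> P" "P \<le> 1" "0 \<le> P + R" "P + R \<le> 1"
  shows "\<bar>(P + R) ^ n - (\<Sum>j\<le>J. real (n choose j) * P ^ (n - j) * R ^ j)\<bar> \<le> real (n choose Suc J) * \<bar>R\<bar> ^ Suc J"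
proof (induction n)
  case 0
  have "(\<Sum>j\<le>J. real (0 choose j) * P ^ (0 - j) * R ^ j) = (\<Sum>j\<in>{0}. real (0 choose j) * P ^ (0 - j) * R ^ j)"
    by (rule sum.mono_neutral_right) auto
  then show ?case by simp
next
  case (Suc n)
  let ?S = "\<Sum>j\<le>J. real (n choose j) * P ^ (n - j) * R ^ j"
  have "\<bar>(P + R) ^ Suc n - (\<Sum>j\<le>J. real (Suc n choose j) * P ^ (Suc n - j) * R ^ j)\<bar>
      = \<bar>(P + R) * ((P + R) ^ n - ?S) + real (n choose J) * P ^ (n - J) * R ^ Suc J\<bar>"
    unfolding binomial_truncation_step by (simp add: algebra_simps)
  also have "\<dots> \<le> \<bar>P + R\<bar> * \<bar>(P + R) ^ n - ?S\<bar> + real (n choose J) * P ^ (n - J) * \<bar>R\<bar> ^ Suc J"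
    using abs_triangle_ineq[of "(P + R) * ((P + R) ^ n - ?S)" "real (n choose J) * P ^ (n - J) * R ^ Suc J"] assms(1)
    by (simp add: abs_mult power_abs)
  also have "\<dots> \<le> 1 * (real (n choose Suc J) * \<bar>R\<bar> ^ Suc J) + real (n choose J) * 1 * \<bar>R\<bar> ^ Suc J"
    using assms Suc.IH by (intro add_mono mult_mono) (auto intro: power_le_one)
  also have "\<dots> = real (Suc n choose Suc J) * \<bar>R\<bar> ^ Suc J" by (simp add: algebra_simps)
  finally show ?case .
qed

text \<open>Expanding over lists avoids multinomial coefficients; the orderings of a family are
  counted only at the end.\<close>

lemma sum_power_lists:
  fixes F :: "'a \<Rightarrow> 'b :: comm_semiring_1"
  assumes "finite A"
  shows "(\<Sum>a\<in>A. F a) ^ j = (\<Sum>xs | set xs \<subseteq> A \<and> length xs = j. prod_list (map F xs))"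
proof (induction j)
  case (Suc j)
  let ?L = "{xs. set xs \<subseteq> A \<and> length xs = j}"
  have inj: "inj_on (\<lambda>(xs, n). n # xs) (?L \<times> A)" by (auto simp: inj_on_def)
  have "(\<Sum>xs | set xs \<subseteq> A \<and> length xs = Suc j. prod_list (map F xs))
      = (\<Sum>(xs, a)\<in>?L \<times> A. F a * prod_list (map F xs))"
    unfolding lists_length_Suc_eq by (subst sum.reindex[OF inj]) (simp add: split_beta)
  also have "\<dots> = (\<Sum>xs\<in>?L. \<Sum>a\<in>A. F a * prod_list (map F xs))"
    by (rule sum.cartesian_product[symmetric])
  also have "\<dots> = (\<Sum>a\<in>A. F a) * (\<Sum>xs\<in>?L. prod_list (map F xs))"
    by (simp add: sum_distrib_right sum_distrib_left)
  finally show ?case using Suc.IH by simp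
next
  case 0
  have "{xs. set xs \<subseteq> A \<and> length xs = 0} = {[]}" by auto
  then show ?case by simp
qed

lemma choose_over_power_tendsto: "(\<lambda>n. real (n choose j) / real n ^ j) \<longlonglongrightarrow> 1 / fact j"
proof -
  have "(\<lambda>n. (\<Prod>i\<in>{0..<j}. (real n - real i) / real n) / fact j) \<longlonglongrightarrow> (\<Prod>i\<in>{0..<j}. 1) / fact j"
  proof (intro tendsto_divide tendsto_prod tendsto_const)
    show "(\<lambda>n. (real n - real i) / real n) \<longlonglongrightarrow> 1" for i by real_asymp
  qed simp
  moreover have "real (n choose j) / real n ^ j = (\<Prod>i\<in>{0..<j}. (real n - real i) / real n) / fact j" for n
    by (simp add: binomial_gbinomial gbinomial_prod_rev prod_dividef)
  ultimately show ?thesis by simp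
qed

text \<open>For \<open>a < 1 / 2\<close> the logarithm \<open>ln (1 - a)\<close> lies between
  \<open>- a - 2 * a^2\<close> and \<open>- a\<close>, and \<open>n * (a n)^2\<close> tends to 0.
  The fixed shift \<open>j\<close> is the number of factors taken by the remainder in a binomial
  term.\<close>

lemma power_exp_limit:
  fixes a :: "nat \<Rightarrow> real"
  assumes a: "\<And>n. 0 \<le> a n" "\<And>n. a n \<le> 1" and lim: "(\<lambda>n. real n * a n) \<longlonglongrightarrow> l"
  shows "(\<lambda>n. (1 - a n) ^ (n - j)) \<longlonglongrightarrow> exp (- l)"
proof -
  have "(\<lambda>n. (real n * a n) * (1 / real n)) \<longlonglongrightarrow> l * 0"
    by (intro tendsto_mult lim) real_asymp
  moreover have "\<forall>\<^sub>F n in sequentially. (real n * a n) * (1 / real n) = a n"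
    using eventually_gt_at_top[of 0] by eventually_elim simp
  ultimately have a0: "a \<longlonglongrightarrow> 0" using Lim_transform_eventually by fastforce
  have na: "(\<lambda>n. real (n - j) * a n) \<longlonglongrightarrow> l"
  proof -
    have "(\<lambda>n. real n * a n - real j * a n) \<longlonglongrightarrow> l - real j * 0"
      by (intro tendsto_intros lim a0)
    moreover have "\<forall>\<^sub>F n in sequentially. real n * a n - real j * a n = real (n - j) * a n"
      using eventually_ge_at_top[of j] by eventually_elim (simp add: of_nat_diff algebra_simps)
    ultimately show ?thesis using Lim_transform_eventually by fastforce
  qed
  have "(\<lambda>n. real (n - j) * ln (1 - a n)) \<longlonglongrightarrow> - l"
  proof (rule tendsto_sandwich)
    have "(\<lambda>n. - (real (n - j) * a n) - 2 * ((real (n - j) * a n) * a n)) \<longlonglongrightarrow> - l - 2 * (l * 0)"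
      by (intro tendsto_intros na a0)
    then show "(\<lambda>n. - (real (n - j) * a n) - 2 * ((real (n - j) * a n) * a n)) \<longlonglongrightarrow> - l" by simp
    show "(\<lambda>n. - (real (n - j) * a n)) \<longlonglongrightarrow> - l" by (intro tendsto_intros na)
    have ev: "\<forall>\<^sub>F n in sequentially. a n < 1 / 2"
      using a0 by (rule order_tendstoD) simp
    then show "\<forall>\<^sub>F n in sequentially. - (real (n - j) * a n) - 2 * ((real (n - j) * a n) * a n) \<le> real (n - j) * ln (1 - a n)"
    proof eventually_elim
      case (elim n)
      have "- a n - 2 * (a n)\<^sup>2 \<le> ln (1 - a n)"
        using elim a by (intro ln_one_minus_pos_lower_bound) auto
      then have "real (n - j) * (- a n - 2 * (a n)\<^sup>2) \<le> real (n - j) * ln (1 - a n)"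
        by (intro mult_left_mono) auto
      then show ?case by (simp add: algebra_simps power2_eq_square)
    qed
    show "\<forall>\<^sub>F n in sequentially. real (n - j) * ln (1 - a n) \<le> - (real (n - j) * a n)"
      using ev
    proof eventually_elim
      case (elim n)
      have "ln (1 - a n) \<le> - a n"
        using elim a by (intro ln_one_minus_pos_upper_bound) (auto intro: less_trans)
      then have "real (n - j) * ln (1 - a n) \<le> real (n - j) * - a n"
        by (intro mult_left_mono) auto
      then show ?case by simp
    qed
  qed
  then have "(\<lambda>n. exp (real (n - j) * ln (1 - a n))) \<longlonglongrightarrow> exp (- l)" by (rule tendsto_exp)
  moreover have "\<forall>\<^sub>F n in sequentially. exp (real (n - j) * ln (1 - a n)) = (1 - a n) ^ (n - j)"
  proof -
    have "\<forall>\<^sub>F n in sequentially. a n < 1" using a0 by (rule order_tendstoD) simp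
    then show ?thesis by eventually_elim (simp add: exp_of_nat_mult)
  qed
  ultimately show ?thesis by (rule Lim_transform_eventually)
qed

lemma prod_list_abs_bound:
  fixes x C :: "'a set \<Rightarrow> real" and b :: real
  assumes "\<And>D. D \<in> set xs \<Longrightarrow> \<bar>x D\<bar> \<le> C D * b ^ (2 * card D)"
  shows "\<bar>prod_list (map x xs)\<bar> \<le> prod_list (map C xs) * b ^ (2 * sum_list (map card xs))"
  using assms
proof (induction xs)
  case (Cons D xs)
  have IH: "\<bar>prod_list (map x xs)\<bar> \<le> prod_list (map C xs) * b ^ (2 * sum_list (map card xs))"
    using Cons by simp
  have D: "\<bar>x D\<bar> \<le> C D * b ^ (2 * card D)" using Cons.prems by simp
  have "\<bar>prod_list (map x (D # xs))\<bar> = \<bar>x D\<bar> * \<bar>prod_list (map x xs)\<bar>" by (simp add: abs_mult)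
  also have "\<dots> \<le> (C D * b ^ (2 * card D)) * (prod_list (map C xs) * b ^ (2 * sum_list (map card xs)))"
    by (rule mult_mono[OF D IH order_trans[OF abs_ge_zero D] abs_ge_zero])
  also have "\<dots> = prod_list (map C (D # xs)) * b ^ (2 * sum_list (map card (D # xs)))"
    by (simp add: power_add algebra_simps)
  finally show ?case .
qed simp

text \<open>A repeated set is charged every time it occurs. That is what pushes lists with
  repetitions below the leading order.\<close>

definition list_cost :: "'a set list \<Rightarrow> nat" where
  "list_cost xs = (\<Sum>D\<leftarrow>xs. card D - 1)"

lemma cost_set_le_list_cost: "cost (set xs) \<le> list_cost xs"
proof (induction xs)
  case (Cons D xs)
  have "cost (set (D # xs)) \<le> (card D - 1) + cost (set xs)"
    unfolding cost_def by (cases "D \<in> set xs") (auto simp: insert_absorb)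
  then show ?case using Cons by (simp add: list_cost_def)
qed (simp add: cost_def list_cost_def)

lemma cost_set_less_list_cost:
  "\<not> distinct xs \<Longrightarrow> (\<And>D. D \<in> set xs \<Longrightarrow> card D \<ge> 2) \<Longrightarrow> cost (set xs) < list_cost xs"
proof (induction xs)
  case (Cons D xs)
  have D: "card D \<ge> 2" using Cons.prems by simp
  show ?case
  proof (cases "D \<in> set xs")
    case True
    then show ?thesis using cost_set_le_list_cost[of xs] D by (simp add: insert_absorb list_cost_def)
  next
    case False
    then have "cost (set xs) < list_cost xs" using Cons by auto
    then show ?thesis using False by (simp add: cost_def list_cost_def)
  qed
qed simp

lemma cost_set_eq_list_cost: "distinct xs \<Longrightarrow> cost (set xs) = list_cost xs"
  unfolding cost_def list_cost_def by (rule sum.distinct_set_conv_list)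

lemma sum_list_card_eq:
  "(\<And>D. D \<in> set xs \<Longrightarrow> card D \<ge> 1) \<Longrightarrow> sum_list (map card xs) = list_cost xs + length xs"
proof (induction xs)
  case (Cons D xs)
  then have "card D \<ge> 1" "sum_list (map card xs) = list_cost xs + length xs" by simp_all
  then show ?case by (simp add: list_cost_def)
qed (simp add: list_cost_def)

text \<open>Here \<open>q n\<close> stands for one minus the characteristic function of an entry of
  W, and \<open>\<Psi>\<close> for \<open>- \<Phi>\<close>. The locale collects the consequences of
  (A1) for W that the asymptotics use.\<close>

locale osc_limit = osc_setup G \<nu> f + connected_graph G
  for G :: "('w, 'v) bigraph" and \<nu> f +
  fixes q :: "nat \<Rightarrow> real \<Rightarrow> real" and \<Psi> :: "real \<Rightarrow> real" and K :: real
  assumes q_meas [measurable]: "\<And>n. q n \<in> borel_measurable borel"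
    and q_even: "\<And>n t. q n (- t) = q n t"
    and q_range: "\<And>n t. 0 \<le> q n t" "\<And>n t. q n t \<le> 1"
    and q_growth: "\<And>n t. real n * q n t \<le> K * (1 + \<bar>t\<bar>)\<^sup>2"
    and q_lim: "\<And>t. (\<lambda>n. real n * q n t) \<longlonglongrightarrow> \<Psi> t"
begin

lemma Psi_meas [measurable]: "\<Psi> \<in> borel_measurable borel"
  by (rule borel_measurable_LIMSEQ_metric[of "\<lambda>n t. real n * q n t"]) (use q_lim in auto)

lemma Psi_even: "\<Psi> (- t) = \<Psi> t"
  using LIMSEQ_unique[OF q_lim[of "- t"]] q_lim[of t] by (simp add: q_even)

lemma Psi_nonneg: "0 \<le> \<Psi> t"
  by (rule LIMSEQ_le_const[OF q_lim]) (use q_range in auto)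

lemma growth_q: "growth (\<lambda>t. real n * q n t) K"
  unfolding growth_def using q_growth q_range by (auto simp: abs_mult)

lemma growth_Psi: "growth \<Psi> K"
  unfolding growth_def
proof (intro conjI allI)
  fix t
  have "\<Psi> t \<le> K * (1 + \<bar>t\<bar>)\<^sup>2" by (rule LIMSEQ_le_const2[OF q_lim]) (use q_growth in auto)
  then show "\<bar>\<Psi> t\<bar> \<le> K * (1 + \<bar>t\<bar>)\<^sup>2" using Psi_nonneg by simp
qed measurable

lemma K_nonneg: "K \<ge> 0" by (rule growth_nonneg[OF growth_Psi])

text \<open>Signed deviation of a joint moment from the product of the single moments. It vanishes
  for sets with at most one element.\<close>

definition \<sigma> :: "(real \<Rightarrow> real) \<Rightarrow> 'w set \<Rightarrow> ('w \<times> 'v \<times> nat \<Rightarrow> real) \<Rightarrow> real" where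
  "\<sigma> u D \<gamma> = (- 1) ^ card D * (mom u D \<gamma> - (\<Prod>w\<in>D. mom u {w} \<gamma>))"

definition sigma_const :: "'w set \<Rightarrow> real" where
  "sigma_const D = mom_const K (card D) + mom_const K 1 ^ card D"

lemma sigma_const_nonneg: "sigma_const D \<ge> 0"
  unfolding sigma_const_def using mom_const_nonneg[OF K_nonneg] by simp

lemma sigma_meas [measurable]:
  assumes [measurable]: "u \<in> borel_measurable borel"
  shows "\<sigma> u D \<in> borel_measurable edge_lborel"
  unfolding \<sigma>_def by measurable

lemma mom_cmult: "mom (\<lambda>t. c * u t) A \<gamma> = c ^ card A * mom u A \<gamma>"
  unfolding mom_def by (simp add: prod.distrib)

lemma sigma_cmult: "\<sigma> (\<lambda>t. c * u t) D \<gamma> = c ^ card D * \<sigma> u D \<gamma>"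
  unfolding \<sigma>_def mom_cmult by (simp add: prod.distrib algebra_simps)

lemma prod_mom_bound:
  assumes u: "growth u K"
  shows "\<bar>\<Prod>w\<in>D. mom u {w} \<gamma>\<bar> \<le> mom_const K 1 ^ card D * edge_prod \<gamma> ^ (2 * card D)"
proof -
  have "\<bar>\<Prod>w\<in>D. mom u {w} \<gamma>\<bar> = (\<Prod>w\<in>D. \<bar>mom u {w} \<gamma>\<bar>)" by (rule abs_prod)
  also have "\<dots> \<le> (\<Prod>w\<in>D. mom_const K 1 * edge_prod \<gamma> ^ 2)"
    using mom_bound[OF u, of "{_}" \<gamma>] by (intro prod_mono) auto
  also have "\<dots> = mom_const K 1 ^ card D * edge_prod \<gamma> ^ (2 * card D)" by (simp add: power_mult_distrib power_mult)
  finally show ?thesis .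
qed

lemma sigma_bound:
  assumes u: "growth u K"
  shows "\<bar>\<sigma> u D \<gamma>\<bar> \<le> sigma_const D * edge_prod \<gamma> ^ (2 * card D)"
proof -
  have "\<bar>\<sigma> u D \<gamma>\<bar> = \<bar>mom u D \<gamma> - (\<Prod>w\<in>D. mom u {w} \<gamma>)\<bar>"
    by (simp add: \<sigma>_def abs_mult power_abs)
  also have "\<dots> \<le> \<bar>mom u D \<gamma>\<bar> + \<bar>\<Prod>w\<in>D. mom u {w} \<gamma>\<bar>" by (rule abs_triangle_ineq4)
  also have "\<dots> \<le> sigma_const D * edge_prod \<gamma> ^ (2 * card D)"
    using mom_bound[OF u, of D \<gamma>] prod_mom_bound[OF u, of \<gamma> D] by (simp add: sigma_const_def algebra_simps)
  finally show ?thesis .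
qed

lemma prod_q_range: "0 \<le> (\<Prod>w\<in>A. q n (t w))" "(\<Prod>w\<in>A. q n (t w)) \<le> 1"
  using q_range by (auto intro!: prod_nonneg prod_le_1)

lemma prod_q_integrable: "integrable vert_law (\<lambda>x. \<Prod>w\<in>A. q n (lin G \<gamma> w x))"
proof (rule finite_measure.integrable_const_bound[where B = 1])
  show "finite_measure vert_law" by (rule prob_space.finite_measure[OF vert_law_prob])
  show "AE x in vert_law. norm (\<Prod>w\<in>A. q n (lin G \<gamma> w x)) \<le> 1"
  proof (intro AE_I2)
    fix x
    show "norm (\<Prod>w\<in>A. q n (lin G \<gamma> w x)) \<le> 1"
      using prod_q_range[of n "\<lambda>w. lin G \<gamma> w x" A] by simp
  qed
qed measurable

lemma mom_q_range: "0 \<le> mom (q n) A \<gamma>" "mom (q n) A \<gamma> \<le> 1"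
proof -
  interpret prob_space vert_law by (rule vert_law_prob)
  show "0 \<le> mom (q n) A \<gamma>" unfolding mom_def using prod_q_range by (intro integral_nonneg_AE AE_I2)
  have "mom (q n) A \<gamma> \<le> (\<integral>x. 1 \<partial>vert_law)"
    unfolding mom_def by (intro integral_mono prod_q_integrable prod_q_range) simp
  then show "mom (q n) A \<gamma> \<le> 1" by (simp add: prob_space)
qed

definition mean_prod :: "nat \<Rightarrow> ('w \<times> 'v \<times> nat \<Rightarrow> real) \<Rightarrow> real" where
  "mean_prod n \<gamma> = (\<Prod>w\<in>W. 1 - mom (q n) {w} \<gamma>)"

definition fam :: "'w set set" where
  "fam = {D. D \<subseteq> W \<and> card D \<ge> 2}"

lemma fin_fam: "finite fam"
  unfolding fam_def by (rule finite_subset[of _ "Pow W"]) (use finW in auto)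

lemma mean_prod_range: "0 \<le> mean_prod n \<gamma>" "mean_prod n \<gamma> \<le> 1"
  unfolding mean_prod_def using mom_q_range by (auto intro!: prod_nonneg prod_le_1 simp: le_diff_eq)

lemma mean_prod_meas [measurable]: "mean_prod n \<in> borel_measurable edge_lborel"
  unfolding mean_prod_def by measurable

text \<open>The mean of the product and the product of the means are both expanded over the subsets
  of \<open>W\<close>. Their difference is summed subset by subset, and subsets with at most one
  element cancel.\<close>

lemma mom_expand: "mom (\<lambda>t. 1 - q n t) W \<gamma> = mean_prod n \<gamma> + (\<Sum>D\<in>fam. \<sigma> (q n) D \<gamma>)"
proof -
  have "mom (\<lambda>t. 1 - q n t) W \<gamma> = (\<integral>x. (\<Sum>D\<in>Pow W. (- 1) ^ card D * (\<Prod>w\<in>D. q n (lin G \<gamma> w x))) \<partial>vert_law)"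
    unfolding mom_def
    by (intro Bochner_Integration.integral_cong refl)
      (use prod_add[OF finW, of "\<lambda>w. - q n (lin G \<gamma> w _)" "\<lambda>_. 1"] in \<open>simp add: prod_uminus\<close>)
  also have "\<dots> = (\<Sum>D\<in>Pow W. (- 1) ^ card D * mom (q n) D \<gamma>)"
    unfolding mom_def using prod_q_integrable by (subst Bochner_Integration.integral_sum) auto
  finally have 1: "mom (\<lambda>t. 1 - q n t) W \<gamma> = (\<Sum>D\<in>Pow W. (- 1) ^ card D * mom (q n) D \<gamma>)" .
  have 2: "mean_prod n \<gamma> = (\<Sum>D\<in>Pow W. (- 1) ^ card D * (\<Prod>w\<in>D. mom (q n) {w} \<gamma>))"
    unfolding mean_prod_def using prod_add[OF finW, of "\<lambda>w. - mom (q n) {w} \<gamma>" "\<lambda>_. 1"] by (simp add: prod_uminus)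
  have "mom (\<lambda>t. 1 - q n t) W \<gamma> - mean_prod n \<gamma> = (\<Sum>D\<in>Pow W. \<sigma> (q n) D \<gamma>)"
    unfolding 1 2 \<sigma>_def by (simp add: sum_subtractf[symmetric] algebra_simps)
  also have "\<dots> = (\<Sum>D\<in>fam. \<sigma> (q n) D \<gamma>)"
  proof (rule sum.mono_neutral_right)
    show "\<forall>D\<in>Pow W - fam. \<sigma> (q n) D \<gamma> = 0"
    proof
      fix D assume D: "D \<in> Pow W - fam"
      then have "card D = 0 \<or> card D = 1" unfolding fam_def by fastforce
      moreover have "finite D" using D finW finite_subset by blast
      ultimately have "D = {} \<or> (\<exists>w. D = {w})" using card_1_singletonE by auto
      then show "\<sigma> (q n) D \<gamma> = 0" by (auto simp: \<sigma>_def)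
    qed
  qed (use finW in \<open>auto simp: fam_def\<close>)
  finally show ?thesis by simp
qed

lemma mom_one_minus_range: "0 \<le> mom (\<lambda>t. 1 - q n t) W \<gamma>" "mom (\<lambda>t. 1 - q n t) W \<gamma> \<le> 1"
proof -
  interpret prob_space vert_law by (rule vert_law_prob)
  have r: "0 \<le> (\<Prod>w\<in>W. 1 - q n (t w))" "(\<Prod>w\<in>W. 1 - q n (t w)) \<le> 1" for t
    using q_range by (auto intro!: prod_nonneg prod_le_1 simp: le_diff_eq)
  show "0 \<le> mom (\<lambda>t. 1 - q n t) W \<gamma>" unfolding mom_def using r by (intro integral_nonneg_AE AE_I2)
  have "integrable vert_law (\<lambda>x. \<Prod>w\<in>W. 1 - q n (lin G \<gamma> w x))"
    by (rule integrable_const_bound[where B = 1]) (use r in auto)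
  then have "mom (\<lambda>t. 1 - q n t) W \<gamma> \<le> (\<integral>x. 1 \<partial>vert_law)"
    unfolding mom_def by (intro integral_mono r) auto
  then show "mom (\<lambda>t. 1 - q n t) W \<gamma> \<le> 1" by (simp add: prob_space)
qed

definition term_fun :: "nat \<Rightarrow> 'w set list \<Rightarrow> ('w \<times> 'v \<times> nat \<Rightarrow> real) \<Rightarrow> real" where
  "term_fun n xs \<gamma> = mean_prod n \<gamma> ^ (n - length xs) * prod_list (map (\<lambda>D. \<sigma> (q n) D \<gamma>) xs)"

definition term_int :: "nat \<Rightarrow> 'w set list \<Rightarrow> complex" where
  "term_int n xs = of_nat (n choose length xs) * (\<integral>\<gamma>. hat_prod \<gamma> * of_real (term_fun n xs \<gamma>) \<partial>edge_lborel)"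

text \<open>Pointwise limit of the rescaled \<open>term_fun\<close>, without the binomial
  coefficient; the exponential is the limit of the power of \<open>mean_prod\<close>.\<close>

definition lim_fun :: "'w set list \<Rightarrow> ('w \<times> 'v \<times> nat \<Rightarrow> real) \<Rightarrow> real" where
  "lim_fun xs \<gamma> = exp (- (\<Sum>w\<in>W. mom \<Psi> {w} \<gamma>)) * prod_list (map (\<lambda>D. \<sigma> \<Psi> D \<gamma>) xs)"

definition osc_int :: "nat \<Rightarrow> complex" where
  "osc_int n = (\<integral>\<gamma>. hat_prod \<gamma> * of_real (mom (\<lambda>t. 1 - q n t) W \<gamma> ^ n) \<partial>edge_lborel)"

lemma prod_list_meas [measurable]:
  assumes "\<And>D. g D \<in> borel_measurable edge_lborel"
  shows "(\<lambda>\<gamma>. prod_list (map (\<lambda>D. g D \<gamma>) xs) :: real) \<in> borel_measurable edge_lborel"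
  using assms by (induction xs) auto

lemma sigma_q_bound:
  assumes "n \<ge> 1"
  shows "\<bar>\<sigma> (q n) D \<gamma>\<bar> \<le> (sigma_const D / real n ^ card D) * edge_prod \<gamma> ^ (2 * card D)"
proof -
  have "real n ^ card D * \<bar>\<sigma> (q n) D \<gamma>\<bar> \<le> sigma_const D * edge_prod \<gamma> ^ (2 * card D)"
    using sigma_bound[OF growth_q, of n D \<gamma>] by (simp add: sigma_cmult abs_mult)
  then show ?thesis using assms by (simp add: field_simps)
qed

lemma term_fun_meas [measurable]: "term_fun n xs \<in> borel_measurable edge_lborel"
  unfolding term_fun_def by measurable

lemma term_fun_integrable: "integrable edge_lborel (\<lambda>\<gamma>. hat_prod \<gamma> * of_real (term_fun n xs \<gamma>))"
proof (rule hat_prod_integrable[OF term_fun_meas])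
  have g: "growth (q n) (max K 2)"
    unfolding growth_def
  proof (intro conjI allI)
    fix t
    have "q n t \<le> 1 * 1" using q_range by simp
    also have "\<dots> \<le> max K 2 * (1 + \<bar>t\<bar>)\<^sup>2" by (intro mult_mono) (auto simp: one_le_power)
    finally show "\<bar>q n t\<bar> \<le> max K 2 * (1 + \<bar>t\<bar>)\<^sup>2" using q_range(1)[of n t] by simp
  qed measurable
  fix \<gamma>
  have s2: "\<bar>\<sigma> (q n) D \<gamma>\<bar> \<le> 2 * edge_prod \<gamma> ^ (2 * card D)" for D
  proof -
    have "0 \<le> (\<Prod>w\<in>D. mom (q n) {w} \<gamma>)" "(\<Prod>w\<in>D. mom (q n) {w} \<gamma>) \<le> 1"
      using mom_q_range by (auto intro!: prod_nonneg prod_le_1)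
    then have "\<bar>\<sigma> (q n) D \<gamma>\<bar> \<le> 2 * 1"
      using mom_q_range[of n D \<gamma>] by (simp add: \<sigma>_def abs_mult power_abs)
    also have "\<dots> \<le> 2 * edge_prod \<gamma> ^ (2 * card D)" by (intro mult_left_mono one_le_power edge_prod_ge_1) auto
    finally show ?thesis .
  qed
  have "\<bar>term_fun n xs \<gamma>\<bar> = mean_prod n \<gamma> ^ (n - length xs) * \<bar>prod_list (map (\<lambda>D. \<sigma> (q n) D \<gamma>) xs)\<bar>"
    using mean_prod_range by (simp add: term_fun_def abs_mult)
  also have "\<dots> \<le> 1 * (prod_list (map (\<lambda>_. 2) xs) * edge_prod \<gamma> ^ (2 * sum_list (map card xs)))"
    using mean_prod_range s2 by (intro mult_mono prod_list_abs_bound power_le_one) auto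
  finally show "\<bar>term_fun n xs \<gamma>\<bar> \<le> prod_list (map (\<lambda>_. 2) xs) * edge_prod \<gamma> ^ (2 * sum_list (map card xs))" by simp
qed

text \<open>Such terms vanish exactly for every \<open>n\<close>, and not merely in the limit. This
  matters because their cost may lie below the exponent of the scaling factor.\<close>

lemma term_fun_zero:
  assumes "\<not> parity_ok G (set xs)"
  shows "term_int n xs = 0"
proof -
  have "(\<integral>\<gamma>. hat_prod \<gamma> * of_real (term_fun n xs \<gamma>) \<partial>edge_lborel) = 0"
  proof (rule hat_prod_zero[OF q_meas q_even term_fun_meas])
    fix S \<gamma> assume m: "\<And>A. A \<in> set xs \<or> (\<exists>w. A = {w}) \<Longrightarrow> mom (q n) A (flip S \<gamma>) = mom (q n) A \<gamma>"
    then have "mean_prod n (flip S \<gamma>) = mean_prod n \<gamma>" by (simp add: mean_prod_def)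
    moreover have "\<sigma> (q n) D (flip S \<gamma>) = \<sigma> (q n) D \<gamma>" if "D \<in> set xs" for D
      using m that by (simp add: \<sigma>_def)
    then have "map (\<lambda>D. \<sigma> (q n) D (flip S \<gamma>)) xs = map (\<lambda>D. \<sigma> (q n) D \<gamma>) xs" by simp
    ultimately show "term_fun n xs (flip S \<gamma>) = term_fun n xs \<gamma>" unfolding term_fun_def by metis
  qed (use assms in simp)
  then show ?thesis by (simp add: term_int_def)
qed

text \<open>Passing from \<open>q n\<close> to \<open>Q n\<close>, which is \<open>n\<close> times
  \<open>q n\<close>, takes out one factor n per element of each set. Of these,
  \<open>length xs\<close> factors are spent on normalizing the binomial coefficient, and
  \<open>list_cost xs\<close> remain.\<close>

lemma term_int_tendsto:
  assumes xs: "set xs \<subseteq> fam"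
  shows "(\<lambda>n. of_nat (n ^ list_cost xs) * term_int n xs)
    \<longlonglongrightarrow> of_real (1 / fact (length xs)) * (\<integral>\<gamma>. hat_prod \<gamma> * of_real (lim_fun xs \<gamma>) \<partial>edge_lborel)"
proof -
  define Q where "Q n t = real n * q n t" for n t
  define j where "j = length xs"
  define H where "H n \<gamma> = mean_prod n \<gamma> ^ (n - j) * prod_list (map (\<lambda>D. \<sigma> (Q n) D \<gamma>) xs)" for n \<gamma>
  have gQ: "growth (Q n) K" for n using growth_q unfolding Q_def .
  have [measurable]: "Q n \<in> borel_measurable borel" for n unfolding Q_def by measurable
  have [measurable]: "H n \<in> borel_measurable edge_lborel" for n unfolding H_def by measurable
  have [measurable]: "lim_fun xs \<in> borel_measurable edge_lborel" unfolding lim_fun_def by measurable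
  have "(\<lambda>n. \<integral>\<gamma>. hat_prod \<gamma> * of_real (H n \<gamma>) \<partial>edge_lborel) \<longlonglongrightarrow> (\<integral>\<gamma>. hat_prod \<gamma> * of_real (lim_fun xs \<gamma>) \<partial>edge_lborel)"
  proof (rule hat_prod_dominated)
    fix n \<gamma>
    have "\<bar>H n \<gamma>\<bar> = mean_prod n \<gamma> ^ (n - j) * \<bar>prod_list (map (\<lambda>D. \<sigma> (Q n) D \<gamma>) xs)\<bar>"
      using mean_prod_range by (simp add: H_def abs_mult)
    also have "\<dots> \<le> 1 * (prod_list (map sigma_const xs) * edge_prod \<gamma> ^ (2 * sum_list (map card xs)))"
      using mean_prod_range sigma_bound[OF gQ] by (intro mult_mono prod_list_abs_bound power_le_one) auto
    finally show "\<bar>H n \<gamma>\<bar> \<le> prod_list (map sigma_const xs) * edge_prod \<gamma> ^ (2 * sum_list (map card xs))" by simp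
  next
    fix \<gamma>
    have mt: "(\<lambda>n. mom (Q n) A \<gamma>) \<longlonglongrightarrow> mom \<Psi> A \<gamma>" for A
      by (rule mom_tendsto[OF gQ _ Psi_meas]) (use q_lim in \<open>simp add: Q_def\<close>)
    have "(\<lambda>n. \<sigma> (Q n) D \<gamma>) \<longlonglongrightarrow> \<sigma> \<Psi> D \<gamma>" for D
      unfolding \<sigma>_def by (intro tendsto_intros mt)
    then have pl: "(\<lambda>n. prod_list (map (\<lambda>D. \<sigma> (Q n) D \<gamma>) ys)) \<longlonglongrightarrow> prod_list (map (\<lambda>D. \<sigma> \<Psi> D \<gamma>) ys)" for ys
      by (induction ys) (auto intro!: tendsto_intros)
    have "(\<lambda>n. (1 - mom (q n) {w} \<gamma>) ^ (n - j)) \<longlonglongrightarrow> exp (- mom \<Psi> {w} \<gamma>)" for w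
    proof (rule power_exp_limit[OF mom_q_range])
      show "(\<lambda>n. real n * mom (q n) {w} \<gamma>) \<longlonglongrightarrow> mom \<Psi> {w} \<gamma>"
        using mt[of "{w}"] by (simp add: Q_def[abs_def] mom_cmult)
    qed
    then have "(\<lambda>n. \<Prod>w\<in>W. (1 - mom (q n) {w} \<gamma>) ^ (n - j)) \<longlonglongrightarrow> (\<Prod>w\<in>W. exp (- mom \<Psi> {w} \<gamma>))"
      by (rule tendsto_prod)
    then have "(\<lambda>n. mean_prod n \<gamma> ^ (n - j)) \<longlonglongrightarrow> exp (- (\<Sum>w\<in>W. mom \<Psi> {w} \<gamma>))"
      using finW by (simp add: mean_prod_def prod_power_distrib exp_sum sum_negf[symmetric])
    then show "(\<lambda>n. H n \<gamma>) \<longlonglongrightarrow> lim_fun xs \<gamma>"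
      unfolding H_def lim_fun_def by (intro tendsto_mult pl)
  qed measurable
  then have main: "(\<lambda>n. of_real (real (n choose j) / real n ^ j) * (\<integral>\<gamma>. hat_prod \<gamma> * of_real (H n \<gamma>) \<partial>edge_lborel))
      \<longlonglongrightarrow> of_real (1 / fact j) * (\<integral>\<gamma>. hat_prod \<gamma> * of_real (lim_fun xs \<gamma>) \<partial>edge_lborel)"
    by (intro tendsto_mult tendsto_of_real choose_over_power_tendsto)
  have eq: "of_real (real (n choose j) / real n ^ j) * (\<integral>\<gamma>. hat_prod \<gamma> * of_real (H n \<gamma>) \<partial>edge_lborel) = of_nat (n ^ list_cost xs) * term_int n xs"
    if n: "n \<ge> 1" for n
  proof -
    have "prod_list (map (\<lambda>D. \<sigma> (Q n) D \<gamma>) ys) = real n ^ sum_list (map card ys) * prod_list (map (\<lambda>D. \<sigma> (q n) D \<gamma>) ys)" for ys \<gamma>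
      by (induction ys) (simp_all add: Q_def[abs_def] sigma_cmult power_add mult_ac)
    moreover have "sum_list (map card xs) = list_cost xs + j"
      unfolding j_def by (rule sum_list_card_eq) (use xs in \<open>auto simp: fam_def\<close>)
    ultimately have "H n \<gamma> = (real n ^ list_cost xs * real n ^ j) * term_fun n xs \<gamma>" for \<gamma>
      by (simp add: H_def term_fun_def power_add mult_ac flip: j_def)
    then have "(\<integral>\<gamma>. hat_prod \<gamma> * of_real (H n \<gamma>) \<partial>edge_lborel) = (\<integral>\<gamma>. of_real (real n ^ list_cost xs * real n ^ j) * (hat_prod \<gamma> * of_real (term_fun n xs \<gamma>)) \<partial>edge_lborel)"
      by (intro Bochner_Integration.integral_cong refl) (simp add: mult_ac)
    also have "\<dots> = of_real (real n ^ list_cost xs * real n ^ j) * (\<integral>\<gamma>. hat_prod \<gamma> * of_real (term_fun n xs \<gamma>) \<partial>edge_lborel)"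
      by (rule integral_mult_right_zero)
    finally show ?thesis using n by (simp add: term_int_def j_def)
  qed
  have "\<forall>\<^sub>F n in sequentially. of_real (real (n choose j) / real n ^ j) * (\<integral>\<gamma>. hat_prod \<gamma> * of_real (H n \<gamma>) \<partial>edge_lborel) = of_nat (n ^ list_cost xs) * term_int n xs"
    using eventually_ge_at_top[of 1] by eventually_elim (rule eq)
  from Lim_transform_eventually[OF main this] show ?thesis unfolding j_def .
qed

end

section \<open>Summing the expansion: the critical families\<close>

context osc_limit
begin

abbreviation fam_lists :: "nat \<Rightarrow> 'w set list set" where
  "fam_lists j \<equiv> {xs. set xs \<subseteq> fam \<and> length xs = j}"

lemma finite_fam_lists: "finite (fam_lists j)"
  by (rule finite_lists_length_eq[OF fin_fam])

lemma remainder_bound: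
  assumes n: "n \<ge> 1"
  shows "\<bar>\<Sum>D\<in>fam. \<sigma> (q n) D \<gamma>\<bar> \<le> ((\<Sum>D\<in>fam. sigma_const D) / real n ^ 2) * edge_prod \<gamma> ^ (2 * card W)"
proof -
  have "\<bar>\<Sum>D\<in>fam. \<sigma> (q n) D \<gamma>\<bar> \<le> (\<Sum>D\<in>fam. \<bar>\<sigma> (q n) D \<gamma>\<bar>)" by (rule sum_abs)
  also have "\<dots> \<le> (\<Sum>D\<in>fam. (sigma_const D / real n ^ 2) * edge_prod \<gamma> ^ (2 * card W))"
  proof (rule sum_mono)
    fix D assume D: "D \<in> fam"
    then have c: "2 \<le> card D" "card D \<le> card W" using card_mono[OF finW] by (auto simp: fam_def)
    have "real n ^ 2 \<le> real n ^ card D" using n c by (intro power_increasing) auto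
    then have "sigma_const D / real n ^ card D \<le> sigma_const D / real n ^ 2"
      using n sigma_const_nonneg[of D] by (intro divide_left_mono) auto
    moreover have "edge_prod \<gamma> ^ (2 * card D) \<le> edge_prod \<gamma> ^ (2 * card W)"
      using c edge_prod_ge_1[of \<gamma>] by (intro power_increasing) auto
    moreover have "0 \<le> edge_prod \<gamma> ^ (2 * card D)" using edge_prod_ge_1[of \<gamma>] by simp
    moreover have "0 \<le> sigma_const D / real n ^ 2" using sigma_const_nonneg[of D] by simp
    ultimately have "(sigma_const D / real n ^ card D) * edge_prod \<gamma> ^ (2 * card D) \<le> (sigma_const D / real n ^ 2) * edge_prod \<gamma> ^ (2 * card W)"
      by (intro mult_mono)
    then show "\<bar>\<sigma> (q n) D \<gamma>\<bar> \<le> (sigma_const D / real n ^ 2) * edge_prod \<gamma> ^ (2 * card W)"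
      using sigma_q_bound[OF n, of D \<gamma>] by linarith
  qed
  also have "\<dots> = ((\<Sum>D\<in>fam. sigma_const D) / real n ^ 2) * edge_prod \<gamma> ^ (2 * card W)"
    by (simp add: sum_divide_distrib sum_distrib_right)
  finally show ?thesis .
qed

text \<open>The coefficient \<open>n choose Suc J\<close> is at most the power n^(J+1), while each
  of the \<open>Suc J\<close> factors of the remainder is of order n^(-2) with a polynomial weight
  in the frequencies.\<close>

lemma osc_int_expand:
  obtains C where "\<And>n. n \<ge> 1 \<Longrightarrow>
    norm (osc_int n - (\<Sum>j\<le>J. \<Sum>xs\<in>fam_lists j. term_int n xs)) \<le> C / real n ^ Suc J"
proof -
  define RC where "RC = (\<Sum>D\<in>fam. sigma_const D)"
  define k where "k = 2 * card W * Suc J"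
  define C where "C = RC ^ Suc J * (\<integral>\<gamma>. norm (hat_prod \<gamma>) * edge_prod \<gamma> ^ k \<partial>edge_lborel)"
  have RC0: "RC \<ge> 0" unfolding RC_def using sigma_const_nonneg by (rule sum_nonneg)
  have "norm (osc_int n - (\<Sum>j\<le>J. \<Sum>xs\<in>fam_lists j. term_int n xs)) \<le> C / real n ^ Suc J" if n: "n \<ge> 1" for n
  proof -
    define R where "R \<gamma> = (\<Sum>D\<in>fam. \<sigma> (q n) D \<gamma>)" for \<gamma>
    define T where "T \<gamma> = (\<Sum>j\<le>J. \<Sum>xs\<in>fam_lists j. real (n choose j) * term_fun n xs \<gamma>)" for \<gamma>
    define e where "e \<gamma> = mom (\<lambda>t. 1 - q n t) W \<gamma> ^ n - T \<gamma>" for \<gamma>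
    have T_eq: "T \<gamma> = (\<Sum>j\<le>J. real (n choose j) * mean_prod n \<gamma> ^ (n - j) * R \<gamma> ^ j)" for \<gamma>
      unfolding T_def R_def sum_power_lists[OF fin_fam]
      by (intro sum.cong refl) (simp add: term_fun_def sum_distrib_left mult_ac)
    have mom_eq: "mom (\<lambda>t. 1 - q n t) W \<gamma> = mean_prod n \<gamma> + R \<gamma>" for \<gamma> by (simp add: mom_expand R_def)
    have e_bound: "\<bar>e \<gamma>\<bar> \<le> (RC ^ Suc J / real n ^ Suc J) * edge_prod \<gamma> ^ k" for \<gamma>
    proof -
      have "\<bar>e \<gamma>\<bar> \<le> real (n choose Suc J) * \<bar>R \<gamma>\<bar> ^ Suc J"
        unfolding e_def T_eq mom_eq
        using binomial_truncation[of "mean_prod n \<gamma>" "R \<gamma>" n J] mean_prod_range[of n \<gamma>] mom_one_minus_range[of n \<gamma>]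
        by (simp add: mom_eq)
      also have "\<dots> \<le> real n ^ Suc J * ((RC / real n ^ 2) * edge_prod \<gamma> ^ (2 * card W)) ^ Suc J"
      proof (intro mult_mono power_mono)
        have "n choose Suc J \<le> n ^ Suc J"
          by (cases "Suc J \<le> n") (auto simp: binomial_eq_0 intro: binomial_le_pow simp del: power_Suc)
        then show "real (n choose Suc J) \<le> real n ^ Suc J" by (metis of_nat_le_iff of_nat_power)
        show "\<bar>R \<gamma>\<bar> \<le> RC / (real n)\<^sup>2 * edge_prod \<gamma> ^ (2 * card W)"
          using remainder_bound[OF n, of \<gamma>] by (simp add: R_def RC_def)
      qed auto
      also have "\<dots> = (real n * ((RC / real n ^ 2) * edge_prod \<gamma> ^ (2 * card W))) ^ Suc J"
        by (rule power_mult_distrib[symmetric])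
      also have "real n * ((RC / real n ^ 2) * edge_prod \<gamma> ^ (2 * card W)) = (RC / real n) * edge_prod \<gamma> ^ (2 * card W)"
        using n by (simp add: power2_eq_square)
      also have "\<dots> ^ Suc J = (RC ^ Suc J / real n ^ Suc J) * edge_prod \<gamma> ^ k"
        unfolding k_def power_mult_distrib power_divide power_mult[symmetric] by (rule refl)
      finally show ?thesis .
    qed
    have intT: "integrable edge_lborel (\<lambda>\<gamma>. hat_prod \<gamma> * of_real (real (n choose j) * term_fun n xs \<gamma>))" for j xs
      using integrable_mult_right[OF term_fun_integrable, of "of_nat (n choose j)" n xs] by (simp add: mult_ac)
    have Tint: "(\<integral>\<gamma>. hat_prod \<gamma> * of_real (T \<gamma>) \<partial>edge_lborel) = (\<Sum>j\<le>J. \<Sum>xs\<in>fam_lists j. term_int n xs)"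
      "integrable edge_lborel (\<lambda>\<gamma>. hat_prod \<gamma> * of_real (T \<gamma>))"
    proof -
      have eq: "(\<lambda>\<gamma>. hat_prod \<gamma> * of_real (T \<gamma>)) = (\<lambda>\<gamma>. \<Sum>j\<le>J. \<Sum>xs\<in>fam_lists j. hat_prod \<gamma> * of_real (real (n choose j) * term_fun n xs \<gamma>))"
        by (simp add: T_def sum_distrib_left fun_eq_iff)
      show "integrable edge_lborel (\<lambda>\<gamma>. hat_prod \<gamma> * of_real (T \<gamma>))"
        unfolding eq by (intro Bochner_Integration.integrable_sum intT)
      have "(\<integral>\<gamma>. hat_prod \<gamma> * of_real (T \<gamma>) \<partial>edge_lborel) = (\<Sum>j\<le>J. \<Sum>xs\<in>fam_lists j. \<integral>\<gamma>. hat_prod \<gamma> * of_real (real (n choose j) * term_fun n xs \<gamma>) \<partial>edge_lborel)"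
        unfolding eq by (simp only: Bochner_Integration.integral_sum Bochner_Integration.integrable_sum intT)
      also have "\<dots> = (\<Sum>j\<le>J. \<Sum>xs\<in>fam_lists j. term_int n xs)"
      proof (intro sum.cong refl)
        fix j xs assume "xs \<in> fam_lists j"
        then have "term_int n xs = (\<integral>\<gamma>. of_nat (n choose j) * (hat_prod \<gamma> * of_real (term_fun n xs \<gamma>)) \<partial>edge_lborel)"
          unfolding term_int_def by (simp only: integral_mult_right_zero) simp
        then show "(\<integral>\<gamma>. hat_prod \<gamma> * of_real (real (n choose j) * term_fun n xs \<gamma>) \<partial>edge_lborel) = term_int n xs"
          by (simp add: mult_ac)
      qed
      finally show "(\<integral>\<gamma>. hat_prod \<gamma> * of_real (T \<gamma>) \<partial>edge_lborel) = (\<Sum>j\<le>J. \<Sum>xs\<in>fam_lists j. term_int n xs)" .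
    qed
    have [measurable]: "e \<in> borel_measurable edge_lborel"
      unfolding e_def T_def by measurable
    have inte: "integrable edge_lborel (\<lambda>\<gamma>. hat_prod \<gamma> * of_real (e \<gamma>))"
      by (rule hat_prod_integrable[OF _ e_bound]) measurable
    have "osc_int n = (\<integral>\<gamma>. hat_prod \<gamma> * of_real (T \<gamma>) + hat_prod \<gamma> * of_real (e \<gamma>) \<partial>edge_lborel)"
      unfolding osc_int_def e_def by (intro Bochner_Integration.integral_cong refl) (simp add: algebra_simps)
    also have "\<dots> = (\<Sum>j\<le>J. \<Sum>xs\<in>fam_lists j. term_int n xs) + (\<integral>\<gamma>. hat_prod \<gamma> * of_real (e \<gamma>) \<partial>edge_lborel)"
      by (subst Bochner_Integration.integral_add[OF Tint(2) inte]) (simp only: Tint(1))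
    finally have "norm (osc_int n - (\<Sum>j\<le>J. \<Sum>xs\<in>fam_lists j. term_int n xs)) = norm (\<integral>\<gamma>. hat_prod \<gamma> * of_real (e \<gamma>) \<partial>edge_lborel)"
      by simp
    also have "\<dots> \<le> (\<integral>\<gamma>. norm (hat_prod \<gamma> * of_real (e \<gamma>)) \<partial>edge_lborel)" by (rule integral_norm_bound)
    also have "\<dots> \<le> (\<integral>\<gamma>. (RC ^ Suc J / real n ^ Suc J) * (norm (hat_prod \<gamma>) * edge_prod \<gamma> ^ k) \<partial>edge_lborel)"
    proof (rule integral_mono)
      fix \<gamma>
      have "norm (hat_prod \<gamma> * of_real (e \<gamma>)) = norm (hat_prod \<gamma>) * \<bar>e \<gamma>\<bar>" by (simp add: norm_mult)
      also have "\<dots> \<le> norm (hat_prod \<gamma>) * ((RC ^ Suc J / real n ^ Suc J) * edge_prod \<gamma> ^ k)"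
        by (intro mult_left_mono e_bound) auto
      finally show "norm (hat_prod \<gamma> * of_real (e \<gamma>)) \<le> (RC ^ Suc J / real n ^ Suc J) * (norm (hat_prod \<gamma>) * edge_prod \<gamma> ^ k)"
        by (simp only: mult_ac)
    qed (intro integrable_norm inte integrable_mult_right hat_prod_edge_prod_integrable)+
    also have "\<dots> = C / real n ^ Suc J" by (simp add: C_def)
    finally show ?thesis .
  qed
  then show thesis using that by blast
qed

definition sigma_term :: "'w set set \<Rightarrow> complex" where
  "sigma_term C = (\<integral>\<gamma>. hat_prod \<gamma> * of_real (exp (- (\<Sum>w\<in>W. mom \<Psi> {w} \<gamma>)) * (\<Prod>D\<in>C. \<sigma> \<Psi> D \<gamma>)) \<partial>edge_lborel)"

text \<open>The families whose power of \<open>n\<close> exactly compensates the scaling factor.\<close>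

definition crit :: "'w set set set" where
  "crit = {C. C \<subseteq> fam \<and> 2 * (card W + card V) = totE + 2 * cost C + 2}"

text \<open>The power of n by which the normalization of the trace grows.
  \<open>parity_cost_bound\<close> says that it is at most the cost of any family that passes the
  test.\<close>

definition growth_exp :: real where
  "growth_exp = real (card W) - 1 + real (card V) - real totE / 2"

lemma fam_mem: "set xs \<subseteq> fam \<Longrightarrow> D \<in> set xs \<Longrightarrow> D \<noteq> {} \<and> D \<subseteq> W \<and> card D \<ge> 2"
  by (auto simp: fam_def)

text \<open>A list that fails the test contributes 0 throughout, and its claimed limit vanishes for
  the same reason. For a list that passes, \<open>growth_exp\<close> is at most the cost of its set;
  a repetition or a noncritical cost makes \<open>list_cost\<close> strictly larger, so the term
  tends to 0.\<close>

lemma term_scaled_tendsto: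
  assumes xs: "set xs \<subseteq> fam"
  shows "(\<lambda>n. of_real (real n powr growth_exp) * term_int n xs) \<longlonglongrightarrow>
    (if distinct xs \<and> 2 * (card W + card V) = totE + 2 * list_cost xs + 2
     then of_real (1 / fact (length xs)) * sigma_term (set xs) else 0)"
proof (cases "parity_ok G (set xs)")
  case False
  have "\<not> (distinct xs \<and> 2 * (card W + card V) = totE + 2 * list_cost xs + 2) \<or> sigma_term (set xs) = 0"
  proof -
    have "sigma_term (set xs) = 0"
      unfolding sigma_term_def
    proof (rule hat_prod_zero[OF Psi_meas Psi_even])
      fix S \<gamma> assume m: "\<And>A. A \<in> set xs \<or> (\<exists>w. A = {w}) \<Longrightarrow> mom \<Psi> A (flip S \<gamma>) = mom \<Psi> A \<gamma>"
      then have "\<sigma> \<Psi> D (flip S \<gamma>) = \<sigma> \<Psi> D \<gamma>" if "D \<in> set xs" for D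
        using that by (simp add: \<sigma>_def)
      then show "exp (- (\<Sum>w\<in>W. mom \<Psi> {w} (flip S \<gamma>))) * (\<Prod>D\<in>set xs. \<sigma> \<Psi> D (flip S \<gamma>))
          = exp (- (\<Sum>w\<in>W. mom \<Psi> {w} \<gamma>)) * (\<Prod>D\<in>set xs. \<sigma> \<Psi> D \<gamma>)"
        using m by simp
    qed (use False in auto)
    then show ?thesis by blast
  qed
  then show ?thesis using term_fun_zero[OF False] by auto
next
  case True
  have "\<forall>D\<in>set xs. D \<noteq> {} \<and> D \<subseteq> W" using fam_mem[OF xs] by blast
  from parity_cost_bound[OF this True]
  have b: "2 * (card W + card V) \<le> totE + 2 * cost (set xs) + 2" .
  show ?thesis
  proof (cases "distinct xs \<and> 2 * (card W + card V) = totE + 2 * list_cost xs + 2")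
    case eq: True
    have growth_exp: "growth_exp = real (list_cost xs)"
    proof -
      have "real (2 * (card W + card V)) = real (totE + 2 * list_cost xs + 2)" using eq by simp
      then show ?thesis unfolding growth_exp_def by simp
    qed
    have lf: "lim_fun xs \<gamma> = exp (- (\<Sum>w\<in>W. mom \<Psi> {w} \<gamma>)) * (\<Prod>D\<in>set xs. \<sigma> \<Psi> D \<gamma>)" for \<gamma>
      using eq by (simp add: lim_fun_def prod.distinct_set_conv_list)
    have "\<forall>\<^sub>F n in sequentially. of_nat (n ^ list_cost xs) * term_int n xs = of_real (real n powr growth_exp) * term_int n xs"
      using eventually_gt_at_top[of 0] by eventually_elim (simp add: growth_exp powr_realpow)
    from Lim_transform_eventually[OF term_int_tendsto[OF xs] this]
    show ?thesis using eq by (simp add: sigma_term_def lf)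
  next
    case ne: False
    have "2 * (card W + card V) < totE + 2 * list_cost xs + 2"
    proof (cases "distinct xs")
      case True
      then show ?thesis using ne b cost_set_eq_list_cost[OF True] by simp
    next
      case False
      have "cost (set xs) < list_cost xs"
        by (rule cost_set_less_list_cost[OF False]) (use fam_mem[OF xs] in blast)
      then show ?thesis using b by simp
    qed
    then have "real (2 * (card W + card V)) < real (totE + 2 * list_cost xs + 2)" by (simp only: of_nat_less_iff)
    then have lt: "growth_exp - real (list_cost xs) < 0" unfolding growth_exp_def by simp
    have "(\<lambda>n. of_real (real n powr (growth_exp - real (list_cost xs))) * (of_nat (n ^ list_cost xs) * term_int n xs))
        \<longlonglongrightarrow> of_real 0 * (of_real (1 / fact (length xs)) * (\<integral>\<gamma>. hat_prod \<gamma> * of_real (lim_fun xs \<gamma>) \<partial>edge_lborel))"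
      by (intro tendsto_mult tendsto_of_real term_int_tendsto[OF xs] tendsto_neg_powr[OF lt] filterlim_real_sequentially)
    moreover have "\<forall>\<^sub>F n in sequentially. of_real (real n powr (growth_exp - real (list_cost xs))) * (of_nat (n ^ list_cost xs) * term_int n xs)
        = of_real (real n powr growth_exp) * term_int n xs"
      using eventually_gt_at_top[of 0]
    proof eventually_elim
      case (elim n)
      have "real n powr (growth_exp - real (list_cost xs)) * real n ^ list_cost xs = real n powr growth_exp"
        using elim by (simp add: powr_realpow[symmetric] powr_add[symmetric])
      then have "complex_of_real (real n powr (growth_exp - real (list_cost xs)) * real n ^ list_cost xs) = of_real (real n powr growth_exp)" by simp
      then show ?case by (simp add: mult.assoc[symmetric])
    qed
    ultimately have "(\<lambda>n. of_real (real n powr growth_exp) * term_int n xs)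
        \<longlonglongrightarrow> of_real 0 * (of_real (1 / fact (length xs)) * (\<integral>\<gamma>. hat_prod \<gamma> * of_real (lim_fun xs \<gamma>) \<partial>edge_lborel))"
      by (rule Lim_transform_eventually)
    then show ?thesis unfolding if_not_P[OF ne] by simp
  qed
qed

lemma osc_int_tendsto: "(\<lambda>n. of_real (real n powr growth_exp) * osc_int n) \<longlonglongrightarrow> (\<Sum>C\<in>crit. sigma_term C)"
proof -
  \<comment> \<open>Large enough in two ways: \<open>Suc J\<close> exceeds
    \<open>growth_exp\<close>, so the truncation error vanishes, and critical families satisfy
    \<open>card C \<le> cost C \<le> J\<close>, so none is cut off.\<close>
  define J where "J = card W + card V"
  define lim where "lim xs = (if distinct xs \<and> 2 * (card W + card V) = totE + 2 * list_cost xs + 2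
     then of_real (1 / fact (length xs)) * sigma_term (set xs) else 0)" for xs
  obtain C where C: "\<And>n. n \<ge> 1 \<Longrightarrow>
    norm (osc_int n - (\<Sum>j\<le>J. \<Sum>xs\<in>fam_lists j. term_int n xs)) \<le> C / real n ^ Suc J"
    using osc_int_expand by blast
  have LJ: "growth_exp - real (Suc J) < 0" unfolding growth_exp_def J_def by simp
  have main: "(\<lambda>n. \<Sum>j\<le>J. \<Sum>xs\<in>fam_lists j. of_real (real n powr growth_exp) * term_int n xs) \<longlonglongrightarrow> (\<Sum>j\<le>J. \<Sum>xs\<in>fam_lists j. lim xs)"
    unfolding lim_def by (intro tendsto_sum term_scaled_tendsto) auto
  have err: "(\<lambda>n. of_real (real n powr growth_exp) * (osc_int n - (\<Sum>j\<le>J. \<Sum>xs\<in>fam_lists j. term_int n xs))) \<longlonglongrightarrow> 0"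
  proof (rule Lim_null_comparison)
    show "\<forall>\<^sub>F n in sequentially. norm (of_real (real n powr growth_exp) * (osc_int n - (\<Sum>j\<le>J. \<Sum>xs\<in>fam_lists j. term_int n xs)))
        \<le> C * real n powr (growth_exp - real (Suc J))"
      using eventually_ge_at_top[of 1]
    proof eventually_elim
      case (elim n)
      have "norm (of_real (real n powr growth_exp) * (osc_int n - (\<Sum>j\<le>J. \<Sum>xs\<in>fam_lists j. term_int n xs)))
          = real n powr growth_exp * norm (osc_int n - (\<Sum>j\<le>J. \<Sum>xs\<in>fam_lists j. term_int n xs))"
        by (simp add: norm_mult)
      also have "\<dots> \<le> real n powr growth_exp * (C / real n ^ Suc J)" by (intro mult_left_mono C elim) auto
      also have "\<dots> = C * real n powr (growth_exp - real (Suc J))"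
      proof -
        have "real n powr real (Suc J) = real n ^ Suc J" by (rule powr_realpow) (use elim in simp)
        then show ?thesis unfolding powr_diff by simp
      qed
      finally show ?case .
    qed
    have "(\<lambda>n. C * real n powr (growth_exp - real (Suc J))) \<longlonglongrightarrow> C * 0"
      by (intro tendsto_mult tendsto_const tendsto_neg_powr[OF LJ] filterlim_real_sequentially)
    then show "(\<lambda>n. C * real n powr (growth_exp - real (Suc J))) \<longlonglongrightarrow> 0" by simp
  qed
  have "(\<lambda>n. (\<Sum>j\<le>J. \<Sum>xs\<in>fam_lists j. of_real (real n powr growth_exp) * term_int n xs)
      + of_real (real n powr growth_exp) * (osc_int n - (\<Sum>j\<le>J. \<Sum>xs\<in>fam_lists j. term_int n xs))) \<longlonglongrightarrow> (\<Sum>j\<le>J. \<Sum>xs\<in>fam_lists j. lim xs) + 0"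
    by (rule tendsto_add[OF main err])
  then have conv: "(\<lambda>n. of_real (real n powr growth_exp) * osc_int n) \<longlonglongrightarrow> (\<Sum>j\<le>J. \<Sum>xs\<in>fam_lists j. lim xs)"
    by (simp add: sum_distrib_left[symmetric] algebra_simps)
  have fcrit: "finite crit" unfolding crit_def
    by (rule finite_subset[of _ "Pow fam"]) (use fin_fam in auto)
  have finC: "finite C" if "C \<in> crit" for C
    using that fin_fam finite_subset by (auto simp: crit_def)
  have "(\<Sum>j\<le>J. \<Sum>xs\<in>fam_lists j. lim xs) = (\<Sum>xs\<in>(\<Union>j\<in>{..J}. fam_lists j). lim xs)"
    by (rule sum.UNION_disjoint[symmetric]) (auto simp: finite_fam_lists)
  \<comment> \<open>Only enumerations of critical families contribute. A family of size k has k! of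
    them, which cancels the factor \<open>1 / fact k\<close> left by the binomial
    coefficient.\<close>
  also have "\<dots> = (\<Sum>xs\<in>(\<Union>C\<in>crit. permutations_of_set C). lim xs)"
  proof (rule sum.mono_neutral_right)
    show "finite (\<Union>j\<in>{..J}. fam_lists j)" by (auto simp: finite_fam_lists)
    show "(\<Union>C\<in>crit. permutations_of_set C) \<subseteq> (\<Union>j\<in>{..J}. fam_lists j)"
    proof
      fix xs assume "xs \<in> (\<Union>C\<in>crit. permutations_of_set C)"
      then obtain C where C: "C \<in> crit" "set xs = C" "distinct xs" by (auto simp: permutations_of_set_def)
      have "length xs = card C" using C distinct_card by metis
      moreover have "card C \<le> cost C"
      proof -
        have "card C = (\<Sum>D\<in>C. 1)" by simp
        also have "\<dots> \<le> cost C" unfolding cost_def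
        proof (rule sum_mono)
          fix D assume "D \<in> C"
          then have "card D \<ge> 2" using C(1) by (auto simp: crit_def fam_def)
          then show "1 \<le> card D - 1" by linarith
        qed
        finally show ?thesis .
      qed
      moreover have "cost C \<le> J" using C(1) by (simp add: crit_def J_def)
      ultimately have "length xs \<le> J" by linarith
      moreover have "set xs \<subseteq> fam" using C by (auto simp: crit_def)
      ultimately show "xs \<in> (\<Union>j\<in>{..J}. fam_lists j)" by blast
    qed
    show "\<forall>xs\<in>(\<Union>j\<in>{..J}. fam_lists j) - (\<Union>C\<in>crit. permutations_of_set C). lim xs = 0"
    proof
      fix xs assume xs: "xs \<in> (\<Union>j\<in>{..J}. fam_lists j) - (\<Union>C\<in>crit. permutations_of_set C)"
      have "\<not> (distinct xs \<and> 2 * (card W + card V) = totE + 2 * list_cost xs + 2)"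
      proof
        assume *: "distinct xs \<and> 2 * (card W + card V) = totE + 2 * list_cost xs + 2"
        then have "set xs \<in> crit" using xs cost_set_eq_list_cost[of xs] by (auto simp: crit_def)
        moreover have "xs \<in> permutations_of_set (set xs)" using * by (simp add: permutations_of_set_def)
        ultimately show False using xs by blast
      qed
      then show "lim xs = 0" unfolding lim_def by (rule if_not_P)
    qed
  qed
  also have "\<dots> = (\<Sum>C\<in>crit. \<Sum>xs\<in>permutations_of_set C. lim xs)"
  proof (rule sum.UNION_disjoint[OF fcrit])
    show "\<forall>C\<in>crit. finite (permutations_of_set C)" by simp
  qed (auto simp: permutations_of_set_def)
  also have "\<dots> = (\<Sum>C\<in>crit. sigma_term C)"
  proof (rule sum.cong[OF refl])
    fix C assume C: "C \<in> crit"
    have "(\<Sum>xs\<in>permutations_of_set C. lim xs) = (\<Sum>xs\<in>permutations_of_set C. of_real (1 / fact (card C)) * sigma_term C)"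
    proof (rule sum.cong[OF refl])
      fix xs assume "xs \<in> permutations_of_set C"
      then have xs: "set xs = C" "distinct xs" by (auto simp: permutations_of_set_def)
      then have "length xs = card C" using distinct_card by metis
      then show "lim xs = of_real (1 / fact (card C)) * sigma_term C"
        using xs C cost_set_eq_list_cost[OF xs(2)] by (simp add: lim_def crit_def)
    qed
    also have "\<dots> = of_nat (fact (card C)) * (of_real (1 / fact (card C)) * sigma_term C)"
      using finC[OF C] by simp
    also have "\<dots> = sigma_term C" by simp
    finally show "(\<Sum>xs\<in>permutations_of_set C. lim xs) = sigma_term C" .
  qed
  finally show ?thesis using conv by simp
qed

text \<open>The real function behind \<open>\<Phi>\<close>; the explicit factor \<open>- 1\<close>
  puts it into the form to which \<open>mom_cmult\<close> applies.\<close>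

definition \<Phi>r :: "real \<Rightarrow> real" where
  "\<Phi>r t = - 1 * \<Psi> t"

lemma mom_Phir: "mom \<Phi>r A \<gamma> = (- 1) ^ card A * mom \<Psi> A \<gamma>"
  unfolding \<Phi>r_def[abs_def] by (rule mom_cmult)

definition mom_term :: "'w set set \<Rightarrow> complex" where
  "mom_term C = (\<integral>\<gamma>. hat_prod \<gamma> * of_real (exp (\<Sum>w\<in>W. mom \<Phi>r {w} \<gamma>) * (\<Prod>D\<in>C. mom \<Phi>r D \<gamma>)) \<partial>edge_lborel)"

lemma growth_Phir: "growth \<Phi>r K"
  using growth_Psi unfolding growth_def \<Phi>r_def[abs_def] by (auto intro!: borel_measurable_times)

lemma mom_Psi_nonneg: "0 \<le> mom \<Psi> A \<gamma>"
  unfolding mom_def using Psi_nonneg by (intro integral_nonneg_AE AE_I2 prod_nonneg) auto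

lemma exp_mom_le_1: "exp (\<Sum>w\<in>A. mom \<Phi>r {w} \<gamma>) \<le> 1"
  using sum_nonneg[of A "\<lambda>w. mom \<Psi> {w} \<gamma>"] mom_Psi_nonneg by (simp add: mom_Phir sum_negf)

lemma mom_term_zero:
  assumes "\<not> parity_ok G C \<or> (\<exists>w\<in>W. odd (wdeg G w))"
  shows "mom_term C = 0"
  unfolding mom_term_def
proof (rule hat_prod_zero[OF Psi_meas Psi_even _ _ assms])
  have "\<Phi>r \<in> borel_measurable borel" using growth_Phir by (simp add: growth_def)
  then show "(\<lambda>\<gamma>. exp (\<Sum>w\<in>W. mom \<Phi>r {w} \<gamma>) * (\<Prod>D\<in>C. mom \<Phi>r D \<gamma>)) \<in> borel_measurable edge_lborel" by measurable
qed (simp add: mom_Phir)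

text \<open>In the expansion of \<open>sigma_term C\<close> every other product of moments has smaller cost, hence fails the
  parity test.\<close>

lemma sigma_term_eq_mom_term:
  assumes C: "C \<in> crit"
  shows "sigma_term C = mom_term C"
proof -
  have Cf: "C \<subseteq> fam" and eq: "2 * (card W + card V) = totE + 2 * cost C + 2" using C by (auto simp: crit_def)
  have finC: "finite C" using Cf fin_fam finite_subset by blast
  \<comment> \<open>Chosen so that \<open>\<sigma> \<Psi> D\<close> equals
    \<open>mom \<Phi>r D + y D\<close>. Since \<open>y\<close> is built from moments of single
    vertices, the flips of the parity test preserve it, and only the sets \<open>X\<close>
    contributing a joint moment count for the test.\<close>
  define y where "y D \<gamma> = - ((- 1) ^ card D * (\<Prod>w\<in>D. mom \<Psi> {w} \<gamma>))" for D \<gamma>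
  define E where "E \<gamma> = exp (\<Sum>w\<in>W. mom \<Phi>r {w} \<gamma>)" for \<gamma>
  have [measurable]: "\<Phi>r \<in> borel_measurable borel" using growth_Phir by (simp add: growth_def)
  have E_eq: "exp (- (\<Sum>w\<in>W. mom \<Psi> {w} \<gamma>)) = E \<gamma>" for \<gamma> by (simp add: E_def mom_Phir sum_negf)
  have E_range: "0 \<le> E \<gamma>" "E \<gamma> \<le> 1" for \<gamma> using exp_mom_le_1 by (auto simp: E_def)
  have [measurable]: "E \<in> borel_measurable edge_lborel" unfolding E_def by measurable
  define H where "H X \<gamma> = E \<gamma> * ((\<Prod>D\<in>X. mom \<Phi>r D \<gamma>) * (\<Prod>D\<in>C - X. y D \<gamma>))" for X \<gamma>
  have Hm: "H X \<in> borel_measurable edge_lborel" for X unfolding H_def y_def by measurable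
  have int: "integrable edge_lborel (\<lambda>\<gamma>. hat_prod \<gamma> * of_real (H X \<gamma>))" if X: "X \<subseteq> C" for X
  proof (rule hat_prod_integrable[OF Hm])
    fix \<gamma>
    let ?M = "\<lambda>D. (mom_const K (card D) + mom_const K 1 ^ card D) * edge_prod \<gamma> ^ (2 * card D)"
    have bnn: "0 \<le> edge_prod \<gamma> ^ k" for k using edge_prod_ge_1[of \<gamma>] by simp
    have 1: "\<bar>mom \<Phi>r D \<gamma>\<bar> \<le> ?M D" for D
    proof -
      have "0 \<le> mom_const K 1 ^ card D * edge_prod \<gamma> ^ (2 * card D)" using mom_const_nonneg[OF K_nonneg] bnn by simp
      then show ?thesis using mom_bound[OF growth_Phir, of D \<gamma>] by (simp add: distrib_right)
    qed
    have 2: "\<bar>y D \<gamma>\<bar> \<le> ?M D" for D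
    proof -
      have "\<bar>y D \<gamma>\<bar> \<le> mom_const K 1 ^ card D * edge_prod \<gamma> ^ (2 * card D)"
        using prod_mom_bound[OF growth_Psi, of \<gamma> D] by (simp add: y_def abs_mult power_abs)
      moreover have "0 \<le> mom_const K (card D) * edge_prod \<gamma> ^ (2 * card D)" using mom_const_nonneg[OF K_nonneg] bnn by simp
      ultimately show ?thesis by (simp add: distrib_right)
    qed
    have "\<bar>H X \<gamma>\<bar> = E \<gamma> * ((\<Prod>D\<in>X. \<bar>mom \<Phi>r D \<gamma>\<bar>) * (\<Prod>D\<in>C - X. \<bar>y D \<gamma>\<bar>))"
      using E_range by (simp add: H_def abs_mult abs_prod)
    also have "\<dots> \<le> 1 * ((\<Prod>D\<in>X. ?M D) * (\<Prod>D\<in>C - X. ?M D))"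
    proof -
      have 3: "(\<Prod>D\<in>X. \<bar>mom \<Phi>r D \<gamma>\<bar>) \<le> (\<Prod>D\<in>X. ?M D)" by (intro prod_mono conjI abs_ge_zero 1)
      have 4: "(\<Prod>D\<in>C - X. \<bar>y D \<gamma>\<bar>) \<le> (\<Prod>D\<in>C - X. ?M D)" by (intro prod_mono conjI abs_ge_zero 2)
      have 5: "0 \<le> (\<Prod>D\<in>X. \<bar>mom \<Phi>r D \<gamma>\<bar>)" "0 \<le> (\<Prod>D\<in>C - X. \<bar>y D \<gamma>\<bar>)" by (auto intro: prod_nonneg)
      show ?thesis
        by (rule mult_mono[OF E_range(2) mult_mono[OF 3 4 order_trans[OF 5(1) 3] 5(2)] _ mult_nonneg_nonneg[OF 5]]) simp
    qed
    also have "\<dots> = (\<Prod>D\<in>C. ?M D)" using prod.subset_diff[OF X finC, of ?M] by (simp add: mult.commute)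
    also have "\<dots> = (\<Prod>D\<in>C. mom_const K (card D) + mom_const K 1 ^ card D) * edge_prod \<gamma> ^ (\<Sum>D\<in>C. 2 * card D)"
      by (simp add: prod.distrib power_sum)
    finally show "\<bar>H X \<gamma>\<bar> \<le> (\<Prod>D\<in>C. mom_const K (card D) + mom_const K 1 ^ card D) * edge_prod \<gamma> ^ (\<Sum>D\<in>C. 2 * card D)" .
  qed
  have zero: "(\<integral>\<gamma>. hat_prod \<gamma> * of_real (H X \<gamma>) \<partial>edge_lborel) = 0" if X: "X \<in> Pow C - {C}" for X
  proof (rule hat_prod_zero[OF Psi_meas Psi_even Hm])
    have "\<not> parity_ok G X"
    proof
      assume p: "parity_ok G X"
      have "\<forall>D\<in>X. D \<noteq> {} \<and> D \<subseteq> W"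
      proof
        fix D assume "D \<in> X"
        then have "card D \<ge> 2" "D \<subseteq> W" using X Cf by (auto simp: fam_def)
        then show "D \<noteq> {} \<and> D \<subseteq> W" by auto
      qed
      from parity_cost_bound[OF this p] have "cost C \<le> cost X" using eq by simp
      moreover obtain D where D: "D \<in> C - X" using X by blast
      have "cost X < cost C"
        unfolding cost_def
      proof (rule sum_strict_mono2[OF finC _ D])
        have "card D \<ge> 2" using D Cf by (auto simp: fam_def)
        then show "0 < card D - 1" by simp
      qed (use X in auto)
      ultimately show False by simp
    qed
    then show "\<not> parity_ok G X \<or> (\<exists>w\<in>W. odd (wdeg G w))" by blast
  next
    fix S \<gamma> assume m: "\<And>A. A \<in> X \<or> (\<exists>w. A = {w}) \<Longrightarrow> mom \<Psi> A (flip S \<gamma>) = mom \<Psi> A \<gamma>"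
    then show "H X (flip S \<gamma>) = H X \<gamma>" by (simp add: H_def E_def y_def mom_Phir)
  qed
  have "(\<Prod>D\<in>C. \<sigma> \<Psi> D \<gamma>) = (\<Sum>X\<in>Pow C. (\<Prod>D\<in>X. mom \<Phi>r D \<gamma>) * (\<Prod>D\<in>C - X. y D \<gamma>))" for \<gamma>
    unfolding prod_add[OF finC, symmetric] by (simp add: \<sigma>_def y_def mom_Phir algebra_simps)
  then have "sigma_term C = (\<integral>\<gamma>. (\<Sum>X\<in>Pow C. hat_prod \<gamma> * of_real (H X \<gamma>)) \<partial>edge_lborel)"
    unfolding sigma_term_def E_eq H_def by (simp add: sum_distrib_left)
  also have "\<dots> = (\<Sum>X\<in>Pow C. \<integral>\<gamma>. hat_prod \<gamma> * of_real (H X \<gamma>) \<partial>edge_lborel)"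
    by (rule Bochner_Integration.integral_sum) (use int in auto)
  also have "\<dots> = (\<Sum>X\<in>{C}. \<integral>\<gamma>. hat_prod \<gamma> * of_real (H X \<gamma>) \<partial>edge_lborel)"
    by (rule sum.mono_neutral_right) (use finC zero in auto)
  also have "\<dots> = mom_term C" by (simp add: mom_term_def H_def E_def)
  finally show ?thesis .
qed

text \<open>\<open>tight_structure\<close> cuts a family with a nonzero term into decompositions of
  the big blocks, and \<open>admissible_family\<close> glues any choice of decompositions to a
  critical family. Cutting undoes gluing and conversely, so the sum can be reindexed by the
  choices.\<close>

lemma crit_sum:
  "(\<Sum>C\<in>crit. sigma_term C) = (if admissible G then \<Sum>c\<in>(\<Pi>\<^sub>E B\<in>big_blocks G. decomps B). mom_term (\<Union>B\<in>big_blocks G. c B) else 0)"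
proof -
  have fcrit: "finite crit" unfolding crit_def
    by (rule finite_subset[of _ "Pow fam"]) (use fin_fam in auto)
  have struct: "admissible G \<and> (\<forall>B\<in>big_blocks G. {A \<in> C. A \<subseteq> B} \<in> decomps B) \<and> C = (\<Union>B\<in>big_blocks G. {A \<in> C. A \<subseteq> B})"
    if C: "C \<in> crit" "mom_term C \<noteq> 0" for C
  proof -
    have p: "parity_ok G C" "\<And>w. w \<in> W \<Longrightarrow> even (wdeg G w)" using mom_term_zero[of C] C(2) by blast+
    have A: "A \<subseteq> W \<and> card A \<ge> 2" if "A \<in> C" for A using that C(1) by (auto simp: crit_def fam_def)
    have e: "2 * (card W + card V) = totE + 2 * cost C + 2" using C(1) by (simp add: crit_def)
    show ?thesis
      using tight_structure(1,3,4)[OF A p e] by blast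
  qed
  have 1: "(\<Sum>C\<in>crit. sigma_term C) = (\<Sum>C\<in>crit. mom_term C)" by (rule sum.cong) (simp_all add: sigma_term_eq_mom_term)
  show ?thesis
  proof (cases "admissible G")
    case False
    then have "mom_term C = 0" if "C \<in> crit" for C using struct[OF that] by blast
    then show ?thesis using False 1 by simp
  next
    case adm: True
    let ?P = "\<Pi>\<^sub>E B\<in>big_blocks G. decomps B"
    let ?u = "\<lambda>c. \<Union>B\<in>big_blocks G. c B"
    have af: "?u c \<in> crit" "\<And>B. B \<in> big_blocks G \<Longrightarrow> {A \<in> ?u c. A \<subseteq> B} = c B" if c: "c \<in> ?P" for c
    proof -
      have cd: "c B \<in> decomps B" if "B \<in> big_blocks G" for B using c that by blast
      note fam = admissible_family[OF adm cd]
      show "{A \<in> ?u c. A \<subseteq> B} = c B" if "B \<in> big_blocks G" for B by (rule fam(2)[OF _ that])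
      have "A \<in> fam" if "A \<in> ?u c" for A using fam(1)[OF _ that] by (simp add: fam_def)
      then show "?u c \<in> crit" using fam(3) by (auto simp: crit_def)
    qed
    have inj: "inj_on ?u ?P"
    proof (rule inj_onI)
      fix c d assume cd: "c \<in> ?P" "d \<in> ?P" "?u c = ?u d"
      show "c = d"
      proof (rule PiE_ext[OF cd(1,2)])
        fix B assume B: "B \<in> big_blocks G"
        show "c B = d B" using af(2)[OF cd(1) B] af(2)[OF cd(2) B] cd(3) by simp
      qed
    qed
    have "(\<Sum>C\<in>crit. mom_term C) = (\<Sum>C\<in>?u ` ?P. mom_term C)"
    proof (rule sum.mono_neutral_right[OF fcrit])
      show "?u ` ?P \<subseteq> crit" using af(1) by blast
      show "\<forall>C\<in>crit - ?u ` ?P. mom_term C = 0"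
      proof (rule ballI, rule ccontr)
        fix C assume C: "C \<in> crit - ?u ` ?P" "mom_term C \<noteq> 0"
        define c where "c = (\<lambda>B\<in>big_blocks G. {A \<in> C. A \<subseteq> B})"
        have "c \<in> ?P" using struct[of C] C by (auto simp: c_def)
        moreover have "?u c = (\<Union>B\<in>big_blocks G. {A \<in> C. A \<subseteq> B})" by (simp add: c_def)
        then have "?u c = C" using struct[of C] C by simp
        ultimately show False using C by blast
      qed
    qed
    also have "\<dots> = (\<Sum>c\<in>?P. mom_term (?u c))" by (simp add: sum.reindex[OF inj])
    finally show ?thesis using adm 1 by simp
  qed
qed

end

section \<open>Positivity, limits and quadratic bounds for the characteristic functions\<close>

section \<open>Characteristic functions of the entries\<close>

lemma char_uminus_symmetric:
  assumes nu: "real_distribution \<nu>" and sym: "symmetric_law \<nu>"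
  shows "char \<nu> (- t) = char \<nu> t"
proof -
  interpret real_distribution \<nu> by (rule nu)
  have "char \<nu> t = (\<integral>x. exp (\<i> * of_real (t * x)) \<partial>distr \<nu> borel uminus)"
    using sym by (simp add: char_def symmetric_law_def)
  also have "\<dots> = (\<integral>x. exp (\<i> * of_real (t * (- x))) \<partial>\<nu>)"
    by (rule integral_distr) auto
  also have "\<dots> = char \<nu> (- t)" by (simp add: char_def)
  finally show ?thesis by simp
qed

lemma Re_char:
  assumes nu: "real_distribution \<nu>"
  shows "Re (char \<nu> t) = (\<integral>x. cos (t * x) \<partial>\<nu>)" and "integrable \<nu> (\<lambda>x. cos (t * x))"
    and "Im (char \<nu> t) = (\<integral>x. sin (t * x) \<partial>\<nu>)"
proof -
  interpret real_distribution \<nu> by (rule nu)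
  have int: "integrable \<nu> (\<lambda>x. exp (\<i> * of_real (t * x)))"
    by (rule integrable_const_bound[where B = 1]) (auto simp del: of_real_mult)
  have e: "exp (\<i> * of_real y) = Complex (cos y) (sin y)" for y
    by (simp add: cis_conv_exp[symmetric] cis.ctr)
  show "Re (char \<nu> t) = (\<integral>x. cos (t * x) \<partial>\<nu>)"
    unfolding char_def using integral_Re[OF int] by (simp add: e del: of_real_mult)
  show "Im (char \<nu> t) = (\<integral>x. sin (t * x) \<partial>\<nu>)"
    unfolding char_def using integral_Im[OF int] by (simp add: e del: of_real_mult)
  show "integrable \<nu> (\<lambda>x. cos (t * x))"
    by (rule integrable_const_bound[where B = 1]) auto
qed

lemma char_symmetric_real:
  assumes nu: "real_distribution \<nu>" and sym: "symmetric_law \<nu>"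
  shows "char \<nu> t = of_real (Re (char \<nu> t))"
proof -
  have "Im (char \<nu> (- t)) = - Im (char \<nu> t)" unfolding Re_char(3)[OF nu] by simp
  then have "Im (char \<nu> t) = 0" using char_uminus_symmetric[OF nu sym, of t] by simp
  then show ?thesis by (simp add: complex_eq_iff)
qed

text \<open>Pointwise, \<open>1 - cos (2 * y)\<close> equals
  \<open>2 * (1 - cos y) * (1 + cos y)\<close>, which is at most \<open>4 * (1 - cos y)\<close>.
  Being linear in the deviation from 1, the inequality survives multiplication by n and the
  limit.\<close>

lemma char_doubling:
  assumes nu: "real_distribution \<nu>"
  shows "1 - Re (char \<nu> (2 * t)) \<le> 4 * (1 - Re (char \<nu> t))"
proof -
  interpret real_distribution \<nu> by (rule nu)
  have one: "prob UNIV = 1" using prob_space by simp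
  have "1 - Re (char \<nu> (2 * t)) = (\<integral>x. 1 - cos (2 * t * x) \<partial>\<nu>)"
    using Re_char(1,2)[OF nu, of "2 * t"] by (simp add: one)
  also have "\<dots> \<le> (\<integral>x. 4 * (1 - cos (t * x)) \<partial>\<nu>)"
  proof (rule integral_mono)
    fix x
    have "0 \<le> (1 - cos (t * x))\<^sup>2" by simp
    moreover have "cos (2 * t * x) = 2 * (cos (t * x))\<^sup>2 - 1"
      using cos_double_cos[of "t * x"] by (simp add: mult.assoc)
    ultimately show "1 - cos (2 * t * x) \<le> 4 * (1 - cos (t * x))"
      by (simp add: power2_eq_square algebra_simps)
  qed (use Re_char(2)[OF nu, of "2 * t"] Re_char(2)[OF nu, of t] in auto)
  also have "\<dots> = 4 * (1 - Re (char \<nu> t))"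
    using Re_char(1,2)[OF nu, of t] by (simp add: one)
  finally show ?thesis .
qed

text \<open>A real continuous function without zeros that equals 1 at the origin stays
  positive.\<close>

lemma char_symmetric_pos:
  assumes nu: "real_distribution \<nu>" and sym: "symmetric_law \<nu>" and nz: "\<And>t. char \<nu> t \<noteq> 0"
  shows "Re (char \<nu> t) > 0"
proof (rule ccontr)
  interpret real_distribution \<nu> by (rule nu)
  assume "\<not> Re (char \<nu> t) > 0"
  then have le: "Re (char \<nu> \<bar>t\<bar>) \<le> 0" using char_uminus_symmetric[OF nu sym, of t] by (cases "t \<ge> 0") auto
  have "continuous_on {0..\<bar>t\<bar>} (\<lambda>x. Re (char \<nu> x))"
    using isCont_char by (intro continuous_intros continuous_at_imp_continuous_on) auto
  then obtain x where "Re (char \<nu> x) = 0"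
    using IVT2'[of "\<lambda>x. Re (char \<nu> x)" "\<bar>t\<bar>" 0 0] le char_zero by auto
  then have "char \<nu> x = 0" using char_symmetric_real[OF nu sym, of x] by simp
  then show False using nz by blast
qed

text \<open>With \<open>y = - ln (c n)\<close>, the inequalities
  \<open>y / (1 + y) \<le> 1 - exp (- y)\<close> and \<open>1 - exp (- y) \<le> y\<close> enclose
  the sequence.\<close>

lemma n_one_minus_tendsto:
  fixes c :: "nat \<Rightarrow> real"
  assumes pos: "\<forall>\<^sub>F n in sequentially. 0 < c n \<and> c n \<le> 1"
    and lim: "(\<lambda>n. - (real n * ln (c n))) \<longlonglongrightarrow> l"
  shows "(\<lambda>n. real n * (1 - c n)) \<longlonglongrightarrow> l"
proof (rule tendsto_sandwich)
  let ?x = "\<lambda>n. - (real n * ln (c n))"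
  have "(\<lambda>n. ?x n / (1 + ?x n * (1 / real n))) \<longlonglongrightarrow> l / (1 + l * 0)"
    by (intro tendsto_intros lim) (real_asymp | simp)+
  then show "(\<lambda>n. ?x n / (1 + ?x n * (1 / real n))) \<longlonglongrightarrow> l" by simp
  show "?x \<longlonglongrightarrow> l" by (rule lim)
  show "\<forall>\<^sub>F n in sequentially. real n * (1 - c n) \<le> ?x n"
    using pos
  proof eventually_elim
    case (elim n)
    have "ln (c n) \<le> c n - 1" using elim by (intro ln_le_minus_one) simp
    then have "real n * (1 - c n) \<le> real n * (- ln (c n))" by (intro mult_left_mono) auto
    then show ?case by simp
  qed
  show "\<forall>\<^sub>F n in sequentially. ?x n / (1 + ?x n * (1 / real n)) \<le> real n * (1 - c n)"
    using pos eventually_gt_at_top[of 0]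
  proof eventually_elim
    case (elim n)
    define y where "y = - ln (c n)"
    have y: "0 \<le> y" "c n = exp (- y)" using elim by (auto simp: y_def ln_le_zero_iff)
    have "1 + y \<le> exp y" by (rule exp_ge_add_one_self)
    then have "exp (- y) \<le> 1 / (1 + y)" using y(1) by (simp add: exp_minus field_simps)
    then have "1 - 1 / (1 + y) \<le> 1 - c n" using y by simp
    moreover have "1 - 1 / (1 + y) = y / (1 + y)" using y(1) by (simp add: field_simps)
    ultimately have "real n * (y / (1 + y)) \<le> real n * (1 - c n)" by (intro mult_left_mono) auto
    moreover have "?x n / (1 + ?x n * (1 / real n)) = real n * (y / (1 + y))"
      using elim by (simp add: y_def)
    ultimately show ?case by simp
  qed
qed

text \<open>The doubling inequality of characteristic functions passes to the limit and gives quadratic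
  growth of the exponent.\<close>

lemma quadratic_growth:
  fixes \<Psi> :: "real \<Rightarrow> real"
  assumes dbl: "\<And>t. \<Psi> (2 * t) \<le> 4 * \<Psi> t" and B: "\<And>t. \<bar>t\<bar> \<le> 1 \<Longrightarrow> \<Psi> t \<le> B" "0 \<le> B"
  shows "\<Psi> t \<le> 4 * B * (1 + \<bar>t\<bar>)\<^sup>2"
proof -
  have pow: "\<bar>t\<bar> \<le> 2 ^ k \<Longrightarrow> \<Psi> t \<le> 4 ^ k * B" for k t
  proof (induction k arbitrary: t)
    case (Suc k)
    have "\<Psi> t \<le> 4 * \<Psi> (t / 2)" using dbl[of "t / 2"] by simp
    also have "\<dots> \<le> 4 * (4 ^ k * B)" using Suc.IH[of "t / 2"] Suc.prems by simp
    finally show ?case by simp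
  qed (use B in simp)
  show ?thesis
  proof (cases "\<bar>t\<bar> \<le> 1")
    case True
    have "1 \<le> (1 + \<bar>t\<bar>)\<^sup>2" by (simp add: one_le_power)
    then have "1 \<le> 4 * (1 + \<bar>t\<bar>)\<^sup>2" by linarith
    then have "B * 1 \<le> B * (4 * (1 + \<bar>t\<bar>)\<^sup>2)" using B(2) by (rule mult_left_mono)
    then show ?thesis using B(1)[OF True] by simp
  next
    case False
    obtain m where m: "\<bar>t\<bar> \<le> 2 ^ m" using real_arch_pow[of 2 "\<bar>t\<bar>"] by (auto intro: less_imp_le)
    \<comment> \<open>The least dyadic scale above the modulus of \<open>t\<close>. The preceding
      scale \<open>2 ^ i\<close> lies below it, so \<open>4 ^ Suc i * B\<close> costs only a factor
      4 against the square of \<open>t\<close>.\<close>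
    define k where "k = (LEAST k. \<bar>t\<bar> \<le> 2 ^ k)"
    have k: "\<bar>t\<bar> \<le> 2 ^ k" unfolding k_def by (rule LeastI[of _ m]) (rule m)
    have "k \<noteq> 0" using k False by (cases k) auto
    then obtain i where i: "k = Suc i" by (cases k) auto
    have "\<not> \<bar>t\<bar> \<le> 2 ^ i" using not_less_Least[of i "\<lambda>k. \<bar>t\<bar> \<le> 2 ^ k"] i by (simp add: k_def)
    then have "(2 ^ i)\<^sup>2 \<le> \<bar>t\<bar>\<^sup>2" by (intro power_mono) auto
    then have "(4 :: real) ^ i \<le> \<bar>t\<bar>\<^sup>2" by (simp add: power2_eq_square power_mult_distrib[symmetric])
    also have "\<dots> \<le> (1 + \<bar>t\<bar>)\<^sup>2" by (intro power_mono) auto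
    finally have "4 * B * 4 ^ i \<le> 4 * B * (1 + \<bar>t\<bar>)\<^sup>2" using B(2) by (intro mult_left_mono) auto
    then show ?thesis using pow[OF k] by (simp add: i mult_ac)
  qed
qed

text \<open>Uniform convergence works in both directions. At the single index \<open>N\<close> the
  logarithm of the characteristic function is continuous, which bounds the limit on [-1, 1];
  \<open>quadratic_growth\<close> extends the bound to the line, and the uniform distance returns it
  to all \<open>n \<ge> N\<close>. Finally \<open>ln c \<le> c - 1\<close> passes from the logarithm
  to \<open>1 - c\<close>.\<close>

lemma A1_exponent:
  assumes A1: "A1 \<nu>w \<Phi> \<nu>x \<sigma>x"
  obtains N K where "\<And>n t. n \<ge> N \<Longrightarrow> char (\<nu>w n) t = of_real (Re (char (\<nu>w n) t)) \<and> 0 < Re (char (\<nu>w n) t) \<and> Re (char (\<nu>w n) t) \<le> 1"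
    and "\<And>n t. Re (char (\<nu>w n) (- t)) = Re (char (\<nu>w n) t)"
    and "\<And>n t. n \<ge> N \<Longrightarrow> real n * (1 - Re (char (\<nu>w n) t)) \<le> K * (1 + \<bar>t\<bar>)\<^sup>2"
    and "\<And>t. (\<lambda>n. real n * (1 - Re (char (\<nu>w n) t))) \<longlonglongrightarrow> - Re (\<Phi> t)"
    and "\<And>t. \<Phi> t = of_real (Re (\<Phi> t))"
proof -
  define c where "c n t = Re (char (\<nu>w n) t)" for n t
  have nu: "real_distribution (\<nu>w n)" and sym: "symmetric_law (\<nu>w n)" for n
    using A1 by (auto simp: A1_def)
  have unif: "uniform_limit UNIV (\<lambda>n t. of_nat n * Ln (char (\<nu>w n) t)) \<Phi> sequentially"
    using A1 by (simp add: A1_def)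
  have "\<forall>\<^sub>F n in sequentially. \<forall>t. char (\<nu>w n) t \<noteq> 0" using A1 by (simp add: A1_def)
  then obtain N0 where N0: "\<And>n t. n \<ge> N0 \<Longrightarrow> char (\<nu>w n) t \<noteq> 0"
    unfolding eventually_sequentially by blast
  have real: "char (\<nu>w n) t = of_real (c n t)" for n t
    unfolding c_def by (rule char_symmetric_real[OF nu sym])
  have pos: "0 < c n t" if "n \<ge> N0" for n t
    unfolding c_def by (rule char_symmetric_pos[OF nu sym N0[OF that]])
  have le1: "c n t \<le> 1" for n t
    using real_distribution.cmod_char_le_1[OF nu, of n t] complex_Re_le_cmod[of "char (\<nu>w n) t"] by (simp add: c_def)
  have even: "c n (- t) = c n t" for n t
    unfolding c_def by (simp only: char_uminus_symmetric[OF nu sym])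
  have Ln_eq: "of_nat n * Ln (char (\<nu>w n) t) = of_real (real n * ln (c n t))" if "n \<ge> N0" for n t
    unfolding real using Ln_of_real[OF pos[OF that, of t]] by simp
  have "\<forall>\<^sub>F n in sequentially. \<forall>t\<in>UNIV. dist (of_nat n * Ln (char (\<nu>w n) t)) (\<Phi> t) < 1"
    using unif unfolding uniform_limit_iff by (elim allE[of _ "1 :: real"]) simp
  then obtain N1 where N1: "\<And>n t. n \<ge> N1 \<Longrightarrow> dist (of_nat n * Ln (char (\<nu>w n) t)) (\<Phi> t) < 1"
    unfolding eventually_sequentially by blast
  have ptlim: "(\<lambda>n. of_nat n * Ln (char (\<nu>w n) t)) \<longlonglongrightarrow> \<Phi> t" for t
    by (rule tendsto_uniform_limitI[OF unif]) simp
  have ev: "\<forall>\<^sub>F n in sequentially. of_nat n * Ln (char (\<nu>w n) t) = of_real (real n * ln (c n t))" for t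
    unfolding eventually_sequentially using Ln_eq by blast
  have lim: "(\<lambda>n. complex_of_real (real n * ln (c n t))) \<longlonglongrightarrow> \<Phi> t" for t
    by (rule Lim_transform_eventually[OF ptlim ev])
  have limr: "(\<lambda>n. real n * ln (c n t)) \<longlonglongrightarrow> Re (\<Phi> t)" for t
    using tendsto_Re[OF lim[of t]] by simp
  have "(\<lambda>n. Im (complex_of_real (real n * ln (c n t)))) \<longlonglongrightarrow> Im (\<Phi> t)" for t
    by (rule tendsto_Im[OF lim])
  then have "Im (\<Phi> t) = 0" for t using LIMSEQ_unique[of "\<lambda>_. 0"] by fastforce
  then have Phi_real: "\<Phi> t = of_real (Re (\<Phi> t))" for t by (simp add: complex_eq_iff)
  have ntend: "(\<lambda>n. real n * (1 - c n t)) \<longlonglongrightarrow> - Re (\<Phi> t)" for t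
  proof (rule n_one_minus_tendsto)
    show "\<forall>\<^sub>F n in sequentially. 0 < c n t \<and> c n t \<le> 1"
      unfolding eventually_sequentially using pos le1 by blast
    show "(\<lambda>n. - (real n * ln (c n t))) \<longlonglongrightarrow> - Re (\<Phi> t)" by (intro tendsto_minus limr)
  qed
  define N where "N = max N0 N1"
  have close: "\<bar>real n * ln (c n t) - Re (\<Phi> t)\<bar> < 1" if "n \<ge> N" for n t
  proof -
    have "n \<ge> N0" "n \<ge> N1" using that by (auto simp: N_def)
    have "\<bar>Re (of_nat n * Ln (char (\<nu>w n) t) - \<Phi> t)\<bar> \<le> norm (of_nat n * Ln (char (\<nu>w n) t) - \<Phi> t)"
      by (rule abs_Re_le_cmod)
    also have "\<dots> < 1" using N1[OF \<open>n \<ge> N1\<close>, of t] by (simp add: dist_norm)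
    finally show ?thesis by (simp add: Ln_eq[OF \<open>n \<ge> N0\<close>])
  qed
  have dbl: "- Re (\<Phi> (2 * t)) \<le> 4 * (- Re (\<Phi> t))" for t
  proof (rule LIMSEQ_le[OF ntend])
    show "(\<lambda>n. 4 * (real n * (1 - c n t))) \<longlonglongrightarrow> 4 * (- Re (\<Phi> t))" by (intro tendsto_intros ntend)
    have "real n * (1 - c n (2 * t)) \<le> 4 * (real n * (1 - c n t))" for n
      using mult_left_mono[OF char_doubling[OF nu, of n t], of "real n"] by (simp add: c_def algebra_simps)
    then show "\<exists>N. \<forall>n\<ge>N. real n * (1 - c n (2 * t)) \<le> 4 * (real n * (1 - c n t))" by blast
  qed
  obtain B where B: "\<And>t. \<bar>t\<bar> \<le> 1 \<Longrightarrow> - Re (\<Phi> t) \<le> B" "0 \<le> B"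
  proof -
    have cont: "continuous_on {-1..1} (\<lambda>t. - (real N * ln (c N t)))"
    proof (intro continuous_intros)
      show "continuous_on {-1..1} (c N)"
        unfolding c_def using real_distribution.isCont_char[OF nu]
        by (intro continuous_intros continuous_at_imp_continuous_on) auto
      show "\<forall>t\<in>{-1..1}. c N t \<noteq> 0" using pos[of N] by (metis N_def less_irrefl max.cobounded1)
    qed
    have "bounded ((\<lambda>t. - (real N * ln (c N t))) ` {-1..1})"
      by (rule compact_imp_bounded[OF compact_continuous_image[OF cont]]) simp
    then obtain b where "\<forall>x \<in> (\<lambda>t. - (real N * ln (c N t))) ` {-1..1}. norm x \<le> b"
      unfolding bounded_iff by blast
    then have b: "\<bar>real N * ln (c N t)\<bar> \<le> b" if "t \<in> {-1..1}" for t using that by fastforce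
    show thesis
    proof (rule that[of "b + 1"])
      fix t :: real assume "\<bar>t\<bar> \<le> 1"
      then have "\<bar>real N * ln (c N t)\<bar> \<le> b" by (intro b) auto
      then show "- Re (\<Phi> t) \<le> b + 1" using close[of N t] by simp
    next
      show "0 \<le> b + 1" using b[of 0] by simp
    qed
  qed
  have growth: "- Re (\<Phi> t) \<le> 4 * B * (1 + \<bar>t\<bar>)\<^sup>2" for t
    by (rule quadratic_growth[of "\<lambda>t. - Re (\<Phi> t)", OF dbl B])
  show thesis
  \<comment> \<open>\<open>4 * B\<close> is the constant of \<open>quadratic_growth\<close>, and 1
    is the uniform distance between the logarithm at \<open>n\<close> and its limit.\<close>
  proof (rule that[of N "4 * B + 1"])
    fix n t assume n: "n \<ge> N"
    then have "n \<ge> N0" by (simp add: N_def)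
    then show "char (\<nu>w n) t = of_real (Re (char (\<nu>w n) t)) \<and> 0 < Re (char (\<nu>w n) t) \<and> Re (char (\<nu>w n) t) \<le> 1"
      using real pos le1 by (simp add: c_def)
    have "ln (c n t) \<le> c n t - 1" using pos[OF \<open>n \<ge> N0\<close>] by (rule ln_le_minus_one)
    then have "real n * (1 - c n t) \<le> real n * (- ln (c n t))" by (intro mult_left_mono) auto
    also have "\<dots> \<le> - Re (\<Phi> t) + 1" using close[OF n, of t] by simp
    also have "\<dots> \<le> 4 * B * (1 + \<bar>t\<bar>)\<^sup>2 + 1 * (1 + \<bar>t\<bar>)\<^sup>2"
      by (intro add_mono growth) (simp add: one_le_power)
    finally show "real n * (1 - Re (char (\<nu>w n) t)) \<le> (4 * B + 1) * (1 + \<bar>t\<bar>)\<^sup>2"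
      by (simp add: c_def algebra_simps)
  next
    fix n t show "Re (char (\<nu>w n) (- t)) = Re (char (\<nu>w n) t)" using even by (simp add: c_def)
  next
    fix t show "(\<lambda>n. real n * (1 - Re (char (\<nu>w n) t))) \<longlonglongrightarrow> - Re (\<Phi> t)"
      using ntend by (simp add: c_def)
  qed (rule Phi_real)
qed

section \<open>Number of injections and powers of the dimensions\<close>

section \<open>The scaling factor\<close>

lemma card_inj_maps: "finite A \<Longrightarrow> card (inj_maps A p) = (\<Prod>i\<in>{0..<card A}. p - i)"
  using card_inj_on_subset_funcset[of A "{1..p}" A] by (simp add: inj_maps_def)

lemma card_inj_maps_tendsto:
  assumes "finite A" and p: "filterlim p at_top sequentially"
  shows "(\<lambda>N. real (card (inj_maps A (p N))) / real (p N) ^ card A) \<longlonglongrightarrow> 1"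
proof -
  have "(\<lambda>p. \<Prod>i\<in>{0..<card A}. (real p - real i) / real p) \<longlonglongrightarrow> (\<Prod>i\<in>{0..<card A}. 1)"
  proof (rule tendsto_prod)
    show "(\<lambda>p. (real p - real i) / real p) \<longlonglongrightarrow> 1" for i by real_asymp
  qed
  moreover have "\<forall>\<^sub>F p in sequentially. (\<Prod>i\<in>{0..<card A}. (real p - real i) / real p) = real (card (inj_maps A p)) / real p ^ card A"
    using eventually_ge_at_top[of "card A"]
  proof eventually_elim
    case (elim p)
    then show ?case
      by (simp add: card_inj_maps[OF assms(1)] prod_dividef of_nat_diff)
  qed
  ultimately have "(\<lambda>p. real (card (inj_maps A p)) / real p ^ card A) \<longlonglongrightarrow> 1"
    using Lim_transform_eventually by fastforce
  then show ?thesis by (rule filterlim_compose[OF _ p])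
qed

text \<open>The number of pairs of injections is asymptotic to a power of p times a power of m.
  Expressing p and m by n and the convergent ratios n/p and n/m leaves exactly n to the power
  \<open>L\<close>.\<close>

lemma scaling_tendsto:
  fixes G :: "('w, 'v) bigraph"
  assumes fin: "finite_bigraph G" and A3: "A3 p m n \<phi> \<psi>"
  defines "L \<equiv> real (card (wverts G)) - 1 + real (card (vverts G)) - real (total_mult G (edges G)) / 2"
  shows "(\<lambda>N. (1 / real (p N) * real (card (inj_maps (wverts G) (p N))) * real (card (inj_maps (vverts G) (m N)))
    * (1 / sqrt (real (m N))) ^ total_mult G (edges G)) / real (n N) powr L) \<longlonglongrightarrow> scale_factor G \<phi> \<psi>"
proof -
  define E where "E = total_mult G (edges G)"
  define w where "w = card (wverts G)"
  define v where "v = card (vverts G)"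
  have finW: "finite (wverts G)" "finite (vverts G)" using fin by (auto simp: finite_bigraph_def)
  have pos: "\<phi> > 0" "\<psi> > 0" and lims: "filterlim p at_top sequentially" "filterlim m at_top sequentially" "filterlim n at_top sequentially"
    and r: "(\<lambda>N. real (n N) / real (m N)) \<longlonglongrightarrow> \<phi>" "(\<lambda>N. real (n N) / real (p N)) \<longlonglongrightarrow> \<psi>"
    using A3 by (auto simp: A3_def)
  have "(\<lambda>N. (real (card (inj_maps (wverts G) (p N))) / real (p N) ^ w) * (real (card (inj_maps (vverts G) (m N))) / real (m N) ^ v)
      * ((real (n N) / real (m N)) powr (real E / 2 - real v) / (real (n N) / real (p N)) powr (real w - 1)))
      \<longlonglongrightarrow> 1 * 1 * (\<phi> powr (real E / 2 - real v) / \<psi> powr (real w - 1))"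
    unfolding w_def v_def
    by (intro tendsto_mult tendsto_divide card_inj_maps_tendsto finW lims tendsto_powr r tendsto_const) (use pos in auto)
  moreover have "\<forall>\<^sub>F N in sequentially. (real (card (inj_maps (wverts G) (p N))) / real (p N) ^ w) * (real (card (inj_maps (vverts G) (m N))) / real (m N) ^ v)
      * ((real (n N) / real (m N)) powr (real E / 2 - real v) / (real (n N) / real (p N)) powr (real w - 1))
      = (1 / real (p N) * real (card (inj_maps (wverts G) (p N))) * real (card (inj_maps (vverts G) (m N)))
        * (1 / sqrt (real (m N))) ^ E) / real (n N) powr L"
  proof -
    have "\<forall>\<^sub>F N in sequentially. 0 < p N" "\<forall>\<^sub>F N in sequentially. 0 < m N" "\<forall>\<^sub>F N in sequentially. 0 < n N"
      by (rule eventually_compose_filterlim[OF eventually_gt_at_top], rule lims)+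
    then show ?thesis
    proof eventually_elim
      case (elim N)
      define P M Q where "P = real (p N)" and "M = real (m N)" and "Q = real (n N)"
      have gt: "P > 0" "M > 0" "Q > 0" using elim by (auto simp: P_def M_def Q_def)
      have s: "(1 / sqrt M) ^ E = M powr (- (real E / 2))"
      proof -
        have "1 / sqrt M = M powr (- (1 / 2))" by (simp only: powr_minus_divide powr_half_sqrt[OF less_imp_le[OF gt(2)]])
        then show ?thesis using gt by (simp add: powr_power)
      qed
      have "(a / P ^ w) * (b / M ^ v) * ((Q / M) powr (real E / 2 - real v) / (Q / P) powr (real w - 1))
          = (1 / P * a * b * (1 / sqrt M) ^ E) / Q powr L" for a b
      proof -
        have "(Q / M) powr (real E / 2 - real v) = Q powr (real E / 2 - real v) * M powr (real v - real E / 2)"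
        proof -
          have "(Q / M) powr (real E / 2 - real v) = Q powr (real E / 2 - real v) / M powr (real E / 2 - real v)"
            using gt by (simp add: powr_divide)
          also have "M powr (real E / 2 - real v) = 1 / M powr (real v - real E / 2)"
            using powr_minus_divide[of M "real v - real E / 2"] by simp
          finally show ?thesis by simp
        qed
        moreover have "1 / (Q / P) powr (real w - 1) = P powr (real w - 1) / Q powr (real w - 1)"
          using gt by (simp add: powr_divide)
        moreover have "M powr (real v - real E / 2) = M ^ v * M powr (- (real E / 2))"
          using gt powr_add[of M "real v" "- (real E / 2)"] by (simp add: powr_realpow)
        moreover have "P powr (real w - 1) = P ^ w / P"
          using gt by (simp add: powr_diff powr_realpow)
        moreover have "Q powr L * Q powr (real E / 2 - real v) = Q powr (real w - 1)"
          by (simp add: powr_add[symmetric] L_def w_def v_def E_def)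
        moreover have "Q powr L > 0" "Q powr (real w - 1) > 0" using gt by auto
        ultimately show ?thesis
          unfolding s using gt
          by (simp add: divide_simps) (simp add: mult_ac)
      qed
      then show ?case unfolding P_def M_def Q_def .
    qed
  qed
  ultimately have "(\<lambda>N. (1 / real (p N) * real (card (inj_maps (wverts G) (p N))) * real (card (inj_maps (vverts G) (m N)))
        * (1 / sqrt (real (m N))) ^ E) / real (n N) powr L) \<longlonglongrightarrow> 1 * 1 * (\<phi> powr (real E / 2 - real v) / \<psi> powr (real w - 1))"
    by (rule Lim_transform_eventually)
  then show ?thesis unfolding scale_factor_def E_def w_def v_def by simp
qed

section \<open>Splitting the limiting integral along the blocks\<close>

section \<open>Factorization over the blocks\<close>

context osc_limit
begin

definition block_eidx :: "'w set \<Rightarrow> ('w \<times> 'v \<times> nat) set" where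
  "block_eidx B = {e \<in> eidx G. fst e \<in> B}"

definition block_int :: "'w set \<Rightarrow> 'w set set \<Rightarrow> complex" where
  "block_int B C = (\<integral>\<gamma>. (\<Prod>e\<in>block_eidx B. fourier f (\<gamma> e)) *
     of_real (exp (\<Sum>w\<in>B. mom \<Phi>r {w} \<gamma>) * (\<Prod>D\<in>C. mom \<Phi>r D \<gamma>)) \<partial>PiM (block_eidx B) (\<lambda>_. lborel))"

lemma finite_block_eidx: "finite (block_eidx B)"
  using finI by (simp add: block_eidx_def)

lemma mom_cong_block_eidx:
  assumes "D \<subseteq> B" "\<And>e. e \<in> block_eidx B \<Longrightarrow> \<gamma> e = \<gamma>' e"
  shows "mom u D \<gamma> = mom u D \<gamma>'"
proof -
  have "lin G \<gamma> w x = lin G \<gamma>' w x" if "w \<in> D" for w x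
    unfolding lin_def
  proof (intro sum.cong refl arg_cong2[where f = "(*)"])
    fix v i assume "v \<in> {v. (w, v) \<in> edges G}" "i \<in> {1..mult G w v}"
    then have "(w, v, i) \<in> block_eidx B" using that assms(1) by (auto simp: block_eidx_def eidx_def)
    then show "\<gamma> (w, v, i) = \<gamma>' (w, v, i)" by (rule assms(2))
  qed
  then show ?thesis unfolding mom_def by (auto intro!: Bochner_Integration.integral_cong prod.cong)
qed

text \<open>Extending the block frequencies by zero gives access to the measurability and the bounds
  on the full frequency space; under this extension \<open>edge_prod\<close> reduces to the product
  over the block.\<close>

lemma block_int_integrable:
  assumes C: "finite C" "\<And>D. D \<in> C \<Longrightarrow> D \<subseteq> B"
  shows "integrable (PiM (block_eidx B) (\<lambda>_. lborel)) (\<lambda>\<gamma>. (\<Prod>e\<in>block_eidx B. fourier f (\<gamma> e)) *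
     of_real (exp (\<Sum>w\<in>B. mom \<Phi>r {w} \<gamma>) * (\<Prod>D\<in>C. mom \<Phi>r D \<gamma>)))"
proof -
  define ext0 :: "('w \<times> 'v \<times> nat \<Rightarrow> real) \<Rightarrow> _" where "ext0 \<gamma> = (\<lambda>e\<in>eidx G. if e \<in> block_eidx B then \<gamma> e else 0)" for \<gamma>
  define H where "H \<gamma> = exp (\<Sum>w\<in>B. mom \<Phi>r {w} \<gamma>) * (\<Prod>D\<in>C. mom \<Phi>r D \<gamma>)" for \<gamma>
  define c where "c = (\<Prod>D\<in>C. mom_const K (card D))"
  define k where "k = (\<Sum>D\<in>C. 2 * card D)"
  have [measurable]: "\<Phi>r \<in> borel_measurable borel" using growth_Phir by (simp add: growth_def)
  have Hm: "H \<in> borel_measurable edge_lborel" unfolding H_def by measurable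
  have extm: "ext0 \<in> measurable (PiM (block_eidx B) (\<lambda>_. lborel)) edge_lborel"
    unfolding ext0_def[abs_def]
  proof (rule measurable_restrict)
    fix e assume "e \<in> eidx G"
    show "(\<lambda>\<gamma>. if e \<in> block_eidx B then \<gamma> e else 0) \<in> measurable (PiM (block_eidx B) (\<lambda>_. lborel :: real measure)) lborel"
      by (cases "e \<in> block_eidx B") (auto intro: measurable_component_singleton)
  qed
  have eqH: "exp (\<Sum>w\<in>B. mom \<Phi>r {w} \<gamma>) * (\<Prod>D\<in>C. mom \<Phi>r D \<gamma>) = H (ext0 \<gamma>)" for \<gamma>
  proof -
    have m: "mom \<Phi>r D \<gamma> = mom \<Phi>r D (ext0 \<gamma>)" if "D \<subseteq> B" for D
      using that by (rule mom_cong_block_eidx) (auto simp: ext0_def block_eidx_def)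
    have "(\<Sum>w\<in>B. mom \<Phi>r {w} \<gamma>) = (\<Sum>w\<in>B. mom \<Phi>r {w} (ext0 \<gamma>))" by (intro sum.cong refl m) auto
    moreover have "(\<Prod>D\<in>C. mom \<Phi>r D \<gamma>) = (\<Prod>D\<in>C. mom \<Phi>r D (ext0 \<gamma>))" by (intro prod.cong refl m C(2))
    ultimately show ?thesis by (simp add: H_def)
  qed
  have edge_prod_ext: "edge_prod (ext0 \<gamma>) = (\<Prod>e\<in>block_eidx B. 1 + \<bar>\<gamma> e\<bar>)" for \<gamma>
    unfolding edge_prod_def
    by (rule prod.mono_neutral_cong_right) (use finI in \<open>auto simp: ext0_def block_eidx_def\<close>)
  have Hb: "\<bar>H \<gamma>\<bar> \<le> c * edge_prod \<gamma> ^ k" for \<gamma>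
  proof -
    have "\<bar>H \<gamma>\<bar> = exp (\<Sum>w\<in>B. mom \<Phi>r {w} \<gamma>) * (\<Prod>D\<in>C. \<bar>mom \<Phi>r D \<gamma>\<bar>)" by (simp add: H_def abs_mult abs_prod)
    also have "\<dots> \<le> 1 * (\<Prod>D\<in>C. mom_const K (card D) * edge_prod \<gamma> ^ (2 * card D))"
      by (intro mult_mono exp_mom_le_1 prod_mono conjI abs_ge_zero mom_bound growth_Phir prod_nonneg) auto
    also have "\<dots> = c * edge_prod \<gamma> ^ k" by (simp add: prod.distrib c_def k_def power_sum)
    finally show ?thesis .
  qed
  show ?thesis
    unfolding eqH
  proof (rule Bochner_Integration.integrable_bound)
    show "integrable (PiM (block_eidx B) (\<lambda>_. lborel)) (\<lambda>\<gamma>. c * (\<Prod>e\<in>block_eidx B. norm (fourier f (\<gamma> e)) * (1 + \<bar>\<gamma> e\<bar>) ^ k))"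
      by (intro integrable_mult_right fourier_prod_integrable finite_block_eidx f)
    have "(\<lambda>\<gamma>. H (ext0 \<gamma>)) \<in> borel_measurable (PiM (block_eidx B) (\<lambda>_. lborel))"
      by (rule measurable_compose[OF extm Hm])
    then show "(\<lambda>\<gamma>. (\<Prod>e\<in>block_eidx B. fourier f (\<gamma> e)) * of_real (H (ext0 \<gamma>))) \<in> borel_measurable (PiM (block_eidx B) (\<lambda>_. lborel))"
      by (intro borel_measurable_times fourier_prod_measurable[OF f] measurable_compose[OF _ borel_measurable_of_real])
    show "AE \<gamma> in PiM (block_eidx B) (\<lambda>_. lborel). norm ((\<Prod>e\<in>block_eidx B. fourier f (\<gamma> e)) * of_real (H (ext0 \<gamma>)))
        \<le> norm (c * (\<Prod>e\<in>block_eidx B. norm (fourier f (\<gamma> e)) * (1 + \<bar>\<gamma> e\<bar>) ^ k))"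
    proof (intro AE_I2)
      fix \<gamma>
      have "norm ((\<Prod>e\<in>block_eidx B. fourier f (\<gamma> e)) * of_real (H (ext0 \<gamma>))) = (\<Prod>e\<in>block_eidx B. norm (fourier f (\<gamma> e))) * \<bar>H (ext0 \<gamma>)\<bar>"
        by (simp add: norm_mult prod_norm)
      also have "\<dots> \<le> (\<Prod>e\<in>block_eidx B. norm (fourier f (\<gamma> e))) * (c * edge_prod (ext0 \<gamma>) ^ k)"
        by (intro mult_left_mono Hb prod_nonneg) auto
      also have "\<dots> = c * (\<Prod>e\<in>block_eidx B. norm (fourier f (\<gamma> e)) * (1 + \<bar>\<gamma> e\<bar>) ^ k)"
        by (simp add: edge_prod_ext prod.distrib prod_power_distrib)
      also have "\<dots> \<le> norm (c * (\<Prod>e\<in>block_eidx B. norm (fourier f (\<gamma> e)) * (1 + \<bar>\<gamma> e\<bar>) ^ k))"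
        unfolding real_norm_def by (rule abs_ge_self)
      finally show "norm ((\<Prod>e\<in>block_eidx B. fourier f (\<gamma> e)) * of_real (H (ext0 \<gamma>)))
        \<le> norm (c * (\<Prod>e\<in>block_eidx B. norm (fourier f (\<gamma> e)) * (1 + \<bar>\<gamma> e\<bar>) ^ k))" .
    qed
  qed
qed

lemma blocks_facts:
  shows "partition_on W (blocks G)" "finite (blocks G)"
    and "\<And>B. B \<in> blocks G \<Longrightarrow> B \<subseteq> W \<and> B \<noteq> {} \<and> finite B"
    and "\<And>B B'. B \<in> blocks G \<Longrightarrow> B' \<in> blocks G \<Longrightarrow> B \<noteq> B' \<Longrightarrow> B \<inter> B' = {}"
proof -
  show p: "partition_on W (blocks G)" by (rule blocks_partition[OF finW])
  show "finite (blocks G)" by (rule finite_elements[OF finW p])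
  show "B \<subseteq> W \<and> B \<noteq> {} \<and> finite B" if "B \<in> blocks G" for B
    using that finite_subset[OF _ finW] by (auto simp: blocks_iff inseparable_def)
  show "B \<inter> B' = {}" if "B \<in> blocks G" "B' \<in> blocks G" "B \<noteq> B'" for B B'
    using partition_onD2[OF p] that by (meson disjointD)
qed

lemma eidx_UN_blocks: "(\<Union>B\<in>blocks G. block_eidx B) = eidx G"
proof -
  have "\<Union>(blocks G) = W" by (rule partition_onD1[OF blocks_facts(1), symmetric])
  then show ?thesis unfolding block_eidx_def eidx_def edges_def by fastforce
qed

lemma block_eidx_disjoint: "B \<in> blocks G \<Longrightarrow> B' \<in> blocks G \<Longrightarrow> B \<noteq> B' \<Longrightarrow> block_eidx B \<inter> block_eidx B' = {}"
  using blocks_facts(4) by (fastforce simp: block_eidx_def)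

text \<open>A moment over \<open>D \<subseteq> B\<close> reads only frequencies whose W-end lies in
  \<open>B\<close>. The integrand is thus a product of functions of disjoint groups of
  variables.\<close>

lemma mom_term_factor:
  assumes c: "\<And>B. B \<in> blocks G \<Longrightarrow> finite (c B)" "\<And>B D. B \<in> blocks G \<Longrightarrow> D \<in> c B \<Longrightarrow> D \<subseteq> B \<and> D \<noteq> {}"
  shows "mom_term (\<Union>B\<in>blocks G. c B) = (\<Prod>B\<in>blocks G. block_int B (c B))"
proof -
  define g where "g B \<gamma> = (\<Prod>e\<in>block_eidx B. fourier f (\<gamma> e)) *
     of_real (exp (\<Sum>w\<in>B. mom \<Phi>r {w} \<gamma>) * (\<Prod>D\<in>c B. mom \<Phi>r D \<gamma>))" for B \<gamma>
  have M: "product_sigma_finite (\<lambda>_. lborel :: real measure)"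
    by (simp add: product_sigma_finite_def sigma_finite_lborel)
  have U: "\<Union>(blocks G) = W" by (rule partition_onD1[OF blocks_facts(1), symmetric])
  have gr: "g B (restrict \<gamma> (block_eidx B)) = g B \<gamma>" if B: "B \<in> blocks G" for B \<gamma>
  proof -
    have m: "mom \<Phi>r D (restrict \<gamma> (block_eidx B)) = mom \<Phi>r D \<gamma>" if "D \<subseteq> B" for D
      using that by (rule mom_cong_block_eidx) simp
    have "(\<Sum>w\<in>B. mom \<Phi>r {w} (restrict \<gamma> (block_eidx B))) = (\<Sum>w\<in>B. mom \<Phi>r {w} \<gamma>)" by (intro sum.cong refl m) auto
    moreover have "(\<Prod>D\<in>c B. mom \<Phi>r D (restrict \<gamma> (block_eidx B))) = (\<Prod>D\<in>c B. mom \<Phi>r D \<gamma>)"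
      by (intro prod.cong refl m) (use c(2)[OF B] in blast)
    ultimately show ?thesis by (simp add: g_def)
  qed
  have pt: "(\<Prod>B\<in>blocks G. g B (restrict \<gamma> (block_eidx B))) = hat_prod \<gamma> * of_real (exp (\<Sum>w\<in>W. mom \<Phi>r {w} \<gamma>) * (\<Prod>D\<in>(\<Union>B\<in>blocks G. c B). mom \<Phi>r D \<gamma>))" for \<gamma>
  proof -
    have 1: "(\<Prod>B\<in>blocks G. \<Prod>e\<in>block_eidx B. fourier f (\<gamma> e)) = hat_prod \<gamma>"
      unfolding hat_prod_def eidx_UN_blocks[symmetric]
      by (rule prod.UNION_disjoint[symmetric]) (use blocks_facts(2) finite_block_eidx block_eidx_disjoint in auto)
    have 2: "(\<Sum>B\<in>blocks G. \<Sum>w\<in>B. mom \<Phi>r {w} \<gamma>) = (\<Sum>w\<in>W. mom \<Phi>r {w} \<gamma>)"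
      unfolding U[symmetric] by (rule sum.Union_disjoint[symmetric, unfolded comp_def]) (use blocks_facts in auto)
    have 3: "(\<Prod>B\<in>blocks G. \<Prod>D\<in>c B. mom \<Phi>r D \<gamma>) = (\<Prod>D\<in>(\<Union>B\<in>blocks G. c B). mom \<Phi>r D \<gamma>)"
    proof (rule prod.UNION_disjoint[symmetric])
      show "\<forall>B\<in>blocks G. \<forall>B'\<in>blocks G. B \<noteq> B' \<longrightarrow> c B \<inter> c B' = {}"
      proof (intro ballI impI)
        fix B B' assume B: "B \<in> blocks G" "B' \<in> blocks G" "B \<noteq> B'"
        show "c B \<inter> c B' = {}"
        proof (rule ccontr)
          assume "c B \<inter> c B' \<noteq> {}"
          then obtain D where D: "D \<in> c B" "D \<in> c B'" by blast
          show False using c(2)[OF B(1) D(1)] c(2)[OF B(2) D(2)] blocks_facts(4)[OF B] by blast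
        qed
      qed
    qed (use blocks_facts(2) c(1) in auto)
    have "(\<Prod>B\<in>blocks G. g B (restrict \<gamma> (block_eidx B))) = (\<Prod>B\<in>blocks G. g B \<gamma>)"
      by (intro prod.cong refl gr)
    also have "\<dots> = (\<Prod>B\<in>blocks G. \<Prod>e\<in>block_eidx B. fourier f (\<gamma> e)) *
        of_real ((\<Prod>B\<in>blocks G. exp (\<Sum>w\<in>B. mom \<Phi>r {w} \<gamma>)) * (\<Prod>B\<in>blocks G. \<Prod>D\<in>c B. mom \<Phi>r D \<gamma>))"
      by (simp add: g_def prod.distrib)
    also have "(\<Prod>B\<in>blocks G. exp (\<Sum>w\<in>B. mom \<Phi>r {w} \<gamma>)) = exp (\<Sum>w\<in>W. mom \<Phi>r {w} \<gamma>)"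
      unfolding 2[symmetric] by (rule exp_sum[OF blocks_facts(2), symmetric])
    finally show ?thesis by (simp only: 1 3)
  qed
  have "(\<Prod>B\<in>blocks G. block_int B (c B)) = (\<Prod>B\<in>blocks G. \<integral>\<gamma>. g B \<gamma> \<partial>PiM (block_eidx B) (\<lambda>_. lborel))"
    by (simp add: block_int_def g_def)
  also have "\<dots> = (\<integral>\<gamma>. (\<Prod>B\<in>blocks G. g B (restrict \<gamma> (block_eidx B))) \<partial>PiM (\<Union>B\<in>blocks G. block_eidx B) (\<lambda>_. lborel))"
  proof (rule integral_PiM_UN[OF M blocks_facts(2), THEN conjunct2, symmetric])
    fix B assume B: "B \<in> blocks G"
    show "integrable (PiM (block_eidx B) (\<lambda>_. lborel)) (g B)"
      unfolding g_def[abs_def] by (rule block_int_integrable) (use c B in auto)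
  qed (use finite_block_eidx block_eidx_disjoint in auto)
  also have "\<dots> = mom_term (\<Union>B\<in>blocks G. c B)"
    unfolding mom_term_def eidx_UN_blocks pt ..
  finally show ?thesis by simp
qed

lemma block_eidx_eq: "B \<subseteq> W \<Longrightarrow> block_eidx B = {(w, v, i). (w, v) \<in> {(w, v). w \<in> B \<and> v \<in> nbs G w} \<and> i \<in> {1..mult G w v}}"
  by (auto simp: block_eidx_def eidx_def edges_def nbs_def)

lemma block_int_eq_C_family:
  assumes Phi: "\<And>t. \<Phi> t = of_real (\<Phi>r t)" and B: "B \<subseteq> W" and C: "\<Union>C = B"
  shows "C_family \<Phi> \<nu> f G C = 1 / (2 * of_real pi) ^ card (block_eidx B) * block_int B C"
proof -
  define E where "E = {(w, v). w \<in> B \<and> v \<in> nbs G w}"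
  have E1: "(\<Union>A\<in>C. edges (induced G A)) = E"
    using C by (auto simp: edges_induced E_def)
  have finE: "finite E"
    by (rule finite_subset[of _ "W \<times> V"]) (use B finW finV in \<open>auto simp: E_def nbs_def\<close>)
  have eBE: "block_eidx B = {(w, v, i). (w, v) \<in> E \<and> i \<in> {1..mult G w v}}"
    unfolding E_def by (rule block_eidx_eq[OF B])
  have cardE: "total_mult G E = card (block_eidx B)" unfolding eBE by (rule card_eidx_of[OF finE, symmetric])
  have Z: "Z_fun \<Phi> G \<gamma> w x = of_real (\<Phi>r (lin G \<gamma> w x))" for \<gamma> w x
    by (simp add: Z_fun_def lin_def Phi)
  have m: "(\<integral>x. (\<Prod>w\<in>A. Z_fun \<Phi> G \<gamma> w x) \<partial>vert_law) = of_real (mom \<Phi>r A \<gamma>)" for A \<gamma>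
    unfolding Z mom_def of_real_prod[symmetric] by (rule integral_complex_of_real)
  have m1: "(\<integral>x. Z_fun \<Phi> G \<gamma> w x \<partial>vert_law) = of_real (mom \<Phi>r {w} \<gamma>)" for w \<gamma>
    using m[where A = "{w}" and \<gamma> = \<gamma>] by simp
  have "C_family \<Phi> \<nu> f G C = 1 / (2 * of_real pi) ^ card (block_eidx B) *
     (\<integral>\<gamma>. (\<Prod>(w, v)\<in>E. \<Prod>i=1..mult G w v. fourier f (\<gamma> (w, v, i))) *
          exp (\<Sum>w\<in>B. of_real (mom \<Phi>r {w} \<gamma>)) * (\<Prod>A\<in>C. of_real (mom \<Phi>r A \<gamma>)) \<partial>PiM (block_eidx B) (\<lambda>_. lborel))"
    unfolding C_family_def Let_def E1 m m1 C cardE eBE ..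
  also have "(\<integral>\<gamma>. (\<Prod>(w, v)\<in>E. \<Prod>i=1..mult G w v. fourier f (\<gamma> (w, v, i))) *
          exp (\<Sum>w\<in>B. of_real (mom \<Phi>r {w} \<gamma>)) * (\<Prod>A\<in>C. of_real (mom \<Phi>r A \<gamma>)) \<partial>PiM (block_eidx B) (\<lambda>_. lborel)) = block_int B C"
    unfolding block_int_def
  proof (rule Bochner_Integration.integral_cong[OF refl])
    fix \<gamma> :: "'w \<times> 'v \<times> nat \<Rightarrow> real"
    have "(\<Prod>(w, v)\<in>E. \<Prod>i=1..mult G w v. fourier f (\<gamma> (w, v, i))) = (\<Prod>e\<in>block_eidx B. fourier f (\<gamma> e))"
      unfolding eBE by (rule prod_eidx[OF finE])
    then show "(\<Prod>(w, v)\<in>E. \<Prod>i=1..mult G w v. fourier f (\<gamma> (w, v, i))) *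
          exp (\<Sum>w\<in>B. of_real (mom \<Phi>r {w} \<gamma>)) * (\<Prod>A\<in>C. of_real (mom \<Phi>r A \<gamma>))
        = (\<Prod>e\<in>block_eidx B. fourier f (\<gamma> e)) * of_real (exp (\<Sum>w\<in>B. mom \<Phi>r {w} \<gamma>) * (\<Prod>D\<in>C. mom \<Phi>r D \<gamma>))"
      by (simp add: exp_of_real[symmetric] mult.assoc)
  qed
  finally show ?thesis .
qed

text \<open>All edges at \<open>w\<close> are double, so an enumeration \<open>\<pi>\<close> of its
  neighbours matches their two frequencies with the pairs in \<open>C_deg\<close>. The vertex
  variables away from these neighbours integrate to 1.\<close>

lemma block_int_eq_C_deg:
  assumes Phi: "\<And>t. \<Phi> t = of_real (\<Phi>r t)" and w: "w \<in> W" and m2: "\<And>v. v \<in> nbs G w \<Longrightarrow> mult G w v = 2"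
  shows "C_deg \<Phi> \<nu> f (wdeg G w) = 1 / (2 * of_real pi) ^ card (block_eidx {w}) * block_int {w} {}"
proof -
  define k where "k = card (nbs G w)"
  have wd: "wdeg G w = 2 * k"
  proof -
    have "wdeg G w = (\<Sum>v\<in>nbs G w. mult G w v)"
      unfolding wdeg_def by (rule sum.mono_neutral_right[OF finV]) (auto simp: nbs_def Suc_le_eq)
    also have "\<dots> = (\<Sum>v\<in>nbs G w. 2)" using m2 by (intro sum.cong) auto
    finally show ?thesis by (simp add: k_def mult.commute)
  qed
  have eBw: "block_eidx {w} = wset w" by (auto simp: block_eidx_def wset_def)
  have card_block_eidx: "card (block_eidx {w}) = wdeg G w" unfolding eBw by (rule card_wset[OF w])
  obtain \<pi> where \<pi>: "bij_betw \<pi> {1..k} (nbs G w)"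
    using ex_bij_betw_nat_finite_1[OF fin_nbs[of w]] unfolding k_def by blast
  define \<rho> where "\<rho> e = (the_inv_into {1..k} \<pi> (fst (snd e)), snd (snd e))" for e :: "'w \<times> 'v \<times> nat"
  let ?J = "{1..k} \<times> {1, 2 :: nat}"
  have eB2: "block_eidx {w} = {w} \<times> (nbs G w \<times> {1, 2})"
    using m2 by (auto simp: block_eidx_eq[of "{w}"] w)
  have inv: "the_inv_into {1..k} \<pi> (\<pi> i) = i" if "i \<in> {1..k}" for i
    using \<pi> that by (simp add: bij_betw_def the_inv_into_f_f)
  have \<pi>in: "\<pi> i \<in> nbs G w" if "i \<in> {1..k}" for i using bij_betwE[OF \<pi>] that by blast
  have invb: "bij_betw (the_inv_into {1..k} \<pi>) (nbs G w) {1..k}" by (rule bij_betw_the_inv_into[OF \<pi>])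
  have \<pi>inv: "\<pi> (the_inv_into {1..k} \<pi> v) = v" if "v \<in> nbs G w" for v
    using f_the_inv_into_f_bij_betw[OF \<pi>] that by blast
  have \<rho>: "bij_betw \<rho> (block_eidx {w}) ?J"
    by (rule bij_betwI[where g = "\<lambda>(i, j). (w, \<pi> i, j)"])
      (use bij_betwE[OF invb] \<pi>in inv \<pi>inv in \<open>auto simp: eB2 \<rho>_def\<close>)
  define g where "g \<gamma> = (\<Prod>e\<in>block_eidx {w}. fourier f (\<gamma> e)) * of_real (exp (mom \<Phi>r {w} \<gamma>))" for \<gamma> :: "'w \<times> 'v \<times> nat \<Rightarrow> real"
  have "integrable (PiM (block_eidx {w}) (\<lambda>_. lborel)) g"
    using block_int_integrable[of "{}" "{w}"] by (simp add: g_def[abs_def])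
  then have gm: "g \<in> borel_measurable (PiM (block_eidx {w}) (\<lambda>_. lborel))" by (rule borel_measurable_integrable)
  have "block_int {w} {} = (\<integral>\<gamma>. g \<gamma> \<partial>PiM (block_eidx {w}) (\<lambda>_. lborel))" by (simp add: block_int_def g_def)
  also have "\<dots> = (\<integral>y. g (\<lambda>e\<in>block_eidx {w}. (\<lambda>t. t) (y (\<rho> e))) \<partial>PiM ?J (\<lambda>_. lborel))"
    by (rule integral_PiM_bij[OF sigma_finite_lborel finite_block_eidx \<rho> _ _ gm, symmetric]) (auto simp: distr_id2)
  also have "\<dots> = (\<integral>\<gamma>. (\<Prod>i\<in>{1..k}. fourier f (\<gamma> (i, 1)) * fourier f (\<gamma> (i, 2))) *
          exp (\<integral>x. \<Phi> (\<Sum>i\<in>{1..k}. (\<gamma> (i, 1) + \<gamma> (i, 2)) * x i) \<partial>PiM {1..k} (\<lambda>_. \<nu>)) \<partial>PiM ?J (\<lambda>_. lborel))"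
  proof (rule Bochner_Integration.integral_cong[OF refl])
    fix y :: "nat \<times> nat \<Rightarrow> real"
    define \<gamma> where "\<gamma> = (\<lambda>e\<in>block_eidx {w}. y (\<rho> e))"
    have "(\<Prod>e\<in>block_eidx {w}. fourier f (\<gamma> e)) = (\<Prod>e\<in>block_eidx {w}. fourier f (y (\<rho> e)))"
      by (rule prod.cong) (auto simp: \<gamma>_def)
    also have "\<dots> = (\<Prod>p\<in>?J. fourier f (y p))" by (rule prod.reindex_bij_betw[OF \<rho>])
    also have "\<dots> = (\<Prod>i\<in>{1..k}. \<Prod>j\<in>{1, 2}. fourier f (y (i, j)))"
      by (subst prod.cartesian_product) (simp add: split_beta)
    finally have 1: "(\<Prod>e\<in>block_eidx {w}. fourier f (\<gamma> e)) = (\<Prod>i\<in>{1..k}. fourier f (y (i, 1)) * fourier f (y (i, 2)))"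
      by simp
    have nb: "{v. (w, v) \<in> edges G} = nbs G w" using w by (auto simp: edges_def nbs_def)
    have lin: "lin G \<gamma> w x = (\<Sum>i\<in>{1..k}. (y (i, 1) + y (i, 2)) * x (\<pi> i))" for x
    proof -
      have "lin G \<gamma> w x = (\<Sum>v\<in>nbs G w. (\<gamma> (w, v, 1) + \<gamma> (w, v, 2)) * x v)"
        unfolding lin_def nb using m2 by (intro sum.cong refl) (simp add: numeral_2_eq_2)
      also have "\<dots> = (\<Sum>i\<in>{1..k}. (\<gamma> (w, \<pi> i, 1) + \<gamma> (w, \<pi> i, 2)) * x (\<pi> i))"
        by (rule sum.reindex_bij_betw[OF \<pi>, symmetric])
      also have "\<dots> = (\<Sum>i\<in>{1..k}. (y (i, 1) + y (i, 2)) * x (\<pi> i))"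
        using \<pi>in inv by (intro sum.cong refl) (simp add: \<gamma>_def eB2 \<rho>_def)
      finally show ?thesis .
    qed
    have \<pi>V: "inj_on \<pi> {1..k}" "\<pi> \<in> {1..k} \<rightarrow> V"
      using \<pi> by (auto simp: bij_betw_def nbs_def)
    have pm: "(\<lambda>x. \<lambda>i\<in>{1..k}. x (\<pi> i)) \<in> measurable vert_law (PiM {1..k} (\<lambda>_. \<nu>))"
      using \<pi>V(2) by (intro measurable_restrict measurable_component_singleton) auto
    have Fm: "(\<lambda>x. \<Phi> (\<Sum>i\<in>{1..k}. (y (i, 1) + y (i, 2)) * x i)) \<in> borel_measurable (PiM {1..k} (\<lambda>_. \<nu>))"
    proof -
      have [measurable]: "\<Phi>r \<in> borel_measurable borel" using growth_Phir by (simp add: growth_def)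
      have "(\<lambda>x. x i) \<in> borel_measurable (PiM {1..k} (\<lambda>_. \<nu>))" if "i \<in> {1..k}" for i
        using measurable_component_singleton[OF that, of "\<lambda>_. \<nu>"] nu_sets by (simp cong: measurable_cong_sets)
      then have [measurable]: "(\<lambda>x. \<Sum>i\<in>{1..k}. (y (i, 1) + y (i, 2)) * x i) \<in> borel_measurable (PiM {1..k} (\<lambda>_. \<nu>))"
        by (intro borel_measurable_sum borel_measurable_times) auto
      show ?thesis unfolding Phi by measurable
    qed
    have d: "distr vert_law (PiM {1..k} (\<lambda>_. \<nu>)) (\<lambda>x. \<lambda>i\<in>{1..k}. x (\<pi> i)) = PiM {1..k} (\<lambda>_. \<nu>)"
      by (rule distr_PiM_reindex[OF nu_prob \<pi>V])
    have "(\<integral>x. \<Phi> (\<Sum>i\<in>{1..k}. (y (i, 1) + y (i, 2)) * x i) \<partial>PiM {1..k} (\<lambda>_. \<nu>))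
        = (\<integral>x. \<Phi> (\<Sum>i\<in>{1..k}. (y (i, 1) + y (i, 2)) * (\<lambda>i\<in>{1..k}. x (\<pi> i)) i) \<partial>vert_law)"
      by (subst d[symmetric]) (rule integral_distr[OF pm Fm])
    also have "\<dots> = (\<integral>x. of_real (\<Phi>r (lin G \<gamma> w x)) \<partial>vert_law)"
      by (intro Bochner_Integration.integral_cong refl) (simp add: Phi lin)
    also have "\<dots> = of_real (mom \<Phi>r {w} \<gamma>)"
      by (simp add: mom_def integral_complex_of_real)
    finally have 2: "exp (\<integral>x. \<Phi> (\<Sum>i\<in>{1..k}. (y (i, 1) + y (i, 2)) * x i) \<partial>PiM {1..k} (\<lambda>_. \<nu>)) = of_real (exp (mom \<Phi>r {w} \<gamma>))"
      by (simp add: exp_of_real)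
    show "g (\<lambda>e\<in>block_eidx {w}. (\<lambda>t. t) (y (\<rho> e))) = (\<Prod>i\<in>{1..k}. fourier f (y (i, 1)) * fourier f (y (i, 2))) *
          exp (\<integral>x. \<Phi> (\<Sum>i\<in>{1..k}. (y (i, 1) + y (i, 2)) * x i) \<partial>PiM {1..k} (\<lambda>_. \<nu>))"
      unfolding 1[symmetric] 2 g_def \<gamma>_def ..
  qed
  finally show ?thesis unfolding C_deg_def card_block_eidx wd by simp
qed

text \<open>A collection of subsets of \<open>B\<close> has at most \<open>card (Pow B)\<close>
  members, so only finitely many \<open>K\<close> contribute to the infinite sum.\<close>

lemma decomps_sum:
  assumes B: "finite B"
  shows "finite (decomps B)"
    and "(\<Sum>C\<in>decomps B. F C) = (\<Sum>\<^sub>\<infinity>K\<in>{1..}. \<Sum>C\<in>adm_decomps G K B. F C :: complex)"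
proof -
  define n where "n = card (Pow B)"
  have sub: "C \<subseteq> Pow B \<and> card C = K" if "C \<in> adm_decomps G K B" for C K
    using that by (auto simp: adm_decomps_def)
  have empty: "adm_decomps G K B = {}" if "K > n" for K
  proof (rule ccontr)
    assume "adm_decomps G K B \<noteq> {}"
    then obtain C where "C \<subseteq> Pow B" "card C = K" using sub by blast
    then have "K \<le> n" unfolding n_def using card_mono[of "Pow B" C] B by simp
    then show False using that by simp
  qed
  have fin: "finite (adm_decomps G K B)" for K
    by (rule finite_subset[of _ "Pow (Pow B)"]) (use sub B in auto)
  have dn: "decomps B = (\<Union>K\<in>{1..n}. adm_decomps G K B)"
  proof
    show "decomps B \<subseteq> (\<Union>K\<in>{1..n}. adm_decomps G K B)"
    proof
      fix C assume "C \<in> decomps B"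
      then obtain K where K: "K \<ge> 1" "C \<in> adm_decomps G K B" by (auto simp: decomps_def)
      then have "K \<le> n" using empty[of K] by (cases "K \<le> n") auto
      then show "C \<in> (\<Union>K\<in>{1..n}. adm_decomps G K B)" using K by auto
    qed
  qed (auto simp: decomps_def)
  show "finite (decomps B)" unfolding dn using fin by blast
  have "(\<Sum>C\<in>decomps B. F C) = (\<Sum>K\<in>{1..n}. \<Sum>C\<in>adm_decomps G K B. F C)"
    unfolding dn
  proof (rule sum.UNION_disjoint)
    show "\<forall>K\<in>{1..n}. \<forall>K'\<in>{1..n}. K \<noteq> K' \<longrightarrow> adm_decomps G K B \<inter> adm_decomps G K' B = {}"
    proof (intro ballI impI)
      fix K K' :: nat assume "K \<noteq> K'"
      then show "adm_decomps G K B \<inter> adm_decomps G K' B = {}" using sub[of _ K] sub[of _ K'] by blast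
    qed
  qed (use fin in auto)
  also have "\<dots> = (\<Sum>\<^sub>\<infinity>K\<in>{1..n}. \<Sum>C\<in>adm_decomps G K B. F C)" by simp
  also have "\<dots> = (\<Sum>\<^sub>\<infinity>K\<in>{1..}. \<Sum>C\<in>adm_decomps G K B. F C)"
    by (rule infsum_cong_neutral) (auto simp: empty)
  finally show "(\<Sum>C\<in>decomps B. F C) = (\<Sum>\<^sub>\<infinity>K\<in>{1..}. \<Sum>C\<in>adm_decomps G K B. F C)" .
qed

text \<open>One-vertex blocks produce the factors \<open>C_deg\<close>, big blocks the factors
  \<open>C_family\<close>. The sum over choice functions of a product over big blocks is then the
  product of the sums over decompositions.\<close>

lemma limit_value:
  assumes Phi: "\<And>t. \<Phi> t = of_real (\<Phi>r t)" and adm: "admissible G"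
  shows "1 / (2 * of_real pi) ^ totE * (\<Sum>C\<in>crit. sigma_term C) =
    (\<Prod>w\<in>W - \<Union>(big_blocks G). C_deg \<Phi> \<nu> f (wdeg G w)) *
    (\<Prod>B\<in>big_blocks G. \<Sum>\<^sub>\<infinity>K\<in>{1..}. \<Sum>C\<in>adm_decomps G K B. C_family \<Phi> \<nu> f G C)"
proof -
  let ?bb = "big_blocks G"
  let ?p = "2 * complex_of_real pi"
  have edge_prod: "?bb \<subseteq> blocks G" by (auto simp: big_blocks_def)
  have finbb: "finite ?bb" using edge_prod blocks_facts(2) by (rule finite_subset)
  define small where "small = blocks G - ?bb"
  have U: "\<Union>(blocks G) = W" by (rule partition_onD1[OF blocks_facts(1), symmetric])
  have small_sing: "\<exists>w. B = {w}" if "B \<in> small" for B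
  proof -
    have "B \<in> blocks G" "\<not> card B \<ge> 2" using that by (auto simp: small_def big_blocks_def)
    moreover from this have "card B \<noteq> 0" using blocks_facts(3)[of B] by auto
    ultimately have "card B = 1" by simp
    then show ?thesis by (simp add: card_1_singleton_iff)
  qed
  have small_eq: "small = (\<lambda>w. {w}) ` (W - \<Union>?bb)"
  proof (intro set_eqI iffI)
    fix B assume B: "B \<in> small"
    then obtain w where w: "B = {w}" using small_sing by blast
    have "B \<in> blocks G" "B \<notin> ?bb" using B by (auto simp: small_def)
    then have "w \<in> W" using blocks_facts(3) w by blast
    moreover have "w \<notin> \<Union>?bb"
    proof
      assume "w \<in> \<Union>?bb"
      then obtain B' where B': "B' \<in> ?bb" "w \<in> B'" by blast
      then have "B \<inter> B' \<noteq> {}" "B \<noteq> B'" using w \<open>B \<notin> ?bb\<close> by auto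
      then show False using blocks_facts(4)[of B B'] \<open>B \<in> blocks G\<close> B' edge_prod by blast
    qed
    ultimately show "B \<in> (\<lambda>w. {w}) ` (W - \<Union>?bb)" using w by blast
  next
    fix B assume "B \<in> (\<lambda>w. {w}) ` (W - \<Union>?bb)"
    then obtain w where w: "B = {w}" "w \<in> W" "w \<notin> \<Union>?bb" by blast
    have "w \<in> \<Union>(blocks G)" using w(2) U by simp
    then obtain B' where B': "B' \<in> blocks G" "w \<in> B'" by blast
    then have "B' \<in> small" using w(3) by (auto simp: small_def)
    then show "B \<in> small" using small_sing[of B'] B'(2) w(1) by auto
  qed
  have deg2: "mult G w v = 2" if "w \<in> W - \<Union>?bb" "v \<in> nbs G w" for w v
  proof -
    have "{w} \<in> blocks G" using that small_eq by (auto simp: small_def)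
    then have "\<forall>v\<in>vverts (induced G {w}). vdeg (induced G {w}) v = 2"
      using adm unfolding admissible_def by blast
    then show ?thesis using that(2) by (simp add: vverts_induced vdeg_induced)
  qed
  have trm: "1 / ?p ^ totE * mom_term (\<Union>B\<in>?bb. c B)
      = (\<Prod>w\<in>W - \<Union>?bb. C_deg \<Phi> \<nu> f (wdeg G w)) * (\<Prod>B\<in>?bb. C_family \<Phi> \<nu> f G (c B))"
    if c: "c \<in> (\<Pi>\<^sub>E B\<in>?bb. decomps B)" for c
  proof -
    \<comment> \<open>Extending the choice by the empty collection on one-vertex blocks allows one
      product over all blocks.\<close>
    define c' where "c' B = (if B \<in> ?bb then c B else {})" for B
    have cd: "finite (c B) \<and> \<Union>(c B) = B \<and> (\<forall>D\<in>c B. D \<subseteq> B \<and> D \<noteq> {})" if "B \<in> ?bb" for B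
    proof -
      have "c B \<in> decomps B" using c that by blast
      then have "finite (c B)" "\<Union>(c B) = B" "\<forall>D\<in>c B. card D \<ge> 2"
        by (auto simp: decomps_def adm_decomps_def)
      then show ?thesis by fastforce
    qed
    have Uc: "(\<Union>B\<in>?bb. c B) = (\<Union>B\<in>blocks G. c' B)" using edge_prod by (auto simp: c'_def split: if_splits)
    have cardE: "totE = (\<Sum>B\<in>blocks G. card (block_eidx B))"
    proof -
      have "totE = card (\<Union>B\<in>blocks G. block_eidx B)" unfolding eidx_UN_blocks by (rule card_eidx[OF fin, symmetric])
      also have "\<dots> = (\<Sum>B\<in>blocks G. card (block_eidx B))"
        by (rule card_UN_disjoint) (use blocks_facts(2) finite_block_eidx block_eidx_disjoint in auto)
      finally show ?thesis .
    qed
    have "1 / ?p ^ totE * mom_term (\<Union>B\<in>?bb. c B) = (\<Prod>B\<in>blocks G. 1 / ?p ^ card (block_eidx B)) * (\<Prod>B\<in>blocks G. block_int B (c' B))"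
    proof -
      have "mom_term (\<Union>B\<in>?bb. c B) = (\<Prod>B\<in>blocks G. block_int B (c' B))"
        unfolding Uc by (rule mom_term_factor) (use cd in \<open>auto simp: c'_def split: if_splits\<close>)
      moreover have "1 / ?p ^ totE = (\<Prod>B\<in>blocks G. 1 / ?p ^ card (block_eidx B))"
        unfolding cardE power_sum by (simp add: prod_dividef)
      ultimately show ?thesis by simp
    qed
    also have "\<dots> = (\<Prod>B\<in>blocks G. 1 / ?p ^ card (block_eidx B) * block_int B (c' B))" by (rule prod.distrib[symmetric])
    also have "\<dots> = (\<Prod>B\<in>small. 1 / ?p ^ card (block_eidx B) * block_int B (c' B)) * (\<Prod>B\<in>?bb. 1 / ?p ^ card (block_eidx B) * block_int B (c' B))"
      unfolding small_def by (rule prod.subset_diff[OF edge_prod blocks_facts(2)])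
    also have "(\<Prod>B\<in>?bb. 1 / ?p ^ card (block_eidx B) * block_int B (c' B)) = (\<Prod>B\<in>?bb. C_family \<Phi> \<nu> f G (c B))"
    proof (rule prod.cong[OF refl])
      fix B assume B: "B \<in> ?bb"
      then have "B \<subseteq> W" using edge_prod blocks_facts(3) by blast
      then have "C_family \<Phi> \<nu> f G (c B) = 1 / ?p ^ card (block_eidx B) * block_int B (c B)"
        by (rule block_int_eq_C_family[OF Phi]) (use cd[OF B] in blast)
      then show "1 / ?p ^ card (block_eidx B) * block_int B (c' B) = C_family \<Phi> \<nu> f G (c B)" using B by (simp add: c'_def)
    qed
    also have "(\<Prod>B\<in>small. 1 / ?p ^ card (block_eidx B) * block_int B (c' B)) = (\<Prod>w\<in>W - \<Union>?bb. C_deg \<Phi> \<nu> f (wdeg G w))"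
    proof -
      have "(\<Prod>B\<in>small. 1 / ?p ^ card (block_eidx B) * block_int B (c' B)) = (\<Prod>w\<in>W - \<Union>?bb. 1 / ?p ^ card (block_eidx {w}) * block_int {w} (c' {w}))"
        unfolding small_eq by (subst prod.reindex) (auto simp: inj_on_def)
      also have "\<dots> = (\<Prod>w\<in>W - \<Union>?bb. C_deg \<Phi> \<nu> f (wdeg G w))"
      proof (rule prod.cong[OF refl])
        fix w assume w: "w \<in> W - \<Union>?bb"
        have "{w} \<notin> ?bb" using w by auto
        then have c0: "c' {w} = {}" by (simp add: c'_def)
        have "C_deg \<Phi> \<nu> f (wdeg G w) = 1 / ?p ^ card (block_eidx {w}) * block_int {w} {}"
          by (rule block_int_eq_C_deg[OF Phi]) (use w deg2[OF w] in auto)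
        then show "1 / ?p ^ card (block_eidx {w}) * block_int {w} (c' {w}) = C_deg \<Phi> \<nu> f (wdeg G w)" unfolding c0 by simp
      qed
      finally show ?thesis .
    qed
    finally show ?thesis .
  qed
  have finB: "finite B" if "B \<in> ?bb" for B using that edge_prod blocks_facts(3) by blast
  have "1 / ?p ^ totE * (\<Sum>C\<in>crit. sigma_term C) = (\<Sum>c\<in>(\<Pi>\<^sub>E B\<in>?bb. decomps B). 1 / ?p ^ totE * mom_term (\<Union>B\<in>?bb. c B))"
    unfolding crit_sum if_P[OF adm] by (rule sum_distrib_left)
  also have "\<dots> = (\<Sum>c\<in>(\<Pi>\<^sub>E B\<in>?bb. decomps B). (\<Prod>w\<in>W - \<Union>?bb. C_deg \<Phi> \<nu> f (wdeg G w)) * (\<Prod>B\<in>?bb. C_family \<Phi> \<nu> f G (c B)))"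
    by (intro sum.cong refl trm)
  also have "\<dots> = (\<Prod>w\<in>W - \<Union>?bb. C_deg \<Phi> \<nu> f (wdeg G w)) * (\<Sum>c\<in>(\<Pi>\<^sub>E B\<in>?bb. decomps B). \<Prod>B\<in>?bb. C_family \<Phi> \<nu> f G (c B))"
    by (rule sum_distrib_left[symmetric])
  also have "(\<Sum>c\<in>(\<Pi>\<^sub>E B\<in>?bb. decomps B). \<Prod>B\<in>?bb. C_family \<Phi> \<nu> f G (c B)) = (\<Prod>B\<in>?bb. \<Sum>C\<in>decomps B. C_family \<Phi> \<nu> f G C)"
    by (rule prod_sum_PiE[symmetric]) (use finbb decomps_sum(1) finB in auto)
  also have "\<dots> = (\<Prod>B\<in>?bb. \<Sum>\<^sub>\<infinity>K\<in>{1..}. \<Sum>C\<in>adm_decomps G K B. C_family \<Phi> \<nu> f G C)"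
    by (intro prod.cong refl decomps_sum(2) finB)
  finally show ?thesis .
qed

end

section \<open>The limit of the traces\<close>

section \<open>Convergence of the mean injective traces\<close>

text \<open>The claimed value as a complex number, built only from the data on which the limit may
  depend. Its real part is the witness for \<open>\<tau>\<close>.\<close>

definition limit_formula :: "('w, 'v) bigraph \<Rightarrow> real \<Rightarrow> real \<Rightarrow> (real \<Rightarrow> real) \<Rightarrow> (real \<Rightarrow> complex) \<Rightarrow> real measure \<Rightarrow> complex" where
  "limit_formula G \<phi> \<psi> f \<Phi> \<nu>x = (if admissible G then
     complex_of_real (scale_factor G \<phi> \<psi>) *
     (\<Prod>w\<in>wverts G - \<Union>(big_blocks G). C_deg \<Phi> \<nu>x f (wdeg G w)) *
     (\<Prod>B\<in>big_blocks G. \<Sum>\<^sub>\<infinity>K\<in>{1..}. \<Sum>C\<in>adm_decomps G K B. C_family \<Phi> \<nu>x f G C) else 0)"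

lemma blocks_no_wverts: "wverts G = {} \<Longrightarrow> blocks G = {}"
  by (auto simp: blocks_iff inseparable_def)

text \<open>Multiplying and dividing by the critical power of n lets the normalization and the
  oscillatory integral converge separately. The limit \<open>z\<close> is left open because graphs
  with and without W-vertices obtain it in different ways.\<close>

lemma trace_tendsto_aux:
  fixes G :: "('w, 'v) bigraph" and M :: "nat \<Rightarrow> 'a measure" and f :: "real \<Rightarrow> real"
  assumes fin: "finite_bigraph G" and A3: "A3 p m n \<phi> \<psi>"
    and mm: "\<And>N. matrix_model (M N) (p N) (m N) (n N) (\<nu>w (n N)) \<nu>x (W N) (X N)"
    and nu: "\<And>n. real_distribution (\<nu>w n)" "real_distribution \<nu>x" and f: "smooth_L1 f"
    and lim: "(\<lambda>n. of_real (real n powr (real (card (wverts G)) - 1 + real (card (vverts G)) - real (total_mult G (edges G)) / 2))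
      * osc_integral G f (\<nu>w n) \<nu>x n) \<longlonglongrightarrow> z"
  shows "(\<lambda>N. complex_of_real (mean_inj_trace (M N) (p N) (m N) (Y_mat f (m N) (n N) (W N) (X N)) G))
    \<longlonglongrightarrow> complex_of_real (scale_factor G \<phi> \<psi>) * (1 / (2 * of_real pi) ^ total_mult G (edges G) * z)"
proof -
  define E where "E = total_mult G (edges G)"
  define L where "L = real (card (wverts G)) - 1 + real (card (vverts G)) - real E / 2"
  define s where "s N = 1 / real (p N) * real (card (inj_maps (wverts G) (p N))) * real (card (inj_maps (vverts G) (m N)))
    * (1 / sqrt (real (m N))) ^ E" for N
  have nlim: "filterlim n at_top sequentially" and plim: "filterlim p at_top sequentially" using A3 unfolding A3_def by blast+
  have s_lim: "(\<lambda>N. s N / real (n N) powr L) \<longlonglongrightarrow> scale_factor G \<phi> \<psi>"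
    using scaling_tendsto[OF fin A3] by (simp only: s_def L_def E_def)
  have o_lim: "(\<lambda>N. of_real (real (n N) powr L) * osc_integral G f (\<nu>w (n N)) \<nu>x (n N)) \<longlonglongrightarrow> z"
    using filterlim_compose[OF lim nlim] by (simp only: L_def E_def)
  have "(\<lambda>N. of_real (s N / real (n N) powr L) * (1 / (2 * of_real pi) ^ E * (of_real (real (n N) powr L) * osc_integral G f (\<nu>w (n N)) \<nu>x (n N))))
      \<longlonglongrightarrow> of_real (scale_factor G \<phi> \<psi>) * (1 / (2 * of_real pi) ^ E * z)"
    by (intro tendsto_mult tendsto_of_real s_lim o_lim tendsto_const)
  moreover have "\<forall>\<^sub>F N in sequentially. of_real (s N / real (n N) powr L) * (1 / (2 * of_real pi) ^ E * (of_real (real (n N) powr L) * osc_integral G f (\<nu>w (n N)) \<nu>x (n N)))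
      = complex_of_real (mean_inj_trace (M N) (p N) (m N) (Y_mat f (m N) (n N) (W N) (X N)) G)"
  proof -
    have "\<forall>\<^sub>F N in sequentially. 1 \<le> n N" "\<forall>\<^sub>F N in sequentially. 1 \<le> p N"
      using nlim plim by (auto simp: filterlim_at_top)
    then show ?thesis
    proof eventually_elim
      case (elim N)
      have "complex_of_real (mean_inj_trace (M N) (p N) (m N) (Y_mat f (m N) (n N) (W N) (X N)) G)
          = of_real (s N) * (1 / (2 * of_real pi) ^ E * osc_integral G f (\<nu>w (n N)) \<nu>x (n N))"
        unfolding s_def E_def by (rule mean_inj_trace_eq[OF fin mm elim nu f])
      moreover have "real (n N) powr L \<noteq> 0" using elim by simp
      ultimately show ?case by simp
    qed
  qed
  ultimately have "(\<lambda>N. complex_of_real (mean_inj_trace (M N) (p N) (m N) (Y_mat f (m N) (n N) (W N) (X N)) G))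
      \<longlonglongrightarrow> of_real (scale_factor G \<phi> \<psi>) * (1 / (2 * of_real pi) ^ E * z)"
    by (rule Lim_transform_eventually)
  then show ?thesis by (simp only: E_def)
qed

lemma trace_tendsto:
  fixes G :: "('w, 'v) bigraph" and M :: "nat \<Rightarrow> 'a measure" and f :: "real \<Rightarrow> real"
  assumes fin: "finite_bigraph G" and conn: "connected_bigraph G"
    and A1: "A1 \<nu>w \<Phi> \<nu>x \<sigma>x" and A2: "A2 f" and A3: "A3 p m n \<phi> \<psi>"
    and mm: "\<And>N. matrix_model (M N) (p N) (m N) (n N) (\<nu>w (n N)) \<nu>x (W N) (X N)"
  shows "(\<lambda>N. complex_of_real (mean_inj_trace (M N) (p N) (m N) (Y_mat f (m N) (n N) (W N) (X N)) G))
    \<longlonglongrightarrow> limit_formula G \<phi> \<psi> f \<Phi> \<nu>x"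
proof -
  have nu: "\<And>n. real_distribution (\<nu>w n)" "real_distribution \<nu>x" and sym: "symmetric_law \<nu>x"
    and moments: "\<And>k :: nat. integrable \<nu>x (\<lambda>x. x ^ k)"
    using A1 unfolding A1_def by blast+
  have f: "smooth_L1 f" and f_odd: "\<And>x. f (- x) = - f x" using A2 by (auto simp: A2_def smooth_L1_def)
  note aux = trace_tendsto_aux[OF fin A3 mm nu f]
  show ?thesis
  proof (cases "wverts G = {}")
    \<comment> \<open>The graph is a single V-vertex. Its trace is m/p, with limit
      \<open>\<psi> / \<phi>\<close>, which is the scaling factor with empty products.\<close>
    case True
    have E0: "edges G = {}" using True by (auto simp: edges_def)
    have e0: "eidx G = {}" by (simp add: eidx_def E0)
    have t0: "total_mult G (edges G) = 0" by (simp add: E0 total_mult_def)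
    have prob: "prob_space (PiM (vverts G) (\<lambda>_. \<nu>x))"
      by (rule prob_space_PiM) (use nu(2) in \<open>simp add: real_distribution_def\<close>)
    have prob0: "prob_space (PiM (eidx G) (\<lambda>_. lborel :: real measure))"
      unfolding e0 by (rule prob_spaceI) (simp add: space_PiM)
    have o1: "osc_integral G f (\<nu>w k) \<nu>x k = 1" for k
      using prob_space.prob_space[OF prob] prob_space.prob_space[OF prob0] by (simp add: osc_integral_def e0 True)
    have "(\<lambda>k. of_real (real k powr (real (card (wverts G)) - 1 + real (card (vverts G)) - real (total_mult G (edges G)) / 2))
        * osc_integral G f (\<nu>w k) \<nu>x k) \<longlonglongrightarrow> 1"
    proof -
      have "real (card (wverts G)) - 1 + real (card (vverts G)) - real (total_mult G (edges G)) / 2 = 0"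
        using True connected_no_wverts[OF conn True] t0 by simp
      moreover have "(\<lambda>k. complex_of_real (real k powr 0)) \<longlonglongrightarrow> 1"
        by (rule Lim_transform_eventually[OF tendsto_const])
          (use eventually_gt_at_top[of 0] in \<open>auto elim: eventually_mono\<close>)
      ultimately show ?thesis by (simp only: o1 mult_1_right)
    qed
    from aux[OF this] have l: "(\<lambda>N. complex_of_real (mean_inj_trace (M N) (p N) (m N) (Y_mat f (m N) (n N) (W N) (X N)) G))
        \<longlonglongrightarrow> complex_of_real (scale_factor G \<phi> \<psi>)" by (simp add: t0)
    have b0: "blocks G = {}" by (rule blocks_no_wverts[OF True])
    have "admissible G" by (auto simp: admissible_def block_tree_def b0)
    then show ?thesis using l True b0 by (simp add: limit_formula_def big_blocks_def)
  next
    case W_ne: False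
    obtain N0 K where c: "\<And>n t. n \<ge> N0 \<Longrightarrow> char (\<nu>w n) t = of_real (Re (char (\<nu>w n) t)) \<and> 0 < Re (char (\<nu>w n) t) \<and> Re (char (\<nu>w n) t) \<le> 1"
      and c_even: "\<And>n t. Re (char (\<nu>w n) (- t)) = Re (char (\<nu>w n) t)"
      and c_growth: "\<And>n t. n \<ge> N0 \<Longrightarrow> real n * (1 - Re (char (\<nu>w n) t)) \<le> K * (1 + \<bar>t\<bar>)\<^sup>2"
      and c_lim: "\<And>t. (\<lambda>n. real n * (1 - Re (char (\<nu>w n) t))) \<longlonglongrightarrow> - Re (\<Phi> t)"
      and Phi: "\<And>t. \<Phi> t = of_real (Re (\<Phi> t))"
      using A1_exponent[OF A1] by blast
    \<comment> \<open>Set to 0 below \<open>N0\<close>, so that the bounds of the locale hold at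
      every index; the limits are unaffected.\<close>
    define q where "q k t = (if k \<ge> N0 then 1 - Re (char (\<nu>w k) t) else 0)" for k t
    have K0: "0 \<le> K * (1 + \<bar>t\<bar>)\<^sup>2" for t
    proof -
      have "0 \<le> real N0 * (1 - Re (char (\<nu>w N0) t))" using c[of N0 t] by simp
      then show ?thesis using c_growth[of N0 t] by simp
    qed
    interpret osc_limit G \<nu>x f q "\<lambda>t. - Re (\<Phi> t)" K
    proof (intro osc_limit.intro osc_setup.intro connected_graph.intro osc_limit_axioms.intro)
      show "finite_bigraph G" "connected_bigraph G" "wverts G \<noteq> {}" by fact+
      then show "finite_bigraph G" by blast
      show "real_distribution \<nu>x" "symmetric_law \<nu>x" "smooth_L1 f" by fact+
      show "integrable \<nu>x (\<lambda>x. x ^ k)" for k :: nat by (rule moments)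
      show "f (- x) = - f x" for x by (rule f_odd)
      show "q k \<in> borel_measurable borel" for k
        using real_distribution.char_measurable[OF nu(1), of k] unfolding q_def by measurable
      show "q k (- t) = q k t" for k t by (simp add: q_def c_even)
      show "0 \<le> q k t" "q k t \<le> 1" for k t using c[of k t] by (auto simp: q_def)
      show "real k * q k t \<le> K * (1 + \<bar>t\<bar>)\<^sup>2" for k t using c_growth[of k t] K0[of t] by (simp add: q_def)
      show "(\<lambda>k. real k * q k t) \<longlonglongrightarrow> - Re (\<Phi> t)" for t
      proof (rule Lim_transform_eventually[OF c_lim])
        show "\<forall>\<^sub>F k in sequentially. real k * (1 - Re (char (\<nu>w k) t)) = real k * q k t"
          using eventually_ge_at_top[of N0] by eventually_elim (simp add: q_def)
      qed
    qed
    have Phi': "\<Phi> t = of_real (\<Phi>r t)" for t using Phi[of t] by (simp add: \<Phi>r_def)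
    have osc: "osc_integral G f (\<nu>w k) \<nu>x k = osc_int k" if k: "k \<ge> N0" for k
      unfolding osc_integral_def osc_int_def hat_prod_def
    proof (rule Bochner_Integration.integral_cong[OF refl])
      fix \<gamma>
      have "(\<integral>x. (\<Prod>w\<in>wverts G. char (\<nu>w k) (lin G \<gamma> w x)) \<partial>PiM (vverts G) (\<lambda>_. \<nu>x))
          = (\<integral>x. of_real (\<Prod>w\<in>wverts G. 1 - q k (lin G \<gamma> w x)) \<partial>PiM (vverts G) (\<lambda>_. \<nu>x))"
      proof (rule Bochner_Integration.integral_cong[OF refl])
        fix x
        have "char (\<nu>w k) t = of_real (1 - q k t)" for t using c[OF k, of t] k by (simp add: q_def)
        then show "(\<Prod>w\<in>wverts G. char (\<nu>w k) (lin G \<gamma> w x)) = of_real (\<Prod>w\<in>wverts G. 1 - q k (lin G \<gamma> w x))"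
          by (simp only: of_real_prod)
      qed
      also have "\<dots> = of_real (mom (\<lambda>t. 1 - q k t) (wverts G) \<gamma>)" unfolding mom_def by (rule integral_complex_of_real)
      finally show "(\<Prod>e\<in>eidx G. fourier f (\<gamma> e)) * (\<integral>x. (\<Prod>w\<in>wverts G. char (\<nu>w k) (lin G \<gamma> w x)) \<partial>PiM (vverts G) (\<lambda>_. \<nu>x)) ^ k
          = (\<Prod>e\<in>eidx G. fourier f (\<gamma> e)) * of_real (mom (\<lambda>t. 1 - q k t) (wverts G) \<gamma> ^ k)" by simp
    qed
    have "(\<lambda>k. of_real (real k powr growth_exp) * osc_integral G f (\<nu>w k) \<nu>x k) \<longlonglongrightarrow> (\<Sum>C\<in>crit. sigma_term C)"
    proof (rule Lim_transform_eventually[OF osc_int_tendsto])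
      show "\<forall>\<^sub>F k in sequentially. of_real (real k powr growth_exp) * osc_int k = of_real (real k powr growth_exp) * osc_integral G f (\<nu>w k) \<nu>x k"
        using eventually_ge_at_top[of N0] by eventually_elim (simp add: osc)
    qed
    from aux[OF this[unfolded growth_exp_def]]
    have l: "(\<lambda>N. complex_of_real (mean_inj_trace (M N) (p N) (m N) (Y_mat f (m N) (n N) (W N) (X N)) G))
        \<longlonglongrightarrow> complex_of_real (scale_factor G \<phi> \<psi>) * (1 / (2 * of_real pi) ^ total_mult G (edges G) * (\<Sum>C\<in>crit. sigma_term C))" .
    show ?thesis
    proof (cases "admissible G")
      case True
      show ?thesis using l unfolding limit_value[OF Phi' True] limit_formula_def if_P[OF True] by (simp only: mult.assoc)
    next
      case False
      show ?thesis using l unfolding crit_sum if_not_P[OF False] limit_formula_def by simp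
    qed
  qed
qed

theorem theorem1p8:
  shows "\<exists>\<tau> :: ('w, 'v) bigraph \<Rightarrow> real \<Rightarrow> real \<Rightarrow> (real \<Rightarrow> real) \<Rightarrow> (real \<Rightarrow> complex) \<Rightarrow> real measure \<Rightarrow> real.
    \<forall>G \<phi> \<psi> f \<Phi> \<nu>x \<sigma>x \<nu>w p m n (M :: nat \<Rightarrow> 'a measure) W X.
      finite_bigraph G \<and> connected_bigraph G \<and>
      A1 \<nu>w \<Phi> \<nu>x \<sigma>x \<and> A2 f \<and> A3 p m n \<phi> \<psi> \<and>
      (\<forall>N. matrix_model (M N) (p N) (m N) (n N) (\<nu>w (n N)) \<nu>x (W N) (X N)) \<longrightarrow>
      (\<lambda>N. mean_inj_trace (M N) (p N) (m N) (Y_mat f (m N) (n N) (W N) (X N)) G)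
        \<longlonglongrightarrow> \<tau> G \<phi> \<psi> f \<Phi> \<nu>x \<and>
      (\<not> admissible G \<longrightarrow> \<tau> G \<phi> \<psi> f \<Phi> \<nu>x = 0) \<and>
      (admissible G \<longrightarrow>
        complex_of_real (\<tau> G \<phi> \<psi> f \<Phi> \<nu>x) =
          complex_of_real (scale_factor G \<phi> \<psi>) *
          (\<Prod>w\<in>wverts G - \<Union>(big_blocks G). C_deg \<Phi> \<nu>x f (wdeg G w)) *
          (\<Prod>B\<in>big_blocks G. \<Sum>\<^sub>\<infinity>K\<in>{1..}. \<Sum>C\<in>adm_decomps G K B. C_family \<Phi> \<nu>x f G C)) \<and>
      (double_tree G \<longrightarrow>
        complex_of_real (\<tau> G \<phi> \<psi> f \<Phi> \<nu>x) =
          complex_of_real (scale_factor G \<phi> \<psi>) *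
          (\<Prod>w\<in>wverts G. C_deg \<Phi> \<nu>x f (wdeg G w)))"
proof (rule exI[of _ "\<lambda>G \<phi> \<psi> f \<Phi> \<nu>x. Re (limit_formula G \<phi> \<psi> f \<Phi> \<nu>x)"], intro allI impI)
  fix G :: "('w, 'v) bigraph" and \<phi> \<psi> f \<Phi> \<nu>x \<sigma>x \<nu>w p m n and M :: "nat \<Rightarrow> 'a measure" and W X
  assume *: "finite_bigraph G \<and> connected_bigraph G \<and>
      A1 \<nu>w \<Phi> \<nu>x \<sigma>x \<and> A2 f \<and> A3 p m n \<phi> \<psi> \<and>
      (\<forall>N. matrix_model (M N) (p N) (m N) (n N) (\<nu>w (n N)) \<nu>x (W N) (X N))"
  let ?t = "\<lambda>N. mean_inj_trace (M N) (p N) (m N) (Y_mat f (m N) (n N) (W N) (X N)) G"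
  let ?z = "limit_formula G \<phi> \<psi> f \<Phi> \<nu>x"
  have l: "(\<lambda>N. complex_of_real (?t N)) \<longlonglongrightarrow> ?z"
    by (rule trace_tendsto[where \<nu>w = \<nu>w and \<sigma>x = \<sigma>x]) (use * in blast)+
  have re: "?t \<longlonglongrightarrow> Re ?z" using tendsto_Re[OF l] by simp
  \<comment> \<open>The value is real as a limit of real numbers, so taking its real part in the
    definition of the witness loses nothing.\<close>
  have "(\<lambda>N. Im (complex_of_real (?t N))) \<longlonglongrightarrow> Im ?z" by (rule tendsto_Im[OF l])
  then have "Im ?z = 0" using LIMSEQ_unique[of "\<lambda>_. 0 :: real"] by fastforce
  then have z: "complex_of_real (Re ?z) = ?z" by (simp add: complex_eq_iff)
  have adm: "?z = complex_of_real (scale_factor G \<phi> \<psi>) *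
          (\<Prod>w\<in>wverts G - \<Union>(big_blocks G). C_deg \<Phi> \<nu>x f (wdeg G w)) *
          (\<Prod>B\<in>big_blocks G. \<Sum>\<^sub>\<infinity>K\<in>{1..}. \<Sum>C\<in>adm_decomps G K B. C_family \<Phi> \<nu>x f G C)" if "admissible G"
    unfolding limit_formula_def by (rule if_P[OF that])
  have dt: "?z = complex_of_real (scale_factor G \<phi> \<psi>) * (\<Prod>w\<in>wverts G. C_deg \<Phi> \<nu>x f (wdeg G w))" if "double_tree G"
  proof -
    have "admissible G" "card (big_blocks G) = 0" using that by (auto simp: double_tree_def)
    moreover have "finite (big_blocks G)"
      by (rule finite_subset[of _ "Pow (wverts G)"])
        (use * in \<open>auto simp: big_blocks_def blocks_def finite_bigraph_def\<close>)
    ultimately show ?thesis using adm by simp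
  qed
  show "?t \<longlonglongrightarrow> Re ?z \<and> (\<not> admissible G \<longrightarrow> Re ?z = 0) \<and>
      (admissible G \<longrightarrow> complex_of_real (Re ?z) = complex_of_real (scale_factor G \<phi> \<psi>) *
          (\<Prod>w\<in>wverts G - \<Union>(big_blocks G). C_deg \<Phi> \<nu>x f (wdeg G w)) *
          (\<Prod>B\<in>big_blocks G. \<Sum>\<^sub>\<infinity>K\<in>{1..}. \<Sum>C\<in>adm_decomps G K B. C_family \<Phi> \<nu>x f G C)) \<and>
      (double_tree G \<longrightarrow> complex_of_real (Re ?z) =
          complex_of_real (scale_factor G \<phi> \<psi>) * (\<Prod>w\<in>wverts G. C_deg \<Phi> \<nu>x f (wdeg G w)))"
    unfolding z using re adm dt by (auto simp: limit_formula_def)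
qed

end
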